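(* Let $\alpha>0$ and let $Y^{(\alpha)}=\{Y_t^{(\alpha)}\}_{t\ge0}$ be a compound Poisson process on $\mathbb{R}$ with Lévy measure $\nu_{Y^{(\alpha)}}(dx)=|x|^{\alpha-1}e^{-|x|^\alpha}dx$ (without drift). Then $$E_\alpha^{0,\mathrm{sym}}(\mathbb{R}^1)=\Big\{\mathcal{L}\Big(\int_0^\infty h(t)\,dY_t^{(\alpha)}\Big):h\in\mathrm{Dom}(Y^{(\alpha)})\Big\}=\Big\{\mathcal{L}\Big(\int_0^\infty h(t)\,dY_t^{(\alpha)}\Big):h\in\mathrm{Dom}^{\downarrow}(Y^{(\alpha)})\Big\}.$$
   Context: $\mathcal{L}(X)$ is the law of $X$. $I(\mathbb{R}^1)$ is the class of infinitely divisible distributions on $\mathbb{R}$; $\mu\in I(\mathbb{R}^1)$ has generating triplet $(A,\nu,\gamma)$ if $\widehat\mu(z)=\exp\{-\frac12Az^2+i\gamma z+\int(e^{izx}-1-izx(1+x^2)^{-1})\nu(dx)\}$, where $\nu$ is the Lévy measure. "No Gaussian part" means $A=0$. Class $E_\alpha(\mathbb{R}^1)$: the set of $\mu\in I(\mathbb{R}^1)$ whose Lévy measure is of the form $\nu(B)=\sum_{\xi\in\{-1,1\}}\int_0^\infty1_B(r\xi)\,r^{\alpha-1}g_\xi(r^\alpha)\,dr$ for Borel $B\subset\mathbb{R}\setminus\{0\}$, where $g_1,g_{-1}$ are completely monotone on $(0,\infty)$ (possibly identically $0$) with $\int_0^\infty(r^{\alpha+1}\wedge r^{\alpha-1})g_\xi(r^\alpha)\,dr<\infty$.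 $E_\alpha^0(\mathbb{R}^1)$ is the set of $\mu\in E_\alpha(\mathbb{R}^1)$ without Gaussian part, and $E_\alpha^{0,\mathrm{sym}}(\mathbb{R}^1)$ is the set of symmetric $\mu\in E_\alpha^0(\mathbb{R}^1)$. Stochastic integrals: for a real Lévy process $Y$, a measurable $h:(0,\infty)\to\mathbb{R}$ is locally $Y$-integrable if on each compact interval $[p,q]\subset(0,\infty)$ there are simple functions $h_n\to h$ a.e. such that $\int_Bh_n\,dY$ converges in probability for every Borel $B\subset[p,q]$ (integration with respect to the independently scattered random measure induced by $Y$); the limit defines $\int_Bh\,dY$. $\int_0^\infty h(t)\,dY_t$ is definable if $\int_p^qh(t)\,dY_t$ converges in probability as $p\downarrow0$, $q\to\infty$; the limit is then denoted $\int_0^\infty h(t)\,dY_t$. $\mathrm{Dom}(Y)$ is the set of locally $Y$-integrable $h$ on $(0,\infty)$ for which $\int_0^\infty h(t)\,dY_t$ is definable. $\mathrm{Dom}^\downarrow(Y)$ is the set of $h\in\mathrm{Dom}(Y)$ that are left-continuous and decreasing (in the weak sense, i.e. nonincreasing) with $\lim_{t\to\infty}h(t)=0$. *)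

theory Defs
  imports "HOL-Probability.Probability"
begin

primrec convolution_power :: "real measure \<Rightarrow> nat \<Rightarrow> real measure" where
  "convolution_power \<mu> 0 = return borel 0"
| "convolution_power \<mu> (Suc n) = convolution \<mu> (convolution_power \<mu> n)"

definition infinitely_divisible :: "real measure \<Rightarrow> bool" where
  "infinitely_divisible \<mu> \<longleftrightarrow> real_distribution \<mu> \<and>
     (\<forall>n\<ge>1. \<exists>\<rho>. real_distribution \<rho> \<and> \<mu> = convolution_power \<rho> n)"

definition levy_measure :: "real measure \<Rightarrow> bool" where
  "levy_measure \<nu> \<longleftrightarrow> sets \<nu> = sets borel \<and> emeasure \<nu> {0} = 0 \<and>
     (\<integral>\<^sup>+x. ennreal (min (x\<^sup>2) 1) \<partial>\<nu>) < \<infinity>"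

definition has_generating_triplet :: "real measure \<Rightarrow> real \<Rightarrow> real measure \<Rightarrow> real \<Rightarrow> bool" where
  "has_generating_triplet \<mu> A \<nu> \<gamma> \<longleftrightarrow> 0 \<le> A \<and> levy_measure \<nu> \<and>
     (\<forall>z. char \<mu> z = exp (- complex_of_real (A * z\<^sup>2 / 2) + \<i> * complex_of_real (\<gamma> * z) +
        (CLINT x|\<nu>. iexp (z * x) - 1 - \<i> * complex_of_real (z * x / (1 + x\<^sup>2)))))"

definition symmetric_distribution :: "real measure \<Rightarrow> bool" where
  "symmetric_distribution \<mu> \<longleftrightarrow> distr \<mu> borel (\<lambda>x. - x) = \<mu>"

text \<open>Only the values on the open half-line matter: there the iterated \<^const>\<open>deriv\<close>
  is determined by \<open>g\<close> restricted to that half-line.\<close>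

definition completely_monotone :: "(real \<Rightarrow> real) \<Rightarrow> bool" where
  "completely_monotone g \<longleftrightarrow>
     (\<forall>n. \<forall>x>0. (deriv ^^ n) g differentiable (at x) \<and> 0 \<le> (- 1) ^ n * (deriv ^^ n) g x)"

definition E_radial_form :: "real \<Rightarrow> real measure \<Rightarrow> bool" where
  "E_radial_form \<alpha> \<nu> \<longleftrightarrow> (\<exists>g :: real \<Rightarrow> real \<Rightarrow> real.
     (\<forall>\<xi>\<in>{-1, 1}. completely_monotone (g \<xi>) \<and>
        (\<integral>\<^sup>+r\<in>{0<..}. ennreal (min (r powr (\<alpha> + 1)) (r powr (\<alpha> - 1)) * g \<xi> (r powr \<alpha>)) \<partial>lborel) < \<infinity>) \<and>
     (\<forall>B\<in>sets borel. 0 \<notin> B \<longrightarrow>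
        emeasure \<nu> B = (\<Sum>\<xi>\<in>{-1, 1}.
          \<integral>\<^sup>+r\<in>{0<..}. indicator B (r * \<xi>) * ennreal (r powr (\<alpha> - 1) * g \<xi> (r powr \<alpha>)) \<partial>lborel)))"

definition E_class :: "real \<Rightarrow> real measure set" where
  "E_class \<alpha> = {\<mu>. infinitely_divisible \<mu> \<and>
     (\<exists>A \<nu> \<gamma>. has_generating_triplet \<mu> A \<nu> \<gamma> \<and> E_radial_form \<alpha> \<nu>)}"

definition E_class0 :: "real \<Rightarrow> real measure set" where
  "E_class0 \<alpha> = {\<mu> \<in> E_class \<alpha>. \<exists>\<nu> \<gamma>. has_generating_triplet \<mu> 0 \<nu> \<gamma>}"

definition E_class0_sym :: "real \<Rightarrow> real measure set" where
  "E_class0_sym \<alpha> = {\<mu> \<in> E_class0 \<alpha>. symmetric_distribution \<mu>}"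

definition tendsto_in_prob ::
    "'a measure \<Rightarrow> ('i \<Rightarrow> 'a \<Rightarrow> real) \<Rightarrow> ('a \<Rightarrow> real) \<Rightarrow> 'i filter \<Rightarrow> bool" where
  "tendsto_in_prob M X Z F \<longleftrightarrow>
     (\<forall>\<epsilon>>0. ((\<lambda>i. measure M {\<omega> \<in> space M. \<epsilon> < \<bar>X i \<omega> - Z \<omega>\<bar>}) \<longlongrightarrow> 0) F)"

text \<open>A process indexed by \<open>[0, \<infinity>)\<close> is a family indexed by \<^typ>\<open>real\<close>; the values at
  negative times are never used.\<close>

locale levy_process = prob_space M for M :: "'a measure" +
  fixes Y :: "real \<Rightarrow> 'a \<Rightarrow> real"
  assumes measurable_process: "0 \<le> t \<Longrightarrow> Y t \<in> borel_measurable M"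
    and starts_at_zero: "AE \<omega> in M. Y 0 \<omega> = 0"
    and independent_increments: "0 \<le> \<tau> 0 \<Longrightarrow> mono \<tau> \<Longrightarrow>
      indep_vars (\<lambda>_. borel) (\<lambda>i \<omega>. Y (\<tau> (Suc i)) \<omega> - Y (\<tau> i) \<omega>) {..<n::nat}"
    and stationary_increments: "0 \<le> s \<Longrightarrow> 0 \<le> t \<Longrightarrow>
      distr M borel (\<lambda>\<omega>. Y (s + t) \<omega> - Y s \<omega>) = distr M borel (Y t)"
    and stochastically_continuous: "0 \<le> t \<Longrightarrow> tendsto_in_prob M Y (Y t) (at t within {0..})"
    and cadlag_paths: "AE \<omega> in M. (\<forall>t\<ge>0. continuous (at_right t) (\<lambda>s. Y s \<omega>)) \<and>
      (\<forall>t>0. \<exists>l. ((\<lambda>s. Y s \<omega>) \<longlongrightarrow> l) (at_left t))"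

text \<open>A compound Poisson process with Levy measure \<open>\<nu>\<close>, i.e. with intensity
  \<open>c = \<nu> UNIV\<close> and jump distribution \<open>\<nu> / c\<close>. The characteristic exponent
  has neither a drift nor a Gaussian term.\<close>

locale compound_poisson_process = levy_process M Y
  for M :: "'a measure" and Y :: "real \<Rightarrow> 'a \<Rightarrow> real" +
  fixes \<nu> :: "real measure"
  assumes sets_nu: "sets \<nu> = sets borel"
    and finite_nu: "0 < emeasure \<nu> UNIV" "emeasure \<nu> UNIV < \<infinity>"
    and nu_zero: "emeasure \<nu> {0} = 0"
    and char_process: "0 \<le> t \<Longrightarrow>
      char (distr M borel (Y t)) z = exp (complex_of_real t * (CLINT x|\<nu>. iexp (z * x) - 1))"

text \<open>The independently scattered random measure induced by \<open>Y\<close>, a family of random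
  variables indexed by the bounded Borel subsets of \<open>[0, \<infinity>)\<close>.\<close>

definition bounded_borel :: "real set set" where
  "bounded_borel = {B \<in> sets borel. bounded B \<and> B \<subseteq> {0..}}"

definition is_induced_random_measure ::
    "'a measure \<Rightarrow> (real \<Rightarrow> 'a \<Rightarrow> real) \<Rightarrow> (real set \<Rightarrow> 'a \<Rightarrow> real) \<Rightarrow> bool" where
  "is_induced_random_measure M Y \<Lambda> \<longleftrightarrow>
     (\<forall>B\<in>bounded_borel. \<Lambda> B \<in> borel_measurable M) \<and>
     (\<forall>B :: nat \<Rightarrow> real set. range B \<subseteq> bounded_borel \<longrightarrow> disjoint_family B \<longrightarrow>
        prob_space.indep_vars M (\<lambda>_. borel) (\<lambda>n. \<Lambda> (B n)) UNIV) \<and>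
     (\<forall>B :: nat \<Rightarrow> real set. range B \<subseteq> bounded_borel \<longrightarrow> disjoint_family B \<longrightarrow>
        (\<Union>n. B n) \<in> bounded_borel \<longrightarrow>
        (AE \<omega> in M. (\<lambda>n. \<Lambda> (B n) \<omega>) sums \<Lambda> (\<Union>n. B n) \<omega>)) \<and>
     (\<forall>t\<ge>0. AE \<omega> in M. \<Lambda> {0..t} \<omega> = Y t \<omega>)"

text \<open>For each fixed bounded Borel set the value is unique up to almost sure equality, which is all
  that the notions below depend on.\<close>

definition induced_random_measure ::
    "'a measure \<Rightarrow> (real \<Rightarrow> 'a \<Rightarrow> real) \<Rightarrow> real set \<Rightarrow> 'a \<Rightarrow> real" where
  "induced_random_measure M Y = (SOME \<Lambda>. is_induced_random_measure M Y \<Lambda>)"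

definition simple_integral ::
    "'a measure \<Rightarrow> (real \<Rightarrow> 'a \<Rightarrow> real) \<Rightarrow> (real \<Rightarrow> real) \<Rightarrow> real set \<Rightarrow> 'a \<Rightarrow> real" where
  "simple_integral M Y s B \<omega> = (\<Sum>y\<in>range s. y * induced_random_measure M Y (B \<inter> s -` {y}) \<omega>)"

definition simple_approximation ::
    "'a measure \<Rightarrow> (real \<Rightarrow> 'a \<Rightarrow> real) \<Rightarrow> (real \<Rightarrow> real) \<Rightarrow> real \<Rightarrow> real \<Rightarrow>
      (nat \<Rightarrow> real \<Rightarrow> real) \<Rightarrow> bool" where
  "simple_approximation M Y h p q s \<longleftrightarrow>
     (\<forall>n. simple_function borel (s n)) \<and>
     (AE t in lborel. t \<in> {p..q} \<longrightarrow> (\<lambda>n. s n t) \<longlonglongrightarrow> h t) \<and>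
     (\<forall>B\<in>sets borel. B \<subseteq> {p..q} \<longrightarrow>
        (\<exists>Z\<in>borel_measurable M. tendsto_in_prob M (\<lambda>n. simple_integral M Y (s n) B) Z sequentially))"

definition locally_integrable ::
    "'a measure \<Rightarrow> (real \<Rightarrow> 'a \<Rightarrow> real) \<Rightarrow> (real \<Rightarrow> real) \<Rightarrow> bool" where
  "locally_integrable M Y h \<longleftrightarrow> set_borel_measurable borel {0<..} h \<and>
     (\<forall>p q. 0 < p \<longrightarrow> p \<le> q \<longrightarrow> (\<exists>s. simple_approximation M Y h p q s))"

definition has_integral_on ::
    "'a measure \<Rightarrow> (real \<Rightarrow> 'a \<Rightarrow> real) \<Rightarrow> (real \<Rightarrow> real) \<Rightarrow> real set \<Rightarrow> ('a \<Rightarrow> real) \<Rightarrow> bool" where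
  "has_integral_on M Y h B Z \<longleftrightarrow> Z \<in> borel_measurable M \<and> B \<in> sets borel \<and>
     (\<exists>p q s. 0 < p \<and> p \<le> q \<and> B \<subseteq> {p..q} \<and> simple_approximation M Y h p q s \<and>
        tendsto_in_prob M (\<lambda>n. simple_integral M Y (s n) B) Z sequentially)"

definition integral_on ::
    "'a measure \<Rightarrow> (real \<Rightarrow> 'a \<Rightarrow> real) \<Rightarrow> (real \<Rightarrow> real) \<Rightarrow> real set \<Rightarrow> 'a \<Rightarrow> real" where
  "integral_on M Y h B = (SOME Z. has_integral_on M Y h B Z)"

text \<open>The integral from \<open>p\<close> to \<open>q\<close> is taken over \<open>(p, q]\<close>; the induced random measure
  vanishes almost surely on singletons, so including or excluding end points is immaterial.\<close>

definition has_improper_integral ::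
    "'a measure \<Rightarrow> (real \<Rightarrow> 'a \<Rightarrow> real) \<Rightarrow> (real \<Rightarrow> real) \<Rightarrow> ('a \<Rightarrow> real) \<Rightarrow> bool" where
  "has_improper_integral M Y h Z \<longleftrightarrow> Z \<in> borel_measurable M \<and>
     tendsto_in_prob M (\<lambda>(p, q). integral_on M Y h {p<..q}) Z (at_right 0 \<times>\<^sub>F at_top)"

definition improper_integral ::
    "'a measure \<Rightarrow> (real \<Rightarrow> 'a \<Rightarrow> real) \<Rightarrow> (real \<Rightarrow> real) \<Rightarrow> 'a \<Rightarrow> real" where
  "improper_integral M Y h = (SOME Z. has_improper_integral M Y h Z)"

definition Dom :: "'a measure \<Rightarrow> (real \<Rightarrow> 'a \<Rightarrow> real) \<Rightarrow> (real \<Rightarrow> real) set" where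
  "Dom M Y = {h. locally_integrable M Y h \<and> (\<exists>Z. has_improper_integral M Y h Z)}"

definition Dom_down :: "'a measure \<Rightarrow> (real \<Rightarrow> 'a \<Rightarrow> real) \<Rightarrow> (real \<Rightarrow> real) set" where
  "Dom_down M Y = {h \<in> Dom M Y. (\<forall>t>0. continuous (at_left t) h) \<and> antimono_on {0<..} h \<and>
     (h \<longlongrightarrow> 0) at_top}"

abbreviation law :: "'a measure \<Rightarrow> ('a \<Rightarrow> real) \<Rightarrow> real measure" where
  "law M X \<equiv> distr M borel X"

definition nu_Y :: "real \<Rightarrow> real measure" where
  "nu_Y \<alpha> = density lborel (\<lambda>x. ennreal (\<bar>x\<bar> powr (\<alpha> - 1) * exp (- (\<bar>x\<bar> powr \<alpha>))))"

end

theory Submission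
  imports Defs
begin

text \<open>With \<open>\<psi> z = \<integral> (1 - cos (z x)) \<nu>(dx)\<close> for the jump measure \<open>\<nu>\<close> of \<open>Y\<close>, the integral of
  \<open>h\<close> exists iff \<open>\<integral>\<integral> min 1 ((h(t) x)^2) \<nu>(dx) dt\<close> is finite, and its characteristic function is
  \<open>exp (- \<integral> \<psi>(z h(t)) dt)\<close>. Substituting \<open>y = h(t) x\<close>, its Levy density is
  \<open>|y|^(\<alpha>-1) g(|y|^\<alpha>)\<close> with \<open>g u = \<integral> k(t) e^(-u k(t)) dt\<close> and \<open>k = |h|^(-\<alpha>)\<close>, which is
  completely monotone as a Laplace transform. Conversely, Bernstein's theorem writes every \<open>g\<close> that
  occurs as a Laplace transform, and the mixing measure is turned into a decreasing \<open>h\<close> by a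
  decreasing rearrangement.\<close>

section \<open>Truncated second moments\<close>

text \<open>All limits here are limits in probability, while the integrals are known only through
  their characteristic functions. The link is the mean of min 1 (X^2): its convergence to 0 is
  convergence in probability, and averaging 1 - cos (z X) over z in [0, 1] bounds it by the
  characteristic function near 0. The same averaging over Lebesgue measure times the jump measure
  yields the necessity of the integrability condition. The obstacle behind the middle part is that
  the integral rests on a random measure named by \<open>SOME\<close>: it has to be built on all
  bounded Borel sets, with almost sure countable additivity. Membership in the class states neither
  that the Levy measure is symmetric nor that the triplet with the radial form is the one without
  Gaussian part. Both points are settled through the characteristic function, and only the mean of
  the two radial functions enters the witness. In Bernstein's theorem g may explode at 0, so it is
  represented to the right of base points a > 0 by laws on (0, 1], and these are matched through
  their moments.\<close>

definition trunc_sq :: "real \<Rightarrow> real" where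
  "trunc_sq x = min (x\<^sup>2) 1"

lemma trunc_sq_nonneg [simp]: "0 \<le> trunc_sq x"
  and trunc_sq_le_1 [simp]: "trunc_sq x \<le> 1"
  and trunc_sq_minus [simp]: "trunc_sq (- x) = trunc_sq x"
  and trunc_sq_0 [simp]: "trunc_sq 0 = 0"
  and trunc_sq_eq_0_iff [simp]: "trunc_sq x = 0 \<longleftrightarrow> x = 0"
  by (auto simp: trunc_sq_def min_def)

lemma borel_measurable_trunc_sq [measurable]: "trunc_sq \<in> borel_measurable borel"
  unfolding trunc_sq_def by measurable

lemma tendsto_trunc_sq: "(f \<longlongrightarrow> l) F \<Longrightarrow> ((\<lambda>x. trunc_sq (f x)) \<longlongrightarrow> trunc_sq l) F"
  unfolding trunc_sq_def by (intro tendsto_intros)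

lemma trunc_sq_mono: "\<bar>x\<bar> \<le> \<bar>y\<bar> \<Longrightarrow> trunc_sq x \<le> trunc_sq y"
  using power_mono[of "\<bar>x\<bar>" "\<bar>y\<bar>" 2] by (auto simp: trunc_sq_def)

text \<open>This takes the role of the triangle inequality. Each use costs a factor 2; together with
  the 16 of \<open>trunc_moment_le_exponent\<close> this is the origin of the constants 32, 64 and
  256 below.\<close>

lemma trunc_sq_add: "trunc_sq (x + y) \<le> 2 * trunc_sq x + 2 * trunc_sq y"
proof -
  have "(x + y)\<^sup>2 \<le> 2 * x\<^sup>2 + 2 * y\<^sup>2"
    using sum_squares_bound[of x y] by (simp add: power2_sum)
  moreover have "0 \<le> x\<^sup>2" "0 \<le> y\<^sup>2" by auto
  ultimately show ?thesis
    unfolding trunc_sq_def min_def by (smt (verit))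
qed

lemma trunc_sq_diff: "trunc_sq (x - y) \<le> 2 * trunc_sq x + 2 * trunc_sq y"
  using trunc_sq_add[of x "- y"] by simp

text \<open>A change of scale costs only a constant, so finiteness of truncated moments does not
  depend on where the truncation sits.\<close>

lemma trunc_sq_scale: "trunc_sq (c * x) \<le> max 1 (c\<^sup>2) * trunc_sq x"
proof (cases "x\<^sup>2 \<le> 1")
  case True
  then have t: "trunc_sq x = x\<^sup>2" by (simp add: trunc_sq_def)
  have "trunc_sq (c * x) \<le> c\<^sup>2 * x\<^sup>2" by (simp add: trunc_sq_def power_mult_distrib)
  also have "\<dots> \<le> max 1 (c\<^sup>2) * x\<^sup>2" by (intro mult_right_mono) auto
  finally show ?thesis using t by simp
next
  case False
  then have "trunc_sq x = 1" by (simp add: trunc_sq_def)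
  then show ?thesis using order_trans[OF trunc_sq_le_1[of "c * x"] max.cobounded1[of 1 "c\<^sup>2"]] by simp
qed

lemma one_minus_cos_le_trunc_sq: "1 - cos x \<le> 2 * trunc_sq (x::real)"
proof -
  have "1 - cos x = 2 * (sin (x / 2))\<^sup>2"
    using cos_double_sin[of "x / 2"] by simp
  moreover have "(sin (x / 2))\<^sup>2 \<le> (x / 2)\<^sup>2"
    using abs_sin_x_le_abs_x[of "x / 2"] using abs_le_square_iff[of "sin (x / 2)" "x / 2"] by blast
  moreover have "(sin (x / 2))\<^sup>2 \<le> 1"
    by (simp add: sin_squared_eq)
  moreover have "0 \<le> (sin (x / 2))\<^sup>2" by simp
  moreover have "(x / 2)\<^sup>2 = x\<^sup>2 / 4" by (simp add: power_divide)
  ultimately have "1 - cos x \<le> 2 * x\<^sup>2" "1 - cos x \<le> 2" by linarith+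
  then show ?thesis by (simp add: trunc_sq_def min_def)
qed

text \<open>The right-hand side is 8 times the mean of 1 - cos (z x) over z in [0, 1]. For 0 < x <=
  2 Taylor's formula gives 1 - sin x / x >= x^2 / 6 - x^4 / 120 >= 2 x^2 / 15, and 8 * 2 / 15 > 1;
  for x > 2 the quotient sin x / x is at most 1/2.\<close>

lemma trunc_sq_le_one_minus_sinc:
  fixes x :: real
  assumes "x \<noteq> 0"
  shows "trunc_sq x \<le> 8 * (1 - sin x / x)"
proof -
  have pos: "trunc_sq x \<le> 8 * (1 - sin x / x)" if "0 < x" for x :: real
  proof (cases "x \<le> 2")
    case True
    have "\<bar>sin x - (\<Sum>m<5. sin_coeff m * x ^ m)\<bar> \<le> inverse (fact 5) * \<bar>x\<bar> ^ 5"
      by (rule Maclaurin_sin_bound)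
    moreover have "{..<5} = {0, 1, 2, 3, 4::nat}" by auto
    then have "(\<Sum>m<5. sin_coeff m * x ^ m) = x - x ^ 3 / 6"
      by (simp add: sin_coeff_def fact_numeral)
    ultimately have "\<bar>sin x - (x - x ^ 3 / 6)\<bar> \<le> x ^ 5 / 120"
      using \<open>0 < x\<close> by (simp add: fact_numeral)
    then have "sin x \<le> x - x ^ 3 / 6 + x ^ 5 / 120" by linarith
    then have "sin x / x \<le> (x - x ^ 3 / 6 + x ^ 5 / 120) / x"
      using \<open>0 < x\<close> by (intro divide_right_mono) auto
    also have "\<dots> = 1 - x\<^sup>2 / 6 + x\<^sup>2 * x\<^sup>2 / 120"
      using \<open>0 < x\<close> by (simp add: field_simps eval_nat_numeral)
    finally have s: "sin x / x \<le> 1 - x\<^sup>2 / 6 + x\<^sup>2 * x\<^sup>2 / 120" .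
    have "x\<^sup>2 \<le> 2\<^sup>2" using True \<open>0 < x\<close> by (intro power_mono) auto
    then have "x\<^sup>2 * x\<^sup>2 \<le> x\<^sup>2 * 4" by (intro mult_left_mono) auto
    moreover have "0 \<le> x\<^sup>2" by simp
    moreover have "u \<le> 8 * (1 - q)" if "u * u \<le> u * 4" "0 \<le> u" "q \<le> 1 - u / 6 + u * u / 120" for u q :: real
      using that by (simp add: field_simps)
    moreover obtain q where q: "sin x / x = q" by simp
    ultimately have "x\<^sup>2 \<le> 8 * (1 - q)" using s[unfolded q] by blast
    then have "x\<^sup>2 \<le> 8 * (1 - sin x / x)" unfolding q .
    then show ?thesis by (auto simp: trunc_sq_def)
  next
    case False
    then have "sin x \<le> x / 2" by (intro order_trans[OF sin_le_one]) simp
    then have "sin x / x \<le> 1 / 2" using \<open>0 < x\<close> by (simp add: field_simps)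
    moreover have "1 \<le> 8 * (1 - q)" if "q \<le> 1 / 2" for q :: real
      using that by simp
    ultimately have "1 \<le> 8 * (1 - sin x / x)" by blast
    with trunc_sq_le_1[of x] show ?thesis by (rule order_trans)
  qed
  show ?thesis
  proof (cases "0 < x")
    case False
    then show ?thesis using pos[of "- x"] assms by simp
  qed (rule pos)
qed

lemma nn_integral_one_minus_cos:
  fixes x :: real
  assumes "x \<noteq> 0"
  shows "(\<integral>\<^sup>+z\<in>{0..1}. ennreal (1 - cos (z * x)) \<partial>lborel) = ennreal (1 - sin x / x)"
proof -
  have "(\<integral>\<^sup>+z. ennreal (1 - cos (z * x)) * indicator {0..1} z \<partial>lborel)
      = ennreal ((1 - sin (1 * x) / x) - (0 - sin (0 * x) / x))"
  proof (rule nn_integral_FTC_Icc)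
    fix z :: real
    show "((\<lambda>z. z - sin (z * x) / x) has_real_derivative 1 - cos (z * x)) (at z)"
      using assms by (auto intro!: derivative_eq_intros)
  qed (auto)
  then show ?thesis by simp
qed

lemma trunc_sq_le_nn_integral_cos:
  "ennreal (trunc_sq x) \<le> 8 * (\<integral>\<^sup>+z\<in>{0..1}. ennreal (1 - cos (z * x)) \<partial>lborel)"
proof (cases "x = 0")
  case False
  have "0 \<le> 1 - sin x / x"
    using order_trans[OF trunc_sq_nonneg trunc_sq_le_one_minus_sinc[OF False]]
    by (simp only: zero_le_mult_iff) simp
  then show ?thesis
    using trunc_sq_le_one_minus_sinc[OF False]
    by (simp add: nn_integral_one_minus_cos[OF False] ennreal_mult'[symmetric] flip: ennreal_numeral)
qed simp

text \<open>Averaging \<open>1 - cos (z x)\<close> over \<open>z \<in> [0, 1]\<close> turns a bound on a characteristic exponent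
  near the origin into a bound on truncated second moments.\<close>

lemma nn_integral_trunc_sq_le:
  assumes "sigma_finite_measure N" and [measurable]: "f \<in> borel_measurable N"
    and K: "\<And>z. 0 \<le> z \<Longrightarrow> z \<le> 1 \<Longrightarrow> (\<integral>\<^sup>+x. ennreal (1 - cos (z * f x)) \<partial>N) \<le> K"
  shows "(\<integral>\<^sup>+x. ennreal (trunc_sq (f x)) \<partial>N) \<le> 8 * K"
proof -
  interpret N: sigma_finite_measure N by fact
  interpret P: pair_sigma_finite lborel N ..
  have "(\<integral>\<^sup>+x. ennreal (trunc_sq (f x)) \<partial>N)
      \<le> (\<integral>\<^sup>+x. 8 * (\<integral>\<^sup>+z\<in>{0..1}. ennreal (1 - cos (z * f x)) \<partial>lborel) \<partial>N)"
    by (intro nn_integral_mono trunc_sq_le_nn_integral_cos)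
  also have "\<dots> = 8 * (\<integral>\<^sup>+x. (\<integral>\<^sup>+z\<in>{0..1}. ennreal (1 - cos (z * f x)) \<partial>lborel) \<partial>N)"
    by (intro nn_integral_cmult) measurable
  also have "(\<integral>\<^sup>+x. (\<integral>\<^sup>+z\<in>{0..1}. ennreal (1 - cos (z * f x)) \<partial>lborel) \<partial>N)
      = (\<integral>\<^sup>+z. (\<integral>\<^sup>+x. ennreal (1 - cos (z * f x)) * indicator {0..1} z \<partial>N) \<partial>lborel)"
    by (intro P.Fubini') measurable
  also have "\<dots> \<le> (\<integral>\<^sup>+z. K * indicator {0..1::real} z \<partial>lborel)"
  proof (intro nn_integral_mono)
    fix z :: real
    show "(\<integral>\<^sup>+x. ennreal (1 - cos (z * f x)) * indicator {0..1} z \<partial>N) \<le> K * indicator {0..1} z"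
      using K[of z] by (auto simp: indicator_def)
  qed
  also have "\<dots> = K" by (simp add: nn_integral_cmult)
  finally show ?thesis by (simp add: mult_left_mono)
qed

subsection \<open>Convergence in probability\<close>

definition trunc_moment :: "'a measure \<Rightarrow> ('a \<Rightarrow> real) \<Rightarrow> real" where
  "trunc_moment M X = (\<integral>\<omega>. trunc_sq (X \<omega>) \<partial>M)"

context prob_space
begin

lemma integrable_trunc_sq [intro]:
  "X \<in> borel_measurable M \<Longrightarrow> integrable M (\<lambda>\<omega>. trunc_sq (X \<omega>))"
  by (rule integrable_const_bound[of _ 1]) auto

lemma integrable_indicator_event [intro]:
  "A \<in> events \<Longrightarrow> integrable M (indicator A :: 'a \<Rightarrow> real)"
  by (simp add: integrable_real_indicator emeasure_eq_measure)

lemma trunc_moment_nonneg: "0 \<le> trunc_moment M X"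
  by (simp add: trunc_moment_def)

lemma trunc_moment_triangle:
  assumes [measurable]: "X \<in> borel_measurable M" "Y \<in> borel_measurable M" "Z \<in> borel_measurable M"
  shows "trunc_moment M (\<lambda>\<omega>. X \<omega> - Z \<omega>)
    \<le> 2 * trunc_moment M (\<lambda>\<omega>. X \<omega> - Y \<omega>) + 2 * trunc_moment M (\<lambda>\<omega>. Y \<omega> - Z \<omega>)"
proof -
  have "trunc_moment M (\<lambda>\<omega>. X \<omega> - Z \<omega>)
      \<le> (\<integral>\<omega>. 2 * trunc_sq (X \<omega> - Y \<omega>) + 2 * trunc_sq (Y \<omega> - Z \<omega>) \<partial>M)"
    unfolding trunc_moment_def
  proof (intro integral_mono)
    show "trunc_sq (X \<omega> - Z \<omega>) \<le> 2 * trunc_sq (X \<omega> - Y \<omega>) + 2 * trunc_sq (Y \<omega> - Z \<omega>)" for \<omega>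
      using trunc_sq_add[of "X \<omega> - Y \<omega>" "Y \<omega> - Z \<omega>"] by simp
  qed (auto intro!: integrable_trunc_sq Bochner_Integration.integrable_add)
  then show ?thesis
    by (simp add: trunc_moment_def integrable_trunc_sq)
qed

lemma trunc_moment_minus_commute:
  "trunc_moment M (\<lambda>\<omega>. X \<omega> - Z \<omega>) = trunc_moment M (\<lambda>\<omega>. Z \<omega> - X \<omega>)"
  unfolding trunc_moment_def using trunc_sq_minus[of "X _ - Z _"] by simp

lemma trunc_moment_cong_AE:
  assumes "AE \<omega> in M. X \<omega> = Y \<omega>" "X \<in> borel_measurable M" "Y \<in> borel_measurable M"
  shows "trunc_moment M X = trunc_moment M Y"
  unfolding trunc_moment_def using assms by (intro integral_cong_AE) auto

lemma trunc_moment_eq_0_AE: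
  assumes [measurable]: "X \<in> borel_measurable M" and "trunc_moment M X = 0"
  shows "AE \<omega> in M. X \<omega> = 0"
  using assms integral_nonneg_eq_0_iff_AE[OF integrable_trunc_sq[of X]]
  by (simp add: trunc_moment_def)

lemma trunc_moment_eq_0_AE_eq:
  assumes "X \<in> borel_measurable M" "Y \<in> borel_measurable M"
    and "trunc_moment M (\<lambda>\<omega>. X \<omega> - Y \<omega>) = 0"
  shows "AE \<omega> in M. X \<omega> = Y \<omega>"
  using trunc_moment_eq_0_AE[of "\<lambda>\<omega>. X \<omega> - Y \<omega>"] assms by auto

lemma prob_gt_le_trunc_moment:
  assumes [measurable]: "X \<in> borel_measurable M" and "0 < a" "a \<le> 1"
  shows "prob {\<omega> \<in> space M. a < \<bar>X \<omega>\<bar>} \<le> trunc_moment M X / a\<^sup>2"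
proof -
  have "prob {\<omega> \<in> space M. a < \<bar>X \<omega>\<bar>} \<le> prob {\<omega> \<in> space M. a\<^sup>2 \<le> trunc_sq (X \<omega>)}"
  proof (intro finite_measure_mono)
    have "a\<^sup>2 \<le> trunc_sq x" if "a < \<bar>x\<bar>" for x
      using that assms power_mono[of a "\<bar>x\<bar>" 2] by (simp add: trunc_sq_def power_le_one)
    then show "{\<omega> \<in> space M. a < \<bar>X \<omega>\<bar>} \<subseteq> {\<omega> \<in> space M. a\<^sup>2 \<le> trunc_sq (X \<omega>)}" by auto
  qed measurable
  also have "\<dots> \<le> trunc_moment M X / a\<^sup>2"
    unfolding trunc_moment_def
    using assms by (intro integral_Markov_inequality_measure[where A = "{}"]) auto
  finally show ?thesis .
qed

lemma trunc_moment_le_prob: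
  assumes [measurable]: "X \<in> borel_measurable M" and "0 < a"
  shows "trunc_moment M X \<le> a\<^sup>2 + prob {\<omega> \<in> space M. a < \<bar>X \<omega>\<bar>}"
proof -
  have "trunc_moment M X \<le> (\<integral>\<omega>. a\<^sup>2 + indicator {\<omega> \<in> space M. a < \<bar>X \<omega>\<bar>} \<omega> \<partial>M)"
    unfolding trunc_moment_def
  proof (intro integral_mono)
    fix \<omega> assume "\<omega> \<in> space M"
    then show "trunc_sq (X \<omega>) \<le> a\<^sup>2 + indicator {\<omega> \<in> space M. a < \<bar>X \<omega>\<bar>} \<omega>"
      using power_mono[of "\<bar>X \<omega>\<bar>" a 2] trunc_sq_le_1[of "X \<omega>"] \<open>0 < a\<close>
      by (cases "a < \<bar>X \<omega>\<bar>") (auto simp: trunc_sq_def intro: add_increasing min.coboundedI2)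
  qed (auto intro!: Bochner_Integration.integrable_add)
  also have "\<dots> = a\<^sup>2 + prob {\<omega> \<in> space M. a < \<bar>X \<omega>\<bar>}"
    by (subst Bochner_Integration.integral_add) (auto simp: prob_space)
  finally show ?thesis .
qed

text \<open>Markov's inequality in one direction, splitting the mean at a level a in the other. The
  filter is arbitrary because both sequences and the two-parameter limit of the improper integral
  are needed.\<close>

lemma tendsto_in_prob_iff_trunc_moment:
  assumes X: "\<And>i. X i \<in> borel_measurable M" and Z: "Z \<in> borel_measurable M"
  shows "tendsto_in_prob M X Z F \<longleftrightarrow> ((\<lambda>i. trunc_moment M (\<lambda>\<omega>. X i \<omega> - Z \<omega>)) \<longlongrightarrow> 0) F"
proof
  note [measurable] = X Z
  assume *: "tendsto_in_prob M X Z F"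
  show "((\<lambda>i. trunc_moment M (\<lambda>\<omega>. X i \<omega> - Z \<omega>)) \<longlongrightarrow> 0) F"
  proof (rule tendstoI)
    fix e :: real assume "0 < e"
    define a where "a = sqrt (e / 2)"
    have a: "0 < a" "a\<^sup>2 = e / 2" using \<open>0 < e\<close> by (auto simp: a_def)
    have "\<forall>\<^sub>F i in F. prob {\<omega> \<in> space M. a < \<bar>X i \<omega> - Z \<omega>\<bar>} < e / 2"
      using * a \<open>0 < e\<close> unfolding tendsto_in_prob_def by (intro order_tendstoD(2)) auto
    then show "\<forall>\<^sub>F i in F. dist (trunc_moment M (\<lambda>\<omega>. X i \<omega> - Z \<omega>)) 0 < e"
    proof eventually_elim
      case (elim i)
      then show ?case
        using trunc_moment_le_prob[of "\<lambda>\<omega>. X i \<omega> - Z \<omega>" a] a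
          trunc_moment_nonneg[of "\<lambda>\<omega>. X i \<omega> - Z \<omega>"] by (simp add: dist_real_def)
    qed
  qed
next
  note [measurable] = X Z
  assume *: "((\<lambda>i. trunc_moment M (\<lambda>\<omega>. X i \<omega> - Z \<omega>)) \<longlongrightarrow> 0) F"
  show "tendsto_in_prob M X Z F"
    unfolding tendsto_in_prob_def
  proof (intro allI impI)
    fix e :: real assume "0 < e"
    define a where "a = min e 1"
    have a: "0 < a" "a \<le> 1" "a \<le> e" using \<open>0 < e\<close> by (auto simp: a_def)
    have l: "((\<lambda>i. trunc_moment M (\<lambda>\<omega>. X i \<omega> - Z \<omega>) / a\<^sup>2) \<longlongrightarrow> 0) F"
      using tendsto_divide[OF * tendsto_const[of "a\<^sup>2"]] a by simp
    show "((\<lambda>i. prob {\<omega> \<in> space M. e < \<bar>X i \<omega> - Z \<omega>\<bar>}) \<longlongrightarrow> 0) F"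
    proof (rule tendsto_sandwich[OF _ _ tendsto_const l])
      have "prob {\<omega> \<in> space M. e < \<bar>X i \<omega> - Z \<omega>\<bar>} \<le> trunc_moment M (\<lambda>\<omega>. X i \<omega> - Z \<omega>) / a\<^sup>2" for i
      proof -
        have "prob {\<omega> \<in> space M. e < \<bar>X i \<omega> - Z \<omega>\<bar>} \<le> prob {\<omega> \<in> space M. a < \<bar>X i \<omega> - Z \<omega>\<bar>}"
          using a by (intro finite_measure_mono) auto
        also have "\<dots> \<le> trunc_moment M (\<lambda>\<omega>. X i \<omega> - Z \<omega>) / a\<^sup>2"
          using a by (intro prob_gt_le_trunc_moment) auto
        finally show ?thesis .
      qed
      then show "\<forall>\<^sub>F i in F. prob {\<omega> \<in> space M. e < \<bar>X i \<omega> - Z \<omega>\<bar>}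
          \<le> trunc_moment M (\<lambda>\<omega>. X i \<omega> - Z \<omega>) / a\<^sup>2" by simp
    qed simp
  qed
qed

text \<open>Where X and Z are within a, the Lipschitz bound controls the integrand; elsewhere it is
  at most 2 on an event of small probability. Applied to \<open>iexp\<close> for characteristic
  functions and to \<open>ramp\<close> for distribution functions.\<close>

lemma tendsto_in_prob_Lipschitz:
  fixes f :: "real \<Rightarrow> 'b::{banach, second_countable_topology}"
  assumes X: "\<And>i. X i \<in> borel_measurable M" and Z: "Z \<in> borel_measurable M"
    and conv: "tendsto_in_prob M X Z F"
    and f: "f \<in> borel_measurable borel" "\<And>x. norm (f x) \<le> 1"
    and lip: "\<And>x y. norm (f x - f y) \<le> L * \<bar>x - y\<bar>"
  shows "((\<lambda>i. \<integral>\<omega>. norm (f (X i \<omega>) - f (Z \<omega>)) \<partial>M) \<longlongrightarrow> 0) F"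
proof (rule tendstoI)
  note [measurable] = X Z f(1)
  fix e :: real assume "0 < e"
  have "0 \<le> norm (f 1 - f 0)" by simp
  also have "\<dots> \<le> L" using lip[of 1 0] by simp
  finally have "0 \<le> L" .
  \<comment> \<open>\<open>L + 1\<close> in place of \<open>L\<close> covers the case L = 0.\<close>
  define a where "a = e / (2 * (L + 1))"
  have a: "0 < a" "L * a \<le> e / 2"
    using \<open>0 < e\<close> \<open>0 \<le> L\<close> by (auto simp: a_def field_simps)
  have "\<forall>\<^sub>F i in F. prob {\<omega> \<in> space M. a < \<bar>X i \<omega> - Z \<omega>\<bar>} < e / 4"
    using conv a \<open>0 < e\<close> unfolding tendsto_in_prob_def by (intro order_tendstoD(2)) auto
  then show "\<forall>\<^sub>F i in F. dist (\<integral>\<omega>. norm (f (X i \<omega>) - f (Z \<omega>)) \<partial>M) 0 < e"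
  proof eventually_elim
    case (elim i)
    have le2: "norm (f x - f y) \<le> 2" for x y
      using norm_triangle_ineq4[of "f x" "f y"] f(2)[of x] f(2)[of y] by linarith
    have ev: "{\<omega> \<in> space M. a < \<bar>X i \<omega> - Z \<omega>\<bar>} \<in> events" by measurable
    have "(\<integral>\<omega>. norm (f (X i \<omega>) - f (Z \<omega>)) \<partial>M)
        \<le> (\<integral>\<omega>. L * a + 2 * indicator {\<omega> \<in> space M. a < \<bar>X i \<omega> - Z \<omega>\<bar>} \<omega> \<partial>M)"
    proof (intro integral_mono)
      show "integrable M (\<lambda>\<omega>. norm (f (X i \<omega>) - f (Z \<omega>)))"
        by (rule integrable_const_bound[of _ 2]) (auto simp: le2)
      fix \<omega> assume \<omega>: "\<omega> \<in> space M"
      show "norm (f (X i \<omega>) - f (Z \<omega>)) \<le> L * a + 2 * indicator {\<omega> \<in> space M. a < \<bar>X i \<omega> - Z \<omega>\<bar>} \<omega>"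
      proof (cases "a < \<bar>X i \<omega> - Z \<omega>\<bar>")
        case True
        then show ?thesis using \<omega> le2[of "X i \<omega>" "Z \<omega>"] \<open>0 \<le> L\<close> a by (simp add: add_increasing)
      next
        case False
        then have "L * \<bar>X i \<omega> - Z \<omega>\<bar> \<le> L * a" using \<open>0 \<le> L\<close> by (intro mult_left_mono) auto
        then show ?thesis using False lip[of "X i \<omega>" "Z \<omega>"] by simp
      qed
    qed (auto intro!: Bochner_Integration.integrable_add ev)
    also have "\<dots> = L * a + 2 * prob {\<omega> \<in> space M. a < \<bar>X i \<omega> - Z \<omega>\<bar>}"
      by (subst Bochner_Integration.integral_add) (auto simp: prob_space)
    also have "\<dots> < e" using elim a by linarith
    finally show ?case by (simp add: dist_real_def)
  qed
qed

lemma iexp_Lipschitz: "norm (iexp (z * x) - iexp (z * y)) \<le> \<bar>z\<bar> * \<bar>x - y\<bar>"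
proof -
  have "iexp (z * x) - iexp (z * y) = iexp (z * y) * (iexp (z * (x - y)) - 1)"
    by (simp add: algebra_simps flip: exp_add)
  then have "norm (iexp (z * x) - iexp (z * y)) = norm (iexp (z * (x - y)) - 1)"
    by (simp add: norm_mult)
  also have "\<dots> \<le> \<bar>z * (x - y)\<bar>"
    using iexp_approx1[of "z * (x - y)" 0] by simp
  finally show ?thesis by (simp add: abs_mult)
qed

lemma char_distr:
  "X \<in> borel_measurable M \<Longrightarrow> char (distr M borel X) z = (\<integral>\<omega>. iexp (z * X \<omega>) \<partial>M)"
  unfolding char_def by (subst integral_distr) auto

lemma integrable_iexp_rv: "X \<in> borel_measurable M \<Longrightarrow> integrable M (\<lambda>\<omega>. iexp (z * X \<omega>))"
  by (rule integrable_const_bound[of _ 1]) auto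

lemma tendsto_in_prob_char:
  assumes X: "\<And>i. X i \<in> borel_measurable M" and Z: "Z \<in> borel_measurable M"
    and conv: "tendsto_in_prob M X Z F"
  shows "((\<lambda>i. char (distr M borel (X i)) z) \<longlongrightarrow> char (distr M borel Z) z) F"
proof -
  note [measurable] = X Z
  have "((\<lambda>i. \<integral>\<omega>. norm (iexp (z * X i \<omega>) - iexp (z * Z \<omega>)) \<partial>M) \<longlongrightarrow> 0) F"
    using tendsto_in_prob_Lipschitz[OF X Z conv, of "\<lambda>x. iexp (z * x)", OF _ _ iexp_Lipschitz] by simp
  then have "((\<lambda>i. char (distr M borel (X i)) z - char (distr M borel Z) z) \<longlongrightarrow> 0) F"
  proof (rule Lim_null_comparison[rotated], intro always_eventually allI)
    fix i
    have "char (distr M borel (X i)) z - char (distr M borel Z) z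
        = (\<integral>\<omega>. iexp (z * X i \<omega>) - iexp (z * Z \<omega>) \<partial>M)"
      by (simp only: char_distr X Z Bochner_Integration.integral_diff[OF integrable_iexp_rv integrable_iexp_rv])
    then show "norm (char (distr M borel (X i)) z - char (distr M borel Z) z)
        \<le> (\<integral>\<omega>. norm (iexp (z * X i \<omega>) - iexp (z * Z \<omega>)) \<partial>M)"
      by (simp add: integral_norm_bound)
  qed
  then show ?thesis by (simp add: LIM_zero_iff)
qed

text \<open>1 - Re of the characteristic function is the mean of 1 - cos (z X), so the averaging
  argument over z in [0, 1] applies. Every Cauchy estimate for random variables below runs through
  this bound.\<close>

lemma trunc_moment_le_char:
  assumes [measurable]: "X \<in> borel_measurable M"
    and K: "\<And>z. 0 \<le> z \<Longrightarrow> z \<le> 1 \<Longrightarrow> 1 - Re (char (distr M borel X) z) \<le> K"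
  shows "trunc_moment M X \<le> 8 * K"
proof -
  have re: "1 - Re (char (distr M borel X) z) = (\<integral>\<omega>. 1 - cos (z * X \<omega>) \<partial>M)" for z
  proof -
    have "Re (char (distr M borel X) z) = (\<integral>\<omega>. Re (iexp (z * X \<omega>)) \<partial>M)"
      by (simp only: char_distr assms) (rule integral_Re[symmetric], rule integrable_iexp_rv, fact)
    also have "\<dots> = (\<integral>\<omega>. cos (z * X \<omega>) \<partial>M)" by (simp add: Re_exp)
    finally show ?thesis
      by (subst Bochner_Integration.integral_diff)
        (auto simp: prob_space intro!: integrable_const_bound[of _ 1])
  qed
  have "0 \<le> (\<integral>\<omega>. 1 - cos (0 * X \<omega>) \<partial>M)" by simp
  with K[of 0] re[of 0] have "0 \<le> K" by simp
  have "(\<integral>\<^sup>+\<omega>. ennreal (trunc_sq (X \<omega>)) \<partial>M) \<le> 8 * ennreal K"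
  proof (rule nn_integral_trunc_sq_le)
    show "sigma_finite_measure M" ..
    fix z :: real assume z: "0 \<le> z" "z \<le> 1"
    have "(\<integral>\<^sup>+\<omega>. ennreal (1 - cos (z * X \<omega>)) \<partial>M) = ennreal (\<integral>\<omega>. 1 - cos (z * X \<omega>) \<partial>M)"
      by (intro nn_integral_eq_integral Bochner_Integration.integrable_diff
          integrable_const_bound[of "\<lambda>\<omega>. cos (z * X \<omega>)" 1]) auto
    then show "(\<integral>\<^sup>+\<omega>. ennreal (1 - cos (z * X \<omega>)) \<partial>M) \<le> ennreal K"
      using K[OF z] re[of z] by (simp add: ennreal_leI)
  qed measurable
  then have "ennreal (trunc_moment M X) \<le> ennreal (8 * K)"
    unfolding trunc_moment_def using \<open>0 \<le> K\<close>
    by (subst nn_integral_eq_integral[symmetric])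
      (auto simp: ennreal_mult' intro: integrable_trunc_sq)
  then show ?thesis using \<open>0 \<le> K\<close> by (simp add: ennreal_le_iff)
qed

end

text \<open>A Lipschitz version of the indicator of {..a}: it equals 1 up to a and falls to 0
  linearly with slope -m.\<close>

definition ramp :: "real \<Rightarrow> real \<Rightarrow> real \<Rightarrow> real" where
  "ramp m a x = min 1 (max 0 (1 - m * (x - a)))"

lemma ramp_Lipschitz:
  assumes "0 \<le> m" shows "norm (ramp m a x - ramp m a y) \<le> m * \<bar>x - y\<bar>"
proof -
  have "\<bar>ramp m a x - ramp m a y\<bar> \<le> \<bar>m * (x - a) - m * (y - a)\<bar>"
    by (auto simp: ramp_def min_def max_def)
  also have "\<dots> = m * \<bar>x - y\<bar>"
    using assms by (simp add: abs_mult flip: right_diff_distrib)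
  finally show ?thesis by simp
qed

lemma ramp_bounds: "0 \<le> ramp m a x" "ramp m a x \<le> 1"
  by (auto simp: ramp_def)

lemma borel_measurable_ramp [measurable]: "ramp m a \<in> borel_measurable borel"
  unfolding ramp_def by measurable

lemma ramp_tendsto_indicator: "(\<lambda>m. ramp (real m) a x) \<longlonglongrightarrow> indicator {..a} x"
proof (cases "x \<le> a")
  case True
  then have "real m * (x - a) \<le> 0" for m by (simp add: mult_nonneg_nonpos)
  moreover have "min 1 (max 0 (1 - u)) = 1" if "u \<le> 0" for u :: real
    using that by simp
  ultimately have "ramp (real m) a x = 1" for m
    unfolding ramp_def by blast
  with True show ?thesis by simp
next
  case False
  obtain n :: nat where n: "1 / (x - a) < real n" using reals_Archimedean2 by blast
  have "ramp (real m) a x = 0" if "n \<le> m" for m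
  proof -
    have "1 / (x - a) < real m" using n that by linarith
    then have "1 < real m * (x - a)" using False by (simp add: field_simps)
    then show ?thesis by (simp add: ramp_def)
  qed
  then have "\<forall>\<^sub>F m in sequentially. ramp (real m) a x = 0"
    by (auto simp: eventually_sequentially)
  with False show ?thesis by (simp add: tendsto_eventually)
qed

section \<open>Convergence in probability: completeness, preservation of independence, random
  series\<close>

context prob_space
begin

lemma AE_tendsto_imp_tendsto_in_prob:
  assumes X: "\<And>n. X n \<in> borel_measurable M" and Z: "Z \<in> borel_measurable M"
    and lim: "AE \<omega> in M. (\<lambda>n. X n \<omega>) \<longlonglongrightarrow> Z \<omega>"
  shows "tendsto_in_prob M X Z sequentially"
  unfolding tendsto_in_prob_iff_trunc_moment[OF X Z] trunc_moment_def
proof -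
  note [measurable] = X Z
  have "(\<lambda>n. \<integral>\<omega>. trunc_sq (X n \<omega> - Z \<omega>) \<partial>M) \<longlonglongrightarrow> (\<integral>\<omega>. 0 \<partial>M)"
  proof (rule integral_dominated_convergence[where w = "\<lambda>_. 1"])
    show "AE \<omega> in M. (\<lambda>n. trunc_sq (X n \<omega> - Z \<omega>)) \<longlonglongrightarrow> 0"
      using lim
    proof eventually_elim
      case (elim \<omega>)
      then show ?case
        using tendsto_trunc_sq[OF tendsto_diff[OF elim tendsto_const[of "Z \<omega>"]]] by simp
    qed
  qed auto
  then show "(\<lambda>n. \<integral>\<omega>. trunc_sq (X n \<omega> - Z \<omega>) \<partial>M) \<longlonglongrightarrow> 0" by simp
qed

lemma tendsto_in_prob_unique:
  assumes X: "\<And>n. X n \<in> borel_measurable M"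
    and Z: "Z \<in> borel_measurable M" "Z' \<in> borel_measurable M"
    and lim: "tendsto_in_prob M X Z F" "tendsto_in_prob M X Z' F" and F: "F \<noteq> bot"
  shows "AE \<omega> in M. Z \<omega> = Z' \<omega>"
proof (rule trunc_moment_eq_0_AE_eq[OF Z])
  have "((\<lambda>i. 2 * trunc_moment M (\<lambda>\<omega>. X i \<omega> - Z \<omega>) + 2 * trunc_moment M (\<lambda>\<omega>. X i \<omega> - Z' \<omega>)) \<longlongrightarrow> 2 * 0 + 2 * 0) F"
    using lim[unfolded tendsto_in_prob_iff_trunc_moment[OF X Z(1)] tendsto_in_prob_iff_trunc_moment[OF X Z(2)]]
    by (intro tendsto_intros)
  moreover have "trunc_moment M (\<lambda>\<omega>. Z \<omega> - Z' \<omega>)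
      \<le> 2 * trunc_moment M (\<lambda>\<omega>. X i \<omega> - Z \<omega>) + 2 * trunc_moment M (\<lambda>\<omega>. X i \<omega> - Z' \<omega>)" for i
    by (subst trunc_moment_minus_commute[of "X i" Z]) (rule trunc_moment_triangle[OF Z(1) X Z(2)])
  ultimately have "trunc_moment M (\<lambda>\<omega>. Z \<omega> - Z' \<omega>) \<le> 2 * 0 + 2 * 0"
    using F by (intro tendsto_lowerbound) auto
  then show "trunc_moment M (\<lambda>\<omega>. Z \<omega> - Z' \<omega>) = 0"
    using trunc_moment_nonneg[of "\<lambda>\<omega>. Z \<omega> - Z' \<omega>"] by simp
qed

text \<open>Along a subsequence with successive distances below 8^-k, Markov's inequality gives a
  step larger than 2^-k probability at most 8^-k / 4^-k = 2^-k. By Borel-Cantelli the subsequence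
  converges almost surely, and the Cauchy property carries the limit over to the whole
  sequence.\<close>

lemma Cauchy_in_prob_convergent:
  assumes X: "\<And>n. X n \<in> borel_measurable M"
    and Cauchy: "\<And>e. 0 < e \<Longrightarrow> \<exists>N. \<forall>m\<ge>N. \<forall>n\<ge>N. trunc_moment M (\<lambda>\<omega>. X m \<omega> - X n \<omega>) < e"
  obtains Z where "Z \<in> borel_measurable M" "tendsto_in_prob M X Z sequentially"
proof -
  note [measurable] = X
  have "\<forall>k. \<exists>N. \<forall>m\<ge>N. \<forall>n\<ge>N. trunc_moment M (\<lambda>\<omega>. X m \<omega> - X n \<omega>) < (1/8) ^ k"
    by (intro allI Cauchy) simp
  then obtain N where N:
    "\<And>k m n. N k \<le> m \<Longrightarrow> N k \<le> n \<Longrightarrow> trunc_moment M (\<lambda>\<omega>. X m \<omega> - X n \<omega>) < (1/8) ^ k"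
    by metis
  \<comment> \<open>Summing all earlier thresholds makes both \<open>r k\<close> and
    \<open>r (Suc k)\<close> at least \<open>N k\<close>; the added k forces r to infinity.\<close>
  define r where "r k = (\<Sum>i\<le>k. N i) + k" for k
  have "N k \<le> (\<Sum>i\<le>k. N i)" for k by (intro member_le_sum) auto
  then have r: "N k \<le> r k" "N k \<le> r (Suc k)" "k \<le> r k" for k
    by (simp_all add: r_def trans_le_add1 le_SucI)
  define A where "A k = {\<omega> \<in> space M. (1/2) ^ k < \<bar>X (r (Suc k)) \<omega> - X (r k) \<omega>\<bar>}" for k
  have [measurable]: "A k \<in> events" for k unfolding A_def by measurable
  have "prob (A k) \<le> (1/2) ^ k" for k
  proof -
    have "prob (A k) \<le> trunc_moment M (\<lambda>\<omega>. X (r (Suc k)) \<omega> - X (r k) \<omega>) / ((1/2) ^ k)\<^sup>2"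
      unfolding A_def by (intro prob_gt_le_trunc_moment) (auto simp: power_le_one)
    also have "\<dots> \<le> (1/8) ^ k / ((1/2) ^ k)\<^sup>2"
      using N[OF r(2) r(1), of k] by (intro divide_right_mono) auto
    also have "((1/8) ^ k :: real) = (1/2) ^ k * ((1/2) ^ k)\<^sup>2"
      by (simp add: power2_eq_square flip: power_mult_distrib)
    finally show ?thesis by simp
  qed
  then have "summable (\<lambda>k. prob (A k))"
    by (intro summable_comparison_test[OF _ summable_geometric[of "1/2"]]) auto
  then have "AE \<omega> in M. \<forall>\<^sub>F k in sequentially. \<omega> \<in> space M - A k"
    by (intro borel_cantelli_AE1) (auto simp: emeasure_eq_measure)
  then have lim: "AE \<omega> in M. (\<lambda>k. X (r k) \<omega>) \<longlonglongrightarrow> lim (\<lambda>k. X (r k) \<omega>)"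
  proof eventually_elim
    case (elim \<omega>)
    then have "\<forall>\<^sub>F k in sequentially. norm (X (r (Suc k)) \<omega> - X (r k) \<omega>) \<le> (1/2) ^ k"
      by eventually_elim (auto simp: A_def)
    then have "summable (\<lambda>k. X (r (Suc k)) \<omega> - X (r k) \<omega>)"
      by (rule summable_comparison_test_ev) (simp add: summable_geometric)
    then have "convergent (\<lambda>n. X (r n) \<omega> - X (r 0) \<omega>)"
      by (simp add: summable_iff_convergent sum_lessThan_telescope[of "\<lambda>k. X (r k) \<omega>"])
    then have "convergent (\<lambda>n. (X (r n) \<omega> - X (r 0) \<omega>) + X (r 0) \<omega>)"
      by (intro convergent_add convergent_const)
    then show ?case by (simp add: convergent_LIMSEQ_iff)
  qed
  define Z where "Z \<omega> = lim (\<lambda>k. X (r k) \<omega>)" for \<omega>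
  have Z [measurable]: "Z \<in> borel_measurable M" unfolding Z_def by measurable
  have sub: "tendsto_in_prob M (\<lambda>k. X (r k)) Z sequentially"
    using lim by (intro AE_tendsto_imp_tendsto_in_prob) (auto simp: Z_def)
  have "tendsto_in_prob M X Z sequentially"
    unfolding tendsto_in_prob_iff_trunc_moment[OF X Z]
  proof (rule LIMSEQ_I)
    fix e :: real assume "0 < e"
    then obtain K where K: "\<And>m n. K \<le> m \<Longrightarrow> K \<le> n \<Longrightarrow> trunc_moment M (\<lambda>\<omega>. X m \<omega> - X n \<omega>) < e / 4"
      using Cauchy[of "e / 4"] by auto
    have lim0: "(\<lambda>k. trunc_moment M (\<lambda>\<omega>. X (r k) \<omega> - Z \<omega>)) \<longlonglongrightarrow> 0"
      using sub by (subst (asm) tendsto_in_prob_iff_trunc_moment) auto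
    obtain k0 where k0: "\<And>k. k0 \<le> k \<Longrightarrow> norm (trunc_moment M (\<lambda>\<omega>. X (r k) \<omega> - Z \<omega>) - 0) < e / 4"
      using LIMSEQ_D[OF lim0, of "e / 4"] \<open>0 < e\<close> by auto
    define k where "k = max k0 K"
    have k: "K \<le> r k" "k0 \<le> k" using r(3)[of k] by (auto simp: k_def)
    have "norm (trunc_moment M (\<lambda>\<omega>. X n \<omega> - Z \<omega>) - 0) < e" if "K \<le> n" for n
      using trunc_moment_triangle[OF X X Z, of n "r k"] K[OF that k(1)] k0[OF k(2)]
        trunc_moment_nonneg[of "\<lambda>\<omega>. X n \<omega> - Z \<omega>"] by simp
    then show "\<exists>n0. \<forall>n\<ge>n0. norm (trunc_moment M (\<lambda>\<omega>. X n \<omega> - Z \<omega>) - 0) < e" by blast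
  qed
  with Z show thesis by (rule that)
qed

text \<open>The product formula for means holds along the sequence for Lipschitz functions of the
  variables and survives the limit. Letting the slope of the ramps grow turns it into the product
  formula for the events Z j <= a j, which determine independence.\<close>

lemma indep_vars_tendsto_in_prob:
  fixes X :: "nat \<Rightarrow> 'i \<Rightarrow> 'a \<Rightarrow> real"
  assumes X: "\<And>n. indep_vars (\<lambda>_. borel) (X n) I"
    and Z: "\<And>i. i \<in> I \<Longrightarrow> Z i \<in> borel_measurable M"
    and lim: "\<And>i. i \<in> I \<Longrightarrow> tendsto_in_prob M (\<lambda>n. X n i) (Z i) sequentially"
  shows "indep_vars (\<lambda>_. borel) Z I"
proof -
  have Xm: "X n i \<in> borel_measurable M" if "i \<in> I" for n i
    using X that by (auto simp: indep_vars_def2)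
  have prod_eq: "(\<integral>\<omega>. (\<Prod>j\<in>J. ramp m (a j) (Z j \<omega>)) \<partial>M) = (\<Prod>j\<in>J. \<integral>\<omega>. ramp m (a j) (Z j \<omega>) \<partial>M)"
    if J: "J \<subseteq> I" "finite J" and "0 \<le> m" for J m a
  proof -
    let ?f = "\<lambda>j. ramp m (a j)"
    have Xm': "X n j \<in> borel_measurable M" if "j \<in> J" for n j using Xm J that by auto
    have Zm': "Z j \<in> borel_measurable M" if "j \<in> J" for j using Z J that by auto
    have int: "integrable M (\<lambda>\<omega>. ?f j (V \<omega>))" if "V \<in> borel_measurable M" for j V
      using that ramp_bounds by (intro integrable_const_bound[of _ 1]) auto
    have intp: "integrable M (\<lambda>\<omega>. \<Prod>j\<in>J. ?f j (V j \<omega>))" if "\<And>j. j \<in> J \<Longrightarrow> V j \<in> borel_measurable M" for V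
      using that ramp_bounds
      by (intro integrable_const_bound[of _ 1] borel_measurable_prod)
        (auto intro!: prod_le_1 prod_nonneg AE_I2 simp: abs_of_nonneg prod_nonneg)
    have l1: "(\<lambda>n. \<integral>\<omega>. norm (?f j (X n j \<omega>) - ?f j (Z j \<omega>)) \<partial>M) \<longlonglongrightarrow> 0" if "j \<in> J" for j
      using that J ramp_bounds \<open>0 \<le> m\<close>
      by (intro tendsto_in_prob_Lipschitz[where L = m] Xm' Zm' lim ramp_Lipschitz) auto
    have eq: "(\<integral>\<omega>. (\<Prod>j\<in>J. ?f j (X n j \<omega>)) \<partial>M) = (\<Prod>j\<in>J. \<integral>\<omega>. ?f j (X n j \<omega>) \<partial>M)" for n
    proof (rule indep_vars_lebesgue_integral[OF J(2)])
      show "indep_vars (\<lambda>_. borel) (\<lambda>j \<omega>. ?f j (X n j \<omega>)) J"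
        using indep_vars_compose2[OF indep_vars_subset[OF X J(1)], of ?f] by simp
    qed (intro int Xm')
    \<comment> \<open>For factors of modulus at most 1, products differ by at most the sum of the
      differences of the factors.\<close>
    have "(\<lambda>n. (\<integral>\<omega>. (\<Prod>j\<in>J. ?f j (X n j \<omega>)) \<partial>M) - (\<integral>\<omega>. (\<Prod>j\<in>J. ?f j (Z j \<omega>)) \<partial>M)) \<longlonglongrightarrow> 0"
    proof (rule Lim_null_comparison)
      show "(\<lambda>n. \<Sum>j\<in>J. \<integral>\<omega>. norm (?f j (X n j \<omega>) - ?f j (Z j \<omega>)) \<partial>M) \<longlonglongrightarrow> 0"
        using l1 by (intro tendsto_null_sum)
      show "\<forall>\<^sub>F n in sequentially. norm ((\<integral>\<omega>. (\<Prod>j\<in>J. ?f j (X n j \<omega>)) \<partial>M) - (\<integral>\<omega>. (\<Prod>j\<in>J. ?f j (Z j \<omega>)) \<partial>M))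
          \<le> (\<Sum>j\<in>J. \<integral>\<omega>. norm (?f j (X n j \<omega>) - ?f j (Z j \<omega>)) \<partial>M)"
      proof (intro always_eventually allI)
        fix n
        have i2: "integrable M (\<lambda>\<omega>. norm (?f j (X n j \<omega>) - ?f j (Z j \<omega>)))" if "j \<in> J" for j
          by (intro integrable_norm Bochner_Integration.integrable_diff int Xm' Zm' that)
        have "(\<integral>\<omega>. (\<Prod>j\<in>J. ?f j (X n j \<omega>)) \<partial>M) - (\<integral>\<omega>. (\<Prod>j\<in>J. ?f j (Z j \<omega>)) \<partial>M)
            = (\<integral>\<omega>. (\<Prod>j\<in>J. ?f j (X n j \<omega>)) - (\<Prod>j\<in>J. ?f j (Z j \<omega>)) \<partial>M)"
          by (intro Bochner_Integration.integral_diff[symmetric] intp Xm' Zm')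
        also have "norm \<dots> \<le> (\<integral>\<omega>. norm ((\<Prod>j\<in>J. ?f j (X n j \<omega>)) - (\<Prod>j\<in>J. ?f j (Z j \<omega>))) \<partial>M)"
          by (rule integral_norm_bound)
        also have "\<dots> \<le> (\<integral>\<omega>. (\<Sum>j\<in>J. norm (?f j (X n j \<omega>) - ?f j (Z j \<omega>))) \<partial>M)"
          using ramp_bounds
          by (intro integral_mono integrable_norm Bochner_Integration.integrable_diff intp Xm' Zm'
              Bochner_Integration.integrable_sum i2 norm_prod_diff) auto
        also have "\<dots> = (\<Sum>j\<in>J. \<integral>\<omega>. norm (?f j (X n j \<omega>) - ?f j (Z j \<omega>)) \<partial>M)"
          by (intro Bochner_Integration.integral_sum i2)
        finally show "norm ((\<integral>\<omega>. (\<Prod>j\<in>J. ?f j (X n j \<omega>)) \<partial>M) - (\<integral>\<omega>. (\<Prod>j\<in>J. ?f j (Z j \<omega>)) \<partial>M))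
          \<le> (\<Sum>j\<in>J. \<integral>\<omega>. norm (?f j (X n j \<omega>) - ?f j (Z j \<omega>)) \<partial>M)" .
      qed
    qed
    then have lim1: "(\<lambda>n. \<integral>\<omega>. (\<Prod>j\<in>J. ?f j (X n j \<omega>)) \<partial>M) \<longlonglongrightarrow> (\<integral>\<omega>. (\<Prod>j\<in>J. ?f j (Z j \<omega>)) \<partial>M)"
      by (simp add: LIM_zero_iff)
    have "(\<lambda>n. \<integral>\<omega>. ?f j (X n j \<omega>) \<partial>M) \<longlonglongrightarrow> (\<integral>\<omega>. ?f j (Z j \<omega>) \<partial>M)" if "j \<in> J" for j
    proof -
      have "(\<lambda>n. (\<integral>\<omega>. ?f j (X n j \<omega>) \<partial>M) - (\<integral>\<omega>. ?f j (Z j \<omega>) \<partial>M)) \<longlonglongrightarrow> 0"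
      proof (rule Lim_null_comparison[OF _ l1[OF that]], intro always_eventually allI)
        fix n
        show "norm ((\<integral>\<omega>. ?f j (X n j \<omega>) \<partial>M) - (\<integral>\<omega>. ?f j (Z j \<omega>) \<partial>M))
            \<le> (\<integral>\<omega>. norm (?f j (X n j \<omega>) - ?f j (Z j \<omega>)) \<partial>M)"
          unfolding Bochner_Integration.integral_diff[OF int[OF Xm'[OF that]] int[OF Zm'[OF that]], symmetric]
          by (rule integral_norm_bound)
      qed
      then show ?thesis by (simp add: LIM_zero_iff)
    qed
    then have "(\<lambda>n. \<Prod>j\<in>J. \<integral>\<omega>. ?f j (X n j \<omega>) \<partial>M) \<longlonglongrightarrow> (\<Prod>j\<in>J. \<integral>\<omega>. ?f j (Z j \<omega>) \<partial>M)"
      by (intro tendsto_prod)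
    then show ?thesis
      using LIMSEQ_unique[OF lim1] by (simp add: eq)
  qed
  have cdf_eq: "prob (\<Inter>j\<in>J. {\<omega> \<in> space M. Z j \<omega> \<le> a j}) = (\<Prod>j\<in>J. prob {\<omega> \<in> space M. Z j \<omega> \<le> a j})"
    if J: "J \<subseteq> I" "finite J" "J \<noteq> {}" for J a
  proof -
    have Zm': "Z j \<in> borel_measurable M" if "j \<in> J" for j using Z J that by auto
    have bd: "norm (\<Prod>j\<in>J. ramp (real m) (a j) (Z j \<omega>)) \<le> 1" for m \<omega>
      using ramp_bounds by (simp add: prod_le_1 prod_nonneg abs_of_nonneg)
    have A: "(\<lambda>m. \<integral>\<omega>. (\<Prod>j\<in>J. ramp (real m) (a j) (Z j \<omega>)) \<partial>M)
        \<longlonglongrightarrow> (\<integral>\<omega>. (\<Prod>j\<in>J. indicator {..a j} (Z j \<omega>)) \<partial>M)"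
      using bd Zm'
      by (intro integral_dominated_convergence[where w = "\<lambda>_. 1"] borel_measurable_prod AE_I2
          tendsto_prod ramp_tendsto_indicator measurable_compose[OF Zm']) auto
    have B: "(\<lambda>m. \<integral>\<omega>. ramp (real m) (a j) (Z j \<omega>) \<partial>M)
        \<longlonglongrightarrow> (\<integral>\<omega>. indicator {..a j} (Z j \<omega>) \<partial>M)" if "j \<in> J" for j
      using ramp_bounds that
      by (intro integral_dominated_convergence[where w = "\<lambda>_. 1"] AE_I2
           ramp_tendsto_indicator measurable_compose[OF Zm']) auto
    have "(\<integral>\<omega>. (\<Prod>j\<in>J. indicator {..a j} (Z j \<omega>)) \<partial>M) = (\<Prod>j\<in>J. \<integral>\<omega>. indicator {..a j} (Z j \<omega>) \<partial>M :: real)"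
    proof (rule LIMSEQ_unique[OF A])
      have "(\<lambda>m. \<Prod>j\<in>J. \<integral>\<omega>. ramp (real m) (a j) (Z j \<omega>) \<partial>M) \<longlonglongrightarrow> (\<Prod>j\<in>J. \<integral>\<omega>. indicator {..a j} (Z j \<omega>) \<partial>M)"
        by (intro tendsto_prod B)
      then show "(\<lambda>m. \<integral>\<omega>. (\<Prod>j\<in>J. ramp (real m) (a j) (Z j \<omega>)) \<partial>M) \<longlonglongrightarrow> (\<Prod>j\<in>J. \<integral>\<omega>. indicator {..a j} (Z j \<omega>) \<partial>M)"
        by (simp only: prod_eq[OF J(1,2) of_nat_0_le_iff])
    qed
    also have "(\<integral>\<omega>. (\<Prod>j\<in>J. indicator {..a j} (Z j \<omega>)) \<partial>M :: real)
        = (\<integral>\<omega>. indicator (\<Inter>j\<in>J. {\<omega> \<in> space M. Z j \<omega> \<le> a j}) \<omega> \<partial>M)"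
    proof (intro Bochner_Integration.integral_cong refl)
      fix \<omega> assume "\<omega> \<in> space M"
      then show "(\<Prod>j\<in>J. indicator {..a j} (Z j \<omega>)) = (indicator (\<Inter>j\<in>J. {\<omega> \<in> space M. Z j \<omega> \<le> a j}) \<omega> :: real)"
        using J by (auto simp: indicator_def prod_eq_1_iff prod_zero_iff)
    qed
    also have "\<dots> = prob (\<Inter>j\<in>J. {\<omega> \<in> space M. Z j \<omega> \<le> a j})"
    proof -
      have "(\<Inter>j\<in>J. {\<omega> \<in> space M. Z j \<omega> \<le> a j}) \<inter> space M = (\<Inter>j\<in>J. {\<omega> \<in> space M. Z j \<omega> \<le> a j})"
        using J by auto
      then show ?thesis by simp
    qed
    also have "(\<Prod>j\<in>J. \<integral>\<omega>. indicator {..a j} (Z j \<omega>) \<partial>M :: real) = (\<Prod>j\<in>J. prob {\<omega> \<in> space M. Z j \<omega> \<le> a j})"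
    proof (intro prod.cong refl)
      fix j assume "j \<in> J"
      have "(\<integral>\<omega>. indicator {..a j} (Z j \<omega>) \<partial>M :: real) = (\<integral>\<omega>. indicator {\<omega> \<in> space M. Z j \<omega> \<le> a j} \<omega> \<partial>M)"
        by (intro Bochner_Integration.integral_cong) (auto simp: indicator_def)
      then show "(\<integral>\<omega>. indicator {..a j} (Z j \<omega>) \<partial>M :: real) = prob {\<omega> \<in> space M. Z j \<omega> \<le> a j}"
        by (simp add: Int_absorb2 subset_eq)
    qed
    finally show ?thesis .
  qed
  \<comment> \<open>These events are stable under intersection and generate the sigma-algebra of Z
    i, so independence need only be checked on them.\<close>
  define E where "E i = {{\<omega> \<in> space M. Z i \<omega> \<le> x} | x. True}" for i
  have Em: "E i \<subseteq> events" if "i \<in> I" for i using Z[OF that] by (auto simp: E_def)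
  have "indep_sets E I"
  proof (rule indep_setsI[OF Em])
    fix A J assume J: "J \<noteq> {}" "J \<subseteq> I" "finite J" and A: "\<forall>j\<in>J. A j \<in> E j"
    then have "\<forall>j\<in>J. \<exists>x. A j = {\<omega> \<in> space M. Z j \<omega> \<le> x}" by (auto simp: E_def)
    then obtain a where a: "\<And>j. j \<in> J \<Longrightarrow> A j = {\<omega> \<in> space M. Z j \<omega> \<le> a j}" by metis
    have "(\<Inter>j\<in>J. A j) = (\<Inter>j\<in>J. {\<omega> \<in> space M. Z j \<omega> \<le> a j})" using a by auto
    then show "prob (\<Inter>j\<in>J. A j) = (\<Prod>j\<in>J. prob (A j))"
      using cdf_eq[OF J(2,3,1)] a by simp
  qed
  then have "indep_sets (\<lambda>i. sigma_sets (space M) (E i)) I"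
  proof (rule indep_sets_sigma)
    fix i
    show "Int_stable (E i)"
    proof (rule Int_stableI)
      fix A B assume "A \<in> E i" "B \<in> E i"
      then obtain x y where "A = {\<omega> \<in> space M. Z i \<omega> \<le> x}" "B = {\<omega> \<in> space M. Z i \<omega> \<le> y}"
        by (auto simp: E_def)
      then have "A \<inter> B = {\<omega> \<in> space M. Z i \<omega> \<le> min x y}" by auto
      then show "A \<inter> B \<in> E i" unfolding E_def by blast
    qed
  qed
  then have "indep_sets (\<lambda>i. {Z i -` A \<inter> space M | A. A \<in> sets borel}) I"
  proof (rule indep_sets_mono_sets)
    fix i assume "i \<in> I"
    have sub: "E i \<subseteq> Pow (space M)" by (auto simp: E_def)
    have "Z i \<in> borel_measurable (sigma (space M) (E i))"
      using sub by (subst borel_measurable_iff_le) (auto simp: space_measure_of sets_measure_of E_def)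
    then show "{Z i -` A \<inter> space M | A. A \<in> sets borel} \<subseteq> sigma_sets (space M) (E i)"
      using measurable_sets[of "Z i" "sigma (space M) (E i)" borel] sub
      by (auto simp: space_measure_of sets_measure_of)
  qed
  then show ?thesis using Z by (simp add: indep_vars_def2)
qed

text \<open>Decompose according to the first passage index.\<close>

lemma Ottaviani_inequality:
  fixes X :: "nat \<Rightarrow> 'a \<Rightarrow> real" and m n :: nat
  defines "S \<equiv> \<lambda>k \<omega>. \<Sum>i\<in>{m..<k}. X i \<omega>"
  assumes indep: "indep_vars (\<lambda>_. borel) X UNIV"
    and half: "\<And>k. k \<in> {m..n} \<Longrightarrow> prob {\<omega> \<in> space M. a < \<bar>S n \<omega> - S k \<omega>\<bar>} \<le> 1 / 2"
  shows "prob {\<omega> \<in> space M. \<exists>k\<in>{m..n}. 2 * a < \<bar>S k \<omega>\<bar>} \<le> 2 * prob {\<omega> \<in> space M. a < \<bar>S n \<omega>\<bar>}"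
proof -
  have X [measurable]: "X i \<in> borel_measurable M" for i
    using indep by (auto simp: indep_vars_def2)
  have S [measurable]: "S k \<in> borel_measurable M" for k unfolding S_def by measurable
  \<comment> \<open>k is the first index at which the partial sum exceeds 2 a; \<open>B k\<close>
    involves only later summands. On the intersection of the two the final sum exceeds a, which
    produces the right-hand side.\<close>
  define A where "A k = {\<omega> \<in> space M. 2 * a < \<bar>S k \<omega>\<bar> \<and> (\<forall>j\<in>{m..<k}. \<bar>S j \<omega>\<bar> \<le> 2 * a)}" for k
  define B where "B k = {\<omega> \<in> space M. \<bar>S n \<omega> - S k \<omega>\<bar> \<le> a}" for k
  have [measurable]: "A k \<in> events" "B k \<in> events" for k unfolding A_def B_def by measurable
  have AB: "prob (A k) \<le> 2 * prob (A k \<inter> B k)" if k: "k \<in> {m..n}" for k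
  proof -
    \<comment> \<open>Both events are expressed through coordinate vectors on the disjoint blocks
      {m..<k} and {k..<n}, the form in which independence of blocks is available.\<close>
    let ?u = "\<lambda>f. if 2 * a < \<bar>\<Sum>i\<in>{m..<k}. f i\<bar> \<and> (\<forall>j\<in>{m..<k}. \<bar>\<Sum>i\<in>{m..<j}. f i\<bar> \<le> 2 * a) then 1 else 0 :: real"
    let ?v = "\<lambda>f. \<Sum>i\<in>{k..<n}. f i :: real"
    have "indep_var (PiM {m..<k} (\<lambda>_. borel)) (\<lambda>\<omega>. restrict (\<lambda>i. X i \<omega>) {m..<k})
        (PiM {k..<n} (\<lambda>_. borel)) (\<lambda>\<omega>. restrict (\<lambda>i. X i \<omega>) {k..<n})"
      by (rule indep_var_restrict[OF indep]) auto
    moreover have "?u \<in> borel_measurable (PiM {m..<k} (\<lambda>_. borel))"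
    proof -
      have sm: "(\<lambda>f. \<Sum>i\<in>{m..<j}. f i) \<in> borel_measurable (PiM {m..<k} (\<lambda>_. borel :: real measure))"
        if "j \<le> k" for j
        using that by (intro borel_measurable_sum measurable_component_singleton) auto
      show ?thesis
        by (intro measurable_If sets.sets_Collect_conj sets.sets_Collect_finite_All borel_measurable_less
            borel_measurable_le borel_measurable_abs sm measurable_const) auto
    qed
    moreover have "?v \<in> borel_measurable (PiM {k..<n} (\<lambda>_. borel))"
      by (intro borel_measurable_sum measurable_component_singleton) auto
    ultimately have "indep_var borel (?u \<circ> (\<lambda>\<omega>. restrict (\<lambda>i. X i \<omega>) {m..<k}))
        borel (?v \<circ> (\<lambda>\<omega>. restrict (\<lambda>i. X i \<omega>) {k..<n}))"
      by (rule indep_var_compose)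
    from prob_indep_random_variable[OF this, of "{1}" "{-a..a}"]
    have "prob {\<omega> \<in> space M. (?u \<circ> (\<lambda>\<omega>. restrict (\<lambda>i. X i \<omega>) {m..<k})) \<omega> \<in> {1} \<and>
          (?v \<circ> (\<lambda>\<omega>. restrict (\<lambda>i. X i \<omega>) {k..<n})) \<omega> \<in> {-a..a}}
        = prob {\<omega> \<in> space M. (?u \<circ> (\<lambda>\<omega>. restrict (\<lambda>i. X i \<omega>) {m..<k})) \<omega> \<in> {1}} *
          prob {\<omega> \<in> space M. (?v \<circ> (\<lambda>\<omega>. restrict (\<lambda>i. X i \<omega>) {k..<n})) \<omega> \<in> {-a..a}}"
      by simp
    moreover have "(?u \<circ> (\<lambda>\<omega>. restrict (\<lambda>i. X i \<omega>) {m..<k})) \<omega> \<in> {1} \<longleftrightarrow> \<omega> \<in> A k" if "\<omega> \<in> space M" for \<omega>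
    proof -
      have "(\<Sum>i\<in>{m..<j}. restrict (\<lambda>i. X i \<omega>) {m..<k} i) = S j \<omega>" if "j \<le> k" for j
        using that by (auto simp: S_def intro!: sum.cong)
      then show ?thesis using that by (auto simp: A_def)
    qed
    moreover have "(?v \<circ> (\<lambda>\<omega>. restrict (\<lambda>i. X i \<omega>) {k..<n})) \<omega> \<in> {-a..a} \<longleftrightarrow> \<omega> \<in> B k" if "\<omega> \<in> space M" for \<omega>
    proof -
      have "(\<Sum>i\<in>{k..<n}. restrict (\<lambda>i. X i \<omega>) {k..<n} i) = S n \<omega> - S k \<omega>"
        using k sum.atLeastLessThan_concat[of m k n "\<lambda>i. X i \<omega>"] by (simp add: S_def)
      then show ?thesis using that by (auto simp: B_def)
    qed
    ultimately have "prob {\<omega> \<in> space M. \<omega> \<in> A k \<and> \<omega> \<in> B k}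
        = prob {\<omega> \<in> space M. \<omega> \<in> A k} * prob {\<omega> \<in> space M. \<omega> \<in> B k}"
      by (simp cong: conj_cong)
    then have prod: "prob (A k \<inter> B k) = prob (A k) * prob (B k)"
    proof -
      have "{\<omega> \<in> space M. \<omega> \<in> A k \<and> \<omega> \<in> B k} = A k \<inter> B k" "{\<omega> \<in> space M. \<omega> \<in> A k} = A k"
        "{\<omega> \<in> space M. \<omega> \<in> B k} = B k" by (auto simp: A_def B_def)
      then show "prob {\<omega> \<in> space M. \<omega> \<in> A k \<and> \<omega> \<in> B k} = prob {\<omega> \<in> space M. \<omega> \<in> A k} * prob {\<omega> \<in> space M. \<omega> \<in> B k} \<Longrightarrow> ?thesis" by simp
    qed
    have "prob (B k) = 1 - prob {\<omega> \<in> space M. a < \<bar>S n \<omega> - S k \<omega>\<bar>}"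
      unfolding B_def by (subst prob_neg[symmetric]) (auto simp: not_less)
    with half[OF k] have "1 \<le> 2 * prob (B k)" by simp
    then have "prob (A k) * 1 \<le> prob (A k) * (2 * prob (B k))"
      by (intro mult_left_mono) auto
    then show ?thesis by (simp add: prod)
  qed
  have disj: "disjoint_family_on A {m..n}"
    unfolding disjoint_family_on_def A_def
  proof (intro ballI impI)
    fix j k :: nat assume "j \<in> {m..n}" "k \<in> {m..n}" "j \<noteq> k"
    then have "j \<in> {m..<k} \<or> k \<in> {m..<j}" by auto
    then show "{\<omega> \<in> space M. 2 * a < \<bar>S j \<omega>\<bar> \<and> (\<forall>i\<in>{m..<j}. \<bar>S i \<omega>\<bar> \<le> 2 * a)} \<inter>
        {\<omega> \<in> space M. 2 * a < \<bar>S k \<omega>\<bar> \<and> (\<forall>i\<in>{m..<k}. \<bar>S i \<omega>\<bar> \<le> 2 * a)} = {}"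
      by fastforce
  qed
  have "{\<omega> \<in> space M. \<exists>k\<in>{m..n}. 2 * a < \<bar>S k \<omega>\<bar>} \<subseteq> (\<Union>k\<in>{m..n}. A k)"
  proof
    fix \<omega> assume \<omega>: "\<omega> \<in> {\<omega> \<in> space M. \<exists>k\<in>{m..n}. 2 * a < \<bar>S k \<omega>\<bar>}"
    define k where "k = (LEAST k. k \<in> {m..n} \<and> 2 * a < \<bar>S k \<omega>\<bar>)"
    have k: "k \<in> {m..n} \<and> 2 * a < \<bar>S k \<omega>\<bar>" 
      unfolding k_def by (rule LeastI_ex) (use \<omega> in auto)
    have "\<bar>S j \<omega>\<bar> \<le> 2 * a" if "j \<in> {m..<k}" for j
    proof (rule ccontr)
      assume "\<not> \<bar>S j \<omega>\<bar> \<le> 2 * a"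
      then have "j \<in> {m..n} \<and> 2 * a < \<bar>S j \<omega>\<bar>" using that k by simp
      then have "k \<le> j" unfolding k_def by (rule Least_le)
      with that show False by simp
    qed
    with k \<omega> show "\<omega> \<in> (\<Union>k\<in>{m..n}. A k)" by (auto simp: A_def)
  qed
  then have "prob {\<omega> \<in> space M. \<exists>k\<in>{m..n}. 2 * a < \<bar>S k \<omega>\<bar>} \<le> prob (\<Union>k\<in>{m..n}. A k)"
    by (intro finite_measure_mono) auto
  also have "\<dots> = (\<Sum>k\<in>{m..n}. prob (A k))"
    using disj by (intro finite_measure_finite_Union) auto
  also have "\<dots> \<le> (\<Sum>k\<in>{m..n}. 2 * prob (A k \<inter> B k))"
    by (intro sum_mono AB)
  also have "\<dots> = 2 * (\<Sum>k\<in>{m..n}. prob (A k \<inter> B k))"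
    by (simp add: sum_distrib_left)
  also have "(\<Sum>k\<in>{m..n}. prob (A k \<inter> B k)) = prob (\<Union>k\<in>{m..n}. A k \<inter> B k)"
    using disj by (intro finite_measure_finite_Union[symmetric]) (auto simp: disjoint_family_on_def)
  also have "\<dots> \<le> prob {\<omega> \<in> space M. a < \<bar>S n \<omega>\<bar>}"
    by (intro finite_measure_mono) (auto simp: A_def B_def)
  finally show ?thesis by simp
qed

text \<open>Levy's equivalence for series of independent variables. The random measure must be
  countably additive almost surely, whereas its construction yields only limits in probability; the
  maximal inequality bridges the gap by bounding the oscillation after N through a single
  increment.\<close>

lemma indep_sums_tendsto_in_prob_imp_AE:
  fixes X :: "nat \<Rightarrow> 'a \<Rightarrow> real"
  assumes indep: "indep_vars (\<lambda>_. borel) X UNIV"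
    and Z: "Z \<in> borel_measurable M"
    and lim: "tendsto_in_prob M (\<lambda>n \<omega>. \<Sum>i<n. X i \<omega>) Z sequentially"
  shows "AE \<omega> in M. (\<lambda>n. X n \<omega>) sums Z \<omega>"
proof -
  have X [measurable]: "X i \<in> borel_measurable M" for i
    using indep by (auto simp: indep_vars_def2)
  note [measurable] = Z
  define S where "S n \<omega> = (\<Sum>i<n. X i \<omega>)" for n \<omega>
  have S [measurable]: "S k \<in> borel_measurable M" for k unfolding S_def by measurable
  have Sdiff: "(\<Sum>i\<in>{m..<k}. X i \<omega>) = S k \<omega> - S m \<omega>" if "m \<le> k" for m k \<omega>
    using that sum_diff_nat_ivl[of 0 m k "\<lambda>i. X i \<omega>"] by (simp add: S_def atLeast0LessThan)
  have small: "\<exists>N. \<forall>m\<ge>N. \<forall>n\<ge>N. prob {\<omega> \<in> space M. a < \<bar>S n \<omega> - S m \<omega>\<bar>} \<le> d"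
    if "0 < a" "0 < d" for a d
  proof -
    have "\<forall>\<^sub>F n in sequentially. prob {\<omega> \<in> space M. a / 2 < \<bar>S n \<omega> - Z \<omega>\<bar>} < d / 2"
      unfolding S_def
      by (rule order_tendstoD(2)[OF lim[unfolded tendsto_in_prob_def, rule_format, of "a / 2"]])
        (use that in auto)
    then obtain N where N: "\<And>n. N \<le> n \<Longrightarrow> prob {\<omega> \<in> space M. a / 2 < \<bar>S n \<omega> - Z \<omega>\<bar>} < d / 2"
      by (auto simp: eventually_sequentially)
    have "prob {\<omega> \<in> space M. a < \<bar>S n \<omega> - S m \<omega>\<bar>} \<le> d" if "N \<le> m" "N \<le> n" for m n
    proof -
      have "prob {\<omega> \<in> space M. a < \<bar>S n \<omega> - S m \<omega>\<bar>}
          \<le> prob ({\<omega> \<in> space M. a / 2 < \<bar>S n \<omega> - Z \<omega>\<bar>} \<union> {\<omega> \<in> space M. a / 2 < \<bar>S m \<omega> - Z \<omega>\<bar>})"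
      proof (intro finite_measure_mono subsetI)
        fix \<omega> assume \<omega>: "\<omega> \<in> {\<omega> \<in> space M. a < \<bar>S n \<omega> - S m \<omega>\<bar>}"
        then have "a / 2 < \<bar>S n \<omega> - Z \<omega>\<bar> \<or> a / 2 < \<bar>S m \<omega> - Z \<omega>\<bar>"
          using abs_triangle_ineq4[of "S n \<omega> - Z \<omega>" "S m \<omega> - Z \<omega>"] by (smt (verit) field_sum_of_halves mem_Collect_eq)
        with \<omega> show "\<omega> \<in> {\<omega> \<in> space M. a / 2 < \<bar>S n \<omega> - Z \<omega>\<bar>} \<union> {\<omega> \<in> space M. a / 2 < \<bar>S m \<omega> - Z \<omega>\<bar>}"
          by blast
      qed auto
      also have "\<dots> \<le> prob {\<omega> \<in> space M. a / 2 < \<bar>S n \<omega> - Z \<omega>\<bar>} + prob {\<omega> \<in> space M. a / 2 < \<bar>S m \<omega> - Z \<omega>\<bar>}"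
        by (intro measure_Un_le) auto
      finally show ?thesis using N[OF that(1)] N[OF that(2)] by simp
    qed
    then show ?thesis by blast
  qed
  have sup: "AE \<omega> in M. \<exists>N. \<forall>k\<ge>N. \<bar>S k \<omega> - S N \<omega>\<bar> \<le> 2 * a" if "0 < a" for a
  proof -
    define D where "D N = {\<omega> \<in> space M. \<exists>k\<ge>N. 2 * a < \<bar>S k \<omega> - S N \<omega>\<bar>}" for N
    have [measurable]: "D N \<in> events" for N unfolding D_def by measurable
    have le: "prob (\<Inter>N. D N) \<le> 0 + d" if "0 < d" for d
    proof -
      obtain N where N: "\<And>m n. N \<le> m \<Longrightarrow> N \<le> n \<Longrightarrow> prob {\<omega> \<in> space M. a < \<bar>S n \<omega> - S m \<omega>\<bar>} \<le> min (1/2) (d/2)"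
        using small[of a "min (1/2) (d/2)"] \<open>0 < a\<close> \<open>0 < d\<close> by auto
      \<comment> \<open>Finite horizon version of \<open>D N\<close>: the maximal inequality bounds
        it uniformly in n, and its increasing union contains \<open>D N\<close>.\<close>
      define C where "C n = {\<omega> \<in> space M. \<exists>k\<in>{N..n}. 2 * a < \<bar>\<Sum>i\<in>{N..<k}. X i \<omega>\<bar>}" for n
      have "prob (C n) \<le> d" for n
      proof (cases "N \<le> n")
        case True
        have "prob (C n) \<le> 2 * prob {\<omega> \<in> space M. a < \<bar>\<Sum>i\<in>{N..<n}. X i \<omega>\<bar>}"
          unfolding C_def
        proof (rule Ottaviani_inequality[OF indep])
          fix k assume "k \<in> {N..n}"
          then show "prob {\<omega> \<in> space M. a < \<bar>(\<Sum>i\<in>{N..<n}. X i \<omega>) - (\<Sum>i\<in>{N..<k}. X i \<omega>)\<bar>} \<le> 1 / 2"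
            using N[of k n] by (simp add: Sdiff)
        qed
        then show ?thesis using N[of N n] True by (simp add: Sdiff)
      next
        case False
        then show ?thesis using \<open>0 < d\<close> by (simp add: C_def)
      qed
      moreover have "(\<lambda>n. prob (C n)) \<longlonglongrightarrow> prob (\<Union>n. C n)"
      proof (rule finite_Lim_measure_incseq)
        show "incseq C" unfolding incseq_def C_def by fastforce
      qed (auto simp: C_def)
      ultimately have "prob (\<Union>n. C n) \<le> d"
        by (intro LIMSEQ_le_const2) auto
      moreover have "D N \<subseteq> (\<Union>n. C n)"
      proof
        fix \<omega> assume "\<omega> \<in> D N"
        then obtain k where "\<omega> \<in> space M" "N \<le> k" "2 * a < \<bar>S k \<omega> - S N \<omega>\<bar>" by (auto simp: D_def)
        then have "\<omega> \<in> C k" by (auto simp: C_def Sdiff intro!: bexI[of _ k])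
        then show "\<omega> \<in> (\<Union>n. C n)" by blast
      qed
      then have "prob (D N) \<le> prob (\<Union>n. C n)"
        by (intro finite_measure_mono) (auto simp: C_def)
      moreover have "prob (\<Inter>N. D N) \<le> prob (D N)"
        by (intro finite_measure_mono) auto
      ultimately show ?thesis by simp
    qed
    have "prob (\<Inter>N. D N) = 0"
      using field_le_epsilon[OF le] by (simp add: measure_le_0_iff)
    then have "AE \<omega> in M. \<omega> \<notin> (\<Inter>N. D N)"
      by (intro AE_not_in) (simp add: null_sets_def emeasure_eq_measure)
    then show ?thesis
      using AE_space
    proof eventually_elim
      case (elim \<omega>)
      then show ?case by (auto simp: D_def not_less)
    qed
  qed
  have "AE \<omega> in M. \<forall>j::nat. \<exists>N. \<forall>k\<ge>N. \<bar>S k \<omega> - S N \<omega>\<bar> \<le> 2 * (1 / Suc j)"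
    by (intro AE_all_countable[THEN iffD2] allI sup) simp
  then have conv: "AE \<omega> in M. (\<lambda>n. S n \<omega>) \<longlonglongrightarrow> lim (\<lambda>n. S n \<omega>)"
  proof eventually_elim
    case (elim \<omega>)
    have "Cauchy (\<lambda>n. S n \<omega>)"
      unfolding Cauchy_altdef2
    proof (intro allI impI)
      fix e :: real assume "0 < e"
      obtain j :: nat where j: "2 / e < real j" using reals_Archimedean2 by blast
      then have "2 * (1 / Suc j) < e" using \<open>0 < e\<close> by (simp add: field_simps)
      with elim show "\<exists>N. \<forall>n\<ge>N. dist (S n \<omega>) (S N \<omega>) < e"
        by (metis dist_real_def le_less_trans)
    qed
    then show ?case by (simp add: Cauchy_convergent convergent_LIMSEQ_iff[symmetric])
  qed
  define Z' where "Z' \<omega> = lim (\<lambda>n. S n \<omega>)" for \<omega>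
  have Z' [measurable]: "Z' \<in> borel_measurable M" unfolding Z'_def by measurable
  have "tendsto_in_prob M S Z' sequentially"
    using conv by (intro AE_tendsto_imp_tendsto_in_prob) (auto simp: Z'_def)
  then have "AE \<omega> in M. Z' \<omega> = Z \<omega>"
  proof (rule tendsto_in_prob_unique[OF S Z' Z])
    have "S = (\<lambda>n \<omega>. \<Sum>i<n. X i \<omega>)" by (simp add: S_def fun_eq_iff)
    with lim show "tendsto_in_prob M S Z sequentially" by simp
  qed auto
  with conv show ?thesis
    by eventually_elim (simp add: sums_def S_def[symmetric] flip: Z'_def)
qed

end

section \<open>Levy exponents of finite symmetric measures\<close>

text \<open>For a symmetric jump measure this is the negated Levy-Khintchine exponent per unit of
  time.\<close>

definition cos_exponent :: "real measure \<Rightarrow> real \<Rightarrow> real" where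
  "cos_exponent N z = (\<integral>x. 1 - cos (z * x) \<partial>N)"

text \<open>The counterpart of \<open>cos_exponent\<close> without oscillation: it dominates
  \<open>cos_exponent\<close> up to a constant, and averaging over z leads back from
  \<open>cos_exponent\<close> to it.\<close>

definition trunc_exponent :: "real measure \<Rightarrow> real \<Rightarrow> real" where
  "trunc_exponent N w = (\<integral>x. trunc_sq (w * x) \<partial>N)"

context finite_borel_measure
begin

lemma measurable_M_borel: "borel_measurable M = borel_measurable borel"
  by (rule measurable_cong_sets) (auto simp: M_is_borel)

lemma integrable_one_minus_cos: "integrable M (\<lambda>x. 1 - cos (z * x))"
  by (rule integrable_const_bound[of _ 2])
    (auto simp: measurable_M_borel intro!: AE_I2 order_trans[OF abs_triangle_ineq4] add_mono[of _ 1 _ 1, simplified])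

lemma integrable_trunc_sq_scaled: "integrable M (\<lambda>x. trunc_sq (w * x))"
  by (rule integrable_const_bound[of _ 1]) (auto simp: measurable_M_borel)

lemma cos_exponent_nonneg: "0 \<le> cos_exponent M z"
  by (simp add: cos_exponent_def)

lemma cos_exponent_0 [simp]: "cos_exponent M 0 = 0"
  by (simp add: cos_exponent_def)

lemma trunc_exponent_nonneg: "0 \<le> trunc_exponent M w"
  by (simp add: trunc_exponent_def)

lemma trunc_exponent_0 [simp]: "trunc_exponent M 0 = 0"
  by (simp add: trunc_exponent_def)

lemma trunc_exponent_minus [simp]: "trunc_exponent M (- w) = trunc_exponent M w"
  by (simp add: trunc_exponent_def)

lemma cos_exponent_le_trunc_exponent:
  assumes "\<bar>z\<bar> \<le> 1" shows "cos_exponent M (z * w) \<le> 2 * trunc_exponent M w"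
proof -
  have "cos_exponent M (z * w) \<le> (\<integral>x. 2 * trunc_sq (w * x) \<partial>M)"
    unfolding cos_exponent_def
  proof (intro integral_mono integrable_one_minus_cos integrable_mult_right integrable_trunc_sq_scaled)
    fix x
    have "1 - cos (z * w * x) \<le> 2 * trunc_sq (z * (w * x))"
      using one_minus_cos_le_trunc_sq[of "z * w * x"] by (simp add: mult.assoc)
    also have "\<dots> \<le> 2 * trunc_sq (w * x)"
      using assms mult_right_mono[of "\<bar>z\<bar>" 1 "\<bar>w * x\<bar>"]
      by (intro mult_left_mono trunc_sq_mono) (auto simp: abs_mult)
    finally show "1 - cos (z * w * x) \<le> 2 * trunc_sq (w * x)" .
  qed
  then show ?thesis by (simp add: trunc_exponent_def)
qed

lemma trunc_exponent_le: "trunc_exponent M w \<le> measure M (space M)"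
proof -
  have "trunc_exponent M w \<le> (\<integral>x. 1 \<partial>M)"
    unfolding trunc_exponent_def by (intro integral_mono integrable_trunc_sq_scaled) auto
  then show ?thesis by simp
qed

lemma cos_exponent_le: "cos_exponent M z \<le> 2 * measure M (space M)"
  using cos_exponent_le_trunc_exponent[of 1 z] trunc_exponent_le[of z] by simp

lemma trunc_exponent_diff: "trunc_exponent M (v - w) \<le> 2 * trunc_exponent M v + 2 * trunc_exponent M w"
proof -
  have "trunc_exponent M (v - w) \<le> (\<integral>x. 2 * trunc_sq (v * x) + 2 * trunc_sq (w * x) \<partial>M)"
    unfolding trunc_exponent_def
    by (intro integral_mono Bochner_Integration.integrable_add integrable_mult_right integrable_trunc_sq_scaled)
      (simp add: left_diff_distrib trunc_sq_diff)
  also have "\<dots> = 2 * trunc_exponent M v + 2 * trunc_exponent M w"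
    unfolding trunc_exponent_def
    by (subst Bochner_Integration.integral_add) (auto intro!: integrable_mult_right integrable_trunc_sq_scaled)
  finally show ?thesis .
qed

lemma trunc_exponent_scale: "trunc_exponent M (c * w) \<le> max 1 (c\<^sup>2) * trunc_exponent M w"
proof -
  have "trunc_exponent M (c * w) \<le> (\<integral>x. max 1 (c\<^sup>2) * trunc_sq (w * x) \<partial>M)"
    unfolding trunc_exponent_def
    by (intro integral_mono integrable_mult_right integrable_trunc_sq_scaled)
      (simp add: mult.assoc trunc_sq_scale)
  then show ?thesis by (simp add: trunc_exponent_def)
qed

lemma tendsto_cos_exponent:
  assumes "f \<longlonglongrightarrow> l" shows "(\<lambda>n. cos_exponent M (f n)) \<longlonglongrightarrow> cos_exponent M l"
  unfolding cos_exponent_def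
  by (rule integral_dominated_convergence[where w = "\<lambda>_. 2"])
    (auto intro!: AE_I2 tendsto_intros assms order_trans[OF abs_triangle_ineq4] add_mono[of _ 1 _ 1, simplified]
      simp: measurable_M_borel)

lemma tendsto_trunc_exponent:
  assumes "f \<longlonglongrightarrow> l" shows "(\<lambda>n. trunc_exponent M (f n)) \<longlonglongrightarrow> trunc_exponent M l"
  unfolding trunc_exponent_def
  by (rule integral_dominated_convergence[where w = "\<lambda>_. 1"])
    (auto intro!: AE_I2 tendsto_trunc_sq tendsto_intros assms simp: measurable_M_borel)

lemma borel_measurable_cos_exponent [measurable]: "cos_exponent M \<in> borel_measurable borel"
proof (intro borel_measurable_continuous_onI continuous_at_imp_continuous_on ballI)
  show "isCont (cos_exponent M) x" for x
    unfolding continuous_at_sequentially by (auto simp: o_def tendsto_cos_exponent)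
qed

lemma borel_measurable_trunc_exponent [measurable]: "trunc_exponent M \<in> borel_measurable borel"
proof (intro borel_measurable_continuous_onI continuous_at_imp_continuous_on ballI)
  show "isCont (trunc_exponent M) x" for x
    unfolding continuous_at_sequentially by (auto simp: o_def tendsto_trunc_exponent)
qed

end

section \<open>The random measure induced by a symmetric compound Poisson process\<close>

text \<open>The distance for which the random measure is continuous in its argument; this continuity
  extends it from unions of dyadic cells to all bounded Borel sets.\<close>

definition symdiff_measure :: "real set \<Rightarrow> real set \<Rightarrow> real" where
  "symdiff_measure A B = measure lborel ((A - B) \<union> (B - A))"

lemma fmeasurable_bounded_borel:
  "B \<in> sets borel \<Longrightarrow> bounded B \<Longrightarrow> B \<in> fmeasurable lborel"
  by (rule fmeasurableI[OF _ emeasure_bounded_finite]) auto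

lemma emeasure_bounded_neq_top: "bounded (A :: real set) \<Longrightarrow> emeasure lborel A \<noteq> \<top>"
  using emeasure_bounded_finite[of A] by auto

lemma symdiff_measure_nonneg: "0 \<le> symdiff_measure A B"
  by (simp add: symdiff_measure_def)

lemma symdiff_measure_commute: "symdiff_measure A B = symdiff_measure B A"
  by (simp add: symdiff_measure_def Un_commute)

lemma symdiff_measure_triangle:
  assumes "A \<in> sets borel" "bounded A" "B \<in> sets borel" "bounded B" "C \<in> sets borel" "bounded C"
  shows "symdiff_measure A C \<le> symdiff_measure A B + symdiff_measure B C"
proof -
  have "symdiff_measure A C \<le> measure lborel (((A - B) \<union> (B - A)) \<union> ((B - C) \<union> (C - B)))"
    unfolding symdiff_measure_def
    using assms by (intro measure_mono_fmeasurable fmeasurable_bounded_borel) auto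
  also have "\<dots> \<le> symdiff_measure A B + symdiff_measure B C"
    unfolding symdiff_measure_def using assms by (intro measure_Un_le) auto
  finally show ?thesis .
qed

section \<open>Approximation of bounded Borel sets by unions of dyadic cells\<close>

definition dyadic :: "nat \<Rightarrow> nat \<Rightarrow> real set" where
  "dyadic n k = {real k / 2 ^ n <.. real (Suc k) / 2 ^ n}"

definition dyadic_union :: "nat \<Rightarrow> nat set \<Rightarrow> real set" where
  "dyadic_union n K = (\<Union>k\<in>K. dyadic n k)"

text \<open>The ceiling names the one cell of its level that contains x > 0, which makes membership
  and disjointness a matter of integers. Cells are open on the left, like the time intervals of the
  increments of Y; the point 0 lies in no cell and is later dropped as a null set.\<close>

lemma dyadic_iff: "x \<in> dyadic n k \<longleftrightarrow> \<lceil>x * 2 ^ n\<rceil> = int (Suc k)"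
proof -
  have "x \<in> dyadic n k \<longleftrightarrow> real k < x * 2 ^ n \<and> x * 2 ^ n \<le> real (Suc k)"
    by (auto simp: dyadic_def field_simps)
  also have "\<dots> \<longleftrightarrow> \<lceil>x * 2 ^ n\<rceil> = int (Suc k)"
    by (simp add: ceiling_eq_iff)
  finally show ?thesis .
qed

lemma dyadic_borel [measurable, simp]: "dyadic n k \<in> sets borel"
  by (simp add: dyadic_def)

lemma bounded_dyadic [simp]: "bounded (dyadic n k)"
  by (simp add: dyadic_def)

lemma measure_dyadic [simp]: "measure lborel (dyadic n k) = 1 / 2 ^ n"
  by (simp add: dyadic_def field_simps)

lemma disjoint_dyadic: "disjoint_family_on (dyadic n) K"
  by (auto simp: disjoint_family_on_def dyadic_iff)

lemma dyadic_union_borel [measurable, simp]: "dyadic_union n K \<in> sets borel"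
  unfolding dyadic_union_def by (intro sets.countable_UN') (auto intro: countable_subset)

lemma bounded_dyadic_union [simp]: "finite K \<Longrightarrow> bounded (dyadic_union n K)"
  unfolding dyadic_union_def by (rule bounded_UN) auto

lemma dyadic_split: "dyadic n k = dyadic (Suc n) (2 * k) \<union> dyadic (Suc n) (Suc (2 * k))"
  by (auto simp: dyadic_def field_simps)

lemma measure_dyadic_union: "finite K \<Longrightarrow> measure lborel (dyadic_union n K) = real (card K) / 2 ^ n"
  unfolding dyadic_union_def
  by (subst measure_finite_Union)
    (auto simp: disjoint_dyadic emeasure_bounded_neq_top)

lemma symdiff_measure_dyadic_union:
  assumes "finite K" "finite L"
  shows "symdiff_measure (dyadic_union n K) (dyadic_union n L) = real (card ((K - L) \<union> (L - K))) / 2 ^ n"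
proof -
  have "(dyadic_union n K - dyadic_union n L) \<union> (dyadic_union n L - dyadic_union n K)
      = dyadic_union n ((K - L) \<union> (L - K))"
    by (auto simp: dyadic_union_def dyadic_iff)
  then show ?thesis using assms by (simp add: symdiff_measure_def measure_dyadic_union)
qed

text \<open>The cells at least half covered by \<open>B\<close> approximate it at least as well as any other cells
  of the same level, and disjoint sets select disjoint sets of cells.\<close>

definition majority :: "nat \<Rightarrow> real set \<Rightarrow> nat set" where
  "majority n B = {k. 1 / 2 ^ n < 2 * measure lborel (B \<inter> dyadic n k)}"

lemma dyadic_subset_range: "\<lceil>T * 2 ^ n\<rceil> \<le> int k \<Longrightarrow> {0..T} \<inter> dyadic n k = {}"
proof -
  assume k: "\<lceil>T * 2 ^ n\<rceil> \<le> int k"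
  have "\<lceil>x * 2 ^ n\<rceil> \<le> \<lceil>T * 2 ^ n\<rceil>" if "x \<le> T" for x
    using that by (intro ceiling_mono mult_right_mono) auto
  with k show ?thesis by (fastforce simp: dyadic_iff)
qed

lemma finite_cells:
  assumes "bounded B" "B \<subseteq> {0..}"
  obtains N where "\<And>k. N \<le> k \<Longrightarrow> B \<inter> dyadic n k = {}"
proof -
  obtain T where "\<forall>x\<in>B. \<bar>x\<bar> \<le> T"
    using assms(1) unfolding bounded_real by blast
  then have "B \<subseteq> {0..T}" using assms(2) by fastforce
  have "B \<inter> dyadic n k = {}" if "nat \<lceil>T * 2 ^ n\<rceil> \<le> k" for k
  proof -
    have "\<lceil>T * 2 ^ n\<rceil> \<le> int k" using that by linarith
    from dyadic_subset_range[OF this] \<open>B \<subseteq> {0..T}\<close> show ?thesis by blast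
  qed
  then show thesis by (rule that)
qed

lemma finite_majority:
  assumes "bounded B" "B \<subseteq> {0..}" shows "finite (majority n B)"
proof -
  obtain N where N: "\<And>k. N \<le> k \<Longrightarrow> B \<inter> dyadic n k = {}"
    using finite_cells[OF assms] by blast
  have "majority n B \<subseteq> {..<N}"
  proof
    fix k assume "k \<in> majority n B"
    then have "B \<inter> dyadic n k \<noteq> {}" by (auto simp: majority_def)
    with N[of k] show "k \<in> {..<N}" by (meson lessThan_iff not_le)
  qed
  then show ?thesis by (rule finite_subset) simp
qed

text \<open>Two disjoint sets cannot both fill more than half of a cell. The strict inequality in
  \<open>majority\<close> matters, as two exact halves could both be selected otherwise.\<close>

lemma majority_disjoint:
  assumes "A \<in> sets borel" "B \<in> sets borel" "A \<inter> B = {}"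
  shows "majority n A \<inter> majority n B = {}"
proof (rule ccontr)
  assume "\<not> ?thesis"
  then obtain k where k: "1 / 2 ^ n < 2 * measure lborel (A \<inter> dyadic n k)"
      "1 / 2 ^ n < 2 * measure lborel (B \<inter> dyadic n k)"
    by (auto simp: majority_def)
  have "measure lborel (A \<inter> dyadic n k) + measure lborel (B \<inter> dyadic n k)
      = measure lborel ((A \<inter> dyadic n k) \<union> (B \<inter> dyadic n k))"
    using assms emeasure_bounded_neq_top[OF bounded_subset[OF bounded_dyadic Int_lower2]]
    by (intro measure_Union[symmetric]) auto
  also have "\<dots> \<le> measure lborel (dyadic n k)"
    using assms by (intro measure_mono_fmeasurable fmeasurable_bounded_borel) auto
  finally show False using k by simp
qed

text \<open>Turns the choice of K into a separate decision in each cell: selecting a cell costs its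
  uncovered part, leaving it out costs the covered part. Hence the optimality of
  \<open>majority\<close>.\<close>

lemma symdiff_measure_cells:
  assumes B: "B \<in> sets borel" "B \<subseteq> {0..}" and N: "\<And>k. N \<le> k \<Longrightarrow> B \<inter> dyadic n k = {}" and K: "K \<subseteq> {..<N}"
  shows "symdiff_measure B (dyadic_union n K)
    = (\<Sum>k<N. if k \<in> K then 1 / 2 ^ n - measure lborel (B \<inter> dyadic n k) else measure lborel (B \<inter> dyadic n k))"
proof -
  let ?D = "(B - dyadic_union n K) \<union> (dyadic_union n K - B)"
  have cell: "x \<in> (\<Union>k<N. dyadic n k)" if "x \<in> ?D" "x \<noteq> 0" for x
  proof -
    have "0 < x"
    proof (cases "x \<in> B")
      case False
      then have "x \<in> dyadic_union n K" using that by blast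
      then obtain k where "x \<in> dyadic n k" by (auto simp: dyadic_union_def)
      then have "real k / 2 ^ n < x" by (simp add: dyadic_def)
      moreover have "0 \<le> real k / 2 ^ n" by simp
      ultimately show ?thesis by linarith
    qed (use B that in force)
    then have "0 < x * 2 ^ n" by simp
    then have "0 < \<lceil>x * 2 ^ n\<rceil>" by simp
    then have k: "x \<in> dyadic n (nat (\<lceil>x * 2 ^ n\<rceil> - 1))" (is "x \<in> dyadic n ?k") by (simp add: dyadic_iff)
    show ?thesis
    proof (cases "x \<in> B")
      case True
      then have "?k < N" using k N[of ?k] by (cases "N \<le> ?k") auto
      with k show ?thesis by blast
    next
      case False
      then show ?thesis using that K by (auto simp: dyadic_union_def)
    qed
  qed
  have Dm: "?D \<in> sets borel" using B by measurable
  have "symdiff_measure B (dyadic_union n K) = measure lborel (\<Union>k<N. ?D \<inter> dyadic n k)"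
    unfolding symdiff_measure_def
  proof (rule measure_eq_AE)
    have "AE x in lborel. x \<noteq> (0::real)" by (rule AE_lborel_singleton)
    then show "AE x in lborel. (x \<in> ?D) = (x \<in> (\<Union>k<N. ?D \<inter> dyadic n k))"
      by eventually_elim (use cell in blast)
  qed (use Dm in auto)
  also have "\<dots> = (\<Sum>k<N. measure lborel (?D \<inter> dyadic n k))"
  proof (rule measure_finite_Union)
    show "disjoint_family_on (\<lambda>k. ?D \<inter> dyadic n k) {..<N}"
      using disjoint_dyadic[of n "{..<N}"] unfolding disjoint_family_on_def by blast
    show "emeasure lborel (?D \<inter> dyadic n i) \<noteq> \<infinity>" for i
      using emeasure_bounded_neq_top[OF bounded_subset[OF bounded_dyadic[of n i]], of "?D \<inter> dyadic n i"] by auto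
  qed (use Dm in auto)
  also have "\<dots> = (\<Sum>k<N. if k \<in> K then 1 / 2 ^ n - measure lborel (B \<inter> dyadic n k) else measure lborel (B \<inter> dyadic n k))"
  proof (intro sum.cong refl)
    fix k
    have disj: "x \<in> dyadic n k \<Longrightarrow> x \<in> dyadic_union n K \<longleftrightarrow> k \<in> K" for x
      by (auto simp: dyadic_union_def dyadic_iff)
    show "measure lborel (?D \<inter> dyadic n k)
      = (if k \<in> K then 1 / 2 ^ n - measure lborel (B \<inter> dyadic n k) else measure lborel (B \<inter> dyadic n k))"
    proof (cases "k \<in> K")
      case True
      then have "?D \<inter> dyadic n k = dyadic n k - (B \<inter> dyadic n k)" using disj by blast
      moreover have "measure lborel (dyadic n k - (B \<inter> dyadic n k)) = measure lborel (dyadic n k) - measure lborel (B \<inter> dyadic n k)"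
        using B by (intro measure_Diff) (auto simp: emeasure_bounded_neq_top)
      ultimately show ?thesis using True by simp
    next
      case False
      then have "?D \<inter> dyadic n k = B \<inter> dyadic n k" using disj by blast
      with False show ?thesis by simp
    qed
  qed
  finally show ?thesis .
qed

lemma majority_optimal:
  assumes B: "B \<in> sets borel" "bounded B" "B \<subseteq> {0..}" and K: "finite K"
  shows "symdiff_measure B (dyadic_union n (majority n B)) \<le> symdiff_measure B (dyadic_union n K)"
proof -
  obtain N0 where N0: "\<And>k. N0 \<le> k \<Longrightarrow> B \<inter> dyadic n k = {}"
    using finite_cells[OF B(2,3)] by blast
  obtain N1 where N1: "K \<union> majority n B \<subseteq> {..<N1}"
    using K finite_majority[OF B(2,3), of n] by (metis finite_Un finite_nat_iff_bounded)
  define N where "N = max N0 N1"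
  have N: "\<And>k. N \<le> k \<Longrightarrow> B \<inter> dyadic n k = {}" "K \<subseteq> {..<N}" "majority n B \<subseteq> {..<N}"
    using N0 N1 by (auto simp: N_def)
  have "symdiff_measure B (dyadic_union n L)
      = (\<Sum>k<N. if k \<in> L then 1 / 2 ^ n - measure lborel (B \<inter> dyadic n k) else measure lborel (B \<inter> dyadic n k))"
    if "L \<subseteq> {..<N}" for L
    by (rule symdiff_measure_cells[OF B(1,3) _ that]) (rule N(1))
  note cells = this[OF N(2)] this[OF N(3)]
  show ?thesis
    unfolding cells by (intro sum_mono) (auto simp: majority_def)
qed

text \<open>Each cell splits into two cells of the next level, so these unions decrease. A point of
  their intersection lies within 2^-n of C for all n, hence in C; only 0 is lost. Continuity from
  above then finishes.\<close>

lemma dyadic_cover_compact: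
  assumes C: "compact C" "C \<subseteq> {0..}"
  shows "(\<lambda>n. symdiff_measure C (dyadic_union n {k. C \<inter> dyadic n k \<noteq> {}})) \<longlonglongrightarrow> 0"
    and "finite {k. C \<inter> dyadic n k \<noteq> {}}"
proof -
  let ?K = "\<lambda>n. {k. C \<inter> dyadic n k \<noteq> {}}"
  show fin: "finite (?K n)" for n
  proof -
    obtain N where N: "\<And>k. N \<le> k \<Longrightarrow> C \<inter> dyadic n k = {}"
      using finite_cells[OF compact_imp_bounded[OF C(1)] C(2)] by blast
    have "k < N" if "k \<in> ?K n" for k using that N[of k] by (cases "N \<le> k") auto
    then have "?K n \<subseteq> {..<N}" by blast
    then show ?thesis by (rule finite_subset) simp
  qed
  have Cb: "C \<in> sets borel" "bounded C" using C by (auto simp: borel_compact compact_imp_bounded)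
  let ?U = "\<lambda>n. dyadic_union n (?K n)"
  have dec: "decseq ?U"
  proof (rule decseq_SucI)
    fix n
    show "?U (Suc n) \<subseteq> ?U n"
    proof
      fix x assume "x \<in> ?U (Suc n)"
      then obtain j y where j: "x \<in> dyadic (Suc n) j" "y \<in> C" "y \<in> dyadic (Suc n) j"
        by (auto simp: dyadic_union_def)
      have "j = 2 * (j div 2) \<or> j = Suc (2 * (j div 2))" by presburger
      then have "dyadic (Suc n) j \<subseteq> dyadic n (j div 2)" 
        using dyadic_split[of n "j div 2"] by (metis Un_upper1 Un_upper2)
      with j show "x \<in> ?U n" by (auto simp: dyadic_union_def)
    qed
  qed
  have lim: "(\<Inter>n. ?U n) = C - {0}"
  proof (intro equalityI subsetI)
    fix x assume x: "x \<in> (\<Inter>n. ?U n)"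
    have near: "\<exists>y\<in>C. dist y x < 1 / 2 ^ n \<and> 0 < x" for n
    proof -
      have "x \<in> ?U n" using x by blast
      then obtain k y where k: "x \<in> dyadic n k" "y \<in> C" "y \<in> dyadic n k" by (auto simp: dyadic_union_def)
      then have "real k / 2 ^ n < x" "x \<le> real k / 2 ^ n + 1 / 2 ^ n" "real k / 2 ^ n < y" "y \<le> real k / 2 ^ n + 1 / 2 ^ n"
        by (auto simp: dyadic_def add_divide_distrib add.commute)
      moreover have "0 \<le> real k / 2 ^ n" by simp
      ultimately have "0 < x" "\<bar>y - x\<bar> < 1 / 2 ^ n" by linarith+
      then show ?thesis using k(2) by (auto simp: dist_real_def)
    qed
    have "x \<in> closure C"
      unfolding closure_approachable
    proof (intro allI impI)
      fix e :: real assume "0 < e"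
      then obtain n where "(1/2) ^ n < e" using real_arch_pow_inv[of e "1/2"] by auto
      then show "\<exists>y\<in>C. dist y x < e" using near[of n] by (auto simp: power_one_over intro: less_trans)
    qed
    then show "x \<in> C - {0}" using near[of 0] C(1) by (auto simp: compact_imp_closed closure_closed)
  next
    fix x assume x: "x \<in> C - {0}"
    then have "0 < x" using C(2) by force
    have "x \<in> ?U n" for n
    proof -
      have "0 < \<lceil>x * 2 ^ n\<rceil>" using \<open>0 < x\<close> by simp
      then have "x \<in> dyadic n (nat (\<lceil>x * 2 ^ n\<rceil> - 1))" by (simp add: dyadic_iff)
      then show ?thesis using x by (auto simp: dyadic_union_def)
    qed
    then show "x \<in> (\<Inter>n. ?U n)" by blast
  qed
  have "(\<lambda>n. measure lborel (?U n)) \<longlonglongrightarrow> measure lborel (\<Inter>n. ?U n)"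
    using fin dec by (intro Lim_measure_decseq) (auto simp: emeasure_bounded_neq_top)
  also have "measure lborel (\<Inter>n. ?U n) = measure lborel C"
    unfolding lim using AE_lborel_singleton[of "0::real"] Cb
    by (intro measure_eq_AE) auto
  finally have l: "(\<lambda>n. measure lborel (?U n) - measure lborel C) \<longlonglongrightarrow> 0"
    by (simp add: LIM_zero_iff)
  have eq: "symdiff_measure C (?U n) = measure lborel (?U n) - measure lborel C" for n
  proof -
    have sub: "C - {0} \<subseteq> ?U n" using lim by blast
    have "symdiff_measure C (?U n) = measure lborel (?U n - (C - {0}))"
      unfolding symdiff_measure_def using AE_lborel_singleton[of "0::real"] Cb sub
      by (intro measure_eq_AE) auto
    also have "\<dots> = measure lborel (?U n) - measure lborel (C - {0})"
      using fin sub Cb by (intro measure_Diff) (auto simp: emeasure_bounded_neq_top)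
    also have "measure lborel (C - {0}) = measure lborel C"
      using AE_lborel_singleton[of "0::real"] Cb by (intro measure_eq_AE) auto
    finally show ?thesis .
  qed
  show "(\<lambda>n. symdiff_measure C (?U n)) \<longlonglongrightarrow> 0"
    unfolding eq by (rule l)
qed

text \<open>Inner regularity supplies a compact C that fills B up to e/2. The cells meeting C
  compete with the majority cells, which can only do better.\<close>

lemma majority_tendsto:
  assumes B: "B \<in> sets borel" "bounded B" "B \<subseteq> {0..}"
  shows "(\<lambda>n. symdiff_measure B (dyadic_union n (majority n B))) \<longlonglongrightarrow> 0"
proof (rule LIMSEQ_I)
  fix e :: real assume "0 < e"
  obtain C where C: "closed C" "C \<subseteq> B" "emeasure lebesgue (B - C) < ennreal (e / 2)"
    by (rule sets_lebesgue_inner_closed[of B "e / 2"]) (use B \<open>0 < e\<close> in auto)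
  have Cb: "C \<in> sets borel" "bounded C" using C B by (auto intro: borel_closed bounded_subset)
  have "compact C" using C Cb by (simp add: compact_eq_bounded_closed)
  have "C \<subseteq> {0..}" using C B by auto
  have BC: "symdiff_measure B C < e / 2"
  proof -
    have "ennreal (measure lborel (B - C)) = emeasure lborel (B - C)"
      using B Cb by (intro emeasure_eq_measure2[symmetric] fmeasurable_bounded_borel) (auto intro: bounded_subset)
    also have "\<dots> < ennreal (e / 2)" using C B Cb by simp
    finally have "measure lborel (B - C) < e / 2" using \<open>0 < e\<close> by (simp add: ennreal_less_iff)
    moreover have "(B - C) \<union> (C - B) = B - C" using C by auto
    ultimately show ?thesis by (simp add: symdiff_measure_def)
  qed
  let ?K = "\<lambda>n. {k. C \<inter> dyadic n k \<noteq> {}}"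
  obtain n0 where n0: "\<And>n. n0 \<le> n \<Longrightarrow> norm (symdiff_measure C (dyadic_union n (?K n)) - 0) < e / 2"
    using LIMSEQ_D[OF dyadic_cover_compact(1)[OF \<open>compact C\<close> \<open>C \<subseteq> {0..}\<close>], of "e / 2"] \<open>0 < e\<close> by auto
  have "norm (symdiff_measure B (dyadic_union n (majority n B)) - 0) < e" if "n0 \<le> n" for n
  proof -
    have fin: "finite (?K n)" using dyadic_cover_compact(2)[OF \<open>compact C\<close> \<open>C \<subseteq> {0..}\<close>] .
    have "symdiff_measure B (dyadic_union n (majority n B)) \<le> symdiff_measure B (dyadic_union n (?K n))"
      by (rule majority_optimal[OF B fin])
    also have "\<dots> \<le> symdiff_measure B C + symdiff_measure C (dyadic_union n (?K n))"
      using B Cb fin by (intro symdiff_measure_triangle) auto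
    finally show ?thesis using BC n0[OF that] symdiff_measure_nonneg[of B] by simp
  qed
  then show "\<exists>n0. \<forall>n\<ge>n0. norm (symdiff_measure B (dyadic_union n (majority n B)) - 0) < e" by blast
qed

section \<open>Sums, and passage of distance bounds to limits in probability\<close>

context prob_space
begin

lemma tendsto_in_prob_add:
  assumes X: "\<And>n. X n \<in> borel_measurable M" "\<And>n. X' n \<in> borel_measurable M"
    and Z: "Z \<in> borel_measurable M" "Z' \<in> borel_measurable M"
    and lim: "tendsto_in_prob M X Z F" "tendsto_in_prob M X' Z' F"
  shows "tendsto_in_prob M (\<lambda>n \<omega>. X n \<omega> + X' n \<omega>) (\<lambda>\<omega>. Z \<omega> + Z' \<omega>) F"
proof -
  note [measurable] = X Z
  have l: "((\<lambda>n. 2 * trunc_moment M (\<lambda>\<omega>. X n \<omega> - Z \<omega>) + 2 * trunc_moment M (\<lambda>\<omega>. X' n \<omega> - Z' \<omega>)) \<longlongrightarrow> 2 * 0 + 2 * 0) F"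
    using lim[unfolded tendsto_in_prob_iff_trunc_moment[OF X(1) Z(1)] tendsto_in_prob_iff_trunc_moment[OF X(2) Z(2)]]
    by (intro tendsto_intros)
  have le: "trunc_moment M (\<lambda>\<omega>. X n \<omega> + X' n \<omega> - (Z \<omega> + Z' \<omega>))
      \<le> 2 * trunc_moment M (\<lambda>\<omega>. X n \<omega> - Z \<omega>) + 2 * trunc_moment M (\<lambda>\<omega>. X' n \<omega> - Z' \<omega>)" for n
  proof -
    have "trunc_moment M (\<lambda>\<omega>. (X n \<omega> - Z \<omega>) - (Z' \<omega> - X' n \<omega>))
      \<le> 2 * trunc_moment M (\<lambda>\<omega>. (X n \<omega> - Z \<omega>) - 0) + 2 * trunc_moment M (\<lambda>\<omega>. 0 - (Z' \<omega> - X' n \<omega>))"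
      by (rule trunc_moment_triangle) measurable
    then show ?thesis by (simp add: algebra_simps)
  qed
  have "((\<lambda>n. trunc_moment M (\<lambda>\<omega>. X n \<omega> + X' n \<omega> - (Z \<omega> + Z' \<omega>))) \<longlongrightarrow> 0) F"
    by (rule tendsto_sandwich[OF _ _ tendsto_const l[simplified]])
      (auto intro!: always_eventually simp: le trunc_moment_nonneg)
  then show ?thesis
    by (subst tendsto_in_prob_iff_trunc_moment) auto
qed

lemma tendsto_in_prob_const: "tendsto_in_prob M (\<lambda>n. Z) Z F"
  by (simp add: tendsto_in_prob_def)

lemma tendsto_in_prob_sum:
  assumes "finite I" "\<And>i n. i \<in> I \<Longrightarrow> X n i \<in> borel_measurable M" "\<And>i. i \<in> I \<Longrightarrow> Z i \<in> borel_measurable M"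
    and "\<And>i. i \<in> I \<Longrightarrow> tendsto_in_prob M (\<lambda>n. X n i) (Z i) F"
  shows "tendsto_in_prob M (\<lambda>n \<omega>. \<Sum>i\<in>I. X n i \<omega>) (\<lambda>\<omega>. \<Sum>i\<in>I. Z i \<omega>) F"
  using assms
proof (induction I rule: finite_induct)
  case empty
  then show ?case by (simp add: tendsto_in_prob_def)
next
  case (insert i I)
  then have "tendsto_in_prob M (\<lambda>n \<omega>. X n i \<omega> + (\<Sum>i\<in>I. X n i \<omega>)) (\<lambda>\<omega>. Z i \<omega> + (\<Sum>i\<in>I. Z i \<omega>)) F"
    by (intro tendsto_in_prob_add borel_measurable_sum) auto
  then show ?case using insert by simp
qed

text \<open>Two uses of the quasi-triangle inequality, from Z to X n to X' n to Z', put the factor 2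
  * 2 in front of the middle distance; the outer distances vanish in the limit.\<close>

lemma trunc_moment_le_liminf:
  assumes X: "\<And>n. X n \<in> borel_measurable M" "\<And>n. X' n \<in> borel_measurable M"
    and Z: "Z \<in> borel_measurable M" "Z' \<in> borel_measurable M"
    and lim: "tendsto_in_prob M X Z F" "tendsto_in_prob M X' Z' F" and F: "F \<noteq> bot"
    and c: "(c \<longlongrightarrow> c0) F" "\<And>n. trunc_moment M (\<lambda>\<omega>. X n \<omega> - X' n \<omega>) \<le> c n"
  shows "trunc_moment M (\<lambda>\<omega>. Z \<omega> - Z' \<omega>) \<le> 4 * c0"
proof -
  have l: "((\<lambda>n. 2 * trunc_moment M (\<lambda>\<omega>. X n \<omega> - Z \<omega>) + 2 * (2 * c n + 2 * trunc_moment M (\<lambda>\<omega>. X' n \<omega> - Z' \<omega>)))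
      \<longlongrightarrow> 2 * 0 + 2 * (2 * c0 + 2 * 0)) F"
    using lim[unfolded tendsto_in_prob_iff_trunc_moment[OF X(1) Z(1)] tendsto_in_prob_iff_trunc_moment[OF X(2) Z(2)]] c(1)
    by (intro tendsto_intros)
  have "trunc_moment M (\<lambda>\<omega>. Z \<omega> - Z' \<omega>)
    \<le> 2 * trunc_moment M (\<lambda>\<omega>. X n \<omega> - Z \<omega>) + 2 * (2 * c n + 2 * trunc_moment M (\<lambda>\<omega>. X' n \<omega> - Z' \<omega>))" for n
  proof -
    have H: "t \<le> 2 * a + 2 * (2 * c + 2 * b)" if "t \<le> 2 * a + 2 * u" "u \<le> 2 * d + 2 * b" "d \<le> c" for t a b c d u :: real
      using that by argo
    show ?thesis
      by (rule H[OF _ trunc_moment_triangle[OF X(1) X(2) Z(2), of n n] c(2)[of n]])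
        (subst trunc_moment_minus_commute[of "X n" Z], rule trunc_moment_triangle[OF Z(1) X(1) Z(2)])
  qed
  then have "trunc_moment M (\<lambda>\<omega>. Z \<omega> - Z' \<omega>) \<le> 2 * 0 + 2 * (2 * c0 + 2 * 0)"
    using F by (intro tendsto_lowerbound[OF l]) auto
  then show ?thesis by simp
qed

lemma char_distr_scale:
  "X \<in> borel_measurable M \<Longrightarrow> char (distr M borel (\<lambda>\<omega>. c * X \<omega>)) z = char (distr M borel X) (z * c)"
  by (simp add: char_distr mult.assoc)

lemma distr_cong_AE':
  "AE \<omega> in M. X \<omega> = Z \<omega> \<Longrightarrow> X \<in> borel_measurable M \<Longrightarrow> Z \<in> borel_measurable M \<Longrightarrow>
    distr M borel X = distr M borel Z"
  by (rule distr_cong_AE) auto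

end

text \<open>The integration theory uses the law of Y only through a real exponent given by a finite
  measure. The compound Poisson process of the theorem is an instance because its jump density is
  even, see \<open>compound_poisson_imp_symmetric_levy\<close>.\<close>

locale symmetric_levy_process = levy_process M Y + N: finite_borel_measure N
  for M :: "'a measure" and Y :: "real \<Rightarrow> 'a \<Rightarrow> real" and N :: "real measure" +
  assumes char_Y: "0 \<le> t \<Longrightarrow> char (distr M borel (Y t)) z = exp (- complex_of_real (t * cos_exponent N z))"
begin

section \<open>Sums of dyadic increments and their limits\<close>

definition increment :: "nat \<Rightarrow> nat \<Rightarrow> 'a \<Rightarrow> real" where
  "increment n k \<omega> = Y (real (Suc k) / 2 ^ n) \<omega> - Y (real k / 2 ^ n) \<omega>"

definition dyadic_sum :: "nat \<Rightarrow> nat set \<Rightarrow> 'a \<Rightarrow> real" where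
  "dyadic_sum n K \<omega> = (\<Sum>k\<in>K. increment n k \<omega>)"

lemma measurable_increment [measurable]: "increment n k \<in> borel_measurable M"
  unfolding increment_def by (intro borel_measurable_diff measurable_process) auto

lemma measurable_dyadic_sum [measurable]: "dyadic_sum n K \<in> borel_measurable M"
  unfolding dyadic_sum_def by measurable

text \<open>Independence of an infinite family concerns finite subfamilies, each inside an initial
  segment, where independence of increments along the grid i / 2^n applies.\<close>

lemma indep_increment: "indep_vars (\<lambda>_. borel) (increment n) UNIV"
  unfolding indep_vars_def2
proof (intro conjI ballI)
  show "indep_sets (\<lambda>i. {increment n i -` A \<inter> space M |A. A \<in> sets borel}) UNIV"
    unfolding indep_sets_finite_index_sets[of _ UNIV]
  proof (intro allI impI)
    fix J :: "nat set" assume "finite J"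
    then obtain m where "J \<subseteq> {..<m}" by (auto simp: finite_nat_iff_bounded)
    have "indep_vars (\<lambda>_. borel) (increment n) {..<m}"
      using independent_increments[of "\<lambda>i. real i / 2 ^ n" m]
      by (simp add: mono_def divide_right_mono increment_def[abs_def])
    then have "indep_sets (\<lambda>i. {increment n i -` A \<inter> space M |A. A \<in> sets borel}) {..<m}"
      by (simp add: indep_vars_def2)
    then show "indep_sets (\<lambda>i. {increment n i -` A \<inter> space M |A. A \<in> sets borel}) J"
      using \<open>J \<subseteq> {..<m}\<close> by (rule indep_sets_mono_index[rotated])
  qed
qed simp

lemma char_Y_diff:
  assumes "0 \<le> s" "s \<le> t"
  shows "char (distr M borel (\<lambda>\<omega>. Y t \<omega> - Y s \<omega>)) z = exp (- complex_of_real ((t - s) * cos_exponent N z))"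
  using stationary_increments[of s "t - s"] char_Y[of "t - s"] assms by simp

lemma char_increment: "char (distr M borel (increment n k)) z = exp (- complex_of_real (cos_exponent N z / 2 ^ n))"
proof -
  have "char (distr M borel (increment n k)) z
      = exp (- complex_of_real ((real (Suc k) / 2 ^ n - real k / 2 ^ n) * cos_exponent N z))"
    unfolding increment_def[abs_def] by (rule char_Y_diff) (auto simp: divide_right_mono)
  also have "real (Suc k) / 2 ^ n - real k / 2 ^ n = 1 / 2 ^ n"
    by (simp add: diff_divide_distrib[symmetric])
  finally show ?thesis by simp
qed

text \<open>1 - exp (-c) <= c turns the bound on the exponent into one on the characteristic
  function; the constant is 8 from averaging times the 2 in 2 K.\<close>

lemma trunc_moment_le_exponent:
  assumes "X \<in> borel_measurable M"
    and "\<And>z. 0 \<le> z \<Longrightarrow> z \<le> 1 \<Longrightarrow> char (distr M borel X) z = exp (- complex_of_real (c z))"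
    and "\<And>z. 0 \<le> z \<Longrightarrow> z \<le> 1 \<Longrightarrow> c z \<le> 2 * K"
  shows "trunc_moment M X \<le> 16 * K"
proof -
  have "trunc_moment M X \<le> 8 * (2 * K)"
  proof (rule trunc_moment_le_char[OF assms(1)])
    fix z :: real assume z: "0 \<le> z" "z \<le> 1"
    have "1 - c z \<le> exp (- c z)" using exp_ge_add_one_self[of "- c z"] by simp
    moreover have "Re (exp (- complex_of_real (c z))) = exp (- c z)"
      by (metis Re_complex_of_real exp_of_real of_real_minus)
    ultimately show "1 - Re (char (distr M borel X) z) \<le> 2 * K"
      using assms(2)[OF z] assms(3)[OF z] by simp
  qed
  then show ?thesis by simp
qed

lemma trunc_moment_Y_diff:
  assumes "0 \<le> s" "s \<le> t"
  shows "trunc_moment M (\<lambda>\<omega>. Y t \<omega> - Y s \<omega>) \<le> 16 * ((t - s) * trunc_exponent N 1)"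
proof (rule trunc_moment_le_exponent[OF _ char_Y_diff[OF assms]])
  fix z :: real assume "0 \<le> z" "z \<le> 1"
  then have "cos_exponent N z \<le> 2 * trunc_exponent N 1"
    using N.cos_exponent_le_trunc_exponent[of z 1] by simp
  then have "(t - s) * cos_exponent N z \<le> (t - s) * (2 * trunc_exponent N 1)"
    using assms by (intro mult_left_mono) auto
  then show "(t - s) * cos_exponent N z \<le> 2 * ((t - s) * trunc_exponent N 1)" by simp
qed (use assms measurable_process in auto)

text \<open>Common cells cancel. What remains is a signed sum of independent increments whose
  exponents add up, one cell length for each cell of the symmetric difference; the signs are
  harmless since \<open>trunc_exponent\<close> is even.\<close>

lemma trunc_moment_dyadic_sum_same_level:
  assumes "finite K" "finite L"
  shows "trunc_moment M (\<lambda>\<omega>. dyadic_sum n K \<omega> - dyadic_sum n L \<omega>)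
    \<le> 16 * (symdiff_measure (dyadic_union n K) (dyadic_union n L) * trunc_exponent N 1)"
proof -
  let ?D = "(K - L) \<union> (L - K)"
  let ?f = "\<lambda>k. if k \<in> K then 1 else - 1 :: real"
  have fin: "finite ?D" using assms by auto
  have eq: "dyadic_sum n K \<omega> - dyadic_sum n L \<omega> = (\<Sum>k\<in>?D. ?f k * increment n k \<omega>)" for \<omega>
  proof -
    have "(\<Sum>k\<in>?D. ?f k * increment n k \<omega>) = (\<Sum>k\<in>K - L. ?f k * increment n k \<omega>) + (\<Sum>k\<in>L - K. ?f k * increment n k \<omega>)"
      using assms by (intro sum.union_disjoint) auto
    also have "(\<Sum>k\<in>K - L. ?f k * increment n k \<omega>) = (\<Sum>k\<in>K - L. increment n k \<omega>)"
      by (intro sum.cong) auto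
    also have "(\<Sum>k\<in>L - K. ?f k * increment n k \<omega>) = - (\<Sum>k\<in>L - K. increment n k \<omega>)"
      unfolding sum_negf[symmetric] by (intro sum.cong) auto
    finally show ?thesis
      using assms sum.Int_Diff[of K "\<lambda>k. increment n k \<omega>" L] sum.Int_Diff[of L "\<lambda>k. increment n k \<omega>" K]
      by (simp add: dyadic_sum_def Int_commute)
  qed
  have "trunc_moment M (\<lambda>\<omega>. \<Sum>k\<in>?D. ?f k * increment n k \<omega>)
      \<le> 16 * (real (card ?D) / 2 ^ n * trunc_exponent N 1)"
  proof (rule trunc_moment_le_exponent)
    fix z :: real assume z: "0 \<le> z" "z \<le> 1"
    have "indep_vars (\<lambda>_. borel) (\<lambda>k \<omega>. ?f k * increment n k \<omega>) ?D"
      by (rule indep_vars_compose2[OF indep_vars_subset[OF indep_increment]]) auto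
    then have "char (distr M borel (\<lambda>\<omega>. \<Sum>k\<in>?D. ?f k * increment n k \<omega>)) z
        = (\<Prod>k\<in>?D. char (distr M borel (\<lambda>\<omega>. ?f k * increment n k \<omega>)) z)"
      by (rule char_distr_sum)
    also have "\<dots> = (\<Prod>k\<in>?D. exp (- complex_of_real (cos_exponent N (z * ?f k) / 2 ^ n)))"
      by (intro prod.cong refl) (simp only: char_distr_scale measurable_increment char_increment)
    also have "\<dots> = exp (\<Sum>k\<in>?D. - complex_of_real (cos_exponent N (z * ?f k) / 2 ^ n))"
      using fin by (simp add: exp_sum)
    finally show "char (distr M borel (\<lambda>\<omega>. \<Sum>k\<in>?D. ?f k * increment n k \<omega>)) z
        = exp (- complex_of_real (\<Sum>k\<in>?D. cos_exponent N (z * ?f k) / 2 ^ n))"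
      by (simp add: sum_negf)
    have "(\<Sum>k\<in>?D. cos_exponent N (z * ?f k) / 2 ^ n) \<le> (\<Sum>k\<in>?D. 2 * trunc_exponent N 1 / 2 ^ n)"
    proof (intro sum_mono divide_right_mono)
      fix k
      show "cos_exponent N (z * ?f k) \<le> 2 * trunc_exponent N 1"
        using N.cos_exponent_le_trunc_exponent[of z "?f k"] z by (cases "k \<in> K") auto
    qed auto
    then show "(\<Sum>k\<in>?D. cos_exponent N (z * ?f k) / 2 ^ n) \<le> 2 * (real (card ?D) / 2 ^ n * trunc_exponent N 1)"
      by (simp add: mult_ac)
  qed measurable
  then show ?thesis
    using assms by (simp add: eq symdiff_measure_dyadic_union)
qed

lemma dyadic_sum_refine:
  assumes "finite K"
  obtains L where "finite L" "dyadic_union n K = dyadic_union (n + d) L" "dyadic_sum n K = dyadic_sum (n + d) L"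
  using assms
proof (induction d arbitrary: n K thesis)
  case 0
  then show ?case by auto
next
  case (Suc d)
  let ?L = "(\<lambda>k. 2 * k) ` K \<union> (\<lambda>k. Suc (2 * k)) ` K"
  have "finite ?L" using Suc.prems by auto
  then obtain L' where L': "finite L'" "dyadic_union (Suc n) ?L = dyadic_union (Suc n + d) L'"
      "dyadic_sum (Suc n) ?L = dyadic_sum (Suc n + d) L'"
    using Suc.IH[of "Suc n" ?L] by blast
  have U: "dyadic_union n K = dyadic_union (Suc n) ?L"
    unfolding dyadic_union_def by (subst dyadic_split[abs_def]) auto
  have inc: "increment n k \<omega> = increment (Suc n) (2 * k) \<omega> + increment (Suc n) (Suc (2 * k)) \<omega>" for k \<omega>
  proof -
    have "real (2 * k) / 2 ^ Suc n = real k / 2 ^ n" "real (Suc (Suc (2 * k))) / 2 ^ Suc n = real (Suc k) / 2 ^ n"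
      by (simp_all add: field_simps)
    then show ?thesis by (simp add: increment_def)
  qed
  have "dyadic_sum n K \<omega> = dyadic_sum (Suc n) ?L \<omega>" for \<omega>
  proof -
    have "dyadic_sum (Suc n) ?L \<omega> = (\<Sum>j\<in>(\<lambda>k. 2 * k) ` K. increment (Suc n) j \<omega>) + (\<Sum>j\<in>(\<lambda>k. Suc (2 * k)) ` K. increment (Suc n) j \<omega>)"
      unfolding dyadic_sum_def
    proof (rule sum.union_disjoint)
      show "(\<lambda>k. 2 * k) ` K \<inter> (\<lambda>k. Suc (2 * k)) ` K = {}"
      proof (rule equals0I)
        fix j assume "j \<in> (\<lambda>k. 2 * k) ` K \<inter> (\<lambda>k. Suc (2 * k)) ` K"
        then obtain a b where "j = 2 * a" "j = Suc (2 * b)" by blast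
        then show False by presburger
      qed
    qed (use Suc.prems in simp_all)
    also have "\<dots> = (\<Sum>k\<in>K. increment (Suc n) (2 * k) \<omega>) + (\<Sum>k\<in>K. increment (Suc n) (Suc (2 * k)) \<omega>)"
      by (simp add: sum.reindex inj_on_def)
    finally show ?thesis by (simp add: dyadic_sum_def inc sum.distrib)
  qed
  then have S: "dyadic_sum n K = dyadic_sum (Suc n) ?L" by (rule ext)
  show ?case
    by (rule Suc.prems(1)[OF L'(1)]) (use U S L' in \<open>simp_all only: add_Suc_right add_Suc\<close>)
qed

text \<open>Refinement changes neither the set nor the sum, so levels n and m are compared at level
  n + m.\<close>

lemma trunc_moment_dyadic_sum:
  assumes "finite K" "finite L"
  shows "trunc_moment M (\<lambda>\<omega>. dyadic_sum n K \<omega> - dyadic_sum m L \<omega>)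
    \<le> 16 * (symdiff_measure (dyadic_union n K) (dyadic_union m L) * trunc_exponent N 1)"
proof -
  obtain K' where K': "finite K'" "dyadic_union n K = dyadic_union (n + m) K'" "dyadic_sum n K = dyadic_sum (n + m) K'"
    using dyadic_sum_refine[OF assms(1)] by blast
  obtain L' where L': "finite L'" "dyadic_union m L = dyadic_union (m + n) L'" "dyadic_sum m L = dyadic_sum (m + n) L'"
    using dyadic_sum_refine[OF assms(2)] by blast
  show ?thesis
    unfolding K' L' add.commute[of m n]
    using trunc_moment_dyadic_sum_same_level[OF K'(1) L'(1)] .
qed

definition approx_measure :: "nat \<Rightarrow> real set \<Rightarrow> 'a \<Rightarrow> real" where
  "approx_measure n B = dyadic_sum n (majority n B)"

lemma measurable_approx_measure [measurable]: "approx_measure n B \<in> borel_measurable M"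
  by (simp add: approx_measure_def)

lemma approx_measure_convergent:
  assumes B: "B \<in> bounded_borel"
  obtains Z where "Z \<in> borel_measurable M" "tendsto_in_prob M (\<lambda>n. approx_measure n B) Z sequentially"
proof (rule Cauchy_in_prob_convergent[of "\<lambda>n. approx_measure n B"])
  fix e :: real assume "0 < e"
  let ?s = "\<lambda>n. symdiff_measure B (dyadic_union n (majority n B))"
  have B': "B \<in> sets borel" "bounded B" "B \<subseteq> {0..}" using B by (auto simp: bounded_borel_def)
  have "(\<lambda>n. 32 * (?s n * trunc_exponent N 1)) \<longlonglongrightarrow> 32 * (0 * trunc_exponent N 1)"
    by (intro tendsto_intros majority_tendsto[OF B'])
  then have "(\<lambda>n. 32 * (?s n * trunc_exponent N 1)) \<longlonglongrightarrow> 0" by simp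
  from LIMSEQ_D[OF this \<open>0 < e\<close>]
  obtain n0 where n0: "\<And>n. n0 \<le> n \<Longrightarrow> norm (32 * (?s n * trunc_exponent N 1) - 0) < e" by auto
  have "trunc_moment M (\<lambda>\<omega>. approx_measure m B \<omega> - approx_measure n B \<omega>) < e" if "n0 \<le> m" "n0 \<le> n" for m n
  proof -
    have "trunc_moment M (\<lambda>\<omega>. approx_measure m B \<omega> - approx_measure n B \<omega>)
        \<le> 16 * (symdiff_measure (dyadic_union m (majority m B)) (dyadic_union n (majority n B)) * trunc_exponent N 1)"
      unfolding approx_measure_def by (intro trunc_moment_dyadic_sum finite_majority B')
    also have "\<dots> \<le> 16 * ((?s m + ?s n) * trunc_exponent N 1)"
      using symdiff_measure_triangle[of "dyadic_union m (majority m B)" B "dyadic_union n (majority n B)"] B'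
      by (intro mult_left_mono mult_right_mono N.trunc_exponent_nonneg) (auto simp: finite_majority symdiff_measure_commute[of _ B])
    finally show ?thesis using n0[OF that(1)] n0[OF that(2)] by (simp add: algebra_simps abs_less_iff)
  qed
  then show "\<exists>n0. \<forall>m\<ge>n0. \<forall>n\<ge>n0. trunc_moment M (\<lambda>\<omega>. approx_measure m B \<omega> - approx_measure n B \<omega>) < e" by blast
qed (use that in auto)

text \<open>A separate choice for each set, fixed only up to null events; additivity can therefore
  only hold almost surely, with an exceptional event depending on the sets.\<close>

definition limit_measure :: "real set \<Rightarrow> 'a \<Rightarrow> real" where
  "limit_measure B = (SOME Z. Z \<in> borel_measurable M \<and> tendsto_in_prob M (\<lambda>n. approx_measure n B) Z sequentially)"

lemma limit_measure:
  assumes "B \<in> bounded_borel"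
  shows measurable_limit_measure: "limit_measure B \<in> borel_measurable M"
    and approx_tendsto_limit_measure: "tendsto_in_prob M (\<lambda>n. approx_measure n B) (limit_measure B) sequentially"
proof -
  have "\<exists>Z. Z \<in> borel_measurable M \<and> tendsto_in_prob M (\<lambda>n. approx_measure n B) Z sequentially"
    using approx_measure_convergent[OF assms] by blast
  from someI_ex[OF this] show "limit_measure B \<in> borel_measurable M"
    "tendsto_in_prob M (\<lambda>n. approx_measure n B) (limit_measure B) sequentially"
    by (simp_all add: limit_measure_def)
qed

text \<open>At every level disjoint sets select disjoint cells, so the approximations are already
  exactly independent; independence then passes to the limit in probability.\<close>

lemma indep_limit_measure:
  fixes B :: "nat \<Rightarrow> real set"
  assumes B: "range B \<subseteq> bounded_borel" and disj: "disjoint_family B"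
  shows "indep_vars (\<lambda>_. borel) (\<lambda>i. limit_measure (B i)) UNIV"
proof (rule indep_vars_tendsto_in_prob[where X = "\<lambda>n i. approx_measure n (B i)"])
  have Bi: "B i \<in> bounded_borel" for i using B by auto
  show "limit_measure (B i) \<in> borel_measurable M" for i by (rule measurable_limit_measure[OF Bi])
  show "tendsto_in_prob M (\<lambda>n. approx_measure n (B i)) (limit_measure (B i)) sequentially" for i
    by (rule approx_tendsto_limit_measure[OF Bi])
  fix n
  have "majority n (B i) \<inter> majority n (B j) = {}" if "i \<noteq> j" for i j
    using Bi disj that by (intro majority_disjoint) (auto simp: bounded_borel_def disjoint_family_on_def)
  then have "disjoint_family (\<lambda>i. majority n (B i))" by (auto simp: disjoint_family_on_def)
  then have "indep_vars (\<lambda>i. PiM (majority n (B i)) (\<lambda>_. borel))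
      (\<lambda>i \<omega>. restrict (\<lambda>k. increment n k \<omega>) (majority n (B i))) UNIV"
    by (intro indep_vars_restrict[OF indep_increment]) auto
  then have "indep_vars (\<lambda>_. borel)
      (\<lambda>i \<omega>. (\<lambda>f. \<Sum>k\<in>majority n (B i). f k) (restrict (\<lambda>k. increment n k \<omega>) (majority n (B i)))) UNIV"
    by (rule indep_vars_compose2) (auto intro!: borel_measurable_sum measurable_component_singleton)
  then show "indep_vars (\<lambda>_. borel) (\<lambda>i. approx_measure n (B i)) UNIV"
    by (simp add: approx_measure_def dyadic_sum_def[abs_def])
qed

text \<open>Boundedness of the union makes the measure of what the first m sets leave over tend to
  0, so the partial sums converge in probability. Independence upgrades this to almost sure
  convergence.\<close>

lemma limit_measure_sums:
  fixes B :: "nat \<Rightarrow> real set"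
  assumes B: "range B \<subseteq> bounded_borel" and disj: "disjoint_family B" and U: "(\<Union>n. B n) \<in> bounded_borel"
  shows "AE \<omega> in M. (\<lambda>n. limit_measure (B n) \<omega>) sums limit_measure (\<Union>n. B n) \<omega>"
proof (rule indep_sums_tendsto_in_prob_imp_AE[OF indep_limit_measure[OF B disj] measurable_limit_measure[OF U]])
  let ?U = "\<Union>n. B n" and ?G = "trunc_exponent N 1"
  have Bi: "B i \<in> bounded_borel" for i using B by auto
  have Bi': "B i \<in> sets borel" "bounded (B i)" "B i \<subseteq> {0..}" for i using Bi by (auto simp: bounded_borel_def)
  have U': "?U \<in> sets borel" "bounded ?U" "?U \<subseteq> {0..}" using U by (simp_all add: bounded_borel_def)
  note [measurable] = measurable_limit_measure[OF Bi] measurable_limit_measure[OF U]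
  define P where "P m = (\<Union>i<m. B i)" for m
  have P': "P m \<in> sets borel" "bounded (P m)" for m
    unfolding P_def using Bi' by auto
  have bound: "trunc_moment M (\<lambda>\<omega>. (\<Sum>i<m. limit_measure (B i) \<omega>) - limit_measure ?U \<omega>)
      \<le> 4 * (16 * (symdiff_measure (P m) ?U * ?G))" for m
  proof (rule trunc_moment_le_liminf[where X = "\<lambda>n \<omega>. \<Sum>i<m. approx_measure n (B i) \<omega>" and X' = "\<lambda>n. approx_measure n ?U" and F = sequentially])
    show "tendsto_in_prob M (\<lambda>n \<omega>. \<Sum>i<m. approx_measure n (B i) \<omega>) (\<lambda>\<omega>. \<Sum>i<m. limit_measure (B i) \<omega>) sequentially"
      by (intro tendsto_in_prob_sum approx_tendsto_limit_measure Bi measurable_approx_measure measurable_limit_measure) auto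
    show "tendsto_in_prob M (\<lambda>n. approx_measure n ?U) (limit_measure ?U) sequentially"
      by (rule approx_tendsto_limit_measure[OF U])
    let ?maj = "\<lambda>n A. dyadic_union n (majority n A)"
    let ?c = "\<lambda>n. 16 * (((\<Sum>i<m. symdiff_measure (B i) (?maj n (B i))) + symdiff_measure (P m) ?U + symdiff_measure ?U (?maj n ?U)) * ?G)"
    have "?c \<longlonglongrightarrow> 16 * (((\<Sum>i<m. 0) + symdiff_measure (P m) ?U + 0) * ?G)"
      by (intro tendsto_intros majority_tendsto Bi' U')
    then show "?c \<longlonglongrightarrow> 16 * (symdiff_measure (P m) ?U * ?G)" by simp
    fix n
    \<comment> \<open>The majority cells of the first m sets are disjoint, so the sum of their
      approximations is a single dyadic sum over K, comparable with the approximation of the whole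
      union.\<close>
    define K where "K = (\<Union>i<m. majority n (B i))"
    have finK: "finite K" unfolding K_def by (auto intro: finite_majority[OF Bi'(2,3)])
    have "(\<Sum>i<m. approx_measure n (B i) \<omega>) = dyadic_sum n K \<omega>" for \<omega>
      unfolding approx_measure_def dyadic_sum_def K_def
    proof (rule sum.UNION_disjoint[symmetric])
      show "\<forall>i\<in>{..<m}. \<forall>j\<in>{..<m}. i \<noteq> j \<longrightarrow> majority n (B i) \<inter> majority n (B j) = {}"
        using Bi' disj by (intro ballI impI majority_disjoint) (auto simp: disjoint_family_on_def)
    qed (auto intro: finite_majority[OF Bi'(2,3)])
    then have "trunc_moment M (\<lambda>\<omega>. (\<Sum>i<m. approx_measure n (B i) \<omega>) - approx_measure n ?U \<omega>)
        \<le> 16 * (symdiff_measure (dyadic_union n K) (?maj n ?U) * ?G)"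
      using trunc_moment_dyadic_sum[OF finK finite_majority[OF U'(2,3)], of n n n] by (simp add: approx_measure_def)
    also have "symdiff_measure (dyadic_union n K) (?maj n ?U)
        \<le> (\<Sum>i<m. symdiff_measure (B i) (?maj n (B i))) + symdiff_measure (P m) ?U + symdiff_measure ?U (?maj n ?U)"
    proof -
      have Km: "dyadic_union n K = (\<Union>i<m. ?maj n (B i))"
        by (auto simp: K_def dyadic_union_def)
      have "bounded (B i \<union> ?maj n (B i))" for i
        using Bi'(2) bounded_dyadic_union[OF finite_majority[OF Bi'(2,3)]] by simp
      then have bd: "bounded (\<Union>i<m. (B i - ?maj n (B i)) \<union> (?maj n (B i) - B i))"
        by (intro bounded_UN) (auto intro: bounded_subset[of "B _ \<union> ?maj n (B _)"])
      have "symdiff_measure (dyadic_union n K) (P m) \<le> measure lborel (\<Union>i<m. (B i - ?maj n (B i)) \<union> (?maj n (B i) - B i))"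
        unfolding symdiff_measure_def Km P_def
      proof (intro measure_mono_fmeasurable fmeasurable_bounded_borel bd)
        show "(\<Union>i<m. ?maj n (B i)) - (\<Union>i<m. B i) \<union> ((\<Union>i<m. B i) - (\<Union>i<m. ?maj n (B i)))
          \<subseteq> (\<Union>i<m. (B i - ?maj n (B i)) \<union> (?maj n (B i) - B i))" by blast
      qed (use Bi' in auto)
      also have "\<dots> \<le> (\<Sum>i<m. symdiff_measure (B i) (?maj n (B i)))"
        unfolding symdiff_measure_def using Bi' by (intro measure_UNION_le) auto
      finally have 1: "symdiff_measure (dyadic_union n K) (P m) \<le> (\<Sum>i<m. symdiff_measure (B i) (?maj n (B i)))" .
      have "symdiff_measure (dyadic_union n K) (?maj n ?U) \<le> symdiff_measure (dyadic_union n K) (P m) + symdiff_measure (P m) (?maj n ?U)"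
        using P' finK U' finite_majority[OF U'(2,3)] by (intro symdiff_measure_triangle) auto
      moreover have "symdiff_measure (P m) (?maj n ?U) \<le> symdiff_measure (P m) ?U + symdiff_measure ?U (?maj n ?U)"
        using P' finK U' finite_majority[OF U'(2,3)] by (intro symdiff_measure_triangle) auto
      ultimately show ?thesis using 1 by linarith
    qed
    finally show "trunc_moment M (\<lambda>\<omega>. (\<Sum>i<m. approx_measure n (B i) \<omega>) - approx_measure n ?U \<omega>) \<le> ?c n"
      by (simp add: mult_left_mono mult_right_mono N.trunc_exponent_nonneg)
  qed (use Bi U in auto)
  have "(\<lambda>m. symdiff_measure (P m) ?U) \<longlonglongrightarrow> 0"
  proof -
    have "(\<lambda>m. measure lborel (?U - P m)) \<longlonglongrightarrow> measure lborel (\<Inter>m. ?U - P m)"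
      using P' U' emeasure_bounded_neq_top[OF bounded_subset[OF U'(2) Diff_subset]]
      by (intro Lim_measure_decseq) (auto simp: decseq_def P_def)
    moreover have "(\<Inter>m. ?U - P m) = {}" by (auto simp: P_def)
    moreover have "symdiff_measure (P m) ?U = measure lborel (?U - P m)" for m
    proof -
      have "(P m - ?U) \<union> (?U - P m) = ?U - P m" by (auto simp: P_def)
      then show ?thesis by (simp only: symdiff_measure_def)
    qed
    ultimately show ?thesis by (simp only: measure_empty)
  qed
  then have lim: "(\<lambda>m. 4 * (16 * (symdiff_measure (P m) ?U * ?G))) \<longlonglongrightarrow> 4 * (16 * (0 * ?G))"
    by (intro tendsto_intros)
  then have lim0: "(\<lambda>m. 4 * (16 * (symdiff_measure (P m) ?U * ?G))) \<longlonglongrightarrow> 0" by (simp only: mult_zero_left mult_zero_right)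
  have "(\<lambda>m. trunc_moment M (\<lambda>\<omega>. (\<Sum>i<m. limit_measure (B i) \<omega>) - limit_measure ?U \<omega>)) \<longlonglongrightarrow> 0"
    by (rule tendsto_sandwich[OF _ _ tendsto_const lim0])
      (intro always_eventually allI trunc_moment_nonneg bound)+
  then show "tendsto_in_prob M (\<lambda>m \<omega>. \<Sum>i<m. limit_measure (B i) \<omega>) (limit_measure ?U) sequentially"
    by (subst tendsto_in_prob_iff_trunc_moment) auto
qed

text \<open>The sum over the cells up to the last grid point before t telescopes to an increment of
  Y. These cells miss [0, t] only by 0 and a piece of length at most 2^-n.\<close>

lemma limit_measure_interval:
  assumes "0 \<le> t" shows "AE \<omega> in M. limit_measure {0..t} \<omega> = Y t \<omega>"
proof -
  let ?B = "{0..t}" and ?G = "trunc_exponent N 1"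
  have B: "?B \<in> bounded_borel" "?B \<in> sets borel" "bounded ?B" "?B \<subseteq> {0..}" by (auto simp: bounded_borel_def)
  define k where "k n = nat \<lfloor>t * 2 ^ n\<rfloor>" for n :: nat
  have k: "real (k n) / 2 ^ n \<le> t" "t \<le> real (k n) / 2 ^ n + 1 / 2 ^ n" for n
  proof -
    have "real (k n) \<le> t * 2 ^ n" "t * 2 ^ n \<le> real (k n) + 1"
      using assms by (auto simp: k_def of_nat_nat)
    then show "real (k n) / 2 ^ n \<le> t" "t \<le> real (k n) / 2 ^ n + 1 / 2 ^ n"
      by (auto simp: field_simps)
  qed
  have lim0: "(\<lambda>n. 1 / 2 ^ n :: real) \<longlonglongrightarrow> 0"
    using LIMSEQ_realpow_zero[of "1/2 :: real"] by (simp add: power_one_over)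
  have un: "dyadic_union n {..<k n} = {0<..real (k n) / 2 ^ n}" for n
  proof (intro equalityI subsetI)
    fix x assume "x \<in> {0<..real (k n) / 2 ^ n}"
    then have x: "0 < x * 2 ^ n" "x * 2 ^ n \<le> real (k n)" by (auto simp: field_simps)
    then have c: "0 < \<lceil>x * 2 ^ n\<rceil>" "\<lceil>x * 2 ^ n\<rceil> \<le> int (k n)" by (simp_all only: ceiling_le_iff zero_less_ceiling of_int_of_nat_eq)
    then have "nat (\<lceil>x * 2 ^ n\<rceil> - 1) < k n" by linarith
    moreover have "x \<in> dyadic n (nat (\<lceil>x * 2 ^ n\<rceil> - 1))" using c by (simp add: dyadic_iff)
    ultimately show "x \<in> dyadic_union n {..<k n}" by (auto simp: dyadic_union_def)
  next
    fix x assume "x \<in> dyadic_union n {..<k n}"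
    then obtain j where j: "j < k n" "real j / 2 ^ n < x" "x \<le> real (Suc j) / 2 ^ n"
      by (auto simp: dyadic_union_def dyadic_def)
    have "real (Suc j) / 2 ^ n \<le> real (k n) / 2 ^ n" using j(1) by (intro divide_right_mono) auto
    moreover have "0 \<le> real j / 2 ^ n" by simp
    ultimately show "x \<in> {0<..real (k n) / 2 ^ n}"
      using le_less_trans[OF _ j(2), of 0] order_trans[OF j(3)] by simp
  qed
  have sd: "symdiff_measure (dyadic_union n {..<k n}) ?B \<le> 1 / 2 ^ n" for n
  proof -
    have "symdiff_measure (dyadic_union n {..<k n}) ?B \<le> measure lborel (insert 0 {real (k n) / 2 ^ n <.. t})"
      unfolding symdiff_measure_def un using k(1)[of n]
      by (intro measure_mono_fmeasurable fmeasurable_bounded_borel) (auto intro: order_trans)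
    also have "\<dots> = measure lborel {real (k n) / 2 ^ n <.. t}"
      using AE_lborel_singleton[of "0::real"] by (intro measure_eq_AE) auto
    also have "\<dots> \<le> 1 / 2 ^ n" using k[of n] by simp
    finally show ?thesis .
  qed
  have tele: "dyadic_sum n {..<k n} \<omega> = Y (real (k n) / 2 ^ n) \<omega> - Y 0 \<omega>" for n \<omega>
    unfolding dyadic_sum_def increment_def
    using sum_lessThan_telescope[of "\<lambda>i. Y (real i / 2 ^ n) \<omega>" "k n"] by simp
  have Ym: "Y (real (k n) / 2 ^ n) \<in> borel_measurable M" "Y 0 \<in> borel_measurable M" "Y t \<in> borel_measurable M" for n
    using assms by (auto intro: measurable_process)
  note [measurable] = Ym measurable_limit_measure[OF B(1)]
  have Y0: "trunc_moment M (\<lambda>\<omega>. dyadic_sum n {..<k n} \<omega> - Y t \<omega>) \<le> 16 * (1 / 2 ^ n * ?G)" for n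
  proof -
    have "trunc_moment M (\<lambda>\<omega>. dyadic_sum n {..<k n} \<omega> - Y t \<omega>) = trunc_moment M (\<lambda>\<omega>. Y (real (k n) / 2 ^ n) \<omega> - Y t \<omega>)"
    proof (rule trunc_moment_cong_AE)
      show "AE \<omega> in M. dyadic_sum n {..<k n} \<omega> - Y t \<omega> = Y (real (k n) / 2 ^ n) \<omega> - Y t \<omega>"
        using starts_at_zero by eventually_elim (simp add: tele)
    qed measurable
    also have "\<dots> \<le> 16 * ((t - real (k n) / 2 ^ n) * ?G)"
      using trunc_moment_Y_diff[of "real (k n) / 2 ^ n" t] k[of n]
      by (simp add: trunc_moment_minus_commute[of "Y (real (k n) / 2 ^ n)"])
    also have "\<dots> \<le> 16 * (1 / 2 ^ n * ?G)"
      using k[of n] by (intro mult_left_mono mult_right_mono N.trunc_exponent_nonneg) auto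
    finally show ?thesis .
  qed
  have lim: "tendsto_in_prob M (\<lambda>n. dyadic_sum n {..<k n}) (Y t) sequentially"
    unfolding tendsto_in_prob_iff_trunc_moment[OF measurable_dyadic_sum Ym(3)]
  proof (rule tendsto_sandwich[OF _ _ tendsto_const])
    have "(\<lambda>n. 16 * (1 / 2 ^ n * ?G)) \<longlonglongrightarrow> 16 * (0 * ?G)" by (intro tendsto_intros lim0)
    then show "(\<lambda>n. 16 * (1 / 2 ^ n * ?G)) \<longlonglongrightarrow> 0" by simp
  qed (use Y0 in \<open>auto intro!: always_eventually simp: trunc_moment_nonneg\<close>)
  have "trunc_moment M (\<lambda>\<omega>. limit_measure ?B \<omega> - Y t \<omega>) \<le> 4 * 0"
  proof (rule trunc_moment_le_liminf[OF _ _ _ _ approx_tendsto_limit_measure[OF B(1)] lim])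
    let ?c = "\<lambda>n. 16 * ((1 / 2 ^ n + symdiff_measure ?B (dyadic_union n (majority n ?B))) * ?G)"
    have "?c \<longlonglongrightarrow> 16 * ((0 + 0) * ?G)" by (intro tendsto_intros lim0 majority_tendsto B)
    then show "?c \<longlonglongrightarrow> 0" by simp
    fix n
    have "trunc_moment M (\<lambda>\<omega>. approx_measure n ?B \<omega> - dyadic_sum n {..<k n} \<omega>)
        \<le> 16 * (symdiff_measure (dyadic_union n (majority n ?B)) (dyadic_union n {..<k n}) * ?G)"
      unfolding approx_measure_def by (intro trunc_moment_dyadic_sum finite_majority B finite_lessThan)
    also have "\<dots> \<le> ?c n"
      using symdiff_measure_triangle[of "dyadic_union n (majority n ?B)" ?B "dyadic_union n {..<k n}"] sd[of n] B(2-)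
      by (intro mult_left_mono mult_right_mono N.trunc_exponent_nonneg)
        (auto simp: finite_majority symdiff_measure_commute[of _ ?B])
    finally show "trunc_moment M (\<lambda>\<omega>. approx_measure n ?B \<omega> - dyadic_sum n {..<k n} \<omega>) \<le> ?c n" .
  qed auto
  then have "trunc_moment M (\<lambda>\<omega>. limit_measure ?B \<omega> - Y t \<omega>) = 0"
    using trunc_moment_nonneg[of "\<lambda>\<omega>. limit_measure ?B \<omega> - Y t \<omega>"] by simp
  then show ?thesis by (intro trunc_moment_eq_0_AE_eq) auto
qed

text \<open>Existence makes the choice in \<open>induced_random_measure\<close> meaningful. From
  here on only the properties in \<open>is_induced_random_measure\<close> enter, not the
  construction.\<close>

theorem induced_random_measure: "is_induced_random_measure M Y (induced_random_measure M Y)"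
proof -
  have "is_induced_random_measure M Y limit_measure"
    unfolding is_induced_random_measure_def
    using measurable_limit_measure indep_limit_measure limit_measure_sums limit_measure_interval by blast
  then show ?thesis unfolding induced_random_measure_def by (rule someI[of "is_induced_random_measure M Y"])
qed

end

section \<open>Additivity and laws of the random measure\<close>

context symmetric_levy_process
begin

abbreviation random_measure :: "real set \<Rightarrow> 'a \<Rightarrow> real" (\<open>\<Lambda>\<close>) where
  "\<Lambda> \<equiv> induced_random_measure M Y"

lemma measurable_random_measure: "B \<in> bounded_borel \<Longrightarrow> \<Lambda> B \<in> borel_measurable M"
  and indep_random_measure: "range S \<subseteq> bounded_borel \<Longrightarrow> disjoint_family S \<Longrightarrow>
    indep_vars (\<lambda>_. borel) (\<lambda>n. \<Lambda> (S n)) UNIV"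
  and random_measure_sums: "range S \<subseteq> bounded_borel \<Longrightarrow> disjoint_family S \<Longrightarrow>
    (\<Union>n. S n) \<in> bounded_borel \<Longrightarrow> AE \<omega> in M. (\<lambda>n. \<Lambda> (S n) \<omega>) sums \<Lambda> (\<Union>n. S n) \<omega>"
  and random_measure_interval: "0 \<le> t \<Longrightarrow> AE \<omega> in M. \<Lambda> {0..t} \<omega> = Y t \<omega>"
  for S :: "nat \<Rightarrow> real set"
  using induced_random_measure unfolding is_induced_random_measure_def by blast+

lemma bounded_borel_empty [simp]: "{} \<in> bounded_borel"
  and bounded_borel_Un: "A \<in> bounded_borel \<Longrightarrow> B \<in> bounded_borel \<Longrightarrow> A \<union> B \<in> bounded_borel"
  and bounded_borel_subset: "A \<in> bounded_borel \<Longrightarrow> B \<subseteq> A \<Longrightarrow> B \<in> sets borel \<Longrightarrow> B \<in> bounded_borel"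
  and bounded_borel_UN: "finite I \<Longrightarrow> (\<And>i. i \<in> I \<Longrightarrow> F i \<in> bounded_borel) \<Longrightarrow> (\<Union>i\<in>I. F i) \<in> bounded_borel"
  by (auto simp: bounded_borel_def intro: bounded_subset)

text \<open>The empty set is the disjoint union of infinitely many copies of itself, and a series
  with constant terms converges only if they are 0.\<close>

lemma random_measure_empty: "AE \<omega> in M. \<Lambda> {} \<omega> = 0"
proof -
  have "AE \<omega> in M. (\<lambda>n::nat. \<Lambda> {} \<omega>) sums \<Lambda> {} \<omega>"
    using random_measure_sums[of "\<lambda>_. {}"] by (simp add: disjoint_family_on_def)
  then show ?thesis
    by eventually_elim (auto dest!: sums_summable simp: summable_const_iff)
qed

lemma random_measure_Un:
  assumes A: "A \<in> bounded_borel" and B: "B \<in> bounded_borel" and disj: "A \<inter> B = {}"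
  shows "AE \<omega> in M. \<Lambda> (A \<union> B) \<omega> = \<Lambda> A \<omega> + \<Lambda> B \<omega>"
proof -
  define S where "S n = (if n = 0 then A else if n = Suc 0 then B else {})" for n :: nat
  have U: "(\<Union>n. S n) = A \<union> B"
  proof -
    have "A \<subseteq> (\<Union>n. S n)" using UN_upper[of 0 UNIV S] by (simp add: S_def)
    moreover have "B \<subseteq> (\<Union>n. S n)" using UN_upper[of "Suc 0" UNIV S] by (simp add: S_def)
    moreover have "S n \<subseteq> A \<union> B" for n by (auto simp: S_def)
    ultimately show ?thesis by blast
  qed
  have "range S \<subseteq> bounded_borel" using A B by (auto simp: S_def)
  moreover have "disjoint_family S" using disj by (auto simp: disjoint_family_on_def S_def)
  ultimately have "AE \<omega> in M. (\<lambda>n. \<Lambda> (S n) \<omega>) sums \<Lambda> (A \<union> B) \<omega>"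
    using random_measure_sums[of S] A B by (simp add: U bounded_borel_Un)
  then show ?thesis
    using random_measure_empty
  proof eventually_elim
    case (elim \<omega>)
    have "(\<lambda>n. \<Lambda> (S n) \<omega>) sums (\<Sum>n\<in>{0, Suc 0}. \<Lambda> (S n) \<omega>)"
      using elim(2) by (intro sums_finite) (auto simp: S_def)
    then show ?case using sums_unique2[OF elim(1)] by (simp add: S_def)
  qed
qed

lemma random_measure_UN:
  assumes "finite I" "\<And>i. i \<in> I \<Longrightarrow> F i \<in> bounded_borel" "disjoint_family_on F I"
  shows "AE \<omega> in M. \<Lambda> (\<Union>i\<in>I. F i) \<omega> = (\<Sum>i\<in>I. \<Lambda> (F i) \<omega>)"
  using assms
proof (induction I rule: finite_induct)
  case empty
  then show ?case using random_measure_empty by simp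
next
  case (insert i I)
  have "disjoint_family_on F I" using insert.prems by (auto simp: disjoint_family_on_def)
  with insert have "AE \<omega> in M. \<Lambda> (\<Union>i\<in>I. F i) \<omega> = (\<Sum>i\<in>I. \<Lambda> (F i) \<omega>)" by simp
  moreover have "AE \<omega> in M. \<Lambda> (F i \<union> (\<Union>i\<in>I. F i)) \<omega> = \<Lambda> (F i) \<omega> + \<Lambda> (\<Union>i\<in>I. F i) \<omega>"
    using insert by (intro random_measure_Un bounded_borel_UN) (auto simp: disjoint_family_on_def)
  ultimately show ?case
    by eventually_elim (use insert in simp)
qed

text \<open>Independence is granted for sequences of sets, so the finite family is enumerated and
  padded with empty sets.\<close>

lemma char_sum_random_measure_prod:
  assumes I: "finite I" and F: "\<And>i. i \<in> I \<Longrightarrow> F i \<in> bounded_borel" and disj: "disjoint_family_on F I"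
  shows "char (distr M borel (\<lambda>\<omega>. \<Sum>i\<in>I. a i * \<Lambda> (F i) \<omega>)) z = (\<Prod>i\<in>I. char (distr M borel (\<Lambda> (F i))) (z * a i))"
proof -
  obtain e where e: "bij_betw e {0..<card I} I" using ex_bij_betw_nat_finite[OF I] by blast
  have e': "e n \<in> I" if "n < card I" for n using e that by (auto simp: bij_betw_def)
  define S where "S n = (if n < card I then F (e n) else {})" for n
  have S: "range S \<subseteq> bounded_borel" using F e' by (auto simp: S_def)
  have "disjoint_family S"
    unfolding disjoint_family_on_def
  proof (intro ballI impI)
    fix m n :: nat assume "m \<noteq> n"
    then have "e m \<noteq> e n" if "m < card I" "n < card I"
      using e that by (auto simp: bij_betw_def inj_on_def)
    then show "S m \<inter> S n = {}"
      using disj e' by (auto simp: S_def disjoint_family_on_def split: if_splits)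
  qed
  then have "indep_vars (\<lambda>_. borel) (\<lambda>n. \<Lambda> (S n)) {0..<card I}"
    by (rule indep_vars_subset[OF indep_random_measure[OF S]]) simp
  then have "indep_vars (\<lambda>_. borel) (\<lambda>n \<omega>. a (e n) * \<Lambda> (S n) \<omega>) {0..<card I}"
    by (rule indep_vars_compose2) simp
  then have "char (distr M borel (\<lambda>\<omega>. \<Sum>n\<in>{0..<card I}. a (e n) * \<Lambda> (S n) \<omega>)) z
      = (\<Prod>n\<in>{0..<card I}. char (distr M borel (\<lambda>\<omega>. a (e n) * \<Lambda> (S n) \<omega>)) z)"
    by (rule char_distr_sum)
  also have "\<dots> = (\<Prod>n\<in>{0..<card I}. char (distr M borel (\<Lambda> (F (e n)))) (z * a (e n)))"
  proof (intro prod.cong refl)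
    fix n assume n: "n \<in> {0..<card I}"
    then have "\<Lambda> (F (e n)) \<in> borel_measurable M" using F e' by (intro measurable_random_measure) auto
    then show "char (distr M borel (\<lambda>\<omega>. a (e n) * \<Lambda> (S n) \<omega>)) z = char (distr M borel (\<Lambda> (F (e n)))) (z * a (e n))"
      using n by (simp add: S_def char_distr_scale)
  qed
  also have "\<dots> = (\<Prod>i\<in>I. char (distr M borel (\<Lambda> (F i))) (z * a i))"
    by (rule prod.reindex_bij_betw[OF e])
  also have "(\<lambda>\<omega>. \<Sum>n\<in>{0..<card I}. a (e n) * \<Lambda> (S n) \<omega>) = (\<lambda>\<omega>. \<Sum>i\<in>I. a i * \<Lambda> (F i) \<omega>)"
  proof
    fix \<omega>
    have "(\<Sum>n\<in>{0..<card I}. a (e n) * \<Lambda> (S n) \<omega>) = (\<Sum>n\<in>{0..<card I}. a (e n) * \<Lambda> (F (e n)) \<omega>)"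
      by (intro sum.cong) (auto simp: S_def)
    also have "\<dots> = (\<Sum>i\<in>I. a i * \<Lambda> (F i) \<omega>)"
      by (rule sum.reindex_bij_betw[OF e])
    finally show "(\<Sum>n\<in>{0..<card I}. a (e n) * \<Lambda> (S n) \<omega>) = (\<Sum>i\<in>I. a i * \<Lambda> (F i) \<omega>)" .
  qed
  finally show ?thesis .
qed

text \<open>Induction over the sigma-algebra from the half-lines, where the value is Y itself. For
  complements the known factor is an exponential and can be divided out; for disjoint unions the
  characteristic functions of partial sums converge. Intersecting with {0..T} keeps complements
  bounded.\<close>

lemma char_random_measure_Int:
  assumes "0 \<le> T" "A \<in> sets borel"
  shows "char (distr M borel (\<Lambda> (A \<inter> {0..T}))) z = exp (- complex_of_real (measure lborel (A \<inter> {0..T}) * cos_exponent N z))"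
proof -
  let ?k = "cos_exponent N z"
  have bb: "A \<inter> {0..T} \<in> bounded_borel" if "A \<in> sets borel" for A
    using that by (auto simp: bounded_borel_def intro: bounded_subset[of "{0..T}"])
  note m = measurable_random_measure
  have A: "A \<in> sigma_sets UNIV (range (\<lambda>a::real. {..a}))"
    using \<open>A \<in> sets borel\<close> by (simp add: borel_eq_atMost)
  have sets: "sigma_sets UNIV (range (\<lambda>a::real. {..a})) = sets borel"
    by (simp add: borel_eq_atMost)
  have empty: "char (distr M borel (\<Lambda> {})) z = 1"
  proof -
    have "char (distr M borel (\<Lambda> {})) z = char (distr M borel (\<lambda>_. 0)) z"
      using distr_cong_AE'[OF random_measure_empty] m by simp
    also have "\<dots> = 1" by (simp add: char_def integral_return)
    finally show ?thesis .
  qed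
  have full: "char (distr M borel (\<Lambda> {0..t})) z = exp (- complex_of_real (t * ?k))" if "0 \<le> t" for t
  proof -
    have "distr M borel (\<Lambda> {0..t}) = distr M borel (Y t)"
      using that by (intro distr_cong_AE' random_measure_interval m measurable_process) (auto simp: bounded_borel_def)
    then show ?thesis using char_Y[OF that] by simp
  qed
  have "Int_stable (range (\<lambda>a::real. {..a}))"
  proof (rule Int_stableI)
    fix A B assume "A \<in> range (\<lambda>a::real. {..a})" "B \<in> range (\<lambda>a::real. {..a})"
    then obtain a b where "A = {..a}" "B = {..b}" by blast
    then have "A \<inter> B = {..min a b}" by auto
    then show "A \<inter> B \<in> range (\<lambda>a. {..a})" by blast
  qed
  moreover have "range (\<lambda>a::real. {..a}) \<subseteq> Pow UNIV" by simp
  ultimately show ?thesis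
    using A
  proof (induction rule: sigma_sets_induct_disjoint)
    case (basic A)
    then obtain a where a: "A = {..a}" by auto
    show ?case
    proof (cases "a < 0")
      case True
      then have "A \<inter> {0..T} = {}" using a by auto
      then show ?thesis by (simp add: empty)
    next
      case False
      then have "A \<inter> {0..T} = {0..min a T}" using a by auto
      then show ?thesis using full[of "min a T"] False \<open>0 \<le> T\<close> by simp
    qed
  next
    case empty
    then show ?case by (simp add: \<open>char (distr M borel (\<Lambda> {})) z = 1\<close>)
  next
    case (compl A)
    have A: "A \<in> sets borel" using compl sets by simp
    let ?A = "A \<inter> {0..T}" and ?B = "(UNIV - A) \<inter> {0..T}"
    have U: "?A \<union> ?B = {0..T}" by auto
    have B: "?A \<in> bounded_borel" "?B \<in> bounded_borel" using A by (auto intro!: bb)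
    let ?F = "\<lambda>b. if b then ?A else ?B"
    have "char (distr M borel (\<lambda>\<omega>. \<Sum>b\<in>UNIV. 1 * \<Lambda> (?F b) \<omega>)) z = (\<Prod>b\<in>UNIV. char (distr M borel (\<Lambda> (?F b))) (z * 1))"
      using B by (intro char_sum_random_measure_prod) (auto simp: disjoint_family_on_def)
    then have "char (distr M borel (\<lambda>\<omega>. \<Lambda> ?A \<omega> + \<Lambda> ?B \<omega>)) z = char (distr M borel (\<Lambda> ?A)) z * char (distr M borel (\<Lambda> ?B)) z"
      by (simp add: UNIV_bool add.commute mult.commute)
    moreover have "distr M borel (\<lambda>\<omega>. \<Lambda> ?A \<omega> + \<Lambda> ?B \<omega>) = distr M borel (\<Lambda> {0..T})"
    proof (rule distr_cong_AE')
      show "AE \<omega> in M. \<Lambda> ?A \<omega> + \<Lambda> ?B \<omega> = \<Lambda> {0..T} \<omega>"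
        using random_measure_Un[OF B, unfolded U] by (auto simp: Int_def)
      show "\<Lambda> {0..T} \<in> borel_measurable M" by (rule m) (auto simp: bounded_borel_def)
    qed (use m B in auto)
    ultimately have "exp (- complex_of_real (T * ?k)) = exp (- complex_of_real (measure lborel ?A * ?k)) * char (distr M borel (\<Lambda> ?B)) z"
      using full[OF \<open>0 \<le> T\<close>] compl.IH by simp
    then have "char (distr M borel (\<Lambda> ?B)) z = exp (- complex_of_real (T * ?k)) / exp (- complex_of_real (measure lborel ?A * ?k))"
      by simp
    also have "\<dots> = exp (- complex_of_real ((T - measure lborel ?A) * ?k))"
      by (simp add: left_diff_distrib flip: exp_diff)
    also have "T - measure lborel ?A = measure lborel ?B"
    proof -
      have "measure lborel ({0..T} - ?A) = measure lborel {0..T} - measure lborel ?A"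
        using A by (intro measure_Diff) (auto simp: emeasure_bounded_neq_top)
      moreover have "{0..T} - ?A = ?B" by blast
      ultimately show ?thesis using \<open>0 \<le> T\<close> by simp
    qed
    finally show ?case .
  next
    case (union A)
    have A: "A i \<in> sets borel" for i
      using subsetD[OF union(2) rangeI[of A i]] by (simp only: sets)
    let ?A = "\<lambda>i. A i \<inter> {0..T}"
    have U: "(\<Union>i. ?A i) = (\<Union>i. A i) \<inter> {0..T}" by blast
    have Bi: "?A i \<in> bounded_borel" for i by (rule bb[OF A])
    have B: "range ?A \<subseteq> bounded_borel" "(\<Union>i. ?A i) \<in> bounded_borel"
      using Bi bb[of "\<Union>i. A i"] A unfolding U by (blast, simp)
    have disj: "disjoint_family ?A"
      using union(1) unfolding disjoint_family_on_def by blast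
    have "(\<lambda>n. char (distr M borel (\<lambda>\<omega>. \<Sum>i<n. 1 * \<Lambda> (?A i) \<omega>)) z) \<longlonglongrightarrow> char (distr M borel (\<Lambda> (\<Union>i. ?A i))) z"
    proof (intro tendsto_in_prob_char AE_tendsto_imp_tendsto_in_prob)
      show "AE \<omega> in M. (\<lambda>n. \<Sum>i<n. 1 * \<Lambda> (?A i) \<omega>) \<longlonglongrightarrow> \<Lambda> (\<Union>i. ?A i) \<omega>"
        using random_measure_sums[OF B(1) disj B(2)] by (simp add: sums_def)
    qed (use m Bi B in \<open>auto intro!: borel_measurable_sum\<close>)
    moreover have "char (distr M borel (\<lambda>\<omega>. \<Sum>i<n. 1 * \<Lambda> (?A i) \<omega>)) z
        = exp (- complex_of_real ((\<Sum>i<n. measure lborel (?A i)) * ?k))" for n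
    proof -
      have "char (distr M borel (\<lambda>\<omega>. \<Sum>i<n. 1 * \<Lambda> (?A i) \<omega>)) z = (\<Prod>i<n. char (distr M borel (\<Lambda> (?A i))) (z * 1))"
        using Bi disj by (intro char_sum_random_measure_prod) (auto simp: disjoint_family_on_def)
      also have "\<dots> = (\<Prod>i<n. exp (- complex_of_real (measure lborel (?A i) * ?k)))"
        using union.IH by simp
      also have "\<dots> = exp (\<Sum>i<n. - complex_of_real (measure lborel (?A i) * ?k))"
        by (simp only: exp_sum finite_lessThan)
      also have "(\<Sum>i<n. - complex_of_real (measure lborel (?A i) * ?k)) = - complex_of_real ((\<Sum>i<n. measure lborel (?A i)) * ?k)"
        by (simp add: sum_negf sum_distrib_right)
      finally show ?thesis .
    qed
    ultimately have 1: "(\<lambda>n. exp (- complex_of_real ((\<Sum>i<n. measure lborel (?A i)) * ?k))) \<longlonglongrightarrow> char (distr M borel (\<Lambda> (\<Union>i. ?A i))) z"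
      by simp
    have "(\<lambda>i. measure lborel (?A i)) sums measure lborel (\<Union>i. ?A i)"
      using B(2) A disj by (intro measure_UNION) (auto simp: bounded_borel_def emeasure_bounded_neq_top)
    then have "(\<lambda>n. exp (- complex_of_real ((\<Sum>i<n. measure lborel (?A i)) * ?k)))
        \<longlonglongrightarrow> exp (- complex_of_real (measure lborel (\<Union>i. ?A i) * ?k))"
      unfolding sums_def by (intro tendsto_intros)
    with 1 show ?case unfolding U by (rule LIMSEQ_unique)
  qed
qed

lemma char_random_measure:
  assumes "B \<in> bounded_borel"
  shows "char (distr M borel (\<Lambda> B)) z = exp (- complex_of_real (measure lborel B * cos_exponent N z))"
proof -
  obtain T where T: "\<forall>x\<in>B. \<bar>x\<bar> \<le> T"
    using assms unfolding bounded_borel_def bounded_real by blast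
  have "B \<inter> {0..max 0 T} = B" using assms T by (fastforce simp: bounded_borel_def)
  then show ?thesis
    using char_random_measure_Int[of "max 0 T" B z] assms by (simp add: bounded_borel_def)
qed

lemma char_sum_random_measure:
  assumes "finite I" "\<And>i. i \<in> I \<Longrightarrow> F i \<in> bounded_borel" "disjoint_family_on F I"
  shows "char (distr M borel (\<lambda>\<omega>. \<Sum>i\<in>I. a i * \<Lambda> (F i) \<omega>)) z
    = exp (- complex_of_real (\<Sum>i\<in>I. measure lborel (F i) * cos_exponent N (z * a i)))"
proof -
  have "(\<Prod>i\<in>I. char (distr M borel (\<Lambda> (F i))) (z * a i)) = (\<Prod>i\<in>I. exp (- complex_of_real (measure lborel (F i) * cos_exponent N (z * a i))))"
    using assms by (intro prod.cong refl char_random_measure)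
  also have "\<dots> = exp (\<Sum>i\<in>I. - complex_of_real (measure lborel (F i) * cos_exponent N (z * a i)))"
    using assms by (simp only: exp_sum)
  finally show ?thesis
    using char_sum_random_measure_prod[OF assms] by (simp add: sum_negf)
qed

subsection \<open>Integrals of simple functions\<close>

text \<open>\<open>simple_integral\<close> sums over the values of s, which is awkward for comparing
  two functions; this rewrites it over an arbitrary partition into sets on which s is
  constant.\<close>

lemma simple_integral_partition:
  assumes s: "simple_function borel s" and I: "finite I" and F: "\<And>i. i \<in> I \<Longrightarrow> F i \<in> bounded_borel"
    and disj: "disjoint_family_on F I" and a: "\<And>i t. i \<in> I \<Longrightarrow> t \<in> F i \<Longrightarrow> s t = a i"
  shows "AE \<omega> in M. simple_integral M Y s (\<Union>i\<in>I. F i) \<omega> = (\<Sum>i\<in>I. a i * \<Lambda> (F i) \<omega>)"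
proof -
  have fin: "finite (range s)" and meas: "s -` {y} \<in> sets borel" for y
    using simple_functionD(2)[OF s, of "{y}"] simple_functionD(1)[OF s] by auto
  have "AE \<omega> in M. \<forall>y\<in>range s. \<Lambda> ((\<Union>i\<in>I. F i) \<inter> s -` {y}) \<omega> = (\<Sum>i\<in>I. \<Lambda> (F i \<inter> s -` {y}) \<omega>)"
  proof (rule AE_finite_allI[OF fin])
    fix y
    have eq: "(\<Union>i\<in>I. F i) \<inter> s -` {y} = (\<Union>i\<in>I. F i \<inter> s -` {y})" by blast
    show "AE \<omega> in M. \<Lambda> ((\<Union>i\<in>I. F i) \<inter> s -` {y}) \<omega> = (\<Sum>i\<in>I. \<Lambda> (F i \<inter> s -` {y}) \<omega>)"
      unfolding eq
    proof (rule random_measure_UN[OF I])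
      show "F i \<inter> s -` {y} \<in> bounded_borel" if "i \<in> I" for i
        by (rule bounded_borel_subset[OF F[OF that] Int_lower1])
          (use F[OF that] meas[of y] in \<open>auto simp: bounded_borel_def\<close>)
      show "disjoint_family_on (\<lambda>i. F i \<inter> s -` {y}) I"
        using disj unfolding disjoint_family_on_def by blast
    qed
  qed
  then show ?thesis
    using random_measure_empty
  proof eventually_elim
    case (elim \<omega>)
    have cell: "\<Lambda> (F i \<inter> s -` {y}) \<omega> = (if y = a i then \<Lambda> (F i) \<omega> else 0)" if "i \<in> I" for i y
    proof -
      have "F i \<inter> s -` {y} = (if y = a i then F i else {})" using a[OF that] by auto
      then show ?thesis using elim(2) by simp
    qed
    have "simple_integral M Y s (\<Union>i\<in>I. F i) \<omega> = (\<Sum>y\<in>range s. y * (\<Sum>i\<in>I. \<Lambda> (F i \<inter> s -` {y}) \<omega>))"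
      unfolding simple_integral_def using elim(1) by (intro sum.cong) auto
    also have "\<dots> = (\<Sum>y\<in>range s. \<Sum>i\<in>I. y * (if y = a i then \<Lambda> (F i) \<omega> else 0))"
      using cell by (simp add: sum_distrib_left)
    also have "\<dots> = (\<Sum>i\<in>I. \<Sum>y\<in>range s. if y = a i then a i * \<Lambda> (F i) \<omega> else 0)"
      by (subst sum.swap) (intro sum.cong refl, auto)
    also have "\<dots> = (\<Sum>i\<in>I. a i * \<Lambda> (F i) \<omega>)"
    proof (intro sum.cong refl)
      fix i assume i: "i \<in> I"
      show "(\<Sum>y\<in>range s. if y = a i then a i * \<Lambda> (F i) \<omega> else 0) = a i * \<Lambda> (F i) \<omega>"
      \<comment> \<open>On an empty cell \<open>a i\<close> is unconstrained and may lie outside the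
        range of s; there the random measure vanishes almost surely.\<close>
      proof (cases "F i = {}")
        case True
        then have "\<Lambda> (F i) \<omega> = 0" using elim(2) by simp
        then show ?thesis by (simp cong: if_cong)
      next
        case False
        then obtain t where "t \<in> F i" by blast
        then have "a i \<in> range s" using a[OF i] by (metis rangeI)
        then show ?thesis using fin by simp
      qed
    qed
    finally show ?case .
  qed
qed

lemma measurable_sum_random_measure:
  "(\<And>i. i \<in> I \<Longrightarrow> F i \<in> bounded_borel) \<Longrightarrow> (\<lambda>\<omega>. \<Sum>i\<in>I. a i * \<Lambda> (F i) \<omega>) \<in> borel_measurable M"
  by (intro borel_measurable_sum borel_measurable_times measurable_random_measure borel_measurable_const)

lemma measurable_simple_integral:
  assumes s: "simple_function borel s" and B: "B \<in> bounded_borel"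
  shows "simple_integral M Y s B \<in> borel_measurable M"
proof -
  have "B \<inter> s -` {y} \<in> bounded_borel" for y
    by (rule bounded_borel_subset[OF B Int_lower1])
      (use simple_functionD(2)[OF s, of "{y}"] B in \<open>auto simp: bounded_borel_def\<close>)
  then show ?thesis
    unfolding simple_integral_def by (intro borel_measurable_sum borel_measurable_times measurable_random_measure) auto
qed

text \<open>The cells are indexed by the value of s, the value of s', membership in B and membership
  in B', with coefficient 0 outside the set concerned. The last clause evaluates Lebesgue integrals
  over the same cells, so one refinement serves characteristic functions and distance bounds
  alike.\<close>

lemma simple_integral_common_refinement:
  assumes s: "simple_function borel s" "simple_function borel s'"
    and B: "B \<in> bounded_borel" "B' \<in> bounded_borel"
  obtains I :: "(real \<times> real \<times> bool \<times> bool) set" and F a a'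
  where "finite I" "\<And>i. i \<in> I \<Longrightarrow> F i \<in> bounded_borel" "disjoint_family_on F I"
    "AE \<omega> in M. simple_integral M Y s B \<omega> = (\<Sum>i\<in>I. a i * \<Lambda> (F i) \<omega>)"
    "AE \<omega> in M. simple_integral M Y s' B' \<omega> = (\<Sum>i\<in>I. a' i * \<Lambda> (F i) \<omega>)"
    "\<And>f :: real \<Rightarrow> real \<Rightarrow> real. f 0 0 = 0 \<Longrightarrow> (\<integral>t. f (s t * indicator B t) (s' t * indicator B' t) \<partial>lborel)
      = (\<Sum>i\<in>I. measure lborel (F i) * f (a i) (a' i))"
proof -
  define I where "I = range s \<times> range s' \<times> (UNIV :: bool set) \<times> (UNIV :: bool set)"
  define F where "F i = (case i of (y, y', b, b') \<Rightarrow> (B \<union> B') \<inter> s -` {y} \<inter> s' -` {y'} \<inter> {t. (t \<in> B) = b} \<inter> {t. (t \<in> B') = b'})"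
    for i :: "real \<times> real \<times> bool \<times> bool"
  define a where "a i = (case i of (y, y', b, b') \<Rightarrow> if b then y else 0)" for i :: "real \<times> real \<times> bool \<times> bool"
  define a' where "a' i = (case i of (y, y', b, b') \<Rightarrow> if b' then y' else 0)" for i :: "real \<times> real \<times> bool \<times> bool"
  have fin: "finite (range s)" "finite (range s')"
    using simple_functionD(1)[OF s(1)] simple_functionD(1)[OF s(2)] by auto
  have meas: "s -` {y} \<in> sets borel" "s' -` {y} \<in> sets borel" for y
    using simple_functionD(2)[OF s(1), of "{y}"] simple_functionD(2)[OF s(2), of "{y}"] by auto
  have I: "finite I" using fin by (simp add: I_def)
  have Bb: "B \<in> sets borel" "B' \<in> sets borel" using B by (auto simp: bounded_borel_def)
  have F: "F i \<in> bounded_borel" for i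
  proof -
    obtain y y' b b' where i: "i = (y, y', b, b')" by (cases i)
    have "{t. (t \<in> B) = b} \<in> sets borel" "{t. (t \<in> B') = b'} \<in> sets borel"
      using Bb borel_comp[of B] borel_comp[of B'] by (cases b; cases b'; simp add: Compl_eq)+
    then have "F i \<in> sets borel" using Bb meas by (simp add: F_def i)
    then show ?thesis
      by (rule bounded_borel_subset[OF bounded_borel_Un[OF B], rotated]) (auto simp: F_def i)
  qed
  have disj: "disjoint_family_on F I"
    by (auto simp: disjoint_family_on_def F_def)
  have memF: "t \<in> F i \<longleftrightarrow> t \<in> B \<union> B' \<and> i = (s t, s' t, t \<in> B, t \<in> B')" for t i
    by (auto simp: F_def split: prod.splits)
  have inI: "(s t, s' t, b, b') \<in> I" for t b b' by (auto simp: I_def)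
  have sub: "AE \<omega> in M. simple_integral M Y u C \<omega> = (\<Sum>i\<in>I. c i * \<Lambda> (F i) \<omega>)"
    if u: "simple_function borel u" and C: "C = (\<Union>i\<in>J. F i)" and J: "J \<subseteq> I" and c: "\<And>i. i \<in> I - J \<Longrightarrow> c i = 0"
      "\<And>i t. i \<in> J \<Longrightarrow> t \<in> F i \<Longrightarrow> u t = c i" for u C J c
  proof -
    have "AE \<omega> in M. simple_integral M Y u (\<Union>i\<in>J. F i) \<omega> = (\<Sum>i\<in>J. c i * \<Lambda> (F i) \<omega>)"
      using J disj I c(2) F by (intro simple_integral_partition[OF u]) (auto intro: finite_subset disjoint_family_on_mono[OF J disj])
    moreover have "(\<Sum>i\<in>J. c i * \<Lambda> (F i) \<omega>) = (\<Sum>i\<in>I. c i * \<Lambda> (F i) \<omega>)" for \<omega>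
      using I J c(1) by (intro sum.mono_neutral_left) auto
    ultimately show ?thesis by (simp add: C)
  qed
  have A1: "AE \<omega> in M. simple_integral M Y s B \<omega> = (\<Sum>i\<in>I. a i * \<Lambda> (F i) \<omega>)"
  proof (rule sub[of s B "{i \<in> I. fst (snd (snd i))}" a, OF s(1)])
    show "B = (\<Union>i\<in>{i \<in> I. fst (snd (snd i))}. F i)"
      using inI by (auto simp: memF)
  qed (auto simp: a_def memF split: prod.splits)
  have A2: "AE \<omega> in M. simple_integral M Y s' B' \<omega> = (\<Sum>i\<in>I. a' i * \<Lambda> (F i) \<omega>)"
  proof (rule sub[of s' B' "{i \<in> I. snd (snd (snd i))}" a', OF s(2)])
    show "B' = (\<Union>i\<in>{i \<in> I. snd (snd (snd i))}. F i)"
      using inI by (auto simp: memF)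
  qed (auto simp: a'_def memF split: prod.splits)
  have A3: "(\<integral>t. f (s t * indicator B t) (s' t * indicator B' t) \<partial>lborel) = (\<Sum>i\<in>I. measure lborel (F i) * f (a i) (a' i))"
    if "f 0 0 = 0" for f :: "real \<Rightarrow> real \<Rightarrow> real"
  proof -
    have eq: "f (s t * indicator B t) (s' t * indicator B' t) = (\<Sum>i\<in>I. f (a i) (a' i) * indicator (F i) t)" for t
    proof (cases "t \<in> B \<union> B'")
      case True
      let ?i = "(s t, s' t, t \<in> B, t \<in> B')"
      have "(\<Sum>i\<in>I. f (a i) (a' i) * indicator (F i) t) = (\<Sum>i\<in>I. if i = ?i then f (a i) (a' i) else 0)"
        using True by (intro sum.cong refl) (auto simp: memF indicator_def)
      also have "\<dots> = f (a ?i) (a' ?i)" using I inI by simp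
      finally show ?thesis by (simp add: a_def a'_def)
    next
      case False
      then have "indicator (F i) t = (0::real)" for i by (auto simp: memF indicator_def)
      then show ?thesis using False that by simp
    qed
    have "emeasure lborel (F i) < \<infinity>" "F i \<in> sets borel" for i
      using F[of i] by (auto simp: bounded_borel_def emeasure_bounded_finite[unfolded infinity_ennreal_def])
    then have "(\<integral>t. (\<Sum>i\<in>I. f (a i) (a' i) * indicator (F i) t) \<partial>lborel) = (\<Sum>i\<in>I. f (a i) (a' i) * measure lborel (F i))"
      by (subst Bochner_Integration.integral_sum) auto
    then show ?thesis by (simp add: eq mult.commute)
  qed
  show thesis by (rule that[OF I F disj A1 A2 A3])
qed

lemma char_simple_integral:
  assumes s: "simple_function borel s" and B: "B \<in> bounded_borel"
  shows "char (distr M borel (simple_integral M Y s B)) z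
    = exp (- complex_of_real (\<integral>t. cos_exponent N (z * (s t * indicator B t)) \<partial>lborel))"
proof -
  obtain I :: "(real \<times> real \<times> bool \<times> bool) set" and F a a' where
    I: "finite I" "\<And>i. i \<in> I \<Longrightarrow> F i \<in> bounded_borel" "disjoint_family_on F I"
    and A: "AE \<omega> in M. simple_integral M Y s B \<omega> = (\<Sum>i\<in>I. a i * \<Lambda> (F i) \<omega>)"
      "AE \<omega> in M. simple_integral M Y s B \<omega> = (\<Sum>i\<in>I. a' i * \<Lambda> (F i) \<omega>)"
    and f: "\<And>f :: real \<Rightarrow> real \<Rightarrow> real. f 0 0 = 0 \<Longrightarrow> (\<integral>t. f (s t * indicator B t) (s t * indicator B t) \<partial>lborel)
      = (\<Sum>i\<in>I. measure lborel (F i) * f (a i) (a' i))"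
    by (rule simple_integral_common_refinement[OF s s B B], rule that; assumption)
  have "distr M borel (simple_integral M Y s B) = distr M borel (\<lambda>\<omega>. \<Sum>i\<in>I. a i * \<Lambda> (F i) \<omega>)"
    by (rule distr_cong_AE'[OF A(1) measurable_simple_integral[OF s B] measurable_sum_random_measure]) (rule I(2))
  then show ?thesis
    using f[of "\<lambda>u v. cos_exponent N (z * u)"] by (simp add: char_sum_random_measure[OF I])
qed

text \<open>The substitute for an isometry: the distance of two integrals is controlled by a
  deterministic integral of the difference of the integrands.\<close>

lemma trunc_moment_simple_integral_diff:
  assumes s: "simple_function borel s" "simple_function borel s'"
    and B: "B \<in> bounded_borel" "B' \<in> bounded_borel"
  shows "trunc_moment M (\<lambda>\<omega>. simple_integral M Y s B \<omega> - simple_integral M Y s' B' \<omega>)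
    \<le> 16 * (\<integral>t. trunc_exponent N (s t * indicator B t - s' t * indicator B' t) \<partial>lborel)"
proof -
  obtain I :: "(real \<times> real \<times> bool \<times> bool) set" and F a a' where
    I: "finite I" "\<And>i. i \<in> I \<Longrightarrow> F i \<in> bounded_borel" "disjoint_family_on F I"
    and A: "AE \<omega> in M. simple_integral M Y s B \<omega> = (\<Sum>i\<in>I. a i * \<Lambda> (F i) \<omega>)"
      "AE \<omega> in M. simple_integral M Y s' B' \<omega> = (\<Sum>i\<in>I. a' i * \<Lambda> (F i) \<omega>)"
    and f: "\<And>f :: real \<Rightarrow> real \<Rightarrow> real. f 0 0 = 0 \<Longrightarrow> (\<integral>t. f (s t * indicator B t) (s' t * indicator B' t) \<partial>lborel)
      = (\<Sum>i\<in>I. measure lborel (F i) * f (a i) (a' i))"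
    by (rule simple_integral_common_refinement[OF s B], rule that; assumption)
  let ?X = "\<lambda>\<omega>. \<Sum>i\<in>I. (a i - a' i) * \<Lambda> (F i) \<omega>"
  have X: "?X \<in> borel_measurable M"
    by (rule measurable_sum_random_measure) (rule I(2))
  have "trunc_moment M (\<lambda>\<omega>. simple_integral M Y s B \<omega> - simple_integral M Y s' B' \<omega>) = trunc_moment M ?X"
  proof (rule trunc_moment_cong_AE[OF _ borel_measurable_diff[OF measurable_simple_integral[OF s(1) B(1)] measurable_simple_integral[OF s(2) B(2)]] X])
    show "AE \<omega> in M. simple_integral M Y s B \<omega> - simple_integral M Y s' B' \<omega> = ?X \<omega>"
      using A by eventually_elim (simp add: left_diff_distrib sum_subtractf)
  qed
  also have "\<dots> \<le> 16 * (\<Sum>i\<in>I. measure lborel (F i) * trunc_exponent N (a i - a' i))"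
  proof (rule trunc_moment_le_exponent[OF X char_sum_random_measure[OF I]])
    fix z :: real assume z: "0 \<le> z" "z \<le> 1"
    have "(\<Sum>i\<in>I. measure lborel (F i) * cos_exponent N (z * (a i - a' i)))
        \<le> (\<Sum>i\<in>I. measure lborel (F i) * (2 * trunc_exponent N (a i - a' i)))"
      using z by (intro sum_mono mult_left_mono N.cos_exponent_le_trunc_exponent) auto
    then show "(\<Sum>i\<in>I. measure lborel (F i) * cos_exponent N (z * (a i - a' i)))
        \<le> 2 * (\<Sum>i\<in>I. measure lborel (F i) * trunc_exponent N (a i - a' i))"
      by (simp add: sum_distrib_left mult_ac)
  qed
  also have "(\<Sum>i\<in>I. measure lborel (F i) * trunc_exponent N (a i - a' i))
      = (\<integral>t. trunc_exponent N (s t * indicator B t - s' t * indicator B' t) \<partial>lborel)"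
    using f[of "\<lambda>u v. trunc_exponent N (u - v)"] by simp
  finally show ?thesis .
qed

end

subsection \<open>Integrals over bounded intervals\<close>

context symmetric_levy_process
begin

text \<open>Integrands are measurable on (0, \<infinity>) only. Extension by 0 gives a Borel
  function on the line, and both exponents vanish at 0, so nothing is added to the
  integrals.\<close>

definition half_line_cut :: "(real \<Rightarrow> real) \<Rightarrow> real \<Rightarrow> real" where
  "half_line_cut h t = indicator {0<..} t * h t"

lemma half_line_cut_simps: "0 < t \<Longrightarrow> half_line_cut h t = h t" "t \<le> 0 \<Longrightarrow> half_line_cut h t = 0"
  by (auto simp: half_line_cut_def)

lemma measurable_half_line_cut: "set_borel_measurable borel {0<..} h \<Longrightarrow> half_line_cut h \<in> borel_measurable borel"
  by (simp add: set_borel_measurable_def half_line_cut_def[abs_def])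

lemma integrable_exponent_bounded:
  assumes f [measurable]: "f \<in> borel_measurable borel" and B: "B \<in> sets borel" "bounded B"
    and supp: "\<And>t. t \<notin> B \<Longrightarrow> f t = 0"
  shows "integrable lborel (\<lambda>t. trunc_exponent N (f t))" "integrable lborel (\<lambda>t. cos_exponent N (f t))"
proof -
  have int: "integrable lborel (\<lambda>t. 2 * measure N (space N) * indicator B t)"
    using B emeasure_bounded_finite[of B] by (intro integrable_mult_right) (auto simp: integrable_indicator_iff)
  have "norm (trunc_exponent N (f t)) \<le> norm (2 * measure N (space N) * indicator B t)" for t
    using supp[of t] N.trunc_exponent_le[of "f t"] N.trunc_exponent_nonneg[of "f t"] measure_nonneg[of N "space N"]
    by (cases "t \<in> B") auto
  then show "integrable lborel (\<lambda>t. trunc_exponent N (f t))"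
    by (intro Bochner_Integration.integrable_bound[OF int] AE_I2) auto
  have "norm (cos_exponent N (f t)) \<le> norm (2 * measure N (space N) * indicator B t)" for t
    using supp[of t] N.cos_exponent_le[of "f t"] N.cos_exponent_nonneg[of "f t"]
    by (cases "t \<in> B") auto
  then show "integrable lborel (\<lambda>t. cos_exponent N (f t))"
    by (intro Bochner_Integration.integrable_bound[OF int] AE_I2) auto
qed

lemma tendsto_integral_exponent:
  assumes f: "\<And>n. f n \<in> borel_measurable borel" "f0 \<in> borel_measurable borel" and B: "B \<in> sets borel" "bounded B"
    and supp: "\<And>n t. t \<notin> B \<Longrightarrow> f n t = 0" "\<And>t. t \<notin> B \<Longrightarrow> f0 t = 0"
    and lim: "AE t in lborel. t \<in> B \<longrightarrow> (\<lambda>n. f n t) \<longlonglongrightarrow> f0 t"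
  shows "(\<lambda>n. \<integral>t. trunc_exponent N (f n t) \<partial>lborel) \<longlonglongrightarrow> (\<integral>t. trunc_exponent N (f0 t) \<partial>lborel)"
    "(\<lambda>n. \<integral>t. cos_exponent N (f n t) \<partial>lborel) \<longlonglongrightarrow> (\<integral>t. cos_exponent N (f0 t) \<partial>lborel)"
proof -
  note [measurable] = f
  let ?w = "\<lambda>t. 2 * measure N (space N) * indicator B t"
  have int: "integrable lborel ?w"
    using B emeasure_bounded_finite[of B] by (intro integrable_mult_right) (auto simp: integrable_indicator_iff)
  show "(\<lambda>n. \<integral>t. trunc_exponent N (f n t) \<partial>lborel) \<longlonglongrightarrow> (\<integral>t. trunc_exponent N (f0 t) \<partial>lborel)"
  proof (rule integral_dominated_convergence[where w = ?w])
    show "AE t in lborel. (\<lambda>n. trunc_exponent N (f n t)) \<longlonglongrightarrow> trunc_exponent N (f0 t)"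
      using lim
    proof eventually_elim
      case (elim t)
      then show ?case using supp by (cases "t \<in> B") (auto intro: N.tendsto_trunc_exponent)
    qed
    show "AE t in lborel. norm (trunc_exponent N (f n t)) \<le> ?w t" for n
    proof (rule AE_I2)
      fix t show "norm (trunc_exponent N (f n t)) \<le> ?w t"
        using supp(1)[of t n] N.trunc_exponent_le[of "f n t"] N.trunc_exponent_nonneg[of "f n t"] measure_nonneg[of N "space N"]
        by (cases "t \<in> B") auto
    qed
  qed (use int in auto)
  show "(\<lambda>n. \<integral>t. cos_exponent N (f n t) \<partial>lborel) \<longlonglongrightarrow> (\<integral>t. cos_exponent N (f0 t) \<partial>lborel)"
  proof (rule integral_dominated_convergence[where w = ?w])
    show "AE t in lborel. (\<lambda>n. cos_exponent N (f n t)) \<longlonglongrightarrow> cos_exponent N (f0 t)"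
      using lim
    proof eventually_elim
      case (elim t)
      then show ?case using supp by (cases "t \<in> B") (auto intro: N.tendsto_cos_exponent)
    qed
    show "AE t in lborel. norm (cos_exponent N (f n t)) \<le> ?w t" for n
    proof (rule AE_I2)
      fix t show "norm (cos_exponent N (f n t)) \<le> ?w t"
        using supp(1)[of t n] N.cos_exponent_le[of "f n t"] N.cos_exponent_nonneg[of "f n t"]
        by (cases "t \<in> B") auto
    qed
  qed (use int in auto)
qed

lemma subset_interval_bounded_borel:
  "0 < p \<Longrightarrow> B \<in> sets borel \<Longrightarrow> B \<subseteq> {p..q} \<Longrightarrow> B \<in> bounded_borel"
  by (auto simp: bounded_borel_def intro: bounded_subset[of "{p..q}"])

lemma measurable_simple_function: "simple_function borel (s :: real \<Rightarrow> real) \<Longrightarrow> s \<in> borel_measurable borel"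
  by (rule borel_measurable_simple_function)

text \<open>Since N is finite, \<open>trunc_exponent\<close> is bounded. On a bounded set, pointwise
  convergence of simple functions therefore suffices by dominated convergence, whatever the size of
  h, and local integrability reduces to measurability.\<close>

lemma simple_approximation_exists:
  assumes h: "set_borel_measurable borel {0<..} h" and p: "0 < p"
  obtains s where "simple_approximation M Y h p q s"
proof -
  have H [measurable]: "half_line_cut h \<in> borel_measurable borel" using h by (rule measurable_half_line_cut)
  obtain s where s: "\<And>n. simple_function borel (s n)" "\<And>t. (\<lambda>n. s n t) \<longlonglongrightarrow> half_line_cut h t"
    using borel_measurable_implies_sequence_metric[OF H, of 0] by auto
  have lim: "(\<lambda>n. s n t) \<longlonglongrightarrow> h t" if "t \<in> {p..q}" for t
    using s(2)[of t] that p by (simp add: half_line_cut_simps)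
  have "\<exists>Z\<in>borel_measurable M. tendsto_in_prob M (\<lambda>n. simple_integral M Y (s n) B) Z sequentially"
    if B: "B \<in> sets borel" "B \<subseteq> {p..q}" for B
  proof -
    have bb: "B \<in> bounded_borel" using subset_interval_bounded_borel[OF p B] .
    then have bd: "bounded B" by (simp add: bounded_borel_def)
    note [measurable] = measurable_simple_function[OF s(1)] B(1)
    define d where "d n = (\<integral>t. trunc_exponent N ((s n t - half_line_cut h t) * indicator B t) \<partial>lborel)" for n
    have "d \<longlonglongrightarrow> (\<integral>t. trunc_exponent N 0 \<partial>(lborel :: real measure))"
      unfolding d_def
    proof (rule tendsto_integral_exponent(1)[where B = B and ?f0.0 = "\<lambda>_. 0"])
      have lim0: "(\<lambda>n. (s n t - half_line_cut h t) * indicator B t) \<longlonglongrightarrow> 0" for t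
        using s(2)[of t] by (intro tendsto_mult_left_zero) (simp add: LIM_zero)
      show "AE t in lborel. t \<in> B \<longrightarrow> (\<lambda>n. (s n t - half_line_cut h t) * indicator B t) \<longlonglongrightarrow> 0"
        by (intro AE_I2 impI lim0)
    qed (use bd B in auto)
    then have d: "d \<longlonglongrightarrow> 0" by simp
    have int: "integrable lborel (\<lambda>t. trunc_exponent N ((s n t - half_line_cut h t) * indicator B t))" for n
      using bd by (intro integrable_exponent_bounded(1)[where B = B]) auto
    have int2: "integrable lborel (\<lambda>t. trunc_exponent N (s m t * indicator B t - s n t * indicator B t))" for m n
      using bd by (intro integrable_exponent_bounded(1)[where B = B]) auto
    have le: "trunc_moment M (\<lambda>\<omega>. simple_integral M Y (s m) B \<omega> - simple_integral M Y (s n) B \<omega>) \<le> 32 * (d m + d n)" for m n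
    proof -
      have "trunc_moment M (\<lambda>\<omega>. simple_integral M Y (s m) B \<omega> - simple_integral M Y (s n) B \<omega>)
        \<le> 16 * (\<integral>t. trunc_exponent N (s m t * indicator B t - s n t * indicator B t) \<partial>lborel)"
        by (rule trunc_moment_simple_integral_diff[OF s(1) s(1) bb bb])
      also have "(\<integral>t. trunc_exponent N (s m t * indicator B t - s n t * indicator B t) \<partial>lborel)
        \<le> (\<integral>t. 2 * trunc_exponent N ((s m t - half_line_cut h t) * indicator B t)
            + 2 * trunc_exponent N ((s n t - half_line_cut h t) * indicator B t) \<partial>lborel)"
      proof (intro integral_mono int2 Bochner_Integration.integrable_add integrable_mult_right int)
        fix t
        show "trunc_exponent N (s m t * indicator B t - s n t * indicator B t)
          \<le> 2 * trunc_exponent N ((s m t - half_line_cut h t) * indicator B t)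
            + 2 * trunc_exponent N ((s n t - half_line_cut h t) * indicator B t)"
          using N.trunc_exponent_diff[of "(s m t - half_line_cut h t) * indicator B t" "(s n t - half_line_cut h t) * indicator B t"]
          by (simp add: algebra_simps)
      qed
      also have "\<dots> = 2 * d m + 2 * d n"
        by (simp add: d_def int)
      finally show ?thesis by simp
    qed
    obtain Z where "Z \<in> borel_measurable M" "tendsto_in_prob M (\<lambda>n. simple_integral M Y (s n) B) Z sequentially"
    proof (rule Cauchy_in_prob_convergent[of "\<lambda>n. simple_integral M Y (s n) B"])
      show "simple_integral M Y (s n) B \<in> borel_measurable M" for n
        by (rule measurable_simple_integral[OF s(1) bb])
      fix e :: real assume "0 < e"
      then obtain n0 where n0: "\<And>n. n0 \<le> n \<Longrightarrow> norm (d n - 0) < e / 64"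
        using LIMSEQ_D[OF d, of "e / 64"] by auto
      have "trunc_moment M (\<lambda>\<omega>. simple_integral M Y (s m) B \<omega> - simple_integral M Y (s n) B \<omega>) < e"
        if "n0 \<le> m" "n0 \<le> n" for m n
        using le[of m n] n0[OF that(1)] n0[OF that(2)] by (simp add: abs_less_iff)
      then show "\<exists>n0. \<forall>m\<ge>n0. \<forall>n\<ge>n0. trunc_moment M (\<lambda>\<omega>. simple_integral M Y (s m) B \<omega> - simple_integral M Y (s n) B \<omega>) < e"
        by blast
    qed
    then show ?thesis by blast
  qed
  then have "simple_approximation M Y h p q s"
    unfolding simple_approximation_def using s(1) lim by simp
  then show thesis by (rule that)
qed

lemma locally_integrable_iff: "locally_integrable M Y h \<longleftrightarrow> set_borel_measurable borel {0<..} h"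
  unfolding locally_integrable_def using simple_approximation_exists by metis

lemma has_integral_on_char:
  assumes h: "set_borel_measurable borel {0<..} h" and Z: "has_integral_on M Y h B Z"
  shows "char (distr M borel Z) z = exp (- complex_of_real (\<integral>t. cos_exponent N (z * (half_line_cut h t * indicator B t)) \<partial>lborel))"
proof -
  have H [measurable]: "half_line_cut h \<in> borel_measurable borel" using h by (rule measurable_half_line_cut)
  obtain p q s where p: "0 < p" "B \<subseteq> {p..q}" and B: "B \<in> sets borel" and s: "simple_approximation M Y h p q s"
    and lim: "tendsto_in_prob M (\<lambda>n. simple_integral M Y (s n) B) Z sequentially" and Zm: "Z \<in> borel_measurable M"
    using Z by (auto simp: has_integral_on_def)
  have bb: "B \<in> bounded_borel" using subset_interval_bounded_borel[OF p(1) B p(2)] .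
  then have bd: "bounded B" by (simp add: bounded_borel_def)
  have sf: "simple_function borel (s n)" for n using s by (simp add: simple_approximation_def)
  note [measurable] = measurable_simple_function[OF sf] B
  have sl: "AE t in lborel. t \<in> {p..q} \<longrightarrow> (\<lambda>n. s n t) \<longlonglongrightarrow> h t" using s by (simp add: simple_approximation_def)
  have "(\<lambda>n. \<integral>t. cos_exponent N (z * (s n t * indicator B t)) \<partial>lborel)
      \<longlonglongrightarrow> (\<integral>t. cos_exponent N (z * (half_line_cut h t * indicator B t)) \<partial>lborel)"
  proof (rule tendsto_integral_exponent(2)[where B = B])
    show "AE t in lborel. t \<in> B \<longrightarrow> (\<lambda>n. z * (s n t * indicator B t)) \<longlonglongrightarrow> z * (half_line_cut h t * indicator B t)"
      using sl
    proof eventually_elim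
      case (elim t)
      show ?case
      proof
        assume "t \<in> B"
        then have "0 < t" "t \<in> {p..q}" using p by auto
        with elim show "(\<lambda>n. z * (s n t * indicator B t)) \<longlonglongrightarrow> z * (half_line_cut h t * indicator B t)"
          by (intro tendsto_intros) (simp add: half_line_cut_simps)
      qed
    qed
  qed (use bd B in auto)
  then have "(\<lambda>n. exp (- complex_of_real (\<integral>t. cos_exponent N (z * (s n t * indicator B t)) \<partial>lborel)))
      \<longlonglongrightarrow> exp (- complex_of_real (\<integral>t. cos_exponent N (z * (half_line_cut h t * indicator B t)) \<partial>lborel))"
    by (intro tendsto_intros)
  then have "(\<lambda>n. char (distr M borel (simple_integral M Y (s n) B)) z)
      \<longlonglongrightarrow> exp (- complex_of_real (\<integral>t. cos_exponent N (z * (half_line_cut h t * indicator B t)) \<partial>lborel))"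
    by (simp only: char_simple_integral[OF sf bb])
  moreover have "(\<lambda>n. char (distr M borel (simple_integral M Y (s n) B)) z) \<longlonglongrightarrow> char (distr M borel Z) z"
    by (rule tendsto_in_prob_char[OF measurable_simple_integral[OF sf bb] Zm lim])
  ultimately show ?thesis by (rule LIMSEQ_unique[symmetric])
qed

text \<open>The constant is 4 * 16, the 4 coming from the passage to limits. For B = B' the bound is
  0, so the integral depends neither on the enclosing interval nor on the approximating
  sequence.\<close>

lemma has_integral_on_diff:
  assumes h: "set_borel_measurable borel {0<..} h" and Z: "has_integral_on M Y h B Z" "has_integral_on M Y h B' Z'"
  shows "trunc_moment M (\<lambda>\<omega>. Z \<omega> - Z' \<omega>)
    \<le> 64 * (\<integral>t. trunc_exponent N (half_line_cut h t * indicator B t - half_line_cut h t * indicator B' t) \<partial>lborel)"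
proof -
  have H [measurable]: "half_line_cut h \<in> borel_measurable borel" using h by (rule measurable_half_line_cut)
  obtain p q s where p: "0 < p" "B \<subseteq> {p..q}" and B: "B \<in> sets borel" and s: "simple_approximation M Y h p q s"
    and lim: "tendsto_in_prob M (\<lambda>n. simple_integral M Y (s n) B) Z sequentially" and Zm: "Z \<in> borel_measurable M"
    using Z(1) by (auto simp: has_integral_on_def)
  obtain p' q' s' where p': "0 < p'" "B' \<subseteq> {p'..q'}" and B': "B' \<in> sets borel" and s': "simple_approximation M Y h p' q' s'"
    and lim': "tendsto_in_prob M (\<lambda>n. simple_integral M Y (s' n) B') Z' sequentially" and Zm': "Z' \<in> borel_measurable M"
    using Z(2) by (auto simp: has_integral_on_def)
  have bb: "B \<in> bounded_borel" "B' \<in> bounded_borel"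
    using subset_interval_bounded_borel[OF p(1) B p(2)] subset_interval_bounded_borel[OF p'(1) B' p'(2)] by auto
  then have bd: "bounded (B \<union> B')" "B \<union> B' \<in> sets borel" by (auto simp: bounded_borel_def)
  have sf: "simple_function borel (s n)" "simple_function borel (s' n)" for n
    using s s' by (auto simp: simple_approximation_def)
  note [measurable] = measurable_simple_function[OF sf(1)] measurable_simple_function[OF sf(2)] B B'
  have sl: "AE t in lborel. t \<in> {p..q} \<longrightarrow> (\<lambda>n. s n t) \<longlonglongrightarrow> h t"
    "AE t in lborel. t \<in> {p'..q'} \<longrightarrow> (\<lambda>n. s' n t) \<longlonglongrightarrow> h t"
    using s s' by (auto simp: simple_approximation_def)
  let ?c = "\<lambda>n. 16 * (\<integral>t. trunc_exponent N (s n t * indicator B t - s' n t * indicator B' t) \<partial>lborel)"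
  let ?l = "\<integral>t. trunc_exponent N (half_line_cut h t * indicator B t - half_line_cut h t * indicator B' t) \<partial>lborel"
  have "(\<lambda>n. \<integral>t. trunc_exponent N (s n t * indicator B t - s' n t * indicator B' t) \<partial>lborel) \<longlonglongrightarrow> ?l"
  proof (rule tendsto_integral_exponent(1)[where B = "B \<union> B'"])
    show "AE t in lborel. t \<in> B \<union> B' \<longrightarrow> (\<lambda>n. s n t * indicator B t - s' n t * indicator B' t)
        \<longlonglongrightarrow> half_line_cut h t * indicator B t - half_line_cut h t * indicator B' t"
      using sl
    proof eventually_elim
      case (elim t)
      have "(\<lambda>n. s n t * indicator B t) \<longlonglongrightarrow> half_line_cut h t * indicator B t"
      proof (cases "t \<in> B")
        case True
        then have "0 < t" "t \<in> {p..q}" using p by auto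
        with elim(1) show ?thesis by (intro tendsto_intros) (simp add: half_line_cut_simps)
      qed simp
      moreover have "(\<lambda>n. s' n t * indicator B' t) \<longlonglongrightarrow> half_line_cut h t * indicator B' t"
      proof (cases "t \<in> B'")
        case True
        then have "0 < t" "t \<in> {p'..q'}" using p' by auto
        with elim(2) show ?thesis by (intro tendsto_intros) (simp add: half_line_cut_simps)
      qed simp
      ultimately show ?case by (intro impI tendsto_diff)
    qed
  qed (use bd in auto)
  then have c: "?c \<longlonglongrightarrow> 16 * ?l" by (intro tendsto_intros)
  have "trunc_moment M (\<lambda>\<omega>. Z \<omega> - Z' \<omega>) \<le> 4 * (16 * ?l)"
    by (rule trunc_moment_le_liminf[OF measurable_simple_integral[OF sf(1) bb(1)] measurable_simple_integral[OF sf(2) bb(2)]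
        Zm Zm' lim lim' _ c]) (auto intro: trunc_moment_simple_integral_diff sf bb)
  then show ?thesis by simp
qed

lemma has_integral_on_integral_on:
  assumes h: "set_borel_measurable borel {0<..} h" and p: "0 < p"
  shows "has_integral_on M Y h {p<..q} (integral_on M Y h {p<..q})"
proof -
  \<comment> \<open>\<open>max p q\<close> covers q < p, where the interval of integration is
    empty.\<close>
  have sub: "{p<..q} \<subseteq> {p..max p q}" by auto
  obtain s where s: "simple_approximation M Y h p (max p q) s"
    using simple_approximation_exists[OF h p] by blast
  moreover obtain Z where "Z \<in> borel_measurable M" "tendsto_in_prob M (\<lambda>n. simple_integral M Y (s n) {p<..q}) Z sequentially"
    using s sub unfolding simple_approximation_def by (metis borel_measurable_simple_function greaterThanAtMost_borel)
  ultimately have "has_integral_on M Y h {p<..q} Z"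
    unfolding has_integral_on_def using p sub by (intro conjI exI[of _ p] exI[of _ "max p q"] exI[of _ s]) auto
  then show ?thesis unfolding integral_on_def by (rule someI[of "has_integral_on M Y h {p<..q}"])
qed

subsection \<open>Improper integrals\<close>

definition exponent_finite :: "(real \<Rightarrow> real) \<Rightarrow> bool" where
  "exponent_finite h \<longleftrightarrow> integrable lborel (\<lambda>t. trunc_exponent N (half_line_cut h t))"

text \<open>For p <= 0 the value of \<open>integral_on\<close> may be an arbitrary function. The
  default 0 makes every member measurable, and the filter \<open>at_right 0\<close> never sees
  it.\<close>

definition finite_integral :: "(real \<Rightarrow> real) \<Rightarrow> real \<times> real \<Rightarrow> 'a \<Rightarrow> real" where
  "finite_integral h = (\<lambda>(p, q). if 0 < p then integral_on M Y h {p<..q} else (\<lambda>_. 0))"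

lemma eventually_exhaust:
  fixes P :: "real \<times> real \<Rightarrow> bool"
  assumes "\<And>p q. 0 < p \<Longrightarrow> p \<le> 1 / real (Suc n) \<Longrightarrow> real (Suc n) \<le> q \<Longrightarrow> P (p, q)"
  shows "eventually P (at_right 0 \<times>\<^sub>F at_top)"
proof -
  have "\<forall>\<^sub>F p in at_right 0. 0 < p \<and> p \<le> 1 / real (Suc n)"
    unfolding eventually_at_right_field by (intro exI[of _ "1 / real (Suc n)"]) auto
  moreover have "\<forall>\<^sub>F q in at_top. real (Suc n) \<le> q" by (rule eventually_ge_at_top)
  ultimately show ?thesis
    unfolding eventually_prod_filter using assms by blast
qed

lemma eventually_positive_fst: "\<forall>\<^sub>F (p, q) in at_right 0 \<times>\<^sub>F (at_top :: real filter). 0 < (p :: real)"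
  using eventually_exhaust[of 0 "\<lambda>i. 0 < fst i"] by (simp add: case_prod_beta')

lemma has_improper_integral_iff:
  "has_improper_integral M Y h Z \<longleftrightarrow> Z \<in> borel_measurable M \<and> tendsto_in_prob M (finite_integral h) Z (at_right 0 \<times>\<^sub>F at_top)"
proof -
  have "((\<lambda>i. measure M {\<omega> \<in> space M. e < \<bar>(case i of (p, q) \<Rightarrow> integral_on M Y h {p<..q}) \<omega> - Z \<omega>\<bar>}) \<longlongrightarrow> 0) (at_right 0 \<times>\<^sub>F at_top)
     \<longleftrightarrow> ((\<lambda>i. measure M {\<omega> \<in> space M. e < \<bar>finite_integral h i \<omega> - Z \<omega>\<bar>}) \<longlongrightarrow> 0) (at_right 0 \<times>\<^sub>F at_top)" for e
    using eventually_positive_fst by (intro tendsto_cong) (auto elim!: eventually_mono simp: finite_integral_def)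
  then show ?thesis by (simp add: has_improper_integral_def tendsto_in_prob_def)
qed

lemma measurable_finite_integral:
  assumes "set_borel_measurable borel {0<..} h" shows "finite_integral h i \<in> borel_measurable M"
  using has_integral_on_integral_on[OF assms, of "fst i" "snd i"]
  by (cases i) (auto simp: finite_integral_def has_integral_on_def)

lemma filterlim_exhaust: "filterlim (\<lambda>n. (1 / real (Suc n), real (Suc n))) (at_right 0 \<times>\<^sub>F at_top) sequentially"
proof (rule filterlim_Pair)
  have "(\<lambda>n. 1 / real (Suc n)) \<longlonglongrightarrow> 0" using LIMSEQ_inverse_real_of_nat by (simp add: inverse_eq_divide)
  then show "filterlim (\<lambda>n. 1 / real (Suc n)) (at_right 0) sequentially"
    by (auto simp: filterlim_at)
  show "filterlim (\<lambda>n. real (Suc n)) at_top sequentially"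
    by (rule filterlim_compose[OF filterlim_real_sequentially filterlim_Suc])
qed

text \<open>The distance between two finite integrals is bounded by the exponent mass that their
  intervals leave out. This mass is monotone and vanishes along (1/n, n], so one sequence produces
  the limit and the bound then holds for all larger intervals.\<close>

lemma has_improper_integral_exists:
  assumes h: "set_borel_measurable borel {0<..} h" and fin: "exponent_finite h"
  obtains Z where "has_improper_integral M Y h Z"
proof -
  have H [measurable]: "half_line_cut h \<in> borel_measurable borel" using h by (rule measurable_half_line_cut)
  let ?g = "\<lambda>t. trunc_exponent N (half_line_cut h t)"
  have int: "integrable lborel ?g" using fin by (simp add: exponent_finite_def)
  define R where "R p q = (\<integral>t. ?g t * indicator (- {p<..q}) t \<partial>lborel)" for p q
  have intR: "integrable lborel (\<lambda>t. ?g t * indicator (- {p<..q}) t)" for p q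
    by (rule Bochner_Integration.integrable_bound[OF int]) (auto simp: indicator_def)
  have Rnn: "0 \<le> R p q" for p q
    unfolding R_def by (intro integral_nonneg_AE AE_I2) (auto simp: N.trunc_exponent_nonneg)
  have Rmono: "R p q \<le> R p' q'" if "p \<le> p'" "q' \<le> q" for p q p' q'
    unfolding R_def using that
    by (intro integral_mono intR mult_left_mono) (auto simp: indicator_def N.trunc_exponent_nonneg)
  have diff: "trunc_moment M (\<lambda>\<omega>. finite_integral h (p, q) \<omega> - finite_integral h (p', q') \<omega>) \<le> 64 * (R p q + R p' q')"
    if "0 < p" "0 < p'" for p q p' q'
  proof -
    have "trunc_moment M (\<lambda>\<omega>. finite_integral h (p, q) \<omega> - finite_integral h (p', q') \<omega>)
      \<le> 64 * (\<integral>t. trunc_exponent N (half_line_cut h t * indicator {p<..q} t - half_line_cut h t * indicator {p'<..q'} t) \<partial>lborel)"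
      using has_integral_on_diff[OF h has_integral_on_integral_on[OF h that(1)] has_integral_on_integral_on[OF h that(2)]] that
      by (simp add: finite_integral_def)
    also have "(\<integral>t. trunc_exponent N (half_line_cut h t * indicator {p<..q} t - half_line_cut h t * indicator {p'<..q'} t) \<partial>lborel)
      \<le> (\<integral>t. ?g t * indicator (- {p<..q}) t + ?g t * indicator (- {p'<..q'}) t \<partial>lborel)"
    proof (intro integral_mono Bochner_Integration.integrable_add intR)
      show "integrable lborel (\<lambda>t. trunc_exponent N (half_line_cut h t * indicator {p<..q} t - half_line_cut h t * indicator {p'<..q'} t))"
        by (rule integrable_exponent_bounded(1)[where B = "{p<..q} \<union> {p'<..q'}"]) auto
      show "trunc_exponent N (half_line_cut h t * indicator {p<..q} t - half_line_cut h t * indicator {p'<..q'} t)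
        \<le> ?g t * indicator (- {p<..q}) t + ?g t * indicator (- {p'<..q'}) t" for t
        using N.trunc_exponent_nonneg[of "half_line_cut h t"] by (auto simp: indicator_def)
    qed
    also have "\<dots> = R p q + R p' q'" by (simp add: R_def intR)
    finally show ?thesis by simp
  qed
  define r where "r n = R (1 / real (Suc n)) (real (Suc n))" for n
  have r: "r \<longlonglongrightarrow> 0"
  proof -
    have "r \<longlonglongrightarrow> (\<integral>t. 0 \<partial>(lborel :: real measure))"
      unfolding r_def R_def
    proof (rule integral_dominated_convergence[where w = ?g])
      show "AE t in lborel. (\<lambda>n. ?g t * indicator (- {1 / real (Suc n)<..real (Suc n)}) t) \<longlonglongrightarrow> 0"
      proof (rule AE_I2)
        fix t :: real
        show "(\<lambda>n. ?g t * indicator (- {1 / real (Suc n)<..real (Suc n)}) t) \<longlonglongrightarrow> 0"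
        proof (cases "0 < t")
          case True
          obtain n0 :: nat where n0: "max t (1 / t) < real n0" using reals_Archimedean2 by blast
          have "?g t * indicator (- {1 / real (Suc n)<..real (Suc n)}) t = 0" if "n0 \<le> n" for n
          proof -
            have "max t (1 / t) < real (Suc n)" using n0 that by simp
            then have "1 / t < real (Suc n)" "t \<le> real (Suc n)" by auto
            then have "1 / real (Suc n) < t" using True by (simp add: field_simps)
            with \<open>t \<le> real (Suc n)\<close> show ?thesis by simp
          qed
          then show ?thesis by (intro tendsto_eventually) (auto simp: eventually_sequentially)
        next
          case False
          then show ?thesis by (simp add: half_line_cut_simps)
        qed
      qed
      show "AE t in lborel. norm (?g t * indicator (- {1 / real (Suc n)<..real (Suc n)}) t) \<le> ?g t" for n
        using N.trunc_exponent_nonneg by (intro AE_I2) (auto simp: indicator_def)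
    qed (use int in auto)
    then show ?thesis by simp
  qed
  let ?X = "\<lambda>n. finite_integral h (1 / real (Suc n), real (Suc n))"
  note Xm = measurable_finite_integral[OF h]
  obtain Z where Z: "Z \<in> borel_measurable M" "tendsto_in_prob M ?X Z sequentially"
  proof (rule Cauchy_in_prob_convergent[of ?X])
    fix e :: real assume "0 < e"
    then obtain n0 where n0: "\<And>n. n0 \<le> n \<Longrightarrow> norm (r n - 0) < e / 128"
      using LIMSEQ_D[OF r, of "e / 128"] by auto
    have "trunc_moment M (\<lambda>\<omega>. ?X m \<omega> - ?X n \<omega>) < e" if "n0 \<le> m" "n0 \<le> n" for m n
      using diff[of "1 / real (Suc m)" "1 / real (Suc n)" "real (Suc m)" "real (Suc n)", folded r_def]
        n0[OF that(1)] n0[OF that(2)] by (simp add: abs_less_iff)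
    then show "\<exists>n0. \<forall>m\<ge>n0. \<forall>n\<ge>n0. trunc_moment M (\<lambda>\<omega>. ?X m \<omega> - ?X n \<omega>) < e" by blast
  qed (use Xm that in auto)
  have bound: "trunc_moment M (\<lambda>\<omega>. finite_integral h (p, q) \<omega> - Z \<omega>) \<le> 4 * (64 * (R p q + 0))" if "0 < p" for p q
  proof (rule trunc_moment_le_liminf[OF Xm Xm Xm Z(1) tendsto_in_prob_const Z(2)])
    show "(\<lambda>n. 64 * (R p q + r n)) \<longlonglongrightarrow> 64 * (R p q + 0)" by (intro tendsto_intros r)
    show "trunc_moment M (\<lambda>\<omega>. finite_integral h (p, q) \<omega> - ?X n \<omega>) \<le> 64 * (R p q + r n)" for n
      using diff[OF that, of "1 / real (Suc n)" q "real (Suc n)"] by (simp add: r_def)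
  qed simp
  have "tendsto_in_prob M (finite_integral h) Z (at_right 0 \<times>\<^sub>F at_top)"
    unfolding tendsto_in_prob_iff_trunc_moment[OF Xm Z(1)]
  proof (rule tendstoI)
    fix e :: real assume "0 < e"
    \<comment> \<open>256 = 4 * 64, the constant of \<open>bound\<close>.\<close>
    then obtain n where n: "norm (r n - 0) < e / 256" using LIMSEQ_D[OF r, of "e / 256"] by auto
    show "\<forall>\<^sub>F i in at_right 0 \<times>\<^sub>F at_top. dist (trunc_moment M (\<lambda>\<omega>. finite_integral h i \<omega> - Z \<omega>)) 0 < e"
    proof (rule eventually_exhaust[of n])
      fix p q :: real assume pq: "0 < p" "p \<le> 1 / real (Suc n)" "real (Suc n) \<le> q"
      have "R p q \<le> r n" unfolding r_def by (rule Rmono[OF pq(2,3)])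
      then show "dist (trunc_moment M (\<lambda>\<omega>. finite_integral h (p, q) \<omega> - Z \<omega>)) 0 < e"
        using bound[OF pq(1), of q] n trunc_moment_nonneg[of "\<lambda>\<omega>. finite_integral h (p, q) \<omega> - Z \<omega>"]
        by (simp add: dist_real_def)
    qed
  qed
  with Z show thesis by (intro that[of Z]) (simp add: has_improper_integral_iff)
qed

lemma has_improper_integral_char_limit:
  assumes h: "set_borel_measurable borel {0<..} h" and Z: "has_improper_integral M Y h Z"
  shows "(\<lambda>n. exp (- complex_of_real (\<integral>t. cos_exponent N (z * (half_line_cut h t * indicator {1 / real (Suc n)<..real (Suc n)} t)) \<partial>lborel)))
    \<longlonglongrightarrow> char (distr M borel Z) z"
proof -
  have Zm: "Z \<in> borel_measurable M" and lim: "tendsto_in_prob M (finite_integral h) Z (at_right 0 \<times>\<^sub>F at_top)"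
    using Z by (auto simp: has_improper_integral_iff)
  have "((\<lambda>i. char (distr M borel (finite_integral h i)) z) \<longlongrightarrow> char (distr M borel Z) z) (at_right 0 \<times>\<^sub>F at_top)"
    by (rule tendsto_in_prob_char[OF measurable_finite_integral[OF h] Zm lim])
  from filterlim_compose[OF this filterlim_exhaust]
  have "(\<lambda>n. char (distr M borel (finite_integral h (1 / real (Suc n), real (Suc n)))) z) \<longlonglongrightarrow> char (distr M borel Z) z" .
  moreover have "char (distr M borel (finite_integral h (1 / real (Suc n), real (Suc n)))) z
      = exp (- complex_of_real (\<integral>t. cos_exponent N (z * (half_line_cut h t * indicator {1 / real (Suc n)<..real (Suc n)} t)) \<partial>lborel))" for n
    using has_integral_on_char[OF h has_integral_on_integral_on[OF h, of "1 / real (Suc n)" "real (Suc n)"]]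
    by (simp add: finite_integral_def)
  ultimately show ?thesis by simp
qed

text \<open>A multiple of \<open>trunc_exponent\<close> of h, depending on z only, dominates the
  exponents of all truncated integrands, so the cut-offs disappear by dominated convergence.\<close>

lemma has_improper_integral_char:
  assumes h: "set_borel_measurable borel {0<..} h" and fin: "exponent_finite h" and Z: "has_improper_integral M Y h Z"
  shows "char (distr M borel Z) z = exp (- complex_of_real (\<integral>t. cos_exponent N (z * half_line_cut h t) \<partial>lborel))"
    and "integrable lborel (\<lambda>t. cos_exponent N (z * half_line_cut h t))"
proof -
  have H [measurable]: "half_line_cut h \<in> borel_measurable borel" using h by (rule measurable_half_line_cut)
  have int: "integrable lborel (\<lambda>t. 2 * (max 1 (z\<^sup>2) * trunc_exponent N (half_line_cut h t)))"
    using fin by (simp add: exponent_finite_def)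
  have le: "cos_exponent N (z * w) \<le> 2 * (max 1 (z\<^sup>2) * trunc_exponent N w)" for w
    using N.cos_exponent_le_trunc_exponent[of 1 "z * w"] N.trunc_exponent_scale[of z w] by simp
  have le': "cos_exponent N (z * (w * indicator A t)) \<le> 2 * (max 1 (z\<^sup>2) * trunc_exponent N w)" for w t :: real and A
    using le[of w] le[of 0] N.trunc_exponent_nonneg[of w] by (auto simp: indicator_def)
  show "integrable lborel (\<lambda>t. cos_exponent N (z * half_line_cut h t))"
    by (rule Bochner_Integration.integrable_bound[OF int])
      (use le in \<open>auto intro!: AE_I2 simp: N.cos_exponent_nonneg N.trunc_exponent_nonneg\<close>)
  have "(\<lambda>n. \<integral>t. cos_exponent N (z * (half_line_cut h t * indicator {1 / real (Suc n)<..real (Suc n)} t)) \<partial>lborel)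
      \<longlonglongrightarrow> (\<integral>t. cos_exponent N (z * half_line_cut h t) \<partial>lborel)"
  proof (rule integral_dominated_convergence[OF _ _ int])
    show "AE t in lborel. (\<lambda>n. cos_exponent N (z * (half_line_cut h t * indicator {1 / real (Suc n)<..real (Suc n)} t)))
        \<longlonglongrightarrow> cos_exponent N (z * half_line_cut h t)"
    proof (rule AE_I2)
      fix t :: real
      show "(\<lambda>n. cos_exponent N (z * (half_line_cut h t * indicator {1 / real (Suc n)<..real (Suc n)} t)))
        \<longlonglongrightarrow> cos_exponent N (z * half_line_cut h t)"
      proof (cases "0 < t")
        case True
        obtain n0 :: nat where n0: "max t (1 / t) < real n0" using reals_Archimedean2 by blast
        have "t \<in> {1 / real (Suc n)<..real (Suc n)}" if "n0 \<le> n" for n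
        proof -
          have "max t (1 / t) < real (Suc n)" using n0 that by simp
          then have "1 / t < real (Suc n)" "t \<le> real (Suc n)" by auto
          then have "1 / real (Suc n) < t" using True by (simp add: field_simps)
          with \<open>t \<le> real (Suc n)\<close> show ?thesis by simp
        qed
        then show ?thesis by (intro tendsto_eventually) (auto simp: eventually_sequentially intro!: exI[of _ n0])
      next
        case False
        then show ?thesis by (simp add: half_line_cut_simps)
      qed
    qed
    show "AE t in lborel. norm (cos_exponent N (z * (half_line_cut h t * indicator {1 / real (Suc n)<..real (Suc n)} t)))
        \<le> 2 * (max 1 (z\<^sup>2) * trunc_exponent N (half_line_cut h t))" for n
      using le' by (intro AE_I2) (simp add: N.cos_exponent_nonneg)
  qed measurable
  then have "(\<lambda>n. exp (- complex_of_real (\<integral>t. cos_exponent N (z * (half_line_cut h t * indicator {1 / real (Suc n)<..real (Suc n)} t)) \<partial>lborel)))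
      \<longlonglongrightarrow> exp (- complex_of_real (\<integral>t. cos_exponent N (z * half_line_cut h t) \<partial>lborel))"
    by (intro tendsto_intros)
  then show "char (distr M borel Z) z = exp (- complex_of_real (\<integral>t. cos_exponent N (z * half_line_cut h t) \<partial>lborel))"
    using has_improper_integral_char_limit[OF h Z] by (intro LIMSEQ_unique)
qed

text \<open>The limit law has a continuous characteristic function, above 1/2 for small z. That
  bounds the integrated exponent by ln 2 uniformly for |z| <= c, and averaging over z converts the
  bound into finiteness of the truncated integral at scale c.\<close>

lemma has_improper_integral_imp_exponent_finite:
  assumes h: "set_borel_measurable borel {0<..} h" and Z: "has_improper_integral M Y h Z"
  shows "exponent_finite h"
proof -
  have H [measurable]: "half_line_cut h \<in> borel_measurable borel" using h by (rule measurable_half_line_cut)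
  have Zm: "Z \<in> borel_measurable M" using Z by (simp add: has_improper_integral_def)
  interpret Z: real_distribution "distr M borel Z"
    using Zm by (intro real_distribution_distr)
  have "isCont (\<lambda>z. Re (char (distr M borel Z) z)) 0"
    by (intro isCont_Re Z.isCont_char)
  then have "((\<lambda>z. Re (char (distr M borel Z) z)) \<longlongrightarrow> 1) (at 0)"
    using Z.char_zero by (simp add: isCont_def)
  then have "\<forall>\<^sub>F z in at 0. 1 / 2 < Re (char (distr M borel Z) z)"
    by (rule order_tendstoD) simp
  then obtain d where d: "0 < d" "\<And>z. z \<noteq> 0 \<Longrightarrow> \<bar>z\<bar> < d \<Longrightarrow> 1 / 2 < Re (char (distr M borel Z) z)"
    by (auto simp: eventually_at dist_real_def)
  define c where "c = d / 2"
  have c: "0 < c" "\<And>z. \<bar>z\<bar> \<le> c \<Longrightarrow> 1 / 2 \<le> Re (char (distr M borel Z) z)"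
  proof -
    show "0 < c" using d by (simp add: c_def)
    fix z assume "\<bar>z\<bar> \<le> c"
    then show "1 / 2 \<le> Re (char (distr M borel Z) z)"
      using d(2)[of z] d(1) Z.char_zero by (cases "z = 0") (auto simp: c_def)
  qed
  let ?I = "\<lambda>n. {1 / real (Suc n)<..real (Suc n)}"
  let ?f = "\<lambda>n z t. cos_exponent N (z * (half_line_cut h t * indicator (?I n) t))"
  have intf: "integrable lborel (?f n z)" for n z
    by (rule integrable_exponent_bounded(2)[where B = "?I n"]) auto
  have Imono: "?I m \<subseteq> ?I n" if "m \<le> n" for m n
  proof -
    have "1 / real (Suc n) \<le> 1 / real (Suc m)" using that by (intro divide_left_mono) auto
    then show ?thesis using that by auto
  qed
  have fmono: "?f m z t \<le> ?f n z t" if "m \<le> n" for m n z t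
    using Imono[OF that] N.cos_exponent_nonneg by (auto simp: indicator_def)
  have bound: "(\<integral>t. ?f n z t \<partial>lborel) \<le> ln 2" if z: "\<bar>z\<bar> \<le> c" for n z
  proof -
    have "(\<lambda>k. Re (exp (- complex_of_real (\<integral>t. ?f k z t \<partial>lborel)))) \<longlonglongrightarrow> Re (char (distr M borel Z) z)"
      by (intro tendsto_Re has_improper_integral_char_limit[OF h Z])
    moreover have "Re (exp (- complex_of_real x)) = exp (- x)" for x
      by (metis Re_complex_of_real exp_of_real of_real_minus)
    ultimately have lim: "(\<lambda>k. exp (- (\<integral>t. ?f k z t \<partial>lborel))) \<longlonglongrightarrow> Re (char (distr M borel Z) z)" by simp
    \<comment> \<open>The exponents grow with the interval of integration, so the limit of their
      exponentials lies below each term.\<close>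
    have "Re (char (distr M borel Z) z) \<le> exp (- (\<integral>t. ?f n z t \<partial>lborel))"
    proof (rule LIMSEQ_le_const2[OF lim], intro exI[of _ n] allI impI)
      fix k assume "n \<le> k"
      then have "(\<integral>t. ?f n z t \<partial>lborel) \<le> (\<integral>t. ?f k z t \<partial>lborel)"
        by (intro integral_mono intf fmono)
      then show "exp (- (\<integral>t. ?f k z t \<partial>lborel)) \<le> exp (- (\<integral>t. ?f n z t \<partial>lborel))" by simp
    qed
    with c(2)[OF z] have "1 / 2 \<le> exp (- (\<integral>t. ?f n z t \<partial>lborel))" by simp
    then have "exp (\<integral>t. ?f n z t \<partial>lborel) \<le> 2" by (simp add: exp_minus field_simps)
    then have "exp (\<integral>t. ?f n z t \<partial>lborel) \<le> exp (ln 2)" by simp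
    then show ?thesis by (simp only: exp_le_cancel_iff)
  qed
  have nnb: "(\<integral>\<^sup>+t. ennreal (cos_exponent N (z * half_line_cut h t)) \<partial>lborel) \<le> ennreal (ln 2)" if z: "\<bar>z\<bar> \<le> c" for z
  proof -
    have eq: "ennreal (cos_exponent N (z * half_line_cut h t)) = (SUP n. ennreal (?f n z t))" for t
    proof (rule antisym)
      show "ennreal (cos_exponent N (z * half_line_cut h t)) \<le> (SUP n. ennreal (?f n z t))"
      proof (cases "0 < t")
        case True
        obtain n :: nat where n: "max t (1 / t) < real n" using reals_Archimedean2 by blast
        then have "max t (1 / t) < real (Suc n)" by simp
        then have "1 / t < real (Suc n)" "t \<le> real (Suc n)" by auto
        then have "1 / real (Suc n) < t" using True by (simp add: field_simps)
        with \<open>t \<le> real (Suc n)\<close> have "t \<in> ?I n" by simp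
        then show ?thesis by (intro SUP_upper2[of n]) auto
      qed (simp add: half_line_cut_simps)
      show "(SUP n. ennreal (?f n z t)) \<le> ennreal (cos_exponent N (z * half_line_cut h t))"
        using N.cos_exponent_nonneg by (intro SUP_least ennreal_leI) (auto simp: indicator_def)
    qed
    have "(\<integral>\<^sup>+t. ennreal (cos_exponent N (z * half_line_cut h t)) \<partial>lborel) = (SUP n. \<integral>\<^sup>+t. ennreal (?f n z t) \<partial>lborel)"
      unfolding eq
    proof (rule nn_integral_monotone_convergence_SUP)
      show "incseq (\<lambda>n t. ennreal (?f n z t))"
        unfolding incseq_def le_fun_def by (intro allI impI ennreal_leI fmono)
    qed measurable
    also have "\<dots> \<le> ennreal (ln 2)"
    proof (rule SUP_least)
      fix n
      have "(\<integral>\<^sup>+t. ennreal (?f n z t) \<partial>lborel) = ennreal (\<integral>t. ?f n z t \<partial>lborel)"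
        by (intro nn_integral_eq_integral intf AE_I2 N.cos_exponent_nonneg)
      also have "\<dots> \<le> ennreal (ln 2)" by (intro ennreal_leI bound z)
      finally show "(\<integral>\<^sup>+t. ennreal (?f n z t) \<partial>lborel) \<le> ennreal (ln 2)" .
    qed
    finally show ?thesis .
  qed
  \<comment> \<open>The averaging lemma is applied to the function c h(t) x on the product of
    Lebesgue measure and N.\<close>
  interpret P: pair_sigma_finite lborel N ..
  have [measurable]: "(\<lambda>x. x) \<in> borel_measurable N" by (simp add: N.measurable_M_borel)
  have "(\<integral>\<^sup>+u. ennreal (trunc_sq (c * half_line_cut h (fst u) * snd u)) \<partial>(lborel \<Otimes>\<^sub>M N)) \<le> 8 * ennreal (ln 2)"
  proof (rule nn_integral_trunc_sq_le)
    show "sigma_finite_measure (lborel \<Otimes>\<^sub>M N)" ..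
    show "(\<lambda>u. c * half_line_cut h (fst u) * snd u) \<in> borel_measurable (lborel \<Otimes>\<^sub>M N)" by measurable
    fix z :: real assume z: "0 \<le> z" "z \<le> 1"
    have "(\<integral>\<^sup>+u. ennreal (1 - cos (z * (c * half_line_cut h (fst u) * snd u))) \<partial>(lborel \<Otimes>\<^sub>M N))
        = (\<integral>\<^sup>+t. \<integral>\<^sup>+x. ennreal (1 - cos ((z * c * half_line_cut h t) * x)) \<partial>N \<partial>lborel)"
      by (subst N.nn_integral_fst[symmetric]) (simp_all add: mult.assoc)
    also have "\<dots> = (\<integral>\<^sup>+t. ennreal (cos_exponent N (z * c * half_line_cut h t)) \<partial>lborel)"
      unfolding cos_exponent_def
      by (intro nn_integral_cong nn_integral_eq_integral N.integrable_one_minus_cos) auto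
    also have "\<dots> \<le> ennreal (ln 2)"
      using z c(1) by (intro nnb) (auto simp: abs_mult mult_le_one intro: mult_left_le_one_le)
    finally show "(\<integral>\<^sup>+u. ennreal (1 - cos (z * (c * half_line_cut h (fst u) * snd u))) \<partial>(lborel \<Otimes>\<^sub>M N)) \<le> ennreal (ln 2)" .
  qed
  also have "(\<integral>\<^sup>+u. ennreal (trunc_sq (c * half_line_cut h (fst u) * snd u)) \<partial>(lborel \<Otimes>\<^sub>M N))
      = (\<integral>\<^sup>+t. \<integral>\<^sup>+x. ennreal (trunc_sq ((c * half_line_cut h t) * x)) \<partial>N \<partial>lborel)"
    by (subst N.nn_integral_fst[symmetric]) simp_all
  also have "\<dots> = (\<integral>\<^sup>+t. ennreal (trunc_exponent N (c * half_line_cut h t)) \<partial>lborel)"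
    unfolding trunc_exponent_def
    by (intro nn_integral_cong nn_integral_eq_integral N.integrable_trunc_sq_scaled) auto
  finally have fin: "(\<integral>\<^sup>+t. ennreal (trunc_exponent N (c * half_line_cut h t)) \<partial>lborel) < \<infinity>"
  proof (rule order_le_less_trans)
    have "8 * ennreal (ln 2) = ennreal (8 * ln 2)" by (simp add: ennreal_mult)
    then show "8 * ennreal (ln 2) < \<infinity>" by simp
  qed
  have "integrable lborel (\<lambda>t. trunc_exponent N (c * half_line_cut h t))"
    using fin by (intro integrableI_nonneg) (auto simp: N.trunc_exponent_nonneg)
  then have int: "integrable lborel (\<lambda>t. max 1 ((1 / c)\<^sup>2) * trunc_exponent N (c * half_line_cut h t))"
    by simp
  show ?thesis
    unfolding exponent_finite_def
  proof (rule Bochner_Integration.integrable_bound[OF int])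
    have "trunc_exponent N w \<le> max 1 ((1 / c)\<^sup>2) * trunc_exponent N (c * w)" for w
      using N.trunc_exponent_scale[of "1 / c" "c * w"] c(1) by simp
    then show "AE t in lborel. norm (trunc_exponent N (half_line_cut h t)) \<le> norm (max 1 ((1 / c)\<^sup>2) * trunc_exponent N (c * half_line_cut h t))"
      by (intro AE_I2) (simp add: N.trunc_exponent_nonneg abs_of_nonneg)
    show "(\<lambda>t. trunc_exponent N (half_line_cut h t)) \<in> borel_measurable lborel"
      by (rule measurable_compose[OF _ N.borel_measurable_trunc_exponent]) (use H in simp)
  qed
qed

theorem Dom_iff: "h \<in> Dom M Y \<longleftrightarrow> set_borel_measurable borel {0<..} h \<and> exponent_finite h"
  unfolding Dom_def locally_integrable_iff
  using has_improper_integral_imp_exponent_finite has_improper_integral_exists by blast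

theorem law_improper_integral:
  assumes "h \<in> Dom M Y"
  shows "real_distribution (law M (improper_integral M Y h))"
    and "char (law M (improper_integral M Y h)) z = exp (- complex_of_real (\<integral>t. cos_exponent N (z * half_line_cut h t) \<partial>lborel))"
    and "integrable lborel (\<lambda>t. cos_exponent N (z * half_line_cut h t))"
proof -
  have h: "set_borel_measurable borel {0<..} h" "exponent_finite h" using assms Dom_iff by auto
  have "\<exists>Z. has_improper_integral M Y h Z" using assms by (simp add: Dom_def)
  then have Z: "has_improper_integral M Y h (improper_integral M Y h)"
    unfolding improper_integral_def by (rule someI_ex)
  show "char (law M (improper_integral M Y h)) z = exp (- complex_of_real (\<integral>t. cos_exponent N (z * half_line_cut h t) \<partial>lborel))"
    "integrable lborel (\<lambda>t. cos_exponent N (z * half_line_cut h t))"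
    by (rule has_improper_integral_char[OF h Z])+
  show "real_distribution (law M (improper_integral M Y h))"
    using Z by (intro real_distribution_distr) (simp add: has_improper_integral_def)
qed

end

section \<open>Completely monotone functions\<close>

text \<open>With the sign absorbed, all these functions are nonnegative, nonincreasing, and the
  derivative of each is minus the next.\<close>

definition cm_deriv :: "(real \<Rightarrow> real) \<Rightarrow> nat \<Rightarrow> real \<Rightarrow> real" where
  "cm_deriv g n x = (- 1) ^ n * (deriv ^^ n) g x"

lemma cm_deriv_0 [simp]: "cm_deriv g 0 = g"
  by (simp add: cm_deriv_def fun_eq_iff)

lemma cm_deriv_nonneg: "completely_monotone g \<Longrightarrow> 0 < x \<Longrightarrow> 0 \<le> cm_deriv g n x"
  by (simp add: completely_monotone_def cm_deriv_def)

lemma cm_deriv_has_derivative: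
  assumes "completely_monotone g" "0 < x"
  shows "(cm_deriv g n has_real_derivative - cm_deriv g (Suc n) x) (at x)"
proof -
  have "(deriv ^^ n) g differentiable (at x)"
    using assms by (simp add: completely_monotone_def)
  then have "((deriv ^^ n) g has_real_derivative deriv ((deriv ^^ n) g) x) (at x)"
    by (simp add: DERIV_deriv_iff_real_differentiable)
  then have "((\<lambda>x. (- 1) ^ n * (deriv ^^ n) g x) has_real_derivative (- 1) ^ n * deriv ((deriv ^^ n) g) x) (at x)"
    by (rule DERIV_cmult)
  then show ?thesis by (simp add: cm_deriv_def[abs_def])
qed

lemma cm_deriv_isCont: "completely_monotone g \<Longrightarrow> 0 < x \<Longrightarrow> isCont (cm_deriv g n) x"
  by (rule DERIV_isCont[OF cm_deriv_has_derivative])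

lemma cm_deriv_antimono:
  assumes g: "completely_monotone g" and "0 < x" "x \<le> y"
  shows "cm_deriv g n y \<le> cm_deriv g n x"
proof (rule DERIV_nonpos_imp_nonincreasing[OF \<open>x \<le> y\<close>])
  fix t assume "x \<le> t" "t \<le> y"
  then have "0 < t" using \<open>0 < x\<close> by simp
  then show "\<exists>d. (cm_deriv g n has_real_derivative d) (at t) \<and> d \<le> 0"
    using cm_deriv_has_derivative[OF g] cm_deriv_nonneg[OF g] by (intro exI[of _ "- cm_deriv g (Suc n) t"]) auto
qed

text \<open>By the mean value theorem and monotonicity, the next function at x is at most the drop
  of the current one over [x - 1, x].\<close>

lemma cm_deriv_tendsto_0:
  assumes g: "completely_monotone g" and lim: "(g \<longlongrightarrow> 0) at_top"
  shows "(cm_deriv g n \<longlongrightarrow> 0) at_top"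
proof (induction n)
  case 0
  then show ?case using lim by simp
next
  case (Suc n)
  have bound: "cm_deriv g (Suc n) x \<le> cm_deriv g n (x - 1)" if "1 < x" for x
  proof -
    have "\<exists>t. x - 1 < t \<and> t < x \<and> cm_deriv g n x - cm_deriv g n (x - 1) = (x - (x - 1)) * - cm_deriv g (Suc n) t"
      by (rule MVT2) (use that in \<open>auto intro!: cm_deriv_has_derivative[OF g]\<close>)
    then obtain t where t: "x - 1 < t" "t < x"
      and eq: "cm_deriv g n x - cm_deriv g n (x - 1) = (x - (x - 1)) * - cm_deriv g (Suc n) t" by blast
    have "cm_deriv g (Suc n) x \<le> cm_deriv g (Suc n) t"
      using t that by (intro cm_deriv_antimono[OF g]) auto
    also have "\<dots> = cm_deriv g n (x - 1) - cm_deriv g n x" using eq by simp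
    also have "\<dots> \<le> cm_deriv g n (x - 1)" using cm_deriv_nonneg[OF g, of x n] that by simp
    finally show ?thesis .
  qed
  have "filterlim (\<lambda>x::real. x - 1) at_top at_top"
    using filterlim_tendsto_add_at_top[OF tendsto_const[of "-1::real"] filterlim_ident] by simp
  then have l: "((\<lambda>x. cm_deriv g n (x - 1)) \<longlongrightarrow> 0) at_top"
    by (rule filterlim_compose[OF Suc.IH])
  show ?case
  proof (rule tendsto_sandwich[OF _ _ tendsto_const l])
    show "\<forall>\<^sub>F x in at_top. 0 \<le> cm_deriv g (Suc n) x"
      using eventually_gt_at_top[of 0] by eventually_elim (rule cm_deriv_nonneg[OF g])
    show "\<forall>\<^sub>F x in at_top. cm_deriv g (Suc n) x \<le> cm_deriv g n (x - 1)"
      using eventually_gt_at_top[of 1] by eventually_elim (rule bound)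
  qed
qed

lemma measurable_cm_deriv_cut:
  assumes "completely_monotone g" "0 < a"
  shows "(\<lambda>s. cm_deriv g n s * indicator {a..} s) \<in> borel_measurable borel"
proof -
  have "continuous_on {a..} (cm_deriv g n)"
    using cm_deriv_isCont[OF assms(1)] assms(2) by (intro continuous_at_imp_continuous_on) auto
  then have "(\<lambda>s. indicator {a..} s *\<^sub>R cm_deriv g n s) \<in> borel_measurable borel"
    by (intro borel_measurable_continuous_on_indicator) auto
  then show ?thesis by (simp add: mult.commute)
qed

lemma nn_integral_cm_deriv:
  assumes g: "completely_monotone g" and lim: "(g \<longlongrightarrow> 0) at_top" and x: "0 < x"
  shows "(\<integral>\<^sup>+s. ennreal (cm_deriv g (Suc n) s) * indicator {x..} s \<partial>lborel) = ennreal (cm_deriv g n x)"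
proof -
  let ?f = "\<lambda>s. cm_deriv g (Suc n) s * indicator {x..} s"
  have "(\<integral>\<^sup>+s. ennreal (?f s) * indicator {x..} s \<partial>lborel) = ennreal (0 - (- cm_deriv g n x))"
  proof (rule nn_integral_FTC_atLeast)
    show "?f \<in> borel_measurable borel" by (rule measurable_cm_deriv_cut[OF g x])
    show "((\<lambda>s. - cm_deriv g n s) \<longlongrightarrow> 0) at_top"
      using tendsto_minus[OF cm_deriv_tendsto_0[OF g lim, of n]] by simp
    fix s assume s: "x \<le> s"
    then show "((\<lambda>s. - cm_deriv g n s) has_real_derivative ?f s) (at s)"
      using DERIV_minus[OF cm_deriv_has_derivative[OF g, of s n]] x by simp
    show "0 \<le> ?f s" using cm_deriv_nonneg[OF g, of s "Suc n"] s x by simp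
  qed
  moreover have "ennreal (?f s) * indicator {x..} s = ennreal (cm_deriv g (Suc n) s) * indicator {x..} s" for s
    by (auto simp: indicator_def)
  ultimately show ?thesis by simp
qed

text \<open>Taylor's formula expanded at infinity, where all boundary terms vanish and only the
  remainder is left. The induction writes the derivative as the integral of the next one and
  exchanges the integrals.\<close>

lemma cm_Taylor_at_infinity:
  assumes g: "completely_monotone g" and lim: "(g \<longlongrightarrow> 0) at_top" and x: "0 < x"
  shows "(\<integral>\<^sup>+s. ennreal ((s - x) ^ n / fact n * cm_deriv g (Suc n) s) * indicator {x..} s \<partial>lborel) = ennreal (g x)"
proof (induction n)
  case 0
  then show ?case using nn_integral_cm_deriv[OF g lim x, of 0] by simp
next
  case (Suc n)
  let ?c = "\<lambda>s. ennreal ((s - x) ^ n / fact n)"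
  define d where "d r = ennreal (cm_deriv g (Suc (Suc n)) r * indicator {x..} r)" for r
  have [measurable]: "d \<in> borel_measurable borel"
    unfolding d_def using measurable_cm_deriv_cut[OF g x, of "Suc (Suc n)"] by measurable
  have "ennreal (g x) = (\<integral>\<^sup>+s. ennreal ((s - x) ^ n / fact n * cm_deriv g (Suc n) s) * indicator {x..} s \<partial>lborel)"
    using Suc.IH by simp
  also have "\<dots> = (\<integral>\<^sup>+s. \<integral>\<^sup>+r. ?c s * indicator {x..} s * (d r * (if s \<le> r then 1 else 0)) \<partial>lborel \<partial>lborel)"
  proof (intro nn_integral_cong)
    fix s :: real
    show "ennreal ((s - x) ^ n / fact n * cm_deriv g (Suc n) s) * indicator {x..} s
      = (\<integral>\<^sup>+r. ?c s * indicator {x..} s * (d r * (if s \<le> r then 1 else 0)) \<partial>lborel)"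
    proof (cases "x \<le> s")
      case True
      then have s: "0 < s" using x by simp
      have "(\<integral>\<^sup>+r. ?c s * indicator {x..} s * (d r * (if s \<le> r then 1 else 0)) \<partial>lborel)
          = ?c s * (\<integral>\<^sup>+r. d r * (if s \<le> r then 1 else 0) \<partial>lborel)"
        using True by (subst nn_integral_cmult) auto
      also have "(\<integral>\<^sup>+r. d r * (if s \<le> r then 1 else 0) \<partial>lborel) = (\<integral>\<^sup>+r. ennreal (cm_deriv g (Suc (Suc n)) r) * indicator {s..} r \<partial>lborel)"
        using True by (intro nn_integral_cong) (auto simp: indicator_def d_def)
      also have "\<dots> = ennreal (cm_deriv g (Suc n) s)"
        by (rule nn_integral_cm_deriv[OF g lim s])
      also have "?c s * ennreal (cm_deriv g (Suc n) s) = ennreal ((s - x) ^ n / fact n * cm_deriv g (Suc n) s)"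
        using True cm_deriv_nonneg[OF g s, of "Suc n"] by (subst ennreal_mult) auto
      finally show ?thesis using True by simp
    qed simp
  qed
  also have "\<dots> = (\<integral>\<^sup>+r. \<integral>\<^sup>+s. ?c s * indicator {x..} s * (d r * (if s \<le> r then 1 else 0)) \<partial>lborel \<partial>lborel)"
    by (rule lborel_pair.Fubini'[symmetric]) measurable
  also have "\<dots> = (\<integral>\<^sup>+r. ennreal ((r - x) ^ Suc n / fact (Suc n) * cm_deriv g (Suc (Suc n)) r) * indicator {x..} r \<partial>lborel)"
  proof (intro nn_integral_cong)
    fix r :: real
    show "(\<integral>\<^sup>+s. ?c s * indicator {x..} s * (d r * (if s \<le> r then 1 else 0)) \<partial>lborel)
      = ennreal ((r - x) ^ Suc n / fact (Suc n) * cm_deriv g (Suc (Suc n)) r) * indicator {x..} r"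
    proof (cases "x \<le> r")
      case True
      let ?f = "\<lambda>s. max 0 (s - x) ^ n / fact n"
      have "(\<integral>\<^sup>+s. ?c s * indicator {x..} s * (d r * (if s \<le> r then 1 else 0)) \<partial>lborel)
          = (\<integral>\<^sup>+s. d r * (ennreal (?f s) * indicator {x..r} s) \<partial>lborel)"
        by (intro nn_integral_cong) (auto simp: indicator_def mult.commute)
      also have "\<dots> = d r * (\<integral>\<^sup>+s. ennreal (?f s) * indicator {x..r} s \<partial>lborel)"
        by (rule nn_integral_cmult) measurable
      also have "(\<integral>\<^sup>+s. ennreal (?f s) * indicator {x..r} s \<partial>lborel)
          = ennreal ((r - x) ^ Suc n / fact (Suc n) - (x - x) ^ Suc n / fact (Suc n))"
      proof (rule nn_integral_FTC_Icc)
        fix s assume "s \<in> {x..r}"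
        then have "((\<lambda>s. (s - x) ^ Suc n / fact (Suc n)) has_real_derivative (s - x) ^ n / fact n) (at s)"
          by (auto intro!: derivative_eq_intros simp: field_simps simp del: of_nat_Suc power_Suc)
        then show "((\<lambda>s. (s - x) ^ Suc n / fact (Suc n)) has_real_derivative ?f s) (at s)"
          using \<open>s \<in> {x..r}\<close> by (simp add: max_def)
      qed (use True in auto)
      also have "d r * ennreal ((r - x) ^ Suc n / fact (Suc n) - (x - x) ^ Suc n / fact (Suc n))
          = ennreal ((r - x) ^ Suc n / fact (Suc n) * cm_deriv g (Suc (Suc n)) r)"
        using True cm_deriv_nonneg[OF g, of r "Suc (Suc n)"] x
        unfolding d_def by (subst ennreal_mult'[symmetric]) (auto simp: mult.commute simp del: power_Suc fact_Suc)
      finally show ?thesis using True by simp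
    next
      case False
      then have z: "?c s * indicator {x..} s * (d r * (if s \<le> r then 1 else 0)) = 0" for s
        by (auto simp: indicator_def)
      show ?thesis unfolding z using False by simp
    qed
  qed
  finally show ?case by simp
qed

text \<open>A rate uniform in u for (1 - u / m)^m. With v = u / m, Bernoulli's inequality for (1 -
  v^2)^m bounds the error by exp (-u) u^2 / m, and u^2 <= 2 exp u.\<close>

lemma exp_minus_power_bounds:
  fixes u :: real
  assumes "0 \<le> u" "0 < m"
  shows "\<bar>exp (- u) - (max 0 (1 - u / real m)) ^ m\<bar> \<le> 2 / real m"
proof (cases "u \<le> real m")
  case True
  define v where "v = u / real m"
  have v: "0 \<le> v" "v \<le> 1" "u = real m * v" using True assms by (auto simp: v_def)
  have up: "(1 - v) ^ m \<le> exp (- u)"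
    using exp_ge_one_minus_x_over_n_power_n[of u m] True assms by (simp add: v_def)
  have "exp (- u) * (1 - real m * v\<^sup>2) \<le> (1 - v) ^ m"
  proof -
    have "1 - real m * v\<^sup>2 \<le> (1 - v\<^sup>2) ^ m"
      using Bernoulli_inequality[of "- v\<^sup>2" m] v by (simp add: power_le_one)
    also have "(1 - v\<^sup>2) ^ m = (1 - v) ^ m * (1 + v) ^ m"
      by (simp add: power2_eq_square algebra_simps flip: power_mult_distrib)
    also have "\<dots> \<le> (1 - v) ^ m * exp v ^ m"
      using v exp_ge_add_one_self[of v] by (intro mult_left_mono power_mono) auto
    also have "exp v ^ m = exp u" using v by (simp add: exp_of_nat_mult[symmetric])
    finally have "exp (- u) * (1 - real m * v\<^sup>2) \<le> exp (- u) * ((1 - v) ^ m * exp u)"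
      by (intro mult_left_mono) auto
    also have "\<dots> = (1 - v) ^ m" by (simp add: exp_minus)
    finally show ?thesis .
  qed
  then have "exp (- u) - (1 - v) ^ m \<le> exp (- u) * (real m * v\<^sup>2)"
    by (simp add: algebra_simps)
  also have "real m * v\<^sup>2 = u\<^sup>2 / real m" using assms by (simp add: v_def power2_eq_square)
  also have "exp (- u) * (u\<^sup>2 / real m) \<le> 2 / real m"
  proof -
    have "u\<^sup>2 / 2 \<le> exp u" using exp_lower_Taylor_quadratic[OF assms(1)] assms(1) by simp
    then have "exp (- u) * u\<^sup>2 \<le> 2" by (simp add: exp_minus field_simps)
    then show ?thesis using assms by (simp add: divide_right_mono)
  qed
  finally have "exp (- u) - (1 - v) ^ m \<le> 2 / real m" .
  moreover have "max 0 (1 - u / real m) = 1 - v" using v(2) unfolding v_def by simp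
  ultimately show ?thesis using up by (simp only: abs_of_nonneg diff_ge_0_iff_ge)
next
  case False
  then have "max 0 (1 - u / real m) = 0" using assms by (simp add: field_simps)
  then have pz: "(max 0 (1 - u / real m)) ^ m = 0" using assms by simp
  have "exp (- u) \<le> 2 / real m"
  proof -
    have "real m \<le> 1 + u" using False by simp
    also have "\<dots> \<le> exp u" by (rule exp_ge_add_one_self)
    finally have "real m \<le> exp u" .
    then have "exp (- u) \<le> 1 / real m" using assms by (simp add: exp_minus field_simps)
    also have "\<dots> \<le> 2 / real m" by (simp add: divide_right_mono)
    finally show ?thesis .
  qed
  then show ?thesis unfolding pz by simp
qed

section \<open>Moment problem on the unit interval\<close>

definition unit_distribution :: "real measure \<Rightarrow> bool" where
  "unit_distribution P \<longleftrightarrow> real_distribution P \<and> (AE u in P. 0 < u \<and> u \<le> 1)"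

text \<open>Polynomials are uniformly dense in the continuous functions on [0, 1], so the moments
  determine the means of cos and sin and thus the characteristic function. It identifies
  representations of g that start from different base points.\<close>

lemma unit_distribution_unique:
  assumes P: "unit_distribution P" and Q: "unit_distribution Q"
    and eq: "\<And>k::nat. (\<integral>u. u ^ k \<partial>P) = (\<integral>u. u ^ k \<partial>Q)"
  shows "P = Q"
proof -
  interpret P: real_distribution P using P by (simp add: unit_distribution_def)
  interpret Q: real_distribution Q using Q by (simp add: unit_distribution_def)
  have AP: "AE u in P. 0 < u \<and> u \<le> 1" and AQ: "AE u in Q. 0 < u \<and> u \<le> 1"
    using P Q by (auto simp: unit_distribution_def)
  have intP: "integrable P f" if "continuous_on UNIV f" "\<And>u. 0 \<le> u \<Longrightarrow> u \<le> 1 \<Longrightarrow> \<bar>f u\<bar> \<le> B" for f :: "real \<Rightarrow> real" and B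
  proof (rule P.integrable_const_bound[of _ B])
    show "AE u in P. norm (f u) \<le> B" using AP by eventually_elim (use that in auto)
    show "f \<in> borel_measurable P"
      using borel_measurable_continuous_onI[OF that(1)] by measurable
  qed
  have intQ: "integrable Q f" if "continuous_on UNIV f" "\<And>u. 0 \<le> u \<Longrightarrow> u \<le> 1 \<Longrightarrow> \<bar>f u\<bar> \<le> B" for f :: "real \<Rightarrow> real" and B
  proof (rule Q.integrable_const_bound[of _ B])
    show "AE u in Q. norm (f u) \<le> B" using AQ by eventually_elim (use that in auto)
    show "f \<in> borel_measurable Q"
      using borel_measurable_continuous_onI[OF that(1)] by measurable
  qed
  have poly: "(\<integral>u. p u \<partial>P) = (\<integral>u. p u \<partial>Q)" if "real_polynomial_function p" for p
  proof -
    obtain a n where p: "p = (\<lambda>x. \<Sum>i\<le>n. a i * x ^ i)"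
      using \<open>real_polynomial_function p\<close> real_polynomial_function_iff_sum[of p] by auto
    have "integrable P (\<lambda>u. u ^ i)" "integrable Q (\<lambda>u. u ^ i)" for i
      by (intro intP[of _ 1] intQ[of _ 1] continuous_intros; simp add: power_le_one power_abs)+
    then show ?thesis by (simp add: p eq)
  qed
  have cts: "(\<integral>u. f u \<partial>P) = (\<integral>u. f u \<partial>Q)" if f: "continuous_on UNIV f" and b: "\<And>u. \<bar>f u\<bar> \<le> 1" for f :: "real \<Rightarrow> real"
  proof -
    have "\<bar>(\<integral>u. f u \<partial>P) - (\<integral>u. f u \<partial>Q)\<bar> \<le> 0 + e" if "0 < e" for e
    proof -
      obtain p where p: "real_polynomial_function p" "\<And>u. u \<in> {0..1} \<Longrightarrow> \<bar>f u - p u\<bar> < e / 2"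
        using Stone_Weierstrass_real_polynomial_function[of "{0..1::real}" f "e / 2"] continuous_on_subset[OF f] \<open>0 < e\<close>
        by auto
      have pc: "continuous_on UNIV p" using p(1) by (intro continuous_at_imp_continuous_on ballI continuous_real_polymonial_function)
      have pb: "\<bar>p u\<bar> \<le> 1 + e / 2" if "0 \<le> u" "u \<le> 1" for u
        using p(2)[of u] b[of u] that by (auto simp: abs_if split: if_splits)
      have "\<bar>(\<integral>u. f u \<partial>P) - (\<integral>u. p u \<partial>P)\<bar> \<le> e / 2"
      proof -
        have "(\<integral>u. f u \<partial>P) - (\<integral>u. p u \<partial>P) = (\<integral>u. f u - p u \<partial>P)"
          by (intro Bochner_Integration.integral_diff[symmetric] intP[OF f, of 1] intP[OF pc pb] b)
        also have "\<bar>\<dots>\<bar> \<le> (\<integral>u. \<bar>f u - p u\<bar> \<partial>P)" by (rule integral_abs_bound)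
        also have "\<dots> \<le> (\<integral>u. e / 2 \<partial>P)"
        proof (intro integral_mono_AE)
          show "integrable P (\<lambda>u. \<bar>f u - p u\<bar>)"
            by (intro integrable_abs Bochner_Integration.integrable_diff intP[OF f, of 1] intP[OF pc pb] b)
          show "AE u in P. \<bar>f u - p u\<bar> \<le> e / 2"
            using AP by eventually_elim (use p(2) in \<open>auto intro: less_imp_le\<close>)
        qed simp
        finally show ?thesis by (simp add: P.prob_space[unfolded P.space_eq_univ])
      qed
      moreover have "\<bar>(\<integral>u. f u \<partial>Q) - (\<integral>u. p u \<partial>Q)\<bar> \<le> e / 2"
      proof -
        have "(\<integral>u. f u \<partial>Q) - (\<integral>u. p u \<partial>Q) = (\<integral>u. f u - p u \<partial>Q)"
          by (intro Bochner_Integration.integral_diff[symmetric] intQ[OF f, of 1] intQ[OF pc pb] b)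
        also have "\<bar>\<dots>\<bar> \<le> (\<integral>u. \<bar>f u - p u\<bar> \<partial>Q)" by (rule integral_abs_bound)
        also have "\<dots> \<le> (\<integral>u. e / 2 \<partial>Q)"
        proof (intro integral_mono_AE)
          show "integrable Q (\<lambda>u. \<bar>f u - p u\<bar>)"
            by (intro integrable_abs Bochner_Integration.integrable_diff intQ[OF f, of 1] intQ[OF pc pb] b)
          show "AE u in Q. \<bar>f u - p u\<bar> \<le> e / 2"
            using AQ by eventually_elim (use p(2) in \<open>auto intro: less_imp_le\<close>)
        qed simp
        finally show ?thesis by (simp add: Q.prob_space[unfolded Q.space_eq_univ])
      qed
      ultimately show ?thesis using poly[OF p(1)] by (simp only: abs_le_iff) linarith
    qed
    then have "\<bar>(\<integral>u. f u \<partial>P) - (\<integral>u. f u \<partial>Q)\<bar> \<le> 0" by (rule field_le_epsilon)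
    then show ?thesis by simp
  qed
  show "P = Q"
  proof (rule Levy_uniqueness)
    show "real_distribution P" "real_distribution Q" ..
    show "char P = char Q"
    proof (rule ext, rule complex_eqI)
      fix t :: real
      have iP: "integrable P (\<lambda>u. iexp (t * u))" by (intro P.integrable_const_bound[of _ 1]) auto
      have iQ: "integrable Q (\<lambda>u. iexp (t * u))" by (intro Q.integrable_const_bound[of _ 1]) auto
      have "Re (char P t) = (\<integral>u. cos (t * u) \<partial>P)" "Re (char Q t) = (\<integral>u. cos (t * u) \<partial>Q)"
        "Im (char P t) = (\<integral>u. sin (t * u) \<partial>P)" "Im (char Q t) = (\<integral>u. sin (t * u) \<partial>Q)"
        unfolding char_def integral_Re[OF iP, symmetric] integral_Re[OF iQ, symmetric]
          integral_Im[OF iP, symmetric] integral_Im[OF iQ, symmetric]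
        by (simp_all add: Re_exp Im_exp)
      then show "Re (char P t) = Re (char Q t)" "Im (char P t) = Im (char Q t)"
        by (simp_all only:) (intro cts continuous_intros; simp)+
    qed
  qed
qed

section \<open>Bernstein's theorem\<close>

text \<open>The power u^y with u clamped to [0, 1]: bounded and, for y > 0, continuous on the whole
  line, as test functions for weak convergence have to be.\<close>

definition unit_powr :: "real \<Rightarrow> real \<Rightarrow> real" where
  "unit_powr y u = (max 0 (min 1 u)) powr y"

lemma unit_powr_eq: "0 < u \<Longrightarrow> u \<le> 1 \<Longrightarrow> unit_powr y u = u powr y"
  by (simp add: unit_powr_def)

lemma unit_powr_bounds: "0 \<le> y \<Longrightarrow> 0 \<le> unit_powr y u \<and> unit_powr y u \<le> 1"
  unfolding unit_powr_def by (auto intro!: powr_le1)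

lemma isCont_unit_powr: "0 < y \<Longrightarrow> isCont (unit_powr y) u"
proof -
  assume "0 < y"
  have "continuous_on UNIV (unit_powr y)"
    unfolding unit_powr_def using \<open>0 < y\<close> by (intro continuous_on_powr' continuous_intros) auto
  then show ?thesis by (simp add: continuous_on_eq_continuous_at)
qed

lemma borel_measurable_unit_powr [measurable]: "unit_powr y \<in> borel_measurable borel"
  unfolding unit_powr_def by measurable

lemma unit_distributionD:
  assumes "unit_distribution P"
  shows "real_distribution P" "AE u in P. 0 < u \<and> u \<le> 1"
  using assms by (auto simp: unit_distribution_def)

text \<open>The Taylor integrals for g (a + y) and g a differ by the factor (1 - y / (s - a))^m,
  which tends to a power of a variable in (0, 1] as m grows. The laws of that variable live on a
  bounded set, so a subsequence converges weakly and the limit represents g.\<close>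

lemma cm_representation_from:
  assumes g: "completely_monotone g" and lim: "(g \<longlongrightarrow> 0) at_top" and a: "0 < a" and ga: "0 < g a"
  obtains P where "unit_distribution P" "\<And>y. 0 < y \<Longrightarrow> g (a + y) = g a * (\<integral>u. unit_powr y u \<partial>P)"
proof -
  \<comment> \<open>The Taylor integrand at a divided by g a, which for m > 0 is a probability
    density.\<close>
  let ?w = "\<lambda>m s. (s - a) ^ m / fact m * (cm_deriv g (Suc m) s * indicator {a..} s) / g a"
  have wm [measurable]: "?w m \<in> borel_measurable borel" for m
    using measurable_cm_deriv_cut[OF g a, of "Suc m"] by measurable
  have wme: "(\<lambda>s. ennreal (?w m s)) \<in> borel_measurable lborel" for m
    using wm[of m] by measurable
  have wnn: "0 \<le> ?w m s" for m s
    using cm_deriv_nonneg[OF g, of s "Suc m"] a ga by (auto simp: indicator_def)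
  define D where "D m = density lborel (\<lambda>s. ennreal (?w m s))" for m
  \<comment> \<open>With u = U m s one has u^y = exp (- m y / (s - a)), the approximation of (1 - y
    / (s - a))^m.\<close>
  define U where "U m s = (if a < s then exp (- (real m / (s - a))) else 0)" for m s
  have [measurable]: "U m \<in> borel_measurable borel" for m unfolding U_def by measurable
  have [measurable_cong, simp]: "sets (D m) = sets borel" for m by (simp add: D_def)
  have Taylor: "(\<integral>\<^sup>+s. ennreal (?w m s) * ennreal ((max 0 (1 - y / (s - a))) ^ m) \<partial>lborel) = ennreal (g (a + y) / g a)"
    if "0 \<le> y" "0 < m" for m y
  proof -
    have "(\<integral>\<^sup>+s. ennreal (?w m s) * ennreal ((max 0 (1 - y / (s - a))) ^ m) \<partial>lborel)
        = (\<integral>\<^sup>+s. ennreal (1 / g a) * (ennreal ((s - (a + y)) ^ m / fact m * cm_deriv g (Suc m) s) * indicator {a + y..} s) \<partial>lborel)"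
    proof (rule nn_integral_cong_AE)
      have "AE s in lborel. s \<noteq> a" by (rule AE_lborel_singleton)
      moreover have "AE s in lborel. s \<noteq> a + y" by (rule AE_lborel_singleton)
      ultimately show "AE s in lborel. ennreal (?w m s) * ennreal ((max 0 (1 - y / (s - a))) ^ m)
          = ennreal (1 / g a) * (ennreal ((s - (a + y)) ^ m / fact m * cm_deriv g (Suc m) s) * indicator {a + y..} s)"
      proof eventually_elim
        case (elim s)
        show ?case
        proof (cases "a + y < s")
          case True
          then have s: "0 < s - a" "a < s" using that by auto
          have "1 - y / (s - a) = (s - (a + y)) / (s - a)" using s by (simp add: field_simps)
          moreover have "0 \<le> (s - (a + y)) / (s - a)" using True s by simp
          ultimately have "(max 0 (1 - y / (s - a))) ^ m = (s - (a + y)) ^ m / (s - a) ^ m" by (simp add: power_divide)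
          then have "?w m s * (max 0 (1 - y / (s - a))) ^ m = 1 / g a * ((s - (a + y)) ^ m / fact m * cm_deriv g (Suc m) s)"
            using s by (simp add: mult_ac)
          moreover have "0 \<le> (s - (a + y)) ^ m / fact m * cm_deriv g (Suc m) s"
            using True cm_deriv_nonneg[OF g, of s "Suc m"] s a by simp
          ultimately show ?thesis
            using True ga wnn[of s m] by (simp add: ennreal_mult'[symmetric] del: times_divide_eq_left times_divide_eq_right)
        next
          case False
          show ?thesis
          proof (cases "a < s")
            case True
            then have "1 - y / (s - a) < 0" using False elim by (simp add: field_simps)
            then have mx: "max 0 (1 - y / (s - a)) = 0" by simp
            show ?thesis using mx False elim \<open>0 < m\<close> \<open>\<not> a + y < s\<close> by simp
          next
            case False
            then show ?thesis using elim \<open>\<not> a + y < s\<close> by simp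
          qed
        qed
      qed
    qed
    also have "\<dots> = ennreal (1 / g a) * ennreal (g (a + y))"

    proof -
      have "0 < a + y" using a that by simp
      then have [measurable]: "(\<lambda>s. cm_deriv g (Suc m) s * indicator {a + y..} s) \<in> borel_measurable borel"
        by (rule measurable_cm_deriv_cut[OF g])
      have eq: "ennreal ((s - (a + y)) ^ m / fact m * cm_deriv g (Suc m) s) * indicator {a + y..} s
          = ennreal ((s - (a + y)) ^ m / fact m * (cm_deriv g (Suc m) s * indicator {a + y..} s))" for s
        by (simp add: indicator_def)
      show ?thesis
        using cm_Taylor_at_infinity[OF g lim \<open>0 < a + y\<close>, of m] unfolding eq
        by (subst nn_integral_cmult) auto
    qed
    finally show ?thesis using ga by (simp add: ennreal_mult'[symmetric])
  qed
  have emD: "emeasure (D m) (space (D m)) = 1" if "0 < m" for m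
  proof -
    have "emeasure (D m) (space (D m)) = (\<integral>\<^sup>+s. ennreal (?w m s) \<partial>lborel)"
      unfolding D_def by (subst emeasure_density[OF wme]) auto
    then show ?thesis using Taylor[of 0 m] that ga by simp
  qed
  have prD: "prob_space (D m)" if "0 < m" for m by (rule prob_spaceI[OF emD[OF that]])
  have AD: "AE s in D m. a < s" for m
  proof -
    have "AE s in lborel. s \<noteq> a" by (rule AE_lborel_singleton)
    then have "AE s in lborel. 0 < ennreal (?w m s) \<longrightarrow> a < s"
      by eventually_elim (auto simp: indicator_def split: if_splits)
    then show ?thesis unfolding D_def AE_density[OF wme] .
  qed
  have U01: "0 < U m s \<and> U m s \<le> 1" if "a < s" for m s
    using that by (simp add: U_def)
  define R where "R k = distr (D (Suc k)) borel (U (Suc k))" for k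
  have Um: "U (Suc k) \<in> measurable (D (Suc k)) borel" for k by measurable
  have R: "real_distribution (R k)" for k
    unfolding R_def by (rule prob_space.real_distribution_distr[OF prD Um]) simp
  have AR: "AE u in R k. 0 < u \<and> u \<le> 1" for k
  proof -
    have "{u \<in> space borel. 0 < u \<and> u \<le> (1::real)} \<in> sets borel" by measurable
    then show ?thesis
      unfolding R_def by (subst AE_distr_iff[OF Um]) (auto intro!: eventually_mono[OF AD] simp: U01)
  qed
  have approx: "\<bar>(\<integral>u. unit_powr y u \<partial>R k) - g (a + y) / g a\<bar> \<le> 2 / real (Suc k)" if y: "0 < y" for y k
  proof -
    let ?m = "Suc k"
    interpret D: prob_space "D ?m" by (rule prD) simp
    let ?q = "\<lambda>s. (max 0 (1 - y / (s - a))) ^ ?m"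
    have q01: "0 \<le> ?q s \<and> ?q s \<le> 1" if "a < s" for s
    proof -
      have b: "0 \<le> max 0 (1 - y / (s - a))" "max 0 (1 - y / (s - a)) \<le> 1" using that y by auto
      show ?thesis using power_le_one[OF b] zero_le_power[OF b(1)] by blast
    qed
    have qm: "?q \<in> borel_measurable (D ?m)" by measurable
    have intq: "integrable (D ?m) ?q"
      using AD[of ?m] q01 qm by (intro D.integrable_const_bound[of _ 1]) auto
    have intU: "integrable (D ?m) (\<lambda>s. unit_powr y (U ?m s))"
      using unit_powr_bounds[of y] y by (intro D.integrable_const_bound[of _ 1] AE_I2) (auto simp: abs_le_iff intro: order_trans[of _ 0])
    have "(\<integral>\<^sup>+s. ennreal (?q s) \<partial>D ?m) = ennreal (g (a + y) / g a)"
    proof -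
      have "(\<integral>\<^sup>+s. ennreal (?q s) \<partial>D ?m) = (\<integral>\<^sup>+s. ennreal (?w ?m s) * ennreal (?q s) \<partial>lborel)"
        unfolding D_def by (rule nn_integral_density[OF wme]) measurable
      also have "\<dots> = ennreal (g (a + y) / g a)" by (rule Taylor) (use y in auto)
      finally show ?thesis .
    qed
    moreover have "AE s in D ?m. 0 \<le> ?q s" using AD[of ?m] by eventually_elim (use q01 in blast)
    then have "ennreal (\<integral>s. ?q s \<partial>D ?m) = (\<integral>\<^sup>+s. ennreal (?q s) \<partial>D ?m)"
      by (intro nn_integral_eq_integral[symmetric] intq)
    moreover have "0 \<le> (\<integral>s. ?q s \<partial>D ?m)"
      using \<open>AE s in D ?m. 0 \<le> ?q s\<close> by (rule integral_nonneg_AE)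
    moreover have "0 \<le> g (a + y) / g a" using cm_deriv_nonneg[OF g, of "a + y" 0] ga a y by simp
    ultimately have q: "(\<integral>s. ?q s \<partial>D ?m) = g (a + y) / g a" by (simp only: ennreal_inj)
    have "(\<integral>u. unit_powr y u \<partial>R k) = (\<integral>s. unit_powr y (U ?m s) \<partial>D ?m)"
      unfolding R_def by (rule integral_distr[OF Um]) measurable
    then have "(\<integral>u. unit_powr y u \<partial>R k) - g (a + y) / g a = (\<integral>s. unit_powr y (U ?m s) - ?q s \<partial>D ?m)"
      using Bochner_Integration.integral_diff[OF intU intq] q by simp
    also have "\<bar>\<dots>\<bar> \<le> (\<integral>s. \<bar>unit_powr y (U ?m s) - ?q s\<bar> \<partial>D ?m)" by (rule integral_abs_bound)
    also have "\<dots> \<le> (\<integral>s. 2 / real ?m \<partial>D ?m)"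
    proof (rule integral_mono_AE)
      show "AE s in D ?m. \<bar>unit_powr y (U ?m s) - ?q s\<bar> \<le> 2 / real ?m"
        using AD[of ?m]
      proof eventually_elim
        case (elim s)
        let ?u = "y * real ?m / (s - a)"
        have "unit_powr y (U ?m s) = exp (- ?u)"
          using elim U01[OF elim, of ?m] by (simp add: unit_powr_eq) (simp add: U_def powr_def)
        moreover have "y / (s - a) = ?u / real ?m" by simp
        moreover have "\<bar>exp (- ?u) - (max 0 (1 - ?u / real ?m)) ^ ?m\<bar> \<le> 2 / real ?m"
          using elim y by (intro exp_minus_power_bounds) auto
        ultimately show ?case by (simp only:)
      qed
    qed (use intU intq in auto)
    finally show ?thesis by (simp add: D.prob_space)
  qed
  have limR: "(\<lambda>k. \<integral>u. unit_powr y u \<partial>R k) \<longlonglongrightarrow> g (a + y) / g a" if "0 < y" for y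
  proof -
    have "(\<lambda>k. 2 / real (Suc k)) \<longlonglongrightarrow> 0"
      using tendsto_mult[OF tendsto_const[of 2] LIMSEQ_inverse_real_of_nat] by (simp add: divide_inverse)
    then have "(\<lambda>k. (\<integral>u. unit_powr y u \<partial>R k) - g (a + y) / g a) \<longlonglongrightarrow> 0"
      by (rule Lim_null_comparison[rotated]) (use approx[OF that] in simp)
    then show ?thesis by (simp add: LIM_zero_iff)
  qed
  have "tight R"
    unfolding tight_def
  proof (intro conjI allI impI)
    fix e :: real assume "0 < e"
    have "measure (R k) {-1<..1} = 1" for k
    proof -
      interpret R: real_distribution "R k" by (rule R)
      show ?thesis using AR[of k] by (subst R.prob_eq_1) (auto elim: eventually_mono)
    qed
    then show "\<exists>a b. a < b \<and> (\<forall>n. 1 - e < measure (R n) {a<..b})"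
      using \<open>0 < e\<close> by (intro exI[of _ "-1"] exI[of _ 1]) auto
  qed (rule R)
  from tight_imp_convergent_subsubsequence[OF this strict_mono_id]
  obtain r P where r: "strict_mono r" and P: "real_distribution P" and w: "weak_conv_m (R \<circ> id \<circ> r) P" by blast
  interpret P: real_distribution P by (rule P)
  have conv: "(\<lambda>k. \<integral>u. f u \<partial>R (r k)) \<longlonglongrightarrow> (\<integral>u. f u \<partial>P)"
    if "\<And>u. isCont f u" "\<And>u. \<bar>f u\<bar> \<le> 1" for f :: "real \<Rightarrow> real"
    using weak_conv_imp_integral_bdd_continuous_conv[of "R \<circ> id \<circ> r" P f 1] R P w that by (simp add: o_def)
  have main: "(\<integral>u. unit_powr y u \<partial>P) = g (a + y) / g a" if y: "0 < y" for y
  proof (rule LIMSEQ_unique)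
    show "(\<lambda>k. \<integral>u. unit_powr y u \<partial>R (r k)) \<longlonglongrightarrow> (\<integral>u. unit_powr y u \<partial>P)"
      using unit_powr_bounds[of y] y by (intro conv isCont_unit_powr) (auto simp: abs_of_nonneg)
    show "(\<lambda>k. \<integral>u. unit_powr y u \<partial>R (r k)) \<longlonglongrightarrow> g (a + y) / g a"
      using LIMSEQ_subseq_LIMSEQ[OF limR[OF y] r] by (simp add: o_def)
  qed
  \<comment> \<open>Distance to [0, 1], capped at 1: a bounded continuous function with mean 0 along
    the sequence, so the weak limit stays in [0, 1].\<close>
  let ?d = "\<lambda>u::real. min 1 \<bar>u - max 0 (min 1 u)\<bar>"
  have dint: "integrable P ?d" by (intro P.integrable_const_bound[of _ 1]) auto
  have "(\<integral>u. ?d u \<partial>P) = 0"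
  proof (rule LIMSEQ_unique)
    show "(\<lambda>k. \<integral>u. ?d u \<partial>R (r k)) \<longlonglongrightarrow> (\<integral>u. ?d u \<partial>P)"
      by (intro conv continuous_intros) auto
    have "(\<integral>u. ?d u \<partial>R (r k)) = 0" for k
      by (intro integral_eq_zero_AE eventually_mono[OF AR]) auto
    then show "(\<lambda>k. \<integral>u. ?d u \<partial>R (r k)) \<longlonglongrightarrow> 0" by simp
  qed
  then have "AE u in P. ?d u = 0"
    by (subst (asm) integral_nonneg_eq_0_iff_AE[OF dint]) auto
  then have P01: "AE u in P. 0 \<le> u \<and> u \<le> 1"
    by eventually_elim (auto simp: min_def max_def split: if_splits)
  \<comment> \<open>As y tends to 0, u^y tends to the indicator of u > 0, while g (a + y) / g a
    tends to 1; so no mass escapes to 0.\<close>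
  have "P.prob {0<..} = 1"
  proof (rule LIMSEQ_unique)
    let ?y = "\<lambda>n. 1 / real (Suc n)"
    have y0: "?y \<longlonglongrightarrow> 0" using LIMSEQ_inverse_real_of_nat by (simp add: inverse_eq_divide)
    have "(\<lambda>n. \<integral>u. unit_powr (?y n) u \<partial>P) \<longlonglongrightarrow> (\<integral>u. indicator {0<..} u \<partial>P)"
    proof (rule integral_dominated_convergence[where w = "\<lambda>_. 1"])
      show "AE u in P. (\<lambda>n. unit_powr (?y n) u) \<longlonglongrightarrow> indicator {0<..} u"
        using P01
      proof eventually_elim
        case (elim u)
        show ?case
        proof (cases "u = 0")
          case False
          then have "(\<lambda>n. u powr (?y n)) \<longlonglongrightarrow> u powr 0"
            using elim by (intro tendsto_powr tendsto_const y0) auto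
          then show ?thesis using False elim by (simp add: unit_powr_eq)
        qed (simp add: unit_powr_def)
      qed
      show "AE u in P. norm (unit_powr (?y n) u) \<le> 1" for n
        using unit_powr_bounds[of "?y n"] by (intro AE_I2) (simp add: abs_of_nonneg)
    qed auto
    then show "(\<lambda>n. \<integral>u. unit_powr (?y n) u \<partial>P) \<longlonglongrightarrow> P.prob {0<..}" by simp
    have "isCont g a" using cm_deriv_isCont[OF g a, of 0] by simp
    then have "(\<lambda>n. g (a + ?y n)) \<longlonglongrightarrow> g (a + 0)"
      by (intro isCont_tendsto_compose[where g = g] tendsto_intros y0) simp
    then have "(\<lambda>n. g (a + ?y n) / g a) \<longlonglongrightarrow> 1"
      using tendsto_divide[of _ "g (a + 0)" sequentially "\<lambda>_. g a" "g a"] ga by simp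
    then show "(\<lambda>n. \<integral>u. unit_powr (?y n) u \<partial>P) \<longlonglongrightarrow> 1" by (subst main) auto
  qed
  then have "AE u in P. u \<in> {0<..}" by (subst (asm) P.prob_eq_1) auto
  then have "AE u in P. 0 < u \<and> u \<le> 1" using P01 by eventually_elim auto
  with P have "unit_distribution P" by (simp add: unit_distribution_def)
  then show thesis using main ga by (intro that[of P]) auto
qed

text \<open>The representation with base 1 settles x > 1. For x < 1 the one with base x, tilted by
  u^(1-x), has the same moments and so is the same law, which extends the formula to the left
  although g may be unbounded near 0.\<close>

theorem Bernstein:
  assumes g: "completely_monotone g" and lim: "(g \<longlongrightarrow> 0) at_top"
  obtains L c where "real_distribution L" "AE s in L. 0 < s" "0 \<le> (c::real)"
    "\<And>x. 0 < x \<Longrightarrow> ennreal (g x) = (\<integral>\<^sup>+s. ennreal (c * exp ((1 - x) * s)) \<partial>L)"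
proof (cases "g 1 = 0")
  case True
  have gnn: "0 \<le> g x" if "0 < x" for x using cm_deriv_nonneg[OF g that, of 0] by simp
  \<comment> \<open>If g 1 = 0 then g vanishes: to the right by monotonicity, to the left since a
    representation with base x < 1 would give a positive function integral 0. Any law then serves
    with c = 0.\<close>
  have "g x = 0" if x: "0 < x" for x
  proof (cases "x < 1")
    case True
    show ?thesis
    proof (rule ccontr)
      assume "g x \<noteq> 0"
      then have gx: "0 < g x" using gnn[OF x] by simp
      obtain P where P: "unit_distribution P" and eq: "\<And>y. 0 < y \<Longrightarrow> g (x + y) = g x * (\<integral>u. unit_powr y u \<partial>P)"
        using cm_representation_from[OF g lim x gx] by blast
      interpret P: real_distribution P by (rule unit_distributionD(1)[OF P])
      have "(\<integral>u. unit_powr (1 - x) u \<partial>P) = 0"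
        using eq[of "1 - x"] \<open>x < 1\<close> \<open>g 1 = 0\<close> gx by simp
      moreover have "integrable P (unit_powr (1 - x))"
        using unit_powr_bounds[of "1 - x"] \<open>x < 1\<close> by (intro P.integrable_const_bound[of _ 1] AE_I2) (auto simp: abs_of_nonneg)
      ultimately have "AE u in P. unit_powr (1 - x) u = 0"
        using unit_powr_bounds[of "1 - x"] \<open>x < 1\<close> by (subst (asm) integral_nonneg_eq_0_iff_AE) auto
      with unit_distributionD(2)[OF P] have "AE u in P. False"
        by eventually_elim (simp add: unit_powr_eq)
      then show False by simp
    qed
  next
    case False
    then show ?thesis using cm_deriv_antimono[OF g, of 1 x 0] \<open>g 1 = 0\<close> gnn[OF x] by simp
  qed
  moreover have "real_distribution (return borel (1::real))"
    by (simp add: real_distribution_def real_distribution_axioms_def prob_space_return)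
  moreover have "AE s in return borel (1::real). 0 < s" by (simp add: AE_return)
  ultimately show thesis by (intro that[of "return borel 1" 0]) auto
next
  case False
  then have g1: "0 < g 1" using cm_deriv_nonneg[OF g, of 1 0] by simp
  obtain P where P: "unit_distribution P" and eq: "\<And>y. 0 < y \<Longrightarrow> g (1 + y) = g 1 * (\<integral>u. unit_powr y u \<partial>P)"
    using cm_representation_from[OF g lim zero_less_one g1] by blast
  interpret P: real_distribution P by (rule unit_distributionD(1)[OF P])
  have AP: "AE u in P. 0 < u \<and> u \<le> 1" by (rule unit_distributionD(2)[OF P])
  have int: "integrable P (unit_powr y)" if "0 \<le> y" for y
    using unit_powr_bounds[OF that] by (intro P.integrable_const_bound[of _ 1] AE_I2) (auto simp: abs_of_nonneg)
  \<comment> \<open>The mass at u = 1 is the limit of g (1 + n) / g 1, which is 0. It would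
    correspond to s = 0, where the later division by s is impossible.\<close>
  have AP1: "AE u in P. u < 1"
  proof -
    have "P.prob {1..} = 0"
    proof (rule LIMSEQ_unique)
      have "(\<lambda>n. \<integral>u. unit_powr (real (Suc n)) u \<partial>P) \<longlonglongrightarrow> (\<integral>u. indicator {1..} u \<partial>P)"
      proof (rule integral_dominated_convergence[where w = "\<lambda>_. 1"])
        show "AE u in P. (\<lambda>n. unit_powr (real (Suc n)) u) \<longlonglongrightarrow> indicator {1..} u"
          using AP
        proof eventually_elim
          case (elim u)
          show ?case
          proof (cases "u < 1")
            case True
            have "(\<lambda>n. u ^ Suc n) \<longlonglongrightarrow> 0" using True elim by (intro LIMSEQ_Suc LIMSEQ_realpow_zero) auto
            then show ?thesis using True elim by (simp add: unit_powr_eq powr_realpow del: power_Suc of_nat_Suc)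
          qed (use elim in \<open>simp add: unit_powr_eq\<close>)
        qed
        show "AE u in P. norm (unit_powr (real (Suc n)) u) \<le> 1" for n
          using unit_powr_bounds[of "real (Suc n)"] by (intro AE_I2) (simp add: abs_of_nonneg)
      qed auto
      then show "(\<lambda>n. \<integral>u. unit_powr (real (Suc n)) u \<partial>P) \<longlonglongrightarrow> P.prob {1..}" by simp
      have "filterlim (\<lambda>n. 1 + real (Suc n)) at_top sequentially"
        by (intro filterlim_tendsto_add_at_top[OF tendsto_const] filterlim_compose[OF filterlim_real_sequentially filterlim_Suc])
      then have "(\<lambda>n. g (1 + real (Suc n))) \<longlonglongrightarrow> 0" by (rule filterlim_compose[OF lim])
      then have "(\<lambda>n. g (1 + real (Suc n)) / g 1) \<longlonglongrightarrow> 0 / g 1" by (intro tendsto_divide tendsto_const) (use g1 in auto)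
      moreover have "(\<integral>u. unit_powr (real (Suc n)) u \<partial>P) = g (1 + real (Suc n)) / g 1" for n
        using eq[of "real (Suc n)"] g1 by simp
      ultimately show "(\<lambda>n. \<integral>u. unit_powr (real (Suc n)) u \<partial>P) \<longlonglongrightarrow> 0" by simp
    qed
    then have "AE u in P. u \<notin> {1..}"
      by (intro AE_not_in) (auto simp: null_sets_def P.emeasure_eq_measure)
    then show ?thesis by eventually_elim auto
  qed
  have rep: "ennreal (g x) = (\<integral>\<^sup>+u. ennreal (g 1 * u powr (x - 1)) \<partial>P)" if x: "0 < x" for x
  proof -
    consider "1 < x" | "x = 1" | "x < 1" by linarith
    then show ?thesis
    proof cases
      case 1
      have "(\<integral>\<^sup>+u. ennreal (g 1 * u powr (x - 1)) \<partial>P) = (\<integral>\<^sup>+u. ennreal (g 1 * unit_powr (x - 1) u) \<partial>P)"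
        by (intro nn_integral_cong_AE eventually_mono[OF AP]) (auto simp: unit_powr_eq)
      also have "\<dots> = ennreal (\<integral>u. g 1 * unit_powr (x - 1) u \<partial>P)"
        using 1 int[of "x - 1"] g1 unit_powr_bounds[of "x - 1"] by (intro nn_integral_eq_integral) auto
      also have "\<dots> = ennreal (g x)" using eq[of "x - 1"] 1 by simp
      finally show ?thesis by simp
    next
      case 2
      have "(\<integral>\<^sup>+u. ennreal (g 1 * u powr (x - 1)) \<partial>P) = (\<integral>\<^sup>+u. ennreal (g 1) \<partial>P)"
        by (intro nn_integral_cong_AE eventually_mono[OF AP]) (auto simp: 2)
      then show ?thesis using 2 P.emeasure_space_1[unfolded P.space_eq_univ] by simp
    next
      case 3
      have gx: "0 < g x" using cm_deriv_antimono[OF g x, of 1 0] 3 g1 by simp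
      obtain P' where P': "unit_distribution P'" and eq': "\<And>y. 0 < y \<Longrightarrow> g (x + y) = g x * (\<integral>u. unit_powr y u \<partial>P')"
        using cm_representation_from[OF g lim x gx] by blast
      interpret P': real_distribution P' by (rule unit_distributionD(1)[OF P'])
      have AP': "AE u in P'. 0 < u \<and> u \<le> 1" by (rule unit_distributionD(2)[OF P'])
      have int': "integrable P' (unit_powr y)" if "0 \<le> y" for y
        using unit_powr_bounds[OF that] by (intro P'.integrable_const_bound[of _ 1] AE_I2) (auto simp: abs_of_nonneg)
      \<comment> \<open>Tilting by u^(1-x) moves the base point from x to 1, and g x / g 1
        normalises.\<close>
      let ?f = "\<lambda>u. g x / g 1 * unit_powr (1 - x) u"
      have fnn: "0 \<le> ?f u" for u using gx g1 unit_powr_bounds[of "1 - x" u] 3 by simp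
      define P2 where "P2 = density P' (\<lambda>u. ennreal (?f u))"
      have "(\<integral>\<^sup>+u. ennreal (?f u) \<partial>P') = ennreal (\<integral>u. ?f u \<partial>P')"
        using 3 int'[of "1 - x"] fnn by (intro nn_integral_eq_integral) auto
      also have "(\<integral>u. ?f u \<partial>P') = 1"
      proof -
        have "(\<integral>u. ?f u \<partial>P') = (g x * (\<integral>u. unit_powr (1 - x) u \<partial>P')) / g 1" by simp
        also have "g x * (\<integral>u. unit_powr (1 - x) u \<partial>P') = g 1" using eq'[of "1 - x"] 3 by simp
        finally show ?thesis using False by simp
      qed
      finally have "prob_space P2"
        by (intro prob_spaceI) (simp add: P2_def emeasure_density)
      then have "real_distribution P2"
        by (simp add: real_distribution_def real_distribution_axioms_def P2_def)
      moreover have "AE u in P2. 0 < u \<and> u \<le> 1"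
        unfolding P2_def by (subst AE_density) (auto intro!: eventually_mono[OF AP'])
      ultimately have "unit_distribution P2" by (simp add: unit_distribution_def)
      have "P = P2"
      proof (rule unit_distribution_unique[OF P \<open>unit_distribution P2\<close>])
        fix k :: nat
        have "(\<integral>u. u ^ k \<partial>P2) = (\<integral>u. ?f u *\<^sub>R u ^ k \<partial>P')"
          unfolding P2_def by (rule integral_density) (use fnn in auto)
        also have "\<dots> = (\<integral>u. g x / g 1 * unit_powr (1 - x + real k) u \<partial>P')"
        proof (rule integral_cong_AE)
          show "AE u in P'. ?f u *\<^sub>R u ^ k = g x / g 1 * unit_powr (1 - x + real k) u"
            using AP' by eventually_elim (simp add: unit_powr_eq powr_add powr_realpow)
        qed measurable
        also have "\<dots> = g (1 + real k) / g 1" using eq'[of "1 - x + real k"] 3 g1 by simp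
        finally have 2: "(\<integral>u. u ^ k \<partial>P2) = g (1 + real k) / g 1" .
        have "(\<integral>u. u ^ k \<partial>P) = g (1 + real k) / g 1"
        proof (cases "k = 0")
          case False
          have "(\<integral>u. u ^ k \<partial>P) = (\<integral>u. unit_powr (real k) u \<partial>P)"
          proof (rule integral_cong_AE)
            show "AE u in P. u ^ k = unit_powr (real k) u"
              using AP by eventually_elim (simp add: unit_powr_eq powr_realpow)
          qed measurable
          then show ?thesis using eq[of "real k"] False g1 by simp
        qed (use g1 P.prob_space[unfolded P.space_eq_univ] in simp)
        with 2 show "(\<integral>u. u ^ k \<partial>P) = (\<integral>u. u ^ k \<partial>P2)" by simp
      qed
      have "(\<integral>\<^sup>+u. ennreal (g 1 * u powr (x - 1)) \<partial>P2) = (\<integral>\<^sup>+u. ennreal (?f u) * ennreal (g 1 * u powr (x - 1)) \<partial>P')"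
        unfolding P2_def by (rule nn_integral_density) measurable
      also have "\<dots> = (\<integral>\<^sup>+u. ennreal (g x) \<partial>P')"
      proof (rule nn_integral_cong_AE)
        show "AE u in P'. ennreal (?f u) * ennreal (g 1 * u powr (x - 1)) = ennreal (g x)"
          using AP'
        proof eventually_elim
          case (elim u)
          have "?f u * (g 1 * u powr (x - 1)) = g x * (u powr (1 - x) * u powr (x - 1))"
            using elim g1 by (simp add: unit_powr_eq)
          also have "u powr (1 - x) * u powr (x - 1) = 1" using elim by (simp flip: powr_add)
          finally show ?case using fnn[of u] by (simp only: ennreal_mult'[symmetric] mult_1_right)
        qed
      qed
      also have "\<dots> = ennreal (g x)" using P'.emeasure_space_1[unfolded P'.space_eq_univ] by simp
      finally show ?thesis using \<open>P = P2\<close> by simp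
    qed
  qed
  \<comment> \<open>The substitution u = e^(-s). The classical representing measure is g 1 * e^s
    L(ds); writing 1 - x in the exponent keeps L a probability law.\<close>
  define L where "L = distr P borel (\<lambda>u. - ln u)"
  have lm: "(\<lambda>u. - ln u) \<in> borel_measurable P" by measurable
  have "real_distribution L" unfolding L_def by (rule P.real_distribution_distr[OF lm])
  moreover have "AE s in L. 0 < s"
  proof -
    have "AE u in P. 0 < - ln u" using AP AP1 by eventually_elim simp
    then show ?thesis unfolding L_def by (subst AE_distr_iff[OF lm]) auto
  qed
  moreover have "ennreal (g x) = (\<integral>\<^sup>+s. ennreal (g 1 * exp ((1 - x) * s)) \<partial>L)" if "0 < x" for x
  proof -
    have "(\<integral>\<^sup>+s. ennreal (g 1 * exp ((1 - x) * s)) \<partial>L) = (\<integral>\<^sup>+u. ennreal (g 1 * exp ((1 - x) * - ln u)) \<partial>P)"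
      unfolding L_def by (rule nn_integral_distr[OF lm]) measurable
    also have "\<dots> = (\<integral>\<^sup>+u. ennreal (g 1 * u powr (x - 1)) \<partial>P)"
      by (intro nn_integral_cong_AE eventually_mono[OF AP]) (auto simp: powr_def algebra_simps)
    finally show ?thesis using rep[OF that] by simp
  qed
  ultimately show thesis using g1 by (intro that[of L "g 1"]) auto
qed

section \<open>Laplace transforms are completely monotone\<close>

lemma exp_second_order_bound: "\<bar>exp y - 1 - y\<bar> \<le> y\<^sup>2 * exp \<bar>y\<bar>" for y :: real
proof -
  have le: "exp y - 1 \<le> y * exp y"
  proof -
    have "exp y * (1 - y) \<le> exp y * exp (- y)"
      using exp_ge_add_one_self[of "- y"] by (intro mult_left_mono) auto
    then show ?thesis by (simp add: algebra_simps exp_minus)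
  qed
  have nn: "0 \<le> exp y - 1 - y"
  proof -
    have "1 + y \<le> exp y" by (rule exp_ge_add_one_self)
    then show ?thesis by argo
  qed
  have "exp y - 1 - y \<le> y * (exp y - 1)" using le by (simp add: algebra_simps)
  also have "\<dots> \<le> y\<^sup>2 * exp \<bar>y\<bar>"
  proof (cases "0 \<le> y")
    case True
    then have "y * (exp y - 1) \<le> y * (y * exp y)" using le by (intro mult_left_mono)
    then show ?thesis using True by (simp add: power2_eq_square mult.assoc)
  next
    case False
    have "y \<le> exp y - 1" unfolding le_diff_eq add.commute[of y 1] by (rule exp_ge_add_one_self)
    then have "y * (exp y - 1) \<le> y * y" using False by (intro mult_left_mono_neg) auto
    also have "\<dots> \<le> y\<^sup>2 * exp \<bar>y\<bar>" using mult_left_mono[of 1 "exp \<bar>y\<bar>" "y\<^sup>2"] by (simp add: power2_eq_square)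
    finally show ?thesis .
  qed
  finally show ?thesis using nn by simp
qed

lemma power_le_fact_exp: "0 \<le> x \<Longrightarrow> x ^ n \<le> fact n * exp x" for x :: real
proof -
  assume x: "0 \<le> x"
  have "(\<Sum>k\<in>{n}. x ^ k /\<^sub>R fact k) \<le> (\<Sum>k. x ^ k /\<^sub>R fact k)"
    using x by (intro sum_le_suminf summable_exp_generic) auto
  then have "x ^ n / fact n \<le> exp x" by (simp add: exp_def divide_inverse mult.commute)
  then show ?thesis by (simp add: field_simps)
qed

text \<open>Differentiation under the integral: each derivative multiplies the integrand by -k, so
  the signs alternate. It is stated with a weight w so that k may also serve as its own
  weight.\<close>

lemma completely_monotone_Laplace:
  fixes w k :: "'b \<Rightarrow> real"
  assumes [measurable]: "w \<in> borel_measurable N" "k \<in> borel_measurable N"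
    and nn: "\<And>t. 0 \<le> w t" "\<And>t. 0 \<le> k t"
    and int: "\<And>u. 0 < u \<Longrightarrow> integrable N (\<lambda>t. w t * exp (- u * k t))"
    and g: "\<And>u. 0 < u \<Longrightarrow> g u = (\<integral>t. w t * exp (- u * k t) \<partial>N)"
  shows "completely_monotone g"
proof -
  define G where "G n u = (\<integral>t. k t ^ n * w t * exp (- u * k t) \<partial>N)" for n u
  have intn: "integrable N (\<lambda>t. k t ^ n * w t * exp (- u * k t))" if u: "0 < u" for n u
  proof (rule Bochner_Integration.integrable_bound)
    \<comment> \<open>Half of the exponential decay absorbs the power: k^n <= n! (2/u)^n exp (u k /
      2).\<close>
    show "integrable N (\<lambda>t. fact n * (2 / u) ^ n * (w t * exp (- (u / 2) * k t)))"
      using int[of "u / 2"] u by simp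
    have "k t ^ n * w t * exp (- u * k t) \<le> fact n * (2 / u) ^ n * (w t * exp (- (u / 2) * k t))" for t
    proof -
      have "k t ^ n = (2 / u) ^ n * (u / 2 * k t) ^ n" using u by (simp flip: power_mult_distrib)
      also have "\<dots> \<le> (2 / u) ^ n * (fact n * exp (u / 2 * k t))"
        using u nn(2)[of t] by (intro mult_left_mono power_le_fact_exp) auto
      finally have "k t ^ n * (w t * exp (- u * k t)) \<le> (2 / u) ^ n * (fact n * exp (u / 2 * k t)) * (w t * exp (- u * k t))"
        using nn(1)[of t] by (intro mult_right_mono) auto
      also have "\<dots> = fact n * (2 / u) ^ n * (w t * (exp (u / 2 * k t) * exp (- u * k t)))" by (simp add: mult_ac)
      also have "exp (u / 2 * k t) * exp (- u * k t) = exp (- (u / 2) * k t)"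
        by (simp flip: exp_add)
      finally show ?thesis by (simp add: mult.assoc)
    qed
    then show "AE t in N. norm (k t ^ n * w t * exp (- u * k t)) \<le> norm (fact n * (2 / u) ^ n * (w t * exp (- (u / 2) * k t)))"
      using nn u by (intro AE_I2) (simp add: abs_of_nonneg)
  qed measurable
  have der: "(G n has_real_derivative - G (Suc n) u) (at u)" if u: "0 < u" for n u
  proof -
    \<comment> \<open>For |h| < u / 2 the second-order remainder of the exponential costs at most
      half of the decay, which leaves an integrable bound of order h^2.\<close>
    have bound: "\<bar>(G n (u + h) - G n u) / h - - G (Suc n) u\<bar> \<le> \<bar>h\<bar> * G (n + 2) (u / 2)"
      if h: "h \<noteq> 0" "\<bar>h\<bar> < u / 2" for h
    proof -
      have uh: "0 < u + h" using h u by auto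
      let ?d = "\<lambda>t. k t ^ n * w t * exp (- (u + h) * k t) - k t ^ n * w t * exp (- u * k t) + h * (k t ^ Suc n * w t * exp (- u * k t))"
      have eq: "G n (u + h) - G n u + h * G (Suc n) u = (\<integral>t. ?d t \<partial>N)"
        unfolding G_def
        by (subst Bochner_Integration.integral_add[OF Bochner_Integration.integrable_diff[OF intn[OF uh] intn[OF u]]
              integrable_mult_right[OF intn[OF u]]],
            subst Bochner_Integration.integral_diff[OF intn[OF uh] intn[OF u]])
          (simp only: integral_mult_right_zero)
      have "\<bar>\<integral>t. ?d t \<partial>N\<bar> \<le> (\<integral>t. \<bar>?d t\<bar> \<partial>N)" by (rule integral_abs_bound)
      also have "\<dots> \<le> (\<integral>t. h\<^sup>2 * (k t ^ (n + 2) * w t * exp (- (u / 2) * k t)) \<partial>N)"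
      proof (intro integral_mono)
        show "integrable N (\<lambda>t. \<bar>?d t\<bar>)"
          by (intro integrable_abs Bochner_Integration.integrable_add Bochner_Integration.integrable_diff integrable_mult_right intn uh u)
        show "integrable N (\<lambda>t. h\<^sup>2 * (k t ^ (n + 2) * w t * exp (- (u / 2) * k t)))"
          using u by (intro integrable_mult_right intn) auto
        fix t
        let ?y = "- h * k t"
        have "?d t = k t ^ n * w t * exp (- u * k t) * (exp ?y - 1 - ?y)"
          by (simp add: algebra_simps exp_add[symmetric])
        then have "\<bar>?d t\<bar> = k t ^ n * w t * exp (- u * k t) * \<bar>exp ?y - 1 - ?y\<bar>"
          using nn[of t] by (simp add: abs_mult)
        also have "\<dots> \<le> k t ^ n * w t * exp (- u * k t) * (?y\<^sup>2 * exp \<bar>?y\<bar>)"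
          using nn[of t] by (intro mult_left_mono exp_second_order_bound) auto
        also have "\<dots> = h\<^sup>2 * (k t ^ (n + 2) * w t * (exp (- u * k t) * exp (\<bar>h\<bar> * k t)))"
          using nn[of t] by (simp add: abs_mult power_mult_distrib power_add power2_eq_square mult_ac)
        also have "\<dots> \<le> h\<^sup>2 * (k t ^ (n + 2) * w t * exp (- (u / 2) * k t))"
        proof (intro mult_left_mono)
          have "\<bar>h\<bar> * k t \<le> u / 2 * k t" using h nn(2)[of t] by (intro mult_right_mono) auto
          then show "exp (- u * k t) * exp (\<bar>h\<bar> * k t) \<le> exp (- (u / 2) * k t)"
            by (simp add: exp_add[symmetric])
        qed (use nn[of t] in auto)
        finally show "\<bar>?d t\<bar> \<le> h\<^sup>2 * (k t ^ (n + 2) * w t * exp (- (u / 2) * k t))" .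
      qed
      also have "\<dots> = h\<^sup>2 * G (n + 2) (u / 2)" by (simp add: G_def)
      finally have "\<bar>G n (u + h) - G n u + h * G (Suc n) u\<bar> / \<bar>h\<bar> \<le> h\<^sup>2 * G (n + 2) (u / 2) / \<bar>h\<bar>"
        unfolding eq by (rule divide_right_mono) simp
      moreover have "(G n (u + h) - G n u) / h - - G (Suc n) u = (G n (u + h) - G n u + h * G (Suc n) u) / h"
        using h by (simp add: field_simps)
      moreover have "h\<^sup>2 * G (n + 2) (u / 2) / \<bar>h\<bar> = \<bar>h\<bar> * G (n + 2) (u / 2)"
        using h by (simp add: power2_eq_square abs_if)
      ultimately show ?thesis by (simp only: abs_divide)
    qed
    have "((\<lambda>h. (G n (u + h) - G n u) / h - - G (Suc n) u) \<longlongrightarrow> 0) (at 0)"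
    proof (rule Lim_null_comparison)
      have "\<forall>\<^sub>F h in at 0. h \<noteq> 0 \<and> \<bar>h\<bar> < u / 2"
        unfolding eventually_at using u by (intro exI[of _ "u / 2"]) (auto simp: dist_real_def)
      then show "\<forall>\<^sub>F h in at 0. norm ((G n (u + h) - G n u) / h - - G (Suc n) u) \<le> \<bar>h\<bar> * G (n + 2) (u / 2)"
        by eventually_elim (use bound in simp)
      have "((\<lambda>h. \<bar>h\<bar> * G (n + 2) (u / 2)) \<longlongrightarrow> \<bar>0\<bar> * G (n + 2) (u / 2)) (at 0)"
        by (intro tendsto_intros)
      then show "((\<lambda>h. \<bar>h\<bar> * G (n + 2) (u / 2)) \<longlongrightarrow> 0) (at 0)" by simp
    qed
    then have "((\<lambda>h. (G n (u + h) - G n u) / h) \<longlongrightarrow> - G (Suc n) u) (at 0)" by (rule LIM_zero_cancel)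
    then show ?thesis by (simp add: DERIV_def)
  qed
  have iter: "(deriv ^^ n) g u = (- 1) ^ n * G n u" if "0 < u" for n u
    using that
  proof (induction n arbitrary: u)
    case 0
    then show ?case using g by (simp add: G_def)
  next
    case (Suc n)
    have "\<forall>\<^sub>F v in nhds u. (deriv ^^ n) g v = (- 1) ^ n * G n v"
      using eventually_nhds_in_open[of "{0<..}" u] Suc by (auto elim!: eventually_mono)
    then have "(deriv ^^ Suc n) g u = deriv (\<lambda>v. (- 1) ^ n * G n v) u"
      by (simp add: deriv_cong_ev)
    also have "\<dots> = (- 1) ^ n * (- G (Suc n) u)"
      by (intro DERIV_imp_deriv DERIV_cmult der Suc.prems)
    finally show ?case by simp
  qed
  show ?thesis
    unfolding completely_monotone_def
  proof (intro allI impI conjI)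
    fix n and u :: real assume u: "0 < u"
    have "((\<lambda>v. (- 1) ^ n * G n v) has_real_derivative (- 1) ^ n * (- G (Suc n) u)) (at u)"
      by (intro DERIV_cmult der u)
    then have "((deriv ^^ n) g has_real_derivative (- 1) ^ n * (- G (Suc n) u)) (at u)"
      by (rule has_field_derivative_transform_within_open[where S = "{0<..}"]) (use u iter in auto)
    then show "(deriv ^^ n) g differentiable (at u)"
      by (auto simp: real_differentiable_def)
    have "0 \<le> G n u" unfolding G_def using nn by (intro integral_nonneg_AE AE_I2) auto
    then show "0 \<le> (- 1) ^ n * (deriv ^^ n) g u"
      by (simp add: iter[OF u] flip: power_mult_distrib mult.assoc)
  qed
qed

lemma completely_monotone_add:
  assumes f: "completely_monotone f" and g: "completely_monotone g"
  shows "completely_monotone (\<lambda>x. f x + g x)"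
proof -
  have d: "((deriv ^^ n) f has_real_derivative (deriv ^^ Suc n) f u) (at u)"
    if "completely_monotone f" "0 < u" for f n u
    using that by (simp add: completely_monotone_def DERIV_deriv_iff_real_differentiable)
  have iter: "(deriv ^^ n) (\<lambda>x. f x + g x) u = (deriv ^^ n) f u + (deriv ^^ n) g u" if "0 < u" for n u
    using that
  proof (induction n arbitrary: u)
    case (Suc n)
    have "\<forall>\<^sub>F v in nhds u. (deriv ^^ n) (\<lambda>x. f x + g x) v = (deriv ^^ n) f v + (deriv ^^ n) g v"
      using eventually_nhds_in_open[of "{0<..}" u] Suc by (auto elim!: eventually_mono)
    then have "(deriv ^^ Suc n) (\<lambda>x. f x + g x) u = deriv (\<lambda>v. (deriv ^^ n) f v + (deriv ^^ n) g v) u"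
      by (simp add: deriv_cong_ev)
    also have "\<dots> = (deriv ^^ Suc n) f u + (deriv ^^ Suc n) g u"
      by (intro DERIV_imp_deriv DERIV_add d f g Suc.prems)
    finally show ?case .
  qed simp
  show ?thesis
    unfolding completely_monotone_def
  proof (intro allI impI conjI)
    fix n and u :: real assume u: "0 < u"
    have "((\<lambda>v. (deriv ^^ n) f v + (deriv ^^ n) g v) has_real_derivative (deriv ^^ Suc n) f u + (deriv ^^ Suc n) g u) (at u)"
      by (intro DERIV_add d f g u)
    then have "((deriv ^^ n) (\<lambda>x. f x + g x) has_real_derivative (deriv ^^ Suc n) f u + (deriv ^^ Suc n) g u) (at u)"
      by (rule has_field_derivative_transform_within_open[where S = "{0<..}"]) (use u iter in auto)
    then show "(deriv ^^ n) (\<lambda>x. f x + g x) differentiable (at u)"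
      by (auto simp: real_differentiable_def)
    show "0 \<le> (- 1) ^ n * (deriv ^^ n) (\<lambda>x. f x + g x) u"
      using f g u by (simp add: iter completely_monotone_def distrib_left)
  qed
qed

section \<open>Generating triplets\<close>

lemma integral_odd_eq_0:
  fixes f :: "real \<Rightarrow> real"
  assumes "\<And>x. f (- x) = - f x"
  shows "(\<integral>x. f x \<partial>lborel) = 0"
proof -
  have "(\<integral>x. f x \<partial>lborel) = \<bar>- 1\<bar> *\<^sub>R (\<integral>x. f (0 + - 1 * x) \<partial>lborel)"
    by (rule lborel_integral_real_affine) simp
  also have "\<dots> = - (\<integral>x. f x \<partial>lborel)" by (simp add: assms)
  finally show ?thesis by simp
qed

lemma nn_integral_half_lines:
  fixes f :: "real \<Rightarrow> ennreal"
  assumes [measurable]: "f \<in> borel_measurable borel"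
  shows "(\<integral>\<^sup>+x. f x \<partial>lborel) = (\<integral>\<^sup>+r\<in>{0<..}. f r \<partial>lborel) + (\<integral>\<^sup>+r\<in>{0<..}. f (- r) \<partial>lborel)"
proof -
  have "(\<integral>\<^sup>+x. f x \<partial>lborel) = (\<integral>\<^sup>+x. f x * indicator {0<..} x + f x * indicator {..<0} x \<partial>lborel)"
  proof (rule nn_integral_cong_AE)
    show "AE x in lborel. f x = f x * indicator {0<..} x + f x * indicator {..<0} x"
      using AE_lborel_singleton[of "0::real"] by eventually_elim (auto simp: indicator_def)
  qed
  also have "\<dots> = (\<integral>\<^sup>+x. f x * indicator {0<..} x \<partial>lborel) + (\<integral>\<^sup>+x. f x * indicator {..<0} x \<partial>lborel)"
    by (rule nn_integral_add) measurable
  also have "(\<integral>\<^sup>+x. f x * indicator {..<0} x \<partial>lborel) = \<bar>- 1 :: real\<bar> * (\<integral>\<^sup>+x. f (0 + - 1 * x) * indicator {..<0} (0 + - 1 * x) \<partial>lborel)"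
    by (rule nn_integral_real_affine) auto
  also have "\<dots> = (\<integral>\<^sup>+r. f (- r) * indicator {0<..} r \<partial>lborel)"
    by (simp add: indicator_def)
  finally show ?thesis .
qed

abbreviation levy_kernel :: "real \<Rightarrow> real \<Rightarrow> complex" where
  "levy_kernel z x \<equiv> iexp (z * x) - 1 - \<i> * complex_of_real (z * x / (1 + x\<^sup>2))"

text \<open>Near 0 the compensator cancels the linear term: the second-order Taylor bound applies,
  and z x differs from the compensator by z x * x^2 / (1 + x^2). For large x all terms are
  bounded.\<close>

lemma norm_levy_kernel: "norm (levy_kernel z x) \<le> (z\<^sup>2 + \<bar>z\<bar> + 2) * trunc_sq x"
proof (cases "x\<^sup>2 \<le> 1")
  case True
  have "levy_kernel z x = (iexp (z * x) - (\<Sum>k\<le>1. (\<i> * complex_of_real (z * x)) ^ k / fact k)) + \<i> * complex_of_real (z * x * (x\<^sup>2 / (1 + x\<^sup>2)))"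
  proof -
    have "z * x - z * x / (1 + x\<^sup>2) = z * x * (x\<^sup>2 / (1 + x\<^sup>2))"
      using sum_power2_gt_zero_iff[of 1 x] by (simp add: field_simps)
    then have "complex_of_real (z * x) - complex_of_real (z * x / (1 + x\<^sup>2)) = complex_of_real (z * x * (x\<^sup>2 / (1 + x\<^sup>2)))"
      by (simp only: flip: of_real_diff)
    then have "\<i> * complex_of_real (z * x * (x\<^sup>2 / (1 + x\<^sup>2))) = \<i> * complex_of_real (z * x) - \<i> * complex_of_real (z * x / (1 + x\<^sup>2))"
      by (simp only: right_diff_distrib[symmetric])
    then show ?thesis by (simp only:) simp
  qed
  also have "norm \<dots> \<le> norm (iexp (z * x) - (\<Sum>k\<le>1. (\<i> * complex_of_real (z * x)) ^ k / fact k)) + norm (\<i> * complex_of_real (z * x * (x\<^sup>2 / (1 + x\<^sup>2))))"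
    by (rule norm_triangle_ineq)
  also have "\<dots> \<le> \<bar>z * x\<bar> ^ Suc 1 / fact (Suc 1) + \<bar>z\<bar> * x\<^sup>2"
  proof (rule add_mono[OF iexp_approx1])
    have "\<bar>x\<bar> \<le> 1" using True by (simp add: abs_square_le_1)
    have "x\<^sup>2 / (1 + x\<^sup>2) \<le> x\<^sup>2" by (simp add: divide_le_eq mult_left_mono add_pos_nonneg algebra_simps)
    then have "\<bar>x\<bar> * (x\<^sup>2 / (1 + x\<^sup>2)) \<le> 1 * x\<^sup>2"
      using \<open>\<bar>x\<bar> \<le> 1\<close> by (intro mult_mono) auto
    then have "\<bar>z\<bar> * (\<bar>x\<bar> * (x\<^sup>2 / (1 + x\<^sup>2))) \<le> \<bar>z\<bar> * (1 * x\<^sup>2)" by (intro mult_left_mono) auto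
    then show "norm (\<i> * complex_of_real (z * x * (x\<^sup>2 / (1 + x\<^sup>2)))) \<le> \<bar>z\<bar> * x\<^sup>2"
      by (simp add: norm_mult abs_mult mult.assoc del: of_real_mult of_real_divide)
  qed
  also have "\<dots> = (z\<^sup>2 / 2 + \<bar>z\<bar>) * x\<^sup>2" by (simp add: power_mult_distrib abs_mult power2_eq_square algebra_simps)
  also have "\<dots> \<le> (z\<^sup>2 + \<bar>z\<bar> + 2) * x\<^sup>2" by (intro mult_right_mono) auto
  finally show ?thesis using True by (simp add: trunc_sq_def)
next
  case False
  have "2 * \<bar>x\<bar> \<le> 1 + x\<^sup>2" using sum_squares_bound[of 1 "\<bar>x\<bar>"] by simp
  then have "\<bar>x\<bar> / (1 + x\<^sup>2) \<le> 1" by (simp add: divide_le_eq add_pos_nonneg)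
  then have b: "\<bar>z\<bar> * (\<bar>x\<bar> / (1 + x\<^sup>2)) \<le> \<bar>z\<bar> * 1" by (intro mult_left_mono) auto
  have "norm (levy_kernel z x) \<le> norm (iexp (z * x) - 1) + norm (\<i> * complex_of_real (z * x / (1 + x\<^sup>2)))"
    by (rule norm_triangle_ineq4)
  also have "norm (iexp (z * x) - 1) \<le> norm (iexp (z * x)) + norm (1 :: complex)" by (rule norm_triangle_ineq4)
  also have "norm (\<i> * complex_of_real (z * x / (1 + x\<^sup>2))) = \<bar>z\<bar> * (\<bar>x\<bar> / (1 + x\<^sup>2))"
    by (simp add: norm_mult abs_mult abs_of_nonneg del: of_real_mult of_real_divide)
  finally have "norm (levy_kernel z x) \<le> 2 + \<bar>z\<bar>" using b by simp
  also have "\<dots> \<le> z\<^sup>2 + \<bar>z\<bar> + 2" by simp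
  finally show ?thesis using False by (simp add: trunc_sq_def)
qed

lemma measurable_sets_borel: "sets \<nu> = sets borel \<Longrightarrow> f \<in> borel_measurable borel \<Longrightarrow> f \<in> borel_measurable \<nu>"
  by (simp cong: measurable_cong_sets)

lemma levy_measure_integrable_trunc_sq:
  assumes "levy_measure \<nu>" shows "integrable \<nu> trunc_sq"
proof (rule integrableI_nonneg)
  have s: "sets \<nu> = sets borel" and f: "(\<integral>\<^sup>+x. ennreal (min (x\<^sup>2) 1) \<partial>\<nu>) < \<infinity>"
    using assms by (auto simp: levy_measure_def)
  show "trunc_sq \<in> borel_measurable \<nu>" by (rule measurable_sets_borel[OF s borel_measurable_trunc_sq])
  show "(\<integral>\<^sup>+x. ennreal (trunc_sq x) \<partial>\<nu>) < \<infinity>" using f by (simp add: trunc_sq_def)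
qed simp

lemma levy_measure_integrable_kernel:
  assumes "levy_measure \<nu>" shows "integrable \<nu> (levy_kernel z)"
proof (rule Bochner_Integration.integrable_bound)
  have s: "sets \<nu> = sets borel" using assms by (simp add: levy_measure_def)
  show "integrable \<nu> (\<lambda>x. (z\<^sup>2 + \<bar>z\<bar> + 2) * trunc_sq x)"
    by (intro integrable_mult_right levy_measure_integrable_trunc_sq assms)
  show "AE x in \<nu>. norm (levy_kernel z x) \<le> norm ((z\<^sup>2 + \<bar>z\<bar> + 2) * trunc_sq x)"
    by (intro AE_I2 order_trans[OF norm_levy_kernel]) simp
  show "levy_kernel z \<in> borel_measurable \<nu>"
    by (rule measurable_sets_borel[OF s]) measurable
qed

lemma Re_levy_kernel: "Re (levy_kernel z x) = - (1 - cos (z * x))"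
  by (simp add: Re_exp)

lemma Im_levy_kernel: "Im (levy_kernel z x) = sin (z * x) - z * x / (1 + x\<^sup>2)"
proof -
  have "Im (\<i> * complex_of_real a) = a" for a by simp
  then show ?thesis by (simp only: minus_complex.simps Im_exp) simp
qed

lemma integral_Re_levy_kernel:
  assumes "levy_measure \<nu>" shows "Re (CLINT x|\<nu>. levy_kernel z x) = - cos_exponent \<nu> z"
    and "integrable \<nu> (\<lambda>x. 1 - cos (z * x))"
proof -
  note int = levy_measure_integrable_kernel[OF assms, of z]
  have "Re (CLINT x|\<nu>. levy_kernel z x) = (\<integral>x. Re (levy_kernel z x) \<partial>\<nu>)"
    by (rule integral_Re[OF int, symmetric])
  then show "Re (CLINT x|\<nu>. levy_kernel z x) = - cos_exponent \<nu> z"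
    unfolding Re_levy_kernel cos_exponent_def by (simp only: integral_minus)
  have "integrable \<nu> (\<lambda>x. - Re (levy_kernel z x))" by (intro integrable_minus integrable_Re int)
  then show "integrable \<nu> (\<lambda>x. 1 - cos (z * x))" unfolding Re_levy_kernel by simp
qed

lemma norm_char_triplet:
  assumes "has_generating_triplet \<mu> A \<nu> \<gamma>"
  shows "norm (char \<mu> z) = exp (- (A * z\<^sup>2 / 2) - cos_exponent \<nu> z)"
proof -
  have "norm (char \<mu> z) = exp (Re (- complex_of_real (A * z\<^sup>2 / 2) + \<i> * complex_of_real (\<gamma> * z) + (CLINT x|\<nu>. levy_kernel z x)))"
    using assms by (simp only: has_generating_triplet_def norm_exp_eq_Re)
  moreover have "Re (CLINT x|\<nu>. levy_kernel z x) = - cos_exponent \<nu> z"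
    using assms by (intro integral_Re_levy_kernel) (simp add: has_generating_triplet_def)
  ultimately show ?thesis by (simp only: plus_complex.simps uminus_complex.simps Re_complex_of_real) simp
qed

text \<open>The Gaussian variance is determined by the decay of the characteristic function, since the
  jumps contribute only \<open>o(z^2)\<close> to its logarithm.\<close>

lemma triplet_no_Gaussian:
  assumes t: "has_generating_triplet \<mu> A \<nu> \<gamma>" and t': "has_generating_triplet \<mu> 0 \<nu>' \<gamma>'"
  shows "A = 0"
proof -
  have l': "levy_measure \<nu>'" and A: "0 \<le> A" using t t' by (auto simp: has_generating_triplet_def)
  have s: "sets \<nu>' = sets borel" using l' by (simp add: levy_measure_def)
  have nn: "0 \<le> cos_exponent \<nu> z" for z by (simp add: cos_exponent_def)
  \<comment> \<open>Moduli remove the drifts; as the jump part of the first triplet is nonnegative,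
    A z^2 / 2 is bounded by the jump exponent of the second.\<close>
  have "A * z\<^sup>2 / 2 + cos_exponent \<nu> z = cos_exponent \<nu>' z" for z
    using norm_char_triplet[OF t, of z] norm_char_triplet[OF t', of z] by simp
  then have le: "A * z\<^sup>2 / 2 \<le> cos_exponent \<nu>' z" for z using nn[of z] by (metis add_increasing2 order_refl)
  have "(\<lambda>n. \<integral>x. (1 - cos (real (Suc n) * x)) / (real (Suc n))\<^sup>2 \<partial>\<nu>') \<longlonglongrightarrow> (\<integral>x. 0 \<partial>\<nu>')"
  proof (rule integral_dominated_convergence[where w = "\<lambda>x. 2 * trunc_sq x"])
    show "integrable \<nu>' (\<lambda>x. 2 * trunc_sq x)" by (intro integrable_mult_right levy_measure_integrable_trunc_sq l')
    show "AE x in \<nu>'. (\<lambda>n. (1 - cos (real (Suc n) * x)) / (real (Suc n))\<^sup>2) \<longlonglongrightarrow> 0"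
    proof (rule AE_I2)
      fix x
      have "(\<lambda>n. inverse (real (Suc n))) \<longlonglongrightarrow> 0" by (rule LIMSEQ_inverse_real_of_nat)
      then have l: "(\<lambda>n. 2 * (inverse (real (Suc n)) * inverse (real (Suc n)))) \<longlonglongrightarrow> 2 * (0 * 0)" by (intro tendsto_intros)
      show "(\<lambda>n. (1 - cos (real (Suc n) * x)) / (real (Suc n))\<^sup>2) \<longlonglongrightarrow> 0"
      proof (rule Lim_null_comparison)
        show "(\<lambda>n. 2 * (inverse (real (Suc n)) * inverse (real (Suc n)))) \<longlonglongrightarrow> 0" using l by simp
        have "1 - cos (real (Suc n) * x) \<le> 2" for n using cos_ge_minus_one[of "real (Suc n) * x"] by linarith
        then have "(1 - cos (real (Suc n) * x)) / (real (Suc n))\<^sup>2 \<le> 2 / (real (Suc n))\<^sup>2" for n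
          by (intro divide_right_mono) auto
        then show "\<forall>\<^sub>F n in sequentially. norm ((1 - cos (real (Suc n) * x)) / (real (Suc n))\<^sup>2) \<le> 2 * (inverse (real (Suc n)) * inverse (real (Suc n)))"
          by (intro always_eventually allI) (simp add: divide_inverse power2_eq_square)
      qed
    qed
    show "AE x in \<nu>'. norm ((1 - cos (real (Suc n) * x)) / (real (Suc n))\<^sup>2) \<le> 2 * trunc_sq x" for n
    proof (rule AE_I2)
      fix x
      have one: "1 \<le> (real (Suc n))\<^sup>2" by (rule one_le_power) simp
      have "1 - cos (real (Suc n) * x) \<le> 2 * (max 1 ((real (Suc n))\<^sup>2) * trunc_sq x)"
        using one_minus_cos_le_trunc_sq[of "real (Suc n) * x"] trunc_sq_scale[of "real (Suc n)" x] by linarith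
      also have "max 1 ((real (Suc n))\<^sup>2) = (real (Suc n))\<^sup>2" using one by simp
      finally have "(1 - cos (real (Suc n) * x)) / (real (Suc n))\<^sup>2 \<le> 2 * ((real (Suc n))\<^sup>2 * trunc_sq x) / (real (Suc n))\<^sup>2"
        by (rule divide_right_mono) simp
      also have "\<dots> = 2 * trunc_sq x" by simp
      finally show "norm ((1 - cos (real (Suc n) * x)) / (real (Suc n))\<^sup>2) \<le> 2 * trunc_sq x" by simp
    qed
  qed (auto intro!: measurable_sets_borel[OF s])
  then have lim: "(\<lambda>n. cos_exponent \<nu>' (real (Suc n)) / (real (Suc n))\<^sup>2) \<longlonglongrightarrow> 0"
    by (simp add: cos_exponent_def)
  have "A / 2 \<le> cos_exponent \<nu>' (real (Suc n)) / (real (Suc n))\<^sup>2" for n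
  proof -
    have "(A * (real (Suc n))\<^sup>2 / 2) / (real (Suc n))\<^sup>2 \<le> cos_exponent \<nu>' (real (Suc n)) / (real (Suc n))\<^sup>2"
      by (rule divide_right_mono[OF le]) simp
    then show ?thesis by simp
  qed
  then have "A / 2 \<le> 0" using lim by (intro LIMSEQ_le_const) auto
  with A show ?thesis by simp
qed

lemma char_uminus:
  assumes "real_distribution \<mu>" shows "char (distr \<mu> borel uminus) z = char \<mu> (- z)"
proof -
  interpret real_distribution \<mu> by fact
  show ?thesis unfolding char_def by (subst integral_distr) auto
qed

text \<open>Symmetry makes the characteristic function real, and its modulus is known from the
  triplet; only the sign is open. Working with the modulus makes it immaterial whether \<nu> itself
  is symmetric or \<gamma> is 0.\<close>

lemma char_symmetric_triplet:
  assumes \<mu>: "real_distribution \<mu>" and sym: "symmetric_distribution \<mu>" and t: "has_generating_triplet \<mu> 0 \<nu> \<gamma>"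
  shows "char \<mu> z = exp (- complex_of_real (cos_exponent \<nu> z))"
proof -
  interpret real_distribution \<mu> by fact
  have even: "char \<mu> (- z) = char \<mu> z" for z
    using char_uminus[OF \<mu>, of z] sym by (simp add: symmetric_distribution_def)
  have cnj: "char \<mu> (- z) = cnj (char \<mu> z)" for z
  proof -
    have "char \<mu> (- z) = (CLINT x|\<mu>. cnj (iexp (z * x)))"
      unfolding char_def by (intro Bochner_Integration.integral_cong refl) (simp add: exp_cnj)
    also have "\<dots> = cnj (char \<mu> z)" unfolding char_def by (rule Bochner_Integration.integral_cnj)
    finally show ?thesis .
  qed
  have real: "Im (char \<mu> z) = 0" for z
    using even[of z] cnj[of z] by (simp add: complex_eq_iff)
  have norm: "norm (char \<mu> z) = exp (- cos_exponent \<nu> z)" for z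
    using norm_char_triplet[OF t, of z] by simp
  have abs: "\<bar>Re (char \<mu> z)\<bar> = exp (- cos_exponent \<nu> z)" for z
    using norm[of z] real[of z] by (simp add: cmod_eq_Re)
  \<comment> \<open>It equals 1 at 0, is continuous and, by its modulus, never 0, so it cannot
    change sign.\<close>
  have pos: "0 < Re (char \<mu> z)" if z: "0 \<le> z" for z
  proof (rule ccontr)
    assume "\<not> 0 < Re (char \<mu> z)"
    moreover have "Re (char \<mu> 0) = 1" by (simp add: char_zero)
    moreover have "continuous_on {0..z} (\<lambda>z. Re (char \<mu> z))"
      by (intro continuous_at_imp_continuous_on ballI isCont_Re isCont_char)
    ultimately obtain x where "Re (char \<mu> x) = 0"
      using IVT2'[of "\<lambda>z. Re (char \<mu> z)" z 0 0] z by auto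
    then show False using abs[of x] by simp
  qed
  have "0 < Re (char \<mu> z)" using pos[of z] pos[of "- z"] even[of z] by (cases "0 \<le> z") auto
  then have "char \<mu> z = complex_of_real (exp (- cos_exponent \<nu> z))"
    using abs[of z] real[of z] by (simp add: complex_eq_iff)
  then show ?thesis by (simp flip: exp_of_real)
qed

section \<open>Infinite divisibility\<close>

lemma real_distribution_convolution:
  assumes "real_distribution A" "real_distribution B"
  shows "real_distribution (convolution A B)"
    and "char (convolution A B) z = char A z * char B z"
proof -
  interpret A: real_distribution A by fact
  interpret B: real_distribution B by fact
  interpret pair_prob_space A B ..
  have m: "(\<lambda>(x, y). x + y) \<in> measurable (A \<Otimes>\<^sub>M B) borel" by measurable
  show "real_distribution (convolution A B)"
    unfolding convolution_def by (rule real_distribution_distr[OF m])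
  have int: "integrable (A \<Otimes>\<^sub>M B) (\<lambda>(x, y). iexp (z * (x + y)))"
    by (intro integrable_const_bound[of _ 1]) auto
  have "char (convolution A B) z = (\<integral>u. iexp (z * (case u of (x, y) \<Rightarrow> x + y)) \<partial>(A \<Otimes>\<^sub>M B))"
    unfolding char_def convolution_def by (rule integral_distr[OF m]) auto
  also have "\<dots> = (\<integral>(x, y). iexp (z * (x + y)) \<partial>(A \<Otimes>\<^sub>M B))" by (simp add: case_prod_unfold)
  also have "\<dots> = (\<integral>x. \<integral>y. iexp (z * (x + y)) \<partial>B \<partial>A)"
    using integral_fst[OF int] by simp
  also have "\<dots> = (\<integral>x. iexp (z * x) * (\<integral>y. iexp (z * y) \<partial>B) \<partial>A)"
    by (simp add: distrib_left exp_add)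
  also have "\<dots> = char A z * char B z" by (simp add: char_def)
  finally show "char (convolution A B) z = char A z * char B z" .
qed

lemma convolution_power_char:
  assumes "real_distribution \<rho>"
  shows "real_distribution (convolution_power \<rho> n) \<and> char (convolution_power \<rho> n) z = char \<rho> z ^ n"
proof (induction n)
  case 0
  have "real_distribution (return borel (0::real))"
    by (simp add: real_distribution_def real_distribution_axioms_def prob_space_return)
  then show ?case by (simp add: char_def integral_return)
next
  case (Suc n)
  then show ?case using real_distribution_convolution[OF assms, of "convolution_power \<rho> n"] by simp
qed

section \<open>The Levy measure of an improper integral\<close>

lemma sets_nu_Y [simp, measurable_cong]: "sets (nu_Y \<alpha>) = sets borel"
  by (simp add: nu_Y_def)

text \<open>The jump density is even, so the sine part of the exponent integrates to 0.\<close>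

lemma compound_poisson_imp_symmetric_levy:
  assumes "compound_poisson_process M Y (nu_Y \<alpha>)"
  shows "symmetric_levy_process M Y (nu_Y \<alpha>)"
proof -
  interpret compound_poisson_process M Y "nu_Y \<alpha>" by fact
  have "finite_measure (nu_Y \<alpha>)"
    using finite_nu by (intro finite_measureI) (simp add: nu_Y_def)
  then interpret N: finite_borel_measure "nu_Y \<alpha>"
    by (simp add: finite_borel_measure_def finite_borel_measure_axioms_def)
  show ?thesis
  proof
    fix t z :: real assume t: "0 \<le> t"
    let ?d = "\<lambda>x. \<bar>x\<bar> powr (\<alpha> - 1) * exp (- (\<bar>x\<bar> powr \<alpha>))"
    have int: "integrable (nu_Y \<alpha>) (\<lambda>x. iexp (z * x) - 1)"
      by (intro Bochner_Integration.integrable_diff N.integrable_const_bound[of "\<lambda>x. iexp (z * x)" 1] N.integrable_const) auto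
    have "(CLINT x|nu_Y \<alpha>. iexp (z * x) - 1) = - complex_of_real (cos_exponent (nu_Y \<alpha>) z)"
    proof (rule complex_eqI)
      have "Re (CLINT x|nu_Y \<alpha>. iexp (z * x) - 1) = (\<integral>x. Re (iexp (z * x) - 1) \<partial>nu_Y \<alpha>)"
        by (rule integral_Re[OF int, symmetric])
      also have "\<dots> = (\<integral>x. - (1 - cos (z * x)) \<partial>nu_Y \<alpha>)" by (simp add: Re_exp)
      finally show "Re (CLINT x|nu_Y \<alpha>. iexp (z * x) - 1) = Re (- complex_of_real (cos_exponent (nu_Y \<alpha>) z))"
        unfolding cos_exponent_def by (simp only: integral_minus uminus_complex.simps Re_complex_of_real)
      have "Im (CLINT x|nu_Y \<alpha>. iexp (z * x) - 1) = (\<integral>x. Im (iexp (z * x) - 1) \<partial>nu_Y \<alpha>)"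
        by (rule integral_Im[OF int, symmetric])
      also have "\<dots> = (\<integral>x. sin (z * x) \<partial>nu_Y \<alpha>)" by (simp add: Im_exp)
      also have "\<dots> = (\<integral>x. ?d x *\<^sub>R sin (z * x) \<partial>lborel)"
        unfolding nu_Y_def by (rule integral_density) auto
      also have "\<dots> = 0" by (rule integral_odd_eq_0) simp
      finally show "Im (CLINT x|nu_Y \<alpha>. iexp (z * x) - 1) = Im (- complex_of_real (cos_exponent (nu_Y \<alpha>) z))" by simp
    qed
    then show "char (distr M borel (Y t)) z = exp (- complex_of_real (t * cos_exponent (nu_Y \<alpha>) z))"
      using char_process[OF t, of z] by simp
  qed
qed

text \<open>The function k of the overview, set to 0 rather than infinity where the integrand
  vanishes, so that such times contribute nothing.\<close>

definition jump_weight :: "real \<Rightarrow> (real \<Rightarrow> real) \<Rightarrow> real \<Rightarrow> real" where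
  "jump_weight \<alpha> H t = (if H t = 0 then 0 else \<bar>H t\<bar> powr (- \<alpha>))"

text \<open>The function g of the overview, with values in \<open>ennreal\<close> so that Tonelli
  applies before finiteness is known.\<close>

definition jump_density :: "real \<Rightarrow> (real \<Rightarrow> real) \<Rightarrow> real \<Rightarrow> ennreal" where
  "jump_density \<alpha> H u = (\<integral>\<^sup>+t. ennreal (jump_weight \<alpha> H t * exp (- u * jump_weight \<alpha> H t)) \<partial>lborel)"

lemma jump_weight_nonneg: "0 \<le> jump_weight \<alpha> H t"
  by (simp add: jump_weight_def)

lemma measurable_jump_weight [measurable]:
  assumes [measurable]: "H \<in> borel_measurable borel"
  shows "jump_weight \<alpha> H \<in> borel_measurable borel"
  unfolding jump_weight_def by measurable

lemma measurable_jump_density [measurable]: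
  assumes [measurable]: "H \<in> borel_measurable borel"
  shows "jump_density \<alpha> H \<in> borel_measurable borel"
  unfolding jump_density_def by measurable

lemma jump_density_antimono: "u \<le> v \<Longrightarrow> jump_density \<alpha> H v \<le> jump_density \<alpha> H u"
  unfolding jump_density_def
  by (intro nn_integral_mono ennreal_leI mult_left_mono) (auto simp: jump_weight_nonneg intro: mult_right_mono)

text \<open>The substitution y = w x. The Jacobian and the factor |w|^(1-\<alpha>) combine to
  |w|^(-\<alpha>), the same quantity that scales |y|^\<alpha> in the exponential; thus weight and
  rate of the Laplace transform coincide.\<close>

lemma nn_integral_nu_Y_scaled:
  fixes F :: "real \<Rightarrow> ennreal"
  assumes [measurable]: "F \<in> borel_measurable borel" and w: "w \<noteq> 0"
  shows "(\<integral>\<^sup>+x. F (w * x) \<partial>nu_Y \<alpha>)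
    = (\<integral>\<^sup>+y. F y * ennreal (\<bar>y\<bar> powr (\<alpha> - 1) * (\<bar>w\<bar> powr (- \<alpha>) * exp (- (\<bar>y\<bar> powr \<alpha>) * \<bar>w\<bar> powr (- \<alpha>)))) \<partial>lborel)"
proof -
  let ?f = "\<lambda>y. F y * ennreal (\<bar>y\<bar> powr (\<alpha> - 1) * (\<bar>w\<bar> powr (- \<alpha>) * exp (- (\<bar>y\<bar> powr \<alpha>) * \<bar>w\<bar> powr (- \<alpha>))))"
  have "(\<integral>\<^sup>+y. ?f y \<partial>lborel) = \<bar>w\<bar> * (\<integral>\<^sup>+x. ?f (0 + w * x) \<partial>lborel)"
    by (rule nn_integral_real_affine) (measurable, rule w)
  also have "\<dots> = (\<integral>\<^sup>+x. \<bar>w\<bar> * ?f (w * x) \<partial>lborel)"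
    by (subst nn_integral_cmult) auto
  also have "\<dots> = (\<integral>\<^sup>+x. ennreal (\<bar>x\<bar> powr (\<alpha> - 1) * exp (- (\<bar>x\<bar> powr \<alpha>))) * F (w * x) \<partial>lborel)"
  proof (rule nn_integral_cong)
    fix x :: real
    have c1: "\<bar>w\<bar> * (\<bar>w\<bar> powr (\<alpha> - 1) * \<bar>w\<bar> powr (- \<alpha>)) = 1"
    proof -
      have "\<bar>w\<bar> * (\<bar>w\<bar> powr (\<alpha> - 1) * \<bar>w\<bar> powr (- \<alpha>)) = \<bar>w\<bar> powr 1 * (\<bar>w\<bar> powr (\<alpha> - 1) * \<bar>w\<bar> powr (- \<alpha>))" by simp
      also have "\<dots> = \<bar>w\<bar> powr (1 + (\<alpha> - 1 + - \<alpha>))" by (simp only: powr_add)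
      finally show ?thesis using w by simp
    qed
    have c2: "\<bar>w * x\<bar> powr \<alpha> * \<bar>w\<bar> powr (- \<alpha>) = \<bar>x\<bar> powr \<alpha>"
    proof -
      have "\<bar>w * x\<bar> powr \<alpha> * \<bar>w\<bar> powr (- \<alpha>) = \<bar>x\<bar> powr \<alpha> * (\<bar>w\<bar> powr \<alpha> * \<bar>w\<bar> powr (- \<alpha>))"
        by (simp add: abs_mult powr_mult mult_ac)
      also have "\<bar>w\<bar> powr \<alpha> * \<bar>w\<bar> powr (- \<alpha>) = 1" using w by (simp flip: powr_add)
      finally show ?thesis by simp
    qed
    have "\<bar>w\<bar> * (\<bar>w * x\<bar> powr (\<alpha> - 1) * (\<bar>w\<bar> powr (- \<alpha>) * exp (- (\<bar>w * x\<bar> powr \<alpha>) * \<bar>w\<bar> powr (- \<alpha>))))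
        = (\<bar>w\<bar> * (\<bar>w\<bar> powr (\<alpha> - 1) * \<bar>w\<bar> powr (- \<alpha>))) * (\<bar>x\<bar> powr (\<alpha> - 1) * exp (- (\<bar>w * x\<bar> powr \<alpha> * \<bar>w\<bar> powr (- \<alpha>))))"
      by (simp add: abs_mult powr_mult mult_ac)
    also have "\<dots> = \<bar>x\<bar> powr (\<alpha> - 1) * exp (- (\<bar>x\<bar> powr \<alpha>))" by (simp only: c1 c2 mult_1)
    finally have e: "\<bar>w\<bar> * (\<bar>w * x\<bar> powr (\<alpha> - 1) * (\<bar>w\<bar> powr (- \<alpha>) * exp (- (\<bar>w * x\<bar> powr \<alpha>) * \<bar>w\<bar> powr (- \<alpha>))))
        = \<bar>x\<bar> powr (\<alpha> - 1) * exp (- (\<bar>x\<bar> powr \<alpha>))" .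
    have "ennreal \<bar>w\<bar> * ?f (w * x) = F (w * x) * (ennreal \<bar>w\<bar> * ennreal (\<bar>w * x\<bar> powr (\<alpha> - 1) * (\<bar>w\<bar> powr (- \<alpha>) * exp (- (\<bar>w * x\<bar> powr \<alpha>) * \<bar>w\<bar> powr (- \<alpha>)))))"
      by (simp only: mult_ac)
    also have "\<dots> = F (w * x) * ennreal (\<bar>x\<bar> powr (\<alpha> - 1) * exp (- (\<bar>x\<bar> powr \<alpha>)))"
      by (simp only: ennreal_mult'[OF abs_ge_zero, symmetric] e)
    finally show "ennreal \<bar>w\<bar> * ?f (w * x) = ennreal (\<bar>x\<bar> powr (\<alpha> - 1) * exp (- (\<bar>x\<bar> powr \<alpha>))) * F (w * x)"
      by (simp only: mult.commute)
  qed
  also have "\<dots> = (\<integral>\<^sup>+x. F (w * x) \<partial>nu_Y \<alpha>)"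
    unfolding nu_Y_def by (rule nn_integral_density[symmetric]) measurable
  finally show ?thesis by simp
qed

text \<open>Tonelli after rescaling at each time; F 0 = 0 discards the times at which H vanishes.
  Taking \<open>trunc_sq\<close> for F yields the integrability criterion, 1 - cos the
  exponent.\<close>

lemma nn_integral_jumps:
  fixes F :: "real \<Rightarrow> ennreal"
  assumes F [measurable]: "F \<in> borel_measurable borel" and F0: "F 0 = 0" and H [measurable]: "H \<in> borel_measurable borel"
    and fin: "finite_measure (nu_Y \<alpha>)"
  shows "(\<integral>\<^sup>+t. \<integral>\<^sup>+x. F (H t * x) \<partial>nu_Y \<alpha> \<partial>lborel)
    = (\<integral>\<^sup>+y. F y * ennreal (\<bar>y\<bar> powr (\<alpha> - 1)) * jump_density \<alpha> H (\<bar>y\<bar> powr \<alpha>) \<partial>lborel)"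
proof -
  let ?k = "jump_weight \<alpha> H"
  have "(\<integral>\<^sup>+t. \<integral>\<^sup>+x. F (H t * x) \<partial>nu_Y \<alpha> \<partial>lborel)
      = (\<integral>\<^sup>+t. \<integral>\<^sup>+y. F y * ennreal (\<bar>y\<bar> powr (\<alpha> - 1)) * ennreal (?k t * exp (- (\<bar>y\<bar> powr \<alpha>) * ?k t)) \<partial>lborel \<partial>lborel)"
  proof (rule nn_integral_cong)
    fix t
    show "(\<integral>\<^sup>+x. F (H t * x) \<partial>nu_Y \<alpha>)
      = (\<integral>\<^sup>+y. F y * ennreal (\<bar>y\<bar> powr (\<alpha> - 1)) * ennreal (?k t * exp (- (\<bar>y\<bar> powr \<alpha>) * ?k t)) \<partial>lborel)"
    proof (cases "H t = 0")
      case True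
      then show ?thesis by (simp add: F0 jump_weight_def)
    next
      case False
      then have k: "?k t = \<bar>H t\<bar> powr (- \<alpha>)" by (simp add: jump_weight_def)
      show ?thesis
        unfolding nn_integral_nu_Y_scaled[OF F False] k
        by (intro nn_integral_cong) (simp add: ennreal_mult' mult.assoc)
    qed
  qed
  also have "\<dots> = (\<integral>\<^sup>+y. \<integral>\<^sup>+t. F y * ennreal (\<bar>y\<bar> powr (\<alpha> - 1)) * ennreal (?k t * exp (- (\<bar>y\<bar> powr \<alpha>) * ?k t)) \<partial>lborel \<partial>lborel)"
    by (rule lborel_pair.Fubini') measurable
  also have "\<dots> = (\<integral>\<^sup>+y. F y * ennreal (\<bar>y\<bar> powr (\<alpha> - 1)) * jump_density \<alpha> H (\<bar>y\<bar> powr \<alpha>) \<partial>lborel)"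
    unfolding jump_density_def by (intro nn_integral_cong nn_integral_cmult) measurable
  finally show ?thesis .
qed

lemma (in symmetric_levy_process) nn_integral_exponents:
  assumes N: "N = nu_Y \<alpha>" and H: "H \<in> borel_measurable borel"
  shows "(\<integral>\<^sup>+t. ennreal (trunc_exponent N (H t)) \<partial>lborel)
      = (\<integral>\<^sup>+y. ennreal (trunc_sq y) * ennreal (\<bar>y\<bar> powr (\<alpha> - 1)) * jump_density \<alpha> H (\<bar>y\<bar> powr \<alpha>) \<partial>lborel)"
    and "(\<integral>\<^sup>+t. ennreal (cos_exponent N (z * H t)) \<partial>lborel)
      = (\<integral>\<^sup>+y. ennreal (1 - cos (z * y)) * ennreal (\<bar>y\<bar> powr (\<alpha> - 1)) * jump_density \<alpha> H (\<bar>y\<bar> powr \<alpha>) \<partial>lborel)"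
proof -
  have fin: "finite_measure (nu_Y \<alpha>)" using N.finite_measure_axioms N by simp
  have "(\<integral>\<^sup>+t. ennreal (trunc_exponent N (H t)) \<partial>lborel) = (\<integral>\<^sup>+t. \<integral>\<^sup>+x. ennreal (trunc_sq (H t * x)) \<partial>N \<partial>lborel)"
    unfolding trunc_exponent_def
    by (intro nn_integral_cong nn_integral_eq_integral[symmetric] N.integrable_trunc_sq_scaled) auto
  also have "\<dots> = (\<integral>\<^sup>+y. ennreal (trunc_sq y) * ennreal (\<bar>y\<bar> powr (\<alpha> - 1)) * jump_density \<alpha> H (\<bar>y\<bar> powr \<alpha>) \<partial>lborel)"
    unfolding N by (rule nn_integral_jumps[OF _ _ H fin, of "\<lambda>y. ennreal (trunc_sq y)"]) auto
  finally show "(\<integral>\<^sup>+t. ennreal (trunc_exponent N (H t)) \<partial>lborel)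
      = (\<integral>\<^sup>+y. ennreal (trunc_sq y) * ennreal (\<bar>y\<bar> powr (\<alpha> - 1)) * jump_density \<alpha> H (\<bar>y\<bar> powr \<alpha>) \<partial>lborel)" .
  have "(\<integral>\<^sup>+t. ennreal (cos_exponent N (z * H t)) \<partial>lborel) = (\<integral>\<^sup>+t. \<integral>\<^sup>+x. ennreal (1 - cos (z * (H t * x))) \<partial>N \<partial>lborel)"
    unfolding cos_exponent_def mult.assoc[of z, symmetric]
    by (intro nn_integral_cong nn_integral_eq_integral[symmetric] N.integrable_one_minus_cos) auto
  also have "\<dots> = (\<integral>\<^sup>+y. ennreal (1 - cos (z * y)) * ennreal (\<bar>y\<bar> powr (\<alpha> - 1)) * jump_density \<alpha> H (\<bar>y\<bar> powr \<alpha>) \<partial>lborel)"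
    unfolding N by (rule nn_integral_jumps[OF _ _ H fin, of "\<lambda>y. ennreal (1 - cos (z * y))"]) auto
  finally show "(\<integral>\<^sup>+t. ennreal (cos_exponent N (z * H t)) \<partial>lborel)
      = (\<integral>\<^sup>+y. ennreal (1 - cos (z * y)) * ennreal (\<bar>y\<bar> powr (\<alpha> - 1)) * jump_density \<alpha> H (\<bar>y\<bar> powr \<alpha>) \<partial>lborel)" .
qed

lemma trunc_sq_mult_powr:
  assumes "0 < r"
  shows "min (r powr (\<alpha> + 1)) (r powr (\<alpha> - 1)) = trunc_sq r * r powr (\<alpha> - 1)"
proof -
  have "r powr (\<alpha> + 1) = r powr (2 + (\<alpha> - 1))" by (simp add: add.commute)
  also have "\<dots> = r\<^sup>2 * r powr (\<alpha> - 1)" unfolding powr_add using assms by simp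
  finally show ?thesis unfolding trunc_sq_def by (simp add: min_mult_distrib_right)
qed

text \<open>The integral makes the density finite almost everywhere, hence at some point below u,
  and the density is nonincreasing.\<close>

lemma jump_density_finite:
  assumes H [measurable]: "H \<in> borel_measurable borel" and \<alpha>: "0 < \<alpha>" and u: "0 < u"
    and fin: "(\<integral>\<^sup>+y. ennreal (trunc_sq y) * ennreal (\<bar>y\<bar> powr (\<alpha> - 1)) * jump_density \<alpha> H (\<bar>y\<bar> powr \<alpha>) \<partial>lborel) < \<infinity>"
  shows "jump_density \<alpha> H u < \<infinity>"
proof -
  have "AE y in lborel. ennreal (trunc_sq y) * ennreal (\<bar>y\<bar> powr (\<alpha> - 1)) * jump_density \<alpha> H (\<bar>y\<bar> powr \<alpha>) \<noteq> \<infinity>"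
    using fin by (intro nn_integral_PInf_AE) auto
  then obtain Z where Z: "{y. \<not> (ennreal (trunc_sq y) * ennreal (\<bar>y\<bar> powr (\<alpha> - 1)) * jump_density \<alpha> H (\<bar>y\<bar> powr \<alpha>) \<noteq> \<infinity>)} \<subseteq> Z"
      "emeasure lborel Z = 0" "Z \<in> sets lborel"
    by (rule AE_E) auto
  have "\<not> {0<..<u powr (1 / \<alpha>)} \<subseteq> Z"
  proof
    assume "{0<..<u powr (1 / \<alpha>)} \<subseteq> Z"
    then have "emeasure lborel {0<..<u powr (1 / \<alpha>)} \<le> emeasure lborel Z" using Z(3) by (rule emeasure_mono)
    then show False using Z(2) u by simp
  qed
  then obtain y where y: "0 < y" "y < u powr (1 / \<alpha>)" "y \<notin> Z" unfolding subset_iff by auto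
  have "y powr \<alpha> \<le> (u powr (1 / \<alpha>)) powr \<alpha>" using y \<alpha> by (intro powr_mono2) auto
  then have le: "y powr \<alpha> \<le> u" using u \<alpha> by (simp add: powr_powr)
  have "ennreal (trunc_sq y) * ennreal (y powr (\<alpha> - 1)) * jump_density \<alpha> H (y powr \<alpha>) \<noteq> \<infinity>"
  proof -
    have "\<not> \<not> (ennreal (trunc_sq y) * ennreal (\<bar>y\<bar> powr (\<alpha> - 1)) * jump_density \<alpha> H (\<bar>y\<bar> powr \<alpha>) \<noteq> \<infinity>)"
      using y(3) Z(1) by blast
    then show ?thesis using y(1) by simp
  qed
  moreover have "ennreal (trunc_sq y) * ennreal (y powr (\<alpha> - 1)) \<noteq> 0"
    using y(1) by (simp add: trunc_sq_def min_def)
  ultimately have "jump_density \<alpha> H (y powr \<alpha>) \<noteq> \<infinity>" by (auto simp: ennreal_mult_eq_top_iff)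
  then show ?thesis
    using jump_density_antimono[OF le, of \<alpha> H] by (auto simp: top.not_eq_extremum)
qed

lemma completely_monotone_jump_density:
  assumes H [measurable]: "H \<in> borel_measurable borel"
    and fin: "\<And>u. 0 < u \<Longrightarrow> jump_density \<alpha> H u < \<infinity>"
  shows "completely_monotone (\<lambda>u. enn2real (jump_density \<alpha> H u))"
proof (rule completely_monotone_Laplace[where N = lborel and w = "jump_weight \<alpha> H" and k = "jump_weight \<alpha> H"])
  fix u :: real assume "0 < u"
  show "integrable lborel (\<lambda>t. jump_weight \<alpha> H t * exp (- u * jump_weight \<alpha> H t))"
    using fin[OF \<open>0 < u\<close>] unfolding jump_density_def
    by (intro integrableI_nonneg) (auto simp: jump_weight_nonneg)
  show "enn2real (jump_density \<alpha> H u) = (\<integral>t. jump_weight \<alpha> H t * exp (- u * jump_weight \<alpha> H t) \<partial>lborel)"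
    unfolding jump_density_def by (rule integral_eq_nn_integral[symmetric]) (auto simp: jump_weight_nonneg)
qed (auto simp: jump_weight_nonneg)

text \<open>The Levy density is even, so the compensated integral is real and equals the negated
  exponent of the integral. The triplet therefore has drift 0, and one g serves for both
  directions.\<close>

lemma (in symmetric_levy_process) law_in_E_class0_sym:
  assumes N: "N = nu_Y \<alpha>" and \<alpha>: "0 < \<alpha>" and h: "h \<in> Dom M Y"
  shows "law M (improper_integral M Y h) \<in> E_class0_sym \<alpha>"
proof -
  define H where "H = half_line_cut h"
  have hm: "set_borel_measurable borel {0<..} h" and "exponent_finite h" using h Dom_iff by auto
  then have H [measurable]: "H \<in> borel_measurable borel" and fin: "integrable lborel (\<lambda>t. trunc_exponent N (H t))"
    by (auto simp: H_def exponent_finite_def measurable_half_line_cut)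
  define \<mu> where "\<mu> = law M (improper_integral M Y h)"
  have \<mu>: "real_distribution \<mu>" "\<And>z. char \<mu> z = exp (- complex_of_real (\<integral>t. cos_exponent N (z * H t) \<partial>lborel))"
    "\<And>z. integrable lborel (\<lambda>t. cos_exponent N (z * H t))"
    unfolding \<mu>_def H_def using law_improper_integral[OF h] by auto
  define J where "J = jump_density \<alpha> H"
  define g where "g u = enn2real (J u)" for u
  have J [measurable]: "J \<in> borel_measurable borel" unfolding J_def by measurable
  have g [measurable]: "g \<in> borel_measurable borel" unfolding g_def by measurable
  have T: "(\<integral>\<^sup>+y. ennreal (trunc_sq y) * ennreal (\<bar>y\<bar> powr (\<alpha> - 1)) * J (\<bar>y\<bar> powr \<alpha>) \<partial>lborel) < \<infinity>"
    unfolding J_def nn_integral_exponents(1)[OF N H, symmetric]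
    using nn_integral_eq_integral[OF fin] by (simp add: N.trunc_exponent_nonneg)
  have Jfin: "J u < \<infinity>" if "0 < u" for u
    unfolding J_def by (rule jump_density_finite[OF H \<alpha> that T[unfolded J_def]])
  have gnn: "0 \<le> g u" for u by (simp add: g_def)
  have gJ: "ennreal (g u) = J u" if "0 < u" for u using Jfin[OF that] by (simp add: g_def)
  have cm: "completely_monotone g"
    unfolding g_def[abs_def] J_def by (rule completely_monotone_jump_density[OF H Jfin[unfolded J_def]])
  let ?f = "\<lambda>y. \<bar>y\<bar> powr (\<alpha> - 1) * g (\<bar>y\<bar> powr \<alpha>)"
  define \<nu> where "\<nu> = density lborel (\<lambda>y. ennreal (?f y))"
  have sets [simp, measurable_cong]: "sets \<nu> = sets borel" by (simp add: \<nu>_def)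
  have nn\<nu>: "(\<integral>\<^sup>+x. F x \<partial>\<nu>) = (\<integral>\<^sup>+y. F y * ennreal (\<bar>y\<bar> powr (\<alpha> - 1)) * J (\<bar>y\<bar> powr \<alpha>) \<partial>lborel)"
    if [measurable]: "F \<in> borel_measurable borel" for F :: "real \<Rightarrow> ennreal"
  proof -
    have "(\<integral>\<^sup>+x. F x \<partial>\<nu>) = (\<integral>\<^sup>+y. ennreal (?f y) * F y \<partial>lborel)"
      unfolding \<nu>_def by (rule nn_integral_density) measurable
    also have "\<dots> = (\<integral>\<^sup>+y. F y * ennreal (\<bar>y\<bar> powr (\<alpha> - 1)) * J (\<bar>y\<bar> powr \<alpha>) \<partial>lborel)"
    proof (rule nn_integral_cong_AE)
      show "AE y in lborel. ennreal (?f y) * F y = F y * ennreal (\<bar>y\<bar> powr (\<alpha> - 1)) * J (\<bar>y\<bar> powr \<alpha>)"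
        using AE_lborel_singleton[of "0::real"]
      proof eventually_elim
        case (elim y)
        then have "J (\<bar>y\<bar> powr \<alpha>) = ennreal (g (\<bar>y\<bar> powr \<alpha>))" by (intro gJ[symmetric]) simp
        then show ?case by (simp add: ennreal_mult gnn mult_ac)
      qed
    qed
    finally show ?thesis .
  qed
  have zero: "emeasure \<nu> {0} = 0"
  proof -
    have "emeasure \<nu> {0} = (\<integral>\<^sup>+y. ennreal (?f y) * indicator {0} y \<partial>lborel)"
      unfolding \<nu>_def by (rule emeasure_density) auto
    also have "\<dots> = (\<integral>\<^sup>+y. 0 \<partial>(lborel :: real measure))"
      by (rule nn_integral_cong_AE, rule eventually_mono[OF AE_lborel_singleton[of "0::real"]]) auto
    finally show ?thesis by simp
  qed
  have levy: "levy_measure \<nu>"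
    unfolding levy_measure_def trunc_sq_def[symmetric]
    using T zero nn\<nu>[of "\<lambda>x. ennreal (trunc_sq x)"] by simp
  have cos\<nu>: "cos_exponent \<nu> z = (\<integral>t. cos_exponent N (z * H t) \<partial>lborel)" for z
  proof -
    have "ennreal (cos_exponent \<nu> z) = (\<integral>\<^sup>+x. ennreal (1 - cos (z * x)) \<partial>\<nu>)"
      unfolding cos_exponent_def by (rule nn_integral_eq_integral[symmetric, OF integral_Re_levy_kernel(2)[OF levy]]) simp
    also have "\<dots> = (\<integral>\<^sup>+t. ennreal (cos_exponent N (z * H t)) \<partial>lborel)"
      unfolding nn_integral_exponents(2)[OF N H] J_def[symmetric] by (rule nn\<nu>) measurable
    also have "\<dots> = ennreal (\<integral>t. cos_exponent N (z * H t) \<partial>lborel)"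
      by (rule nn_integral_eq_integral[OF \<mu>(3)]) (simp add: N.cos_exponent_nonneg)
    finally show ?thesis
      by (subst (asm) ennreal_inj) (auto simp: cos_exponent_def intro!: integral_nonneg)
  qed
  have ker: "(CLINT x|\<nu>. levy_kernel z x) = - complex_of_real (\<integral>t. cos_exponent N (z * H t) \<partial>lborel)" for z
  proof (rule complex_eqI)
    show "Re (CLINT x|\<nu>. levy_kernel z x) = Re (- complex_of_real (\<integral>t. cos_exponent N (z * H t) \<partial>lborel))"
      unfolding integral_Re_levy_kernel(1)[OF levy] cos\<nu> by simp
    have "Im (CLINT x|\<nu>. levy_kernel z x) = (\<integral>x. Im (levy_kernel z x) \<partial>\<nu>)"
      by (rule integral_Im[OF levy_measure_integrable_kernel[OF levy], symmetric])
    also have "\<dots> = (\<integral>x. ?f x *\<^sub>R (sin (z * x) - z * x / (1 + x\<^sup>2)) \<partial>lborel)"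
      unfolding Im_levy_kernel \<nu>_def by (rule integral_density) (auto simp: gnn)
    also have "\<dots> = 0" by (rule integral_odd_eq_0) (simp add: algebra_simps)
    finally show "Im (CLINT x|\<nu>. levy_kernel z x) = Im (- complex_of_real (\<integral>t. cos_exponent N (z * H t) \<partial>lborel))" by simp
  qed
  have triplet: "has_generating_triplet \<mu> 0 \<nu> 0"
    unfolding has_generating_triplet_def ker \<mu>(2) using levy by simp
  have radial: "E_radial_form \<alpha> \<nu>"
    unfolding E_radial_form_def
  proof (intro exI[of _ "\<lambda>_. g"] conjI ballI impI)
    show "completely_monotone g" by (rule cm)
    have "(\<integral>\<^sup>+r\<in>{0<..}. ennreal (min (r powr (\<alpha> + 1)) (r powr (\<alpha> - 1)) * g (r powr \<alpha>)) \<partial>lborel)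
        \<le> (\<integral>\<^sup>+y. ennreal (trunc_sq y) * ennreal (\<bar>y\<bar> powr (\<alpha> - 1)) * J (\<bar>y\<bar> powr \<alpha>) \<partial>lborel)"
    proof (rule nn_integral_mono)
      fix r :: real
      show "ennreal (min (r powr (\<alpha> + 1)) (r powr (\<alpha> - 1)) * g (r powr \<alpha>)) * indicator {0<..} r
        \<le> ennreal (trunc_sq r) * ennreal (\<bar>r\<bar> powr (\<alpha> - 1)) * J (\<bar>r\<bar> powr \<alpha>)"
      proof (cases "0 < r")
        case True
        then show ?thesis
          using gJ[of "r powr \<alpha>"] by (simp add: trunc_sq_mult_powr ennreal_mult' gnn)
      qed simp
    qed
    then show "(\<integral>\<^sup>+r\<in>{0<..}. ennreal (min (r powr (\<alpha> + 1)) (r powr (\<alpha> - 1)) * g (r powr \<alpha>)) \<partial>lborel) < \<infinity>"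
      using T by (rule le_less_trans)
    fix B :: "real set" assume B [measurable]: "B \<in> sets borel"
    have "emeasure \<nu> B = (\<integral>\<^sup>+y. ennreal (?f y) * indicator B y \<partial>lborel)"
      unfolding \<nu>_def by (rule emeasure_density) auto
    also have "\<dots> = (\<integral>\<^sup>+r\<in>{0<..}. ennreal (?f r) * indicator B r \<partial>lborel) + (\<integral>\<^sup>+r\<in>{0<..}. ennreal (?f (- r)) * indicator B (- r) \<partial>lborel)"
      by (rule nn_integral_half_lines) measurable
    also have "\<dots> = (\<integral>\<^sup>+r\<in>{0<..}. indicator B (r * 1) * ennreal (r powr (\<alpha> - 1) * g (r powr \<alpha>)) \<partial>lborel)
       + (\<integral>\<^sup>+r\<in>{0<..}. indicator B (r * -1) * ennreal (r powr (\<alpha> - 1) * g (r powr \<alpha>)) \<partial>lborel)"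
      by (intro arg_cong2[where f = "(+)"] nn_integral_cong) (auto simp: indicator_def)
    finally show "emeasure \<nu> B = (\<Sum>\<xi>\<in>{-1, 1}. \<integral>\<^sup>+r\<in>{0<..}. indicator B (r * \<xi>) * ennreal (r powr (\<alpha> - 1) * g (r powr \<alpha>)) \<partial>lborel)"
      by (simp add: add.commute)
  qed
  have sym: "symmetric_distribution \<mu>"
    unfolding symmetric_distribution_def
  proof (rule Levy_uniqueness)
    interpret \<mu>: real_distribution \<mu> by (rule \<mu>(1))
    show "real_distribution (distr \<mu> borel (\<lambda>x. - x))" by (rule \<mu>.real_distribution_distr) simp
    show "char (distr \<mu> borel (\<lambda>x. - x)) = char \<mu>"
      using char_uminus[OF \<mu>(1)] by (simp add: fun_eq_iff \<mu>(2) cos_exponent_def)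
  qed (rule \<mu>(1))
  have "\<exists>\<rho>. real_distribution \<rho> \<and> \<mu> = convolution_power \<rho> n" if n: "1 \<le> n" for n :: nat
  proof -
    \<comment> \<open>Running through h at n-fold speed divides the exponent by n, so the integral
      of hn has the law of an n-th convolution root.\<close>
    define hn where "hn t = h (real n * t)" for t
    have cut: "half_line_cut hn t = H (0 + real n * t)" for t
      using n by (simp add: half_line_cut_def H_def hn_def indicator_def zero_less_mult_iff)
    have "set_borel_measurable borel {0<..} hn"
      unfolding set_borel_measurable_def
      using cut by (simp add: half_line_cut_def)
    moreover have "exponent_finite hn"
      unfolding exponent_finite_def cut using n by (intro lborel_integrable_real_affine fin) simp
    ultimately have hn: "hn \<in> Dom M Y" by (simp add: Dom_iff)
    define \<rho> where "\<rho> = law M (improper_integral M Y hn)"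
    have \<rho>: "real_distribution \<rho>" unfolding \<rho>_def by (rule law_improper_integral(1)[OF hn])
    have "char (convolution_power \<rho> n) z = char \<mu> z" for z
    proof -
      have "(\<integral>t. cos_exponent N (z * H t) \<partial>lborel) = \<bar>real n\<bar> *\<^sub>R (\<integral>t. cos_exponent N (z * H (0 + real n * t)) \<partial>lborel)"
        using n by (intro lborel_integral_real_affine) simp
      then have "char \<mu> z = exp (of_nat n * - complex_of_real (\<integral>t. cos_exponent N (z * half_line_cut hn t) \<partial>lborel))"
        unfolding \<mu>(2) cut by simp
      also have "\<dots> = char \<rho> z ^ n"
        unfolding exp_of_nat_mult \<rho>_def law_improper_integral(2)[OF hn] by simp
      finally show ?thesis using convolution_power_char[OF \<rho>, of n z] by simp
    qed
    then have "\<mu> = convolution_power \<rho> n"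
      using convolution_power_char[OF \<rho>, of n] by (intro Levy_uniqueness[OF \<mu>(1)]) (auto simp: fun_eq_iff)
    with \<rho> show ?thesis by blast
  qed
  then have "infinitely_divisible \<mu>" using \<mu>(1) by (auto simp: infinitely_divisible_def)
  then have "\<mu> \<in> E_class \<alpha>" using triplet radial by (auto simp: E_class_def)
  then have "\<mu> \<in> E_class0_sym \<alpha>" using triplet sym by (auto simp: E_class0_def E_class0_sym_def)
  then show ?thesis by (simp add: \<mu>_def)
qed

section \<open>Decreasing rearrangements\<close>

text \<open>On {c..} with c > 0 both measures are finite and closed half-lines generate; letting c
  tend to 0 reaches (0, \<infinity>). Neither measure has to be finite near 0, and the law of a
  function under Lebesgue measure may have infinite mass at 0.\<close>

lemma borel_measure_eq_on_half_line:
  fixes D n :: "real measure"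
  assumes [measurable_cong]: "sets D = sets borel" "sets n = sets borel"
    and eq: "\<And>a. 0 < a \<Longrightarrow> emeasure D {a..} = emeasure n {a..}" and fin: "\<And>a. 0 < a \<Longrightarrow> emeasure n {a..} < \<infinity>"
  shows "density D (indicator {0<..}) = density n (indicator {0<..})"
proof (rule measure_eqI)
  have piece: "density D (indicator {c..}) = density n (indicator {c..})" if c: "0 < c" for c
  proof (rule measure_eqI_generator_eq[where E = "range atLeast" and \<Omega> = UNIV and A = "\<lambda>i. {- real i..}"])
    have int: "{a..} \<inter> {b..} = {max a b..}" for a b :: real by auto
    show "Int_stable (range (atLeast :: real \<Rightarrow> real set))" by (auto simp: Int_stable_def int)
    have em: "emeasure (density D (indicator {c..})) {a..} = emeasure D {max c a..}"
      "emeasure (density n (indicator {c..})) {a..} = emeasure n {max c a..}" for a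
      by (subst emeasure_restricted; simp add: int)+
    show "emeasure (density D (indicator {c..})) X = emeasure (density n (indicator {c..})) X" if "X \<in> range atLeast" for X
      using that c by (auto simp: em eq)
    show "emeasure (density D (indicator {c..})) {- real i..} \<noteq> \<infinity>" for i
      using fin[of "max c (- real i)"] c by (auto simp: em eq)
    have b: "sets borel = sigma_sets UNIV (range (atLeast :: real \<Rightarrow> real set))" by (subst borel_Ici) simp
    show "sets (density D (indicator {c..})) = sigma_sets UNIV (range atLeast)"
      "sets (density n (indicator {c..})) = sigma_sets UNIV (range atLeast)"
      using b assms(1,2) by simp_all
    show "(\<Union>i. {- real i..}) = (UNIV :: real set)"
    proof -
      have "\<exists>i. - real i \<le> x" for x :: real using real_arch_simple[of "- x"] by (auto simp: minus_le_iff)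
      then show ?thesis by auto
    qed
  qed auto
  have un: "(\<Union>k. {1 / real (Suc k)..} \<inter> A) = {0<..} \<inter> A" for A :: "real set"
  proof -
    have "\<exists>k. 1 / real (Suc k) \<le> x" if "0 < x" for x :: real
      using reals_Archimedean[OF that] by (auto simp: inverse_eq_divide intro: less_imp_le)
    moreover have "0 < x" if "1 / real (Suc k) \<le> x" for x k using that by (rule less_le_trans[rotated]) simp
    ultimately have iff: "(\<exists>k. 1 / real (Suc k) \<le> x) \<longleftrightarrow> 0 < x" for x :: real by blast
    have "x \<in> (\<Union>k. {1 / real (Suc k)..} \<inter> A) \<longleftrightarrow> (\<exists>k. 1 / real (Suc k) \<le> x) \<and> x \<in> A" for x by blast
    then show ?thesis unfolding iff by blast
  qed
  have inc: "incseq (\<lambda>k. {1 / real (Suc k)..} \<inter> A)" for A :: "real set"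
  proof -
    have "1 / real (Suc l) \<le> 1 / real (Suc k)" if "k \<le> l" for k l using that by (intro divide_left_mono) auto
    then show ?thesis unfolding incseq_def by (intro allI impI Int_mono order_refl) (simp only: atLeast_subset_iff)
  qed
  show "emeasure (density D (indicator {0<..})) A = emeasure (density n (indicator {0<..})) A"
    if "A \<in> sets (density D (indicator {0<..}))" for A
  proof -
    have A [measurable]: "A \<in> sets borel" using that assms(1) by simp
    have sup: "emeasure (density m (indicator {0<..})) A = (SUP k. emeasure (density m (indicator {1 / real (Suc k)..})) A)"
      if s: "sets m = sets borel" for m
    proof -
      have r: "emeasure (density m (indicator S)) A = emeasure m (S \<inter> A)" if "S \<in> sets borel" for S
        by (rule emeasure_restricted) (simp_all only: s that A)
      have "emeasure (density m (indicator {0<..})) A = emeasure m (\<Union>k. {1 / real (Suc k)..} \<inter> A)"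
        unfolding un by (rule r) simp
      also have "\<dots> = (SUP k. emeasure m ({1 / real (Suc k)..} \<inter> A))"
      proof (rule SUP_emeasure_incseq[OF _ inc, symmetric])
        have "{1 / real (Suc k)..} \<inter> A \<in> sets m" for k unfolding s by measurable
        then show "range (\<lambda>k. {1 / real (Suc k)..} \<inter> A) \<subseteq> sets m" by blast
      qed
      also have "\<dots> = (SUP k. emeasure (density m (indicator {1 / real (Suc k)..})) A)"
        by (simp only: r[OF atLeast_borel])
      finally show ?thesis .
    qed
    have "density D (indicator {1 / real (Suc k)..}) = density n (indicator {1 / real (Suc k)..})" for k
      by (rule piece) simp
    then show ?thesis unfolding sup[OF assms(1)] sup[OF assms(2)] by (simp only:)
  qed
  show "sets (density D (indicator {0<..})) = sets (density n (indicator {0<..}))" using assms by simp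
qed

text \<open>The function \<open>h\<close> is the left-continuous inverse of the tail function \<open>w \<mapsto> n [w, \<infinity>)\<close>.\<close>

lemma decreasing_rearrangement:
  fixes n :: "real measure"
  assumes s [measurable_cong]: "sets n = sets borel" and fin: "\<And>w. 0 < w \<Longrightarrow> emeasure n {w..} < \<infinity>"
  obtains h :: "real \<Rightarrow> real" where "\<And>t. 0 < t \<Longrightarrow> continuous (at_left t) h" "antimono_on {0<..} h" "(h \<longlongrightarrow> 0) at_top"
    "\<And>t. 0 \<le> h t" "\<And>t. t \<le> 0 \<Longrightarrow> h t = 0" "h \<in> borel_measurable borel"
    "\<And>F :: real \<Rightarrow> ennreal. F \<in> borel_measurable borel \<Longrightarrow> (\<And>x. x \<le> 0 \<Longrightarrow> F x = 0) \<Longrightarrow>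
      (\<integral>\<^sup>+t. F (h t) \<partial>lborel) = (\<integral>\<^sup>+w. F w \<partial>n)"
proof -
  define T where "T w = measure n {w..}" for w
  have fin': "emeasure n {w..} \<noteq> \<infinity>" if "0 < w" for w using fin[OF that] by simp
  have emT: "emeasure n {w..} = ennreal (T w)" if "0 < w" for w
    unfolding T_def using fin'[OF that] by (simp add: emeasure_eq_ennreal_measure)
  have Tnn: "0 \<le> T w" for w by (simp add: T_def)
  have Tmono: "T w \<le> T v" if "0 < v" "v \<le> w" for v w
  proof -
    have "emeasure n {w..} \<le> emeasure n {v..}" using that by (intro emeasure_mono) auto
    then show ?thesis using that by (simp add: emT Tnn)
  qed
  have Tlim: "\<exists>w>0. T w < e" if e: "0 < e" for e
  proof -
    have "(\<lambda>i. measure n {1 + real i..}) \<longlonglongrightarrow> measure n (\<Inter>i. {1 + real i..})"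
      by (rule Lim_measure_decseq) (auto simp: decseq_def fin'[unfolded infinity_ennreal_def])
    also have "(\<Inter>i. {1 + real i..}) = {}"
    proof -
      have "\<exists>i. x < 1 + real i" for x :: real
      proof -
        obtain m where "x < real m" using reals_Archimedean2 by blast
        then have "x < 1 + real m" by simp
        then show ?thesis by blast
      qed
      then have "x \<notin> (\<Inter>i. {1 + real i..})" for x :: real by (metis INT_D UNIV_I atLeast_iff not_le)
      then show ?thesis by blast
    qed
    finally have "(\<lambda>i. T (1 + real i)) \<longlonglongrightarrow> 0" by (simp add: T_def)
    then have "\<forall>\<^sub>F i in sequentially. T (1 + real i) < e" using e by (rule order_tendstoD(2))
    then obtain i where "T (1 + real i) < e" unfolding eventually_sequentially by blast
    then show ?thesis by (intro exI[of _ "1 + real i"]) simp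
  qed
  \<comment> \<open>The half-lines {v..} decrease to {w..} as v increases to w, so the tail is
    left-continuous; this makes the supremum defining h satisfy its own inequality. The index i + 2
    keeps each v strictly between 0 and w.\<close>
  have Tleft: "t \<le> T w" if w: "0 < w" and le: "\<And>v. 0 < v \<Longrightarrow> v < w \<Longrightarrow> t \<le> T v" for t w
  proof -
    let ?v = "\<lambda>i. w - w / real (Suc (Suc i))"
    have v: "0 < ?v i" "?v i < w" for i
    proof -
      have "w / real (Suc (Suc i)) < w / 1" by (rule divide_strict_left_mono) (use w in simp_all)
      moreover have "0 < w / real (Suc (Suc i))" using w by (intro divide_pos_pos) simp_all
      ultimately show "0 < ?v i" "?v i < w" by simp_all
    qed
    have "(\<lambda>i. measure n {?v i..}) \<longlonglongrightarrow> measure n (\<Inter>i. {?v i..})"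
    proof (rule Lim_measure_decseq)
      have "?v i \<le> ?v j" if "i \<le> j" for i j using that w by (intro diff_left_mono divide_left_mono) auto
      then show "decseq (\<lambda>i. {?v i..})" unfolding decseq_def atLeast_subset_iff by blast
      show "emeasure n {?v i..} \<noteq> \<infinity>" for i by (rule fin'[OF v(1)])
    qed auto
    also have "(\<Inter>i. {?v i..}) = {w..}"
    proof (rule equalityI)
      show "(\<Inter>i. {?v i..}) \<subseteq> {w..}"
      proof
        fix x assume x: "x \<in> (\<Inter>i. {?v i..})"
        have "(\<lambda>i. w * inverse (real (Suc (Suc i)))) \<longlonglongrightarrow> w * 0"
          by (intro tendsto_intros LIMSEQ_Suc[OF LIMSEQ_inverse_real_of_nat])
        then have "(\<lambda>i. w / real (Suc (Suc i))) \<longlonglongrightarrow> 0" by (simp only: divide_inverse mult_zero_right)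
        then have lim: "?v \<longlonglongrightarrow> w - 0" by (intro tendsto_intros)
        have "?v i \<le> x" for i using x by blast
        then have "\<exists>k. \<forall>i\<ge>k. ?v i \<le> x" by (intro exI allI impI)
        with lim have "w - 0 \<le> x" by (rule LIMSEQ_le_const2)
        then show "x \<in> {w..}" by simp
      qed
      show "{w..} \<subseteq> (\<Inter>i. {?v i..})"
        by (intro INT_greatest) (simp only: atLeast_subset_iff less_imp_le[OF v(2)])
    qed
    finally have "(\<lambda>i. T (?v i)) \<longlonglongrightarrow> T w" by (simp add: T_def)
    moreover have "\<exists>k. \<forall>i\<ge>k. t \<le> T (?v i)" by (intro exI allI impI le v)
    ultimately show ?thesis by (rule LIMSEQ_le_const)
  qed
  \<comment> \<open>The added 0 keeps the set nonempty, so that Sup is 0 when no w > 0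
    qualifies.\<close>
  define S where "S t = insert 0 {w. 0 < w \<and> t \<le> T w}" for t
  define h where "h t = (if t \<le> 0 then 0 else Sup (S t))" for t
  have bdd: "bdd_above (S t)" if t: "0 < t" for t
  proof -
    obtain w where w: "0 < w" "T w < t" using Tlim[OF t] by auto
    have "v \<le> w" if "v \<in> S t" for v
    proof (rule ccontr)
      assume "\<not> v \<le> w"
      then show False using that w Tmono[of w v] by (auto simp: S_def)
    qed
    then show ?thesis by (rule bdd_aboveI)
  qed
  have hnn: "0 \<le> h t" for t
  proof (cases "0 < t")
    case True
    have "0 \<in> S t" by (simp add: S_def)
    then have "0 \<le> Sup (S t)" using bdd[OF True] by (rule cSup_upper)
    then show ?thesis by (simp add: h_def)
  qed (simp add: h_def)
  \<comment> \<open>The Galois connection between h and the tail. Monotonicity, level sets,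
    left-continuity and the limit at infinity are read off it.\<close>
  have key: "w \<le> h t \<longleftrightarrow> t \<le> T w" if w: "0 < w" and t: "0 < t" for w t
  proof
    assume "t \<le> T w"
    then have "w \<in> S t" using w by (simp add: S_def)
    then have "w \<le> Sup (S t)" using bdd[OF t] by (rule cSup_upper)
    then show "w \<le> h t" using t by (simp add: h_def)
  next
    assume "w \<le> h t"
    show "t \<le> T w"
    proof (rule Tleft[OF w])
      fix v assume v: "0 < v" "v < w"
      then have "v < Sup (S t)" using \<open>w \<le> h t\<close> t by (simp add: h_def)
      then obtain x where "x \<in> S t" "v < x" using less_cSup_iff[OF _ bdd[OF t], of v] by (metis S_def insert_not_empty)
      then show "t \<le> T v" using v Tmono[of v x] by (auto simp: S_def)
    qed
  qed
  have anti: "h t \<le> h r" if "0 < r" "r \<le> t" for r t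
  proof (cases "0 < h t")
    case True
    then have "t \<le> T (h t)" using key[of "h t" t] that by simp
    then show ?thesis using key[of "h t" r] True that by simp
  next
    case False
    then show ?thesis using hnn[of r] by simp
  qed
  have level: "{t. w \<le> h t} = {0<..T w}" if w: "0 < w" for w
  proof (rule set_eqI)
    fix t
    show "t \<in> {t. w \<le> h t} \<longleftrightarrow> t \<in> {0<..T w}"
      using key[OF w, of t] w by (cases "0 < t") (auto simp: h_def)
  qed
  have small: "h t < w" if "0 < w" "0 < t" "T w < t" for w t using key[OF that(1,2)] that(3) by (metis not_le)
  have hm [measurable]: "h \<in> borel_measurable borel"
    unfolding borel_measurable_iff_ge
  proof
    fix a :: real
    show "{w \<in> space borel. a \<le> h w} \<in> sets borel"
    proof (cases "0 < a")
      case True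
      then show ?thesis by (simp add: level)
    next
      case False
      then have "a \<le> h t" for t using hnn[of t] by simp
      then show ?thesis by simp
    qed
  qed
  let ?D = "distr lborel borel h"
  have eq: "density ?D (indicator {0<..}) = density n (indicator {0<..})"
  proof (rule borel_measure_eq_on_half_line)
    fix a :: real assume a: "0 < a"
    have "emeasure ?D {a..} = emeasure lborel (h -` {a..} \<inter> space lborel)" by (rule emeasure_distr) auto
    also have "h -` {a..} \<inter> space lborel = {0<..T a}" using level[OF a] by (simp add: vimage_def)
    also have "emeasure lborel {0<..T a} = emeasure n {a..}" using Tnn by (simp add: emT[OF a])
    finally show "emeasure ?D {a..} = emeasure n {a..}" .
  qed (use s fin in auto)
  have image: "(\<integral>\<^sup>+t. F (h t) \<partial>lborel) = (\<integral>\<^sup>+w. F w \<partial>n)"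
    if [measurable]: "F \<in> borel_measurable borel" and F: "\<And>x. x \<le> 0 \<Longrightarrow> F x = 0" for F :: "real \<Rightarrow> ennreal"
  proof -
    have ind: "(\<integral>\<^sup>+w. F w \<partial>m) = (\<integral>\<^sup>+w. F w \<partial>density m (indicator {0<..}))" if [measurable_cong]: "sets m = sets borel" for m
    proof -
      have "(\<integral>\<^sup>+w. F w \<partial>density m (indicator {0<..})) = (\<integral>\<^sup>+w. indicator {0<..} w * F w \<partial>m)"
        by (rule nn_integral_density) measurable
      also have "\<dots> = (\<integral>\<^sup>+w. F w \<partial>m)" using F by (intro nn_integral_cong) (auto simp: indicator_def)
      finally show ?thesis by simp
    qed
    have "(\<integral>\<^sup>+t. F (h t) \<partial>lborel) = (\<integral>\<^sup>+w. F w \<partial>?D)" by (rule nn_integral_distr[symmetric]) measurable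
    also have "\<dots> = (\<integral>\<^sup>+w. F w \<partial>n)" using ind[of ?D] ind[OF s] eq by simp
    finally show ?thesis .
  qed
  show ?thesis
  proof (rule that[of h])
    show "continuous (at_left t) h" if t: "0 < t" for t
      unfolding continuous_within
    proof (rule order_tendstoI)
      fix a assume a: "a < h t"
      have "a < h r" if "0 < r" "r < t" for r using anti[of r t] that a by simp
      then show "\<forall>\<^sub>F r in at_left t. a < h r" using t unfolding eventually_at_left_field by (intro exI[of _ 0]) simp
    next
      fix a assume a: "h t < a"
      then have "0 < a" using hnn[of t] by simp
      then have "T a < t" using key[of a t] a t by (metis not_le)
      moreover have "h r < a" if "T a < r" for r using small[OF \<open>0 < a\<close> _ that] Tnn[of a] that by simp
      ultimately show "\<forall>\<^sub>F r in at_left t. h r < a" unfolding eventually_at_left_field by (intro exI[of _ "T a"]) simp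
    qed
    show "(h \<longlongrightarrow> 0) at_top"
    proof (rule order_tendstoI)
      show "\<forall>\<^sub>F r in at_top. a < h r" if "a < 0" for a
        by (intro always_eventually allI less_le_trans[OF that hnn])
      show "\<forall>\<^sub>F r in at_top. h r < a" if a: "0 < a" for a
        using eventually_gt_at_top[of "T a"]
      proof eventually_elim
        case (elim r)
        then show ?case using small[OF a _ elim] Tnn[of a] by simp
      qed
    qed
    show "antimono_on {0<..} h" using anti by (auto simp: monotone_on_def)
    show "(\<integral>\<^sup>+t. F (h t) \<partial>lborel) = (\<integral>\<^sup>+w. F w \<partial>n)"
      if "F \<in> borel_measurable borel" "\<And>x. x \<le> 0 \<Longrightarrow> F x = 0" for F using image[OF that] .
    show "0 \<le> h t" for t by (rule hnn)
    show "h t = 0" if "t \<le> 0" for t using that by (simp add: h_def)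
    show "h \<in> borel_measurable borel" by (rule hm)
  qed
qed

section \<open>Representation of members of the class\<close>

lemma completely_monotone_measurable_cut:
  assumes "completely_monotone g" shows "(\<lambda>u. indicator {0<..} u * g u) \<in> borel_measurable borel"
proof -
  have "continuous_on {0<..} g"
    using cm_deriv_isCont[OF assms, of _ 0] by (auto intro!: continuous_at_imp_continuous_on)
  then show ?thesis using borel_measurable_continuous_on_indicator[of "{0<..}" g] by simp
qed

text \<open>The radial form fixes \<nu> as a measure with a density on each half-line. Against an
  even function the two half-lines merge, so only the sum of the radial functions matters.\<close>

lemma radial_form_nn_integral:
  fixes g :: "real \<Rightarrow> real \<Rightarrow> real" and F :: "real \<Rightarrow> ennreal"
  assumes \<nu>: "levy_measure \<nu>" and cm: "\<And>\<xi>. \<xi> \<in> {-1, 1} \<Longrightarrow> completely_monotone (g \<xi>)"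
    and em: "\<And>B. B \<in> sets borel \<Longrightarrow> 0 \<notin> B \<Longrightarrow> emeasure \<nu> B = (\<Sum>\<xi>\<in>{-1, 1}.
      \<integral>\<^sup>+r\<in>{0<..}. indicator B (r * \<xi>) * ennreal (r powr (\<alpha> - 1) * g \<xi> (r powr \<alpha>)) \<partial>lborel)"
    and F [measurable]: "F \<in> borel_measurable borel" and even: "\<And>x. F (- x) = F x"
  shows "(\<integral>\<^sup>+x. F x \<partial>\<nu>)
    = (\<integral>\<^sup>+r\<in>{0<..}. F r * ennreal (r powr (\<alpha> - 1) * (g 1 (r powr \<alpha>) + g (-1) (r powr \<alpha>))) \<partial>lborel)"
proof -
  define G where "G \<xi> u = indicator {0<..} u * g \<xi> u" for \<xi> u
  have G [measurable]: "G 1 \<in> borel_measurable borel" "G (-1) \<in> borel_measurable borel"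
    unfolding G_def[abs_def] by (rule completely_monotone_measurable_cut, rule cm, simp)+
  have Gg: "G \<xi> (r powr \<alpha>) = g \<xi> (r powr \<alpha>)" if "0 < r" for \<xi> r using that by (simp add: G_def)
  have gnn: "0 \<le> g \<xi> u" if "0 < u" "\<xi> \<in> {-1, 1}" for \<xi> u using cm_deriv_nonneg[OF cm[OF that(2)] that(1), of 0] by simp
  let ?f = "\<lambda>y. \<bar>y\<bar> powr (\<alpha> - 1) * (if 0 < y then G 1 (\<bar>y\<bar> powr \<alpha>) else G (-1) (\<bar>y\<bar> powr \<alpha>))"
  have s: "sets \<nu> = sets borel" and z: "emeasure \<nu> {0} = 0" using \<nu> by (auto simp: levy_measure_def)
  have dens: "\<nu> = density lborel (\<lambda>y. ennreal (?f y))"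
  proof (rule measure_eqI)
    fix B assume "B \<in> sets \<nu>"
    then have B [measurable]: "B \<in> sets borel" using s by simp
    have d: "emeasure (density lborel (\<lambda>y. ennreal (?f y))) B' = (\<integral>\<^sup>+y. ennreal (?f y) * indicator B' y \<partial>lborel)"
      if [measurable]: "B' \<in> sets borel" for B' by (rule emeasure_density) auto
    \<comment> \<open>The radial form is silent on sets containing 0, but a Levy measure does not
      charge 0.\<close>
    have "emeasure \<nu> B = emeasure \<nu> (B - {0})"
    proof (cases "0 \<in> B")
      case True
      have "emeasure \<nu> ((B - {0}) \<union> {0}) = emeasure \<nu> (B - {0}) + emeasure \<nu> {0}"
        by (rule plus_emeasure[symmetric]) (auto simp: s)
      then show ?thesis using True z by (simp add: insert_absorb)
    qed simp
    also have "\<dots> = (\<integral>\<^sup>+r\<in>{0<..}. indicator (B - {0}) (r * 1) * ennreal (r powr (\<alpha> - 1) * g 1 (r powr \<alpha>)) \<partial>lborel)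
        + (\<integral>\<^sup>+r\<in>{0<..}. indicator (B - {0}) (r * -1) * ennreal (r powr (\<alpha> - 1) * g (-1) (r powr \<alpha>)) \<partial>lborel)"
      by (subst em) (auto simp: add.commute)
    also have "\<dots> = (\<integral>\<^sup>+r\<in>{0<..}. ennreal (?f r) * indicator B r \<partial>lborel) + (\<integral>\<^sup>+r\<in>{0<..}. ennreal (?f (- r)) * indicator B (- r) \<partial>lborel)"
      by (intro arg_cong2[where f = "(+)"] nn_integral_cong) (auto simp: indicator_def Gg)
    also have "\<dots> = (\<integral>\<^sup>+y. ennreal (?f y) * indicator B y \<partial>lborel)"
      by (rule nn_integral_half_lines[symmetric]) measurable
    finally show "emeasure \<nu> B = emeasure (density lborel (\<lambda>y. ennreal (?f y))) B" using d[OF B] by simp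
  qed (simp add: s)
  have "(\<integral>\<^sup>+x. F x \<partial>\<nu>) = (\<integral>\<^sup>+y. ennreal (?f y) * F y \<partial>lborel)"
    unfolding dens by (rule nn_integral_density) measurable
  also have "\<dots> = (\<integral>\<^sup>+r\<in>{0<..}. ennreal (?f r) * F r \<partial>lborel) + (\<integral>\<^sup>+r\<in>{0<..}. ennreal (?f (- r)) * F (- r) \<partial>lborel)"
    by (rule nn_integral_half_lines) measurable
  also have "\<dots> = (\<integral>\<^sup>+r. ennreal (?f r) * F r * indicator {0<..} r + ennreal (?f (- r)) * F (- r) * indicator {0<..} r \<partial>lborel)"
    by (rule nn_integral_add[symmetric]) measurable
  also have "\<dots> = (\<integral>\<^sup>+r\<in>{0<..}. F r * ennreal (r powr (\<alpha> - 1) * (g 1 (r powr \<alpha>) + g (-1) (r powr \<alpha>))) \<partial>lborel)"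
  proof (rule nn_integral_cong)
    fix r :: real
    have split: "ennreal (a * p) * f + ennreal (a * q) * f = f * ennreal (a * (p + q))"
      if "0 \<le> a" "0 \<le> p" "0 \<le> q" for a p q :: real and f :: ennreal
    proof -
      have "ennreal (a * (p + q)) = ennreal (a * p) + ennreal (a * q)"
        unfolding distrib_left using that by (intro ennreal_plus) auto
      then show ?thesis by (simp only: distrib_left mult.commute[of f])
    qed
    show "ennreal (?f r) * F r * indicator {0<..} r + ennreal (?f (- r)) * F (- r) * indicator {0<..} r
      = F r * ennreal (r powr (\<alpha> - 1) * (g 1 (r powr \<alpha>) + g (-1) (r powr \<alpha>))) * indicator {0<..} r"
    proof (cases "0 < r")
      case True
      then show ?thesis
        using split[of "r powr (\<alpha> - 1)" "g 1 (r powr \<alpha>)" "g (-1) (r powr \<alpha>)" "F r"]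
        by (simp add: even Gg gnn)
    qed simp
  qed
  finally show ?thesis .
qed

text \<open>The factor r^(\<alpha>-1) is the derivative of r^\<alpha> up to \<alpha>, so the
  integral is explicit. It exposes the factor 1 / s that integrability of g on large jumps imposes
  on the mixing measure.\<close>

lemma nn_integral_powr_exp:
  assumes \<alpha>: "0 < (\<alpha>::real)" and s: "0 < s"
  shows "(\<integral>\<^sup>+r\<in>{1..}. ennreal (r powr (\<alpha> - 1) * exp (- (s * r powr \<alpha>))) \<partial>lborel) = ennreal (exp (- s) / (\<alpha> * s))"
proof -
  let ?F = "\<lambda>r. - (exp (- (s * r powr \<alpha>)) / (\<alpha> * s))"
  have "(\<integral>\<^sup>+r. ennreal (r powr (\<alpha> - 1) * exp (- (s * r powr \<alpha>))) * indicator {1..} r \<partial>lborel) = ennreal (0 - ?F 1)"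
  proof (rule nn_integral_FTC_atLeast)
    fix r :: real assume r: "1 \<le> r"
    have "((\<lambda>r. r powr \<alpha>) has_real_derivative \<alpha> * r powr (\<alpha> - 1)) (at r)"
      using r by (intro has_real_derivative_powr) simp
    then have "(?F has_real_derivative - (exp (- (s * r powr \<alpha>)) * - (s * (\<alpha> * r powr (\<alpha> - 1))) / (\<alpha> * s))) (at r)"
      by (intro DERIV_minus DERIV_cdivide DERIV_fun_exp DERIV_cmult)
    then show "(?F has_real_derivative r powr (\<alpha> - 1) * exp (- (s * r powr \<alpha>))) (at r)"
      using \<alpha> s by (simp add: field_simps)
  next
    have lim: "((\<lambda>r. r powr (- \<alpha>) / (\<alpha> * s * s)) \<longlongrightarrow> 0) at_top"
      using tendsto_divide[OF tendsto_neg_powr[OF _ filterlim_ident] tendsto_const, of "- \<alpha>" "\<alpha> * s * s"] \<alpha> s by simp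
    show "(?F \<longlongrightarrow> 0) at_top"
    proof (rule Lim_null_comparison[OF _ lim])
      show "\<forall>\<^sub>F r in at_top. norm (?F r) \<le> r powr (- \<alpha>) / (\<alpha> * s * s)"
        using eventually_ge_at_top[of 1]
      proof eventually_elim
        case (elim r)
        define y where "y = s * r powr \<alpha>"
        have y: "0 < y" using s elim by (simp add: y_def)
        have "1 + y \<le> exp y" by (rule exp_ge_add_one_self)
        then have "y \<le> exp y" by argo
        then have "exp (- y) \<le> 1 / y" using y by (simp add: exp_minus field_simps)
        also have "\<dots> = r powr (- \<alpha>) / s" using elim by (simp add: y_def powr_minus field_simps)
        finally have "exp (- y) / (\<alpha> * s) \<le> r powr (- \<alpha>) / s / (\<alpha> * s)" using \<alpha> s by (intro divide_right_mono) auto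
        then show ?case using \<alpha> s by (simp add: y_def mult_ac)
      qed
    qed
  qed auto
  then show ?thesis by simp
qed

text \<open>g is nonincreasing, and if it stayed above e > 0 the integral would be at least a
  multiple of b^\<alpha> - 1 for every b.\<close>

lemma completely_monotone_tendsto_0:
  assumes g: "completely_monotone g" and \<alpha>: "0 < \<alpha>"
    and fin: "(\<integral>\<^sup>+r\<in>{1..}. ennreal (r powr (\<alpha> - 1) * g (r powr \<alpha>)) \<partial>lborel) < \<infinity>"
  shows "(g \<longlongrightarrow> 0) at_top"
proof -
  have nn: "0 \<le> g u" if "0 < u" for u using cm_deriv_nonneg[OF g that, of 0] by simp
  have anti: "g v \<le> g u" if "0 < u" "u \<le> v" for u v using cm_deriv_antimono[OF g that, of 0] by simp
  have ex: "\<exists>u>0. g u < e" if e: "0 < e" for e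
  proof (rule ccontr)
    assume "\<not> (\<exists>u>0. g u < e)"
    then have ge: "e \<le> g u" if "0 < u" for u using that by force
    obtain T where T: "(\<integral>\<^sup>+r\<in>{1..}. ennreal (r powr (\<alpha> - 1) * g (r powr \<alpha>)) \<partial>lborel) = ennreal T" "0 \<le> T"
      using fin by (cases "(\<integral>\<^sup>+r\<in>{1..}. ennreal (r powr (\<alpha> - 1) * g (r powr \<alpha>)) \<partial>lborel)" rule: ennreal_cases) auto
    \<comment> \<open>Chosen so that e (b^\<alpha> - 1) / \<alpha>, the integral of e r^(\<alpha>-1)
      over [1, b], equals T + 1.\<close>
    define b where "b = (1 + \<alpha> * (T + 1) / e) powr (1 / \<alpha>)"
    have pos: "0 \<le> \<alpha> * (T + 1) / e" using \<alpha> e T(2) by simp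
    then have ba: "b powr \<alpha> = 1 + \<alpha> * (T + 1) / e" using \<alpha> by (simp add: b_def powr_powr)
    have b: "1 \<le> b" unfolding b_def using pos \<alpha> by (intro ge_one_powr_ge_zero) auto
    have "ennreal (e * b powr \<alpha> / \<alpha> - e * 1 powr \<alpha> / \<alpha>) = (\<integral>\<^sup>+r. ennreal (e * r powr (\<alpha> - 1)) * indicator {1..b} r \<partial>lborel)"
    proof (rule nn_integral_FTC_Icc[symmetric])
      fix r :: real assume "r \<in> {1..b}"
      then have "((\<lambda>r. r powr \<alpha>) has_real_derivative \<alpha> * r powr (\<alpha> - 1)) (at r)"
        by (intro has_real_derivative_powr) simp
      then have "((\<lambda>r. e * r powr \<alpha> / \<alpha>) has_real_derivative e * (\<alpha> * r powr (\<alpha> - 1)) / \<alpha>) (at r)"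
        by (intro DERIV_cdivide DERIV_cmult)
      then show "((\<lambda>r. e * r powr \<alpha> / \<alpha>) has_real_derivative e * r powr (\<alpha> - 1)) (at r)"
        using \<alpha> by simp
    qed (use b e in auto)
    also have "\<dots> \<le> (\<integral>\<^sup>+r\<in>{1..}. ennreal (r powr (\<alpha> - 1) * g (r powr \<alpha>)) \<partial>lborel)"
    proof (rule nn_integral_mono)
      fix r :: real
      show "ennreal (e * r powr (\<alpha> - 1)) * indicator {1..b} r \<le> ennreal (r powr (\<alpha> - 1) * g (r powr \<alpha>)) * indicator {1..} r"
        using ge[of "r powr \<alpha>"] by (auto simp: indicator_def mult.commute[of e] intro!: ennreal_leI mult_left_mono)
    qed
    also have "\<dots> = ennreal T" by (rule T)
    finally have "e * b powr \<alpha> / \<alpha> - e / \<alpha> \<le> T" using T(2) by simp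
    moreover have "e * b powr \<alpha> / \<alpha> - e / \<alpha> = T + 1" unfolding ba using \<alpha> e by (simp add: field_simps)
    ultimately show False by simp
  qed
  show ?thesis
  proof (rule order_tendstoI)
    show "\<forall>\<^sub>F u in at_top. a < g u" if "a < 0" for a
      using eventually_gt_at_top[of 0] by eventually_elim (use nn that in \<open>force intro: less_le_trans\<close>)
    fix a :: real assume "0 < a"
    then obtain u where u: "0 < u" "g u < a" using ex by blast
    show "\<forall>\<^sub>F v in at_top. g v < a"
      using eventually_ge_at_top[of u] by eventually_elim (use anti u in \<open>force intro: le_less_trans\<close>)
  qed
qed

text \<open>By Bernstein's theorem \<open>g u = \<integral> e^(-us) \<rho>(ds)\<close>; the witness is the
  decreasing rearrangement of \<open>s \<mapsto> s^(-1/\<alpha>)\<close> with respect to \<open>\<rho>(ds) / s\<close>.\<close>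

lemma completely_monotone_eq_jump_density:
  assumes g: "completely_monotone g" and \<alpha>: "0 < \<alpha>"
    and fin: "(\<integral>\<^sup>+r\<in>{1..}. ennreal (r powr (\<alpha> - 1) * g (r powr \<alpha>)) \<partial>lborel) < \<infinity>"
  obtains h :: "real \<Rightarrow> real" where "\<And>t. 0 < t \<Longrightarrow> continuous (at_left t) h" "antimono_on {0<..} h" "(h \<longlongrightarrow> 0) at_top"
    "\<And>t. t \<le> 0 \<Longrightarrow> h t = 0" "h \<in> borel_measurable borel"
    "\<And>u. 0 < u \<Longrightarrow> jump_density \<alpha> h u = ennreal (g u)"
proof -
  obtain L c where L: "real_distribution L" "AE s in L. 0 < s" "0 \<le> (c::real)"
    and gL: "\<And>x. 0 < x \<Longrightarrow> ennreal (g x) = (\<integral>\<^sup>+s. ennreal (c * exp ((1 - x) * s)) \<partial>L)"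
    by (rule Bernstein[OF g completely_monotone_tendsto_0[OF g \<alpha> fin]]) (rule that; blast)
  interpret L: real_distribution L by (rule L(1))
  \<comment> \<open>Exchanging the integrals over r >= 1 and s turns the integrability of g into
    that of 1 / s. This controls small s, which correspond to large values of the rearranged
    function.\<close>
  have finc: "(\<integral>\<^sup>+s. ennreal (c / (\<alpha> * s)) \<partial>L) < \<infinity>"
  proof -
    have "(\<integral>\<^sup>+s. ennreal (c / (\<alpha> * s)) \<partial>L)
        = (\<integral>\<^sup>+s. (\<integral>\<^sup>+r. ennreal (r powr (\<alpha> - 1)) * ennreal (c * exp ((1 - r powr \<alpha>) * s)) * indicator {1..} r \<partial>lborel) \<partial>L)"
    proof (rule nn_integral_cong_AE, rule eventually_mono[OF L(2)])
      fix s :: real assume s: "0 < s"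
      have "(\<integral>\<^sup>+r. ennreal (r powr (\<alpha> - 1)) * ennreal (c * exp ((1 - r powr \<alpha>) * s)) * indicator {1..} r \<partial>lborel)
        = (\<integral>\<^sup>+r. ennreal (c * exp s) * (ennreal (r powr (\<alpha> - 1) * exp (- (s * r powr \<alpha>))) * indicator {1..} r) \<partial>lborel)"
      proof (rule nn_integral_cong)
        fix r :: real
        have e: "c * exp ((1 - r powr \<alpha>) * s) = c * exp s * exp (- (s * r powr \<alpha>))"
          by (simp add: algebra_simps flip: exp_add)
        show "ennreal (r powr (\<alpha> - 1)) * ennreal (c * exp ((1 - r powr \<alpha>) * s)) * indicator {1..} r
          = ennreal (c * exp s) * (ennreal (r powr (\<alpha> - 1) * exp (- (s * r powr \<alpha>))) * indicator {1..} r)"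
          unfolding e using L(3) by (simp add: ennreal_mult mult_ac)
      qed
      also have "\<dots> = ennreal (c * exp s) * ennreal (exp (- s) / (\<alpha> * s))"
        unfolding nn_integral_powr_exp[OF \<alpha> s, symmetric] by (rule nn_integral_cmult) measurable
      also have "\<dots> = ennreal (c / (\<alpha> * s))"
        using L(3) \<alpha> s by (simp add: exp_minus flip: ennreal_mult)
      finally show "ennreal (c / (\<alpha> * s))
        = (\<integral>\<^sup>+r. ennreal (r powr (\<alpha> - 1)) * ennreal (c * exp ((1 - r powr \<alpha>) * s)) * indicator {1..} r \<partial>lborel)" by simp
    qed
    also have "\<dots> = (\<integral>\<^sup>+r. (\<integral>\<^sup>+s. ennreal (r powr (\<alpha> - 1)) * ennreal (c * exp ((1 - r powr \<alpha>) * s)) * indicator {1..} r \<partial>L) \<partial>lborel)"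
    proof -
      interpret pair_sigma_finite lborel L by unfold_locales
      show ?thesis by (rule Fubini') measurable
    qed
    also have "\<dots> = (\<integral>\<^sup>+r\<in>{1..}. ennreal (r powr (\<alpha> - 1) * g (r powr \<alpha>)) \<partial>lborel)"
    proof (rule nn_integral_cong)
      fix r :: real
      show "(\<integral>\<^sup>+s. ennreal (r powr (\<alpha> - 1)) * ennreal (c * exp ((1 - r powr \<alpha>) * s)) * indicator {1..} r \<partial>L)
        = ennreal (r powr (\<alpha> - 1) * g (r powr \<alpha>)) * indicator {1..} r"
      proof (cases "1 \<le> r")
        case True
        then have "ennreal (g (r powr \<alpha>)) = (\<integral>\<^sup>+s. ennreal (c * exp ((1 - r powr \<alpha>) * s)) \<partial>L)" by (intro gL) simp
        then show ?thesis using True by (simp add: ennreal_mult' nn_integral_cmult)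
      qed simp
    qed
    finally show ?thesis using fin by simp
  qed
  \<comment> \<open>c e^s L(ds) is the Bernstein measure; the division by s compensates the weight
    w^(-\<alpha>) = s that \<open>jump_density\<close> puts on the value w =
    s^(-1/\<alpha>).\<close>
  let ?d = "\<lambda>s. ennreal (c * exp s / s)"
  let ?m = "\<lambda>s::real. s powr (- (1 / \<alpha>))"
  define n where "n = distr (density L ?d) borel ?m"
  have sn: "sets n = sets borel" by (simp add: n_def)
  have nn: "(\<integral>\<^sup>+w. F w \<partial>n) = (\<integral>\<^sup>+s. ?d s * F (?m s) \<partial>L)" if [measurable]: "F \<in> borel_measurable borel" for F :: "real \<Rightarrow> ennreal"
  proof -
    have "(\<integral>\<^sup>+w. F w \<partial>n) = (\<integral>\<^sup>+s. F (?m s) \<partial>density L ?d)" unfolding n_def by (rule nn_integral_distr) measurable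
    also have "\<dots> = (\<integral>\<^sup>+s. ?d s * F (?m s) \<partial>L)" by (rule nn_integral_density) measurable
    finally show ?thesis .
  qed
  have fin_tail: "emeasure n {w..} < \<infinity>" if w: "0 < w" for w
  proof -
    have "emeasure n {w..} = (\<integral>\<^sup>+x. indicator {w..} x \<partial>n)" by (simp add: sn)
    also have "\<dots> = (\<integral>\<^sup>+s. ?d s * indicator {w..} (?m s) \<partial>L)" by (rule nn) measurable
    also have "\<dots> \<le> (\<integral>\<^sup>+s. ennreal (\<alpha> * exp (w powr (- \<alpha>))) * ennreal (c / (\<alpha> * s)) \<partial>L)"
    proof (rule nn_integral_mono_AE, rule eventually_mono[OF L(2)])
      fix s :: real assume s: "0 < s"
      show "?d s * indicator {w..} (?m s) \<le> ennreal (\<alpha> * exp (w powr (- \<alpha>))) * ennreal (c / (\<alpha> * s))"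
      proof (cases "w \<le> ?m s")
        case True
        \<comment> \<open>Values of at least w come from s <= w^(-\<alpha>), where e^s is bounded,
          so the tail is controlled by \<open>finc\<close>.\<close>
        have "(?m s) powr (- \<alpha>) \<le> w powr (- \<alpha>)" using True w \<alpha> by (intro powr_mono2') auto
        then have "s \<le> w powr (- \<alpha>)" using s \<alpha> by (simp add: powr_powr)
        then have "c * exp s / s \<le> c * exp (w powr (- \<alpha>)) / s"
          using L(3) s by (intro divide_right_mono mult_left_mono) auto
        also have "\<dots> = \<alpha> * exp (w powr (- \<alpha>)) * (c / (\<alpha> * s))" using \<alpha> by simp
        finally have "?d s \<le> ennreal (\<alpha> * exp (w powr (- \<alpha>)) * (c / (\<alpha> * s)))" by (rule ennreal_leI)
        then show ?thesis using True \<alpha> L(3) s by (simp add: ennreal_mult del: times_divide_eq_right)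
      qed simp
    qed
    also have "\<dots> = ennreal (\<alpha> * exp (w powr (- \<alpha>))) * (\<integral>\<^sup>+s. ennreal (c / (\<alpha> * s)) \<partial>L)" by (rule nn_integral_cmult) measurable
    also have "\<dots> < \<infinity>" using finc by (simp add: ennreal_mult_less_top)
    finally show ?thesis .
  qed
  obtain h :: "real \<Rightarrow> real" where h: "\<And>t. 0 < t \<Longrightarrow> continuous (at_left t) h" "antimono_on {0<..} h" "(h \<longlongrightarrow> 0) at_top"
    and hnn: "\<And>t. 0 \<le> h t" and h0: "\<And>t. t \<le> 0 \<Longrightarrow> h t = 0" and hm: "h \<in> borel_measurable borel"
    and image: "\<And>F :: real \<Rightarrow> ennreal. F \<in> borel_measurable borel \<Longrightarrow> (\<And>x. x \<le> 0 \<Longrightarrow> F x = 0) \<Longrightarrow>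
      (\<integral>\<^sup>+t. F (h t) \<partial>lborel) = (\<integral>\<^sup>+w. F w \<partial>n)"
    using decreasing_rearrangement[OF sn fin_tail] by blast
  have "jump_density \<alpha> h u = ennreal (g u)" if u: "0 < u" for u
  proof -
    define F where "F w = (if w \<le> 0 then 0 else ennreal (w powr (- \<alpha>) * exp (- u * w powr (- \<alpha>))))" for w :: real
    have [measurable]: "F \<in> borel_measurable borel" unfolding F_def[abs_def] by measurable
    have "jump_density \<alpha> h u = (\<integral>\<^sup>+t. F (h t) \<partial>lborel)"
      unfolding jump_density_def
    proof (rule nn_integral_cong)
      fix t
      show "ennreal (jump_weight \<alpha> h t * exp (- u * jump_weight \<alpha> h t)) = F (h t)"
        using hnn[of t] by (auto simp: jump_weight_def F_def)
    qed
    also have "\<dots> = (\<integral>\<^sup>+w. F w \<partial>n)" by (rule image) (auto simp: F_def)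
    also have "\<dots> = (\<integral>\<^sup>+s. ?d s * F (?m s) \<partial>L)" by (rule nn) measurable
    also have "\<dots> = (\<integral>\<^sup>+s. ennreal (c * exp ((1 - u) * s)) \<partial>L)"
    proof (rule nn_integral_cong_AE, rule eventually_mono[OF L(2)])
      fix s :: real assume s: "0 < s"
      have "F (?m s) = ennreal (s * exp (- u * s))" using s \<alpha> by (simp add: F_def powr_powr)
      moreover have "c * exp s / s * (s * exp (- u * s)) = c * exp ((1 - u) * s)"
        using s by (simp add: algebra_simps flip: exp_add)
      ultimately show "?d s * F (?m s) = ennreal (c * exp ((1 - u) * s))"
        using s L(3) by (simp flip: ennreal_mult)
    qed
    also have "\<dots> = ennreal (g u)" by (rule gL[OF u, symmetric])
    finally show ?thesis .
  qed
  with h h0 hm show ?thesis by (intro that) auto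
qed

lemma completely_monotone_cmult:
  assumes g: "completely_monotone g" and a: "0 \<le> a" shows "completely_monotone (\<lambda>x. a * g x)"
proof -
  have d: "((deriv ^^ n) g has_real_derivative (deriv ^^ Suc n) g u) (at u)" if "0 < u" for n u
    using g that by (simp add: completely_monotone_def DERIV_deriv_iff_real_differentiable)
  have iter: "(deriv ^^ n) (\<lambda>x. a * g x) u = a * (deriv ^^ n) g u" if "0 < u" for n u
    using that
  proof (induction n arbitrary: u)
    case (Suc n)
    have "((\<lambda>x. a * (deriv ^^ n) g x) has_real_derivative a * (deriv ^^ Suc n) g u) (at u)"
      by (intro DERIV_cmult d Suc.prems)
    then have "((deriv ^^ n) (\<lambda>x. a * g x) has_real_derivative a * (deriv ^^ Suc n) g u) (at u)"
      using Suc.prems Suc.IH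
      by (elim has_field_derivative_transform_within_open[where S = "{0<..}"]) auto
    then show ?case by (simp add: DERIV_imp_deriv)
  qed simp
  show ?thesis
    unfolding completely_monotone_def
  proof (intro allI impI conjI)
    fix n and x :: real assume x: "0 < x"
    have "((\<lambda>x. a * (deriv ^^ n) g x) has_real_derivative a * (deriv ^^ Suc n) g x) (at x)"
      by (intro DERIV_cmult d x)
    then have "((deriv ^^ n) (\<lambda>x. a * g x) has_real_derivative a * (deriv ^^ Suc n) g x) (at x)"
      using x iter by (elim has_field_derivative_transform_within_open[where S = "{0<..}"]) auto
    then show "(deriv ^^ n) (\<lambda>x. a * g x) differentiable at x"
      by (auto simp: real_differentiable_def)
    have "0 \<le> (- 1) ^ n * (deriv ^^ n) g x" using g x by (simp add: completely_monotone_def)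
    then have "0 \<le> a * ((- 1) ^ n * (deriv ^^ n) g x)" using a by simp
    then show "0 \<le> (- 1) ^ n * (deriv ^^ n) (\<lambda>x. a * g x) x" by (simp add: iter[OF x] mult_ac)
  qed
qed

text \<open>The witness is built from the Levy measure alone; equality of laws then follows by
  comparing characteristic functions, both of which are determined by integrals of 1 - cos.\<close>

lemma (in symmetric_levy_process) E_class0_sym_imp_law:
  assumes N: "N = nu_Y \<alpha>" and \<alpha>: "0 < \<alpha>" and mem: "\<mu> \<in> E_class0_sym \<alpha>"
  shows "\<exists>h\<in>Dom_down M Y. \<mu> = law M (improper_integral M Y h)"
proof -
  obtain A \<nu> \<gamma> \<nu>' \<gamma>' where t: "has_generating_triplet \<mu> A \<nu> \<gamma>" and rad: "E_radial_form \<alpha> \<nu>"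
    and t': "has_generating_triplet \<mu> 0 \<nu>' \<gamma>'" and sym: "symmetric_distribution \<mu>" and \<mu>: "real_distribution \<mu>"
    using mem by (auto simp: E_class0_sym_def E_class0_def E_class_def infinitely_divisible_def)
  \<comment> \<open>The class supplies the radial form and the absence of a Gaussian part for
    possibly different triplets; uniqueness of the Gaussian variance joins them.\<close>
  have t0: "has_generating_triplet \<mu> 0 \<nu> \<gamma>" using t triplet_no_Gaussian[OF t t'] by simp
  then have levy: "levy_measure \<nu>" by (simp add: has_generating_triplet_def)
  obtain g0 :: "real \<Rightarrow> real \<Rightarrow> real" where cm: "\<And>\<xi>. \<xi> \<in> {-1, 1} \<Longrightarrow> completely_monotone (g0 \<xi>)"
    and em: "\<And>B. B \<in> sets borel \<Longrightarrow> 0 \<notin> B \<Longrightarrow> emeasure \<nu> B = (\<Sum>\<xi>\<in>{-1, 1}.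
      \<integral>\<^sup>+r\<in>{0<..}. indicator B (r * \<xi>) * ennreal (r powr (\<alpha> - 1) * g0 \<xi> (r powr \<alpha>)) \<partial>lborel)"
    using rad unfolding E_radial_form_def
    by (elim exE conjE) (rule that, drule (1) bspec, erule conjunct1, drule (1) bspec, erule (1) mp)
  \<comment> \<open>Averaging the two radial functions leaves integrals of even functions unchanged,
    and the characteristic function of a symmetric law involves no others.\<close>
  define g where "g u = 1 / 2 * (g0 1 u + g0 (-1) u)" for u
  have g: "completely_monotone g"
    unfolding g_def[abs_def] by (intro completely_monotone_cmult completely_monotone_add cm) auto
  have gnn: "0 \<le> g u" if "0 < u" for u using cm_deriv_nonneg[OF g that, of 0] by simp
  have nn\<nu>: "(\<integral>\<^sup>+x. F x \<partial>\<nu>) = (\<integral>\<^sup>+r\<in>{0<..}. F r * ennreal (2 * (r powr (\<alpha> - 1) * g (r powr \<alpha>))) \<partial>lborel)"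
    if "F \<in> borel_measurable borel" "\<And>x. F (- x) = F x" for F :: "real \<Rightarrow> ennreal"
  proof -
    have "(\<integral>\<^sup>+x. F x \<partial>\<nu>)
      = (\<integral>\<^sup>+r\<in>{0<..}. F r * ennreal (r powr (\<alpha> - 1) * (g0 1 (r powr \<alpha>) + g0 (-1) (r powr \<alpha>))) \<partial>lborel)"
      by (rule radial_form_nn_integral[OF levy], erule cm, erule (1) em, rule that, rule that)
    then show ?thesis by (simp add: g_def)
  qed
  have T: "(\<integral>\<^sup>+x. ennreal (trunc_sq x) \<partial>\<nu>) < \<infinity>" using levy by (simp add: levy_measure_def trunc_sq_def)
  have "(\<integral>\<^sup>+r\<in>{1..}. ennreal (r powr (\<alpha> - 1) * g (r powr \<alpha>)) \<partial>lborel) \<le> (\<integral>\<^sup>+x. ennreal (trunc_sq x) \<partial>\<nu>)"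
  proof (subst nn\<nu>)
    show "(\<integral>\<^sup>+r\<in>{1..}. ennreal (r powr (\<alpha> - 1) * g (r powr \<alpha>)) \<partial>lborel)
      \<le> (\<integral>\<^sup>+r\<in>{0<..}. ennreal (trunc_sq r) * ennreal (2 * (r powr (\<alpha> - 1) * g (r powr \<alpha>))) \<partial>lborel)"
    proof (rule nn_integral_mono)
      fix r :: real
      show "ennreal (r powr (\<alpha> - 1) * g (r powr \<alpha>)) * indicator {1..} r
        \<le> ennreal (trunc_sq r) * ennreal (2 * (r powr (\<alpha> - 1) * g (r powr \<alpha>))) * indicator {0<..} r"
      proof (cases "1 \<le> r")
        case True
        then have "trunc_sq r = 1" by (simp add: trunc_sq_def one_le_power)
        moreover have "0 \<le> g (r powr \<alpha>)" using True by (intro gnn) simp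
        ultimately show ?thesis using True by (auto intro!: ennreal_leI)
      qed simp
    qed
  qed auto
  then have "(\<integral>\<^sup>+r\<in>{1..}. ennreal (r powr (\<alpha> - 1) * g (r powr \<alpha>)) \<partial>lborel) < \<infinity>" using T by (rule le_less_trans)
  then obtain h :: "real \<Rightarrow> real" where h: "\<And>t. 0 < t \<Longrightarrow> continuous (at_left t) h" "antimono_on {0<..} h" "(h \<longlongrightarrow> 0) at_top"
    and h0: "\<And>t. t \<le> 0 \<Longrightarrow> h t = 0" and hm: "h \<in> borel_measurable borel"
    and J: "\<And>u. 0 < u \<Longrightarrow> jump_density \<alpha> h u = ennreal (g u)"
    using completely_monotone_eq_jump_density[OF g \<alpha>] by blast
  have cut: "half_line_cut h = h" using h0 by (auto simp: half_line_cut_def indicator_def fun_eq_iff not_less)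
  have nnJ: "(\<integral>\<^sup>+y. F y * ennreal (\<bar>y\<bar> powr (\<alpha> - 1)) * jump_density \<alpha> h (\<bar>y\<bar> powr \<alpha>) \<partial>lborel) = (\<integral>\<^sup>+x. F x \<partial>\<nu>)"
    if F [measurable]: "F \<in> borel_measurable borel" and even: "\<And>x. F (- x) = F x" for F :: "real \<Rightarrow> ennreal"
  proof -
    note hm [measurable]
    let ?K = "\<lambda>y. F y * ennreal (\<bar>y\<bar> powr (\<alpha> - 1)) * jump_density \<alpha> h (\<bar>y\<bar> powr \<alpha>)"
    have "(\<integral>\<^sup>+y. ?K y \<partial>lborel) = (\<integral>\<^sup>+r\<in>{0<..}. ?K r \<partial>lborel) + (\<integral>\<^sup>+r\<in>{0<..}. ?K (- r) \<partial>lborel)"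
      by (rule nn_integral_half_lines) measurable
    also have "\<dots> = (\<integral>\<^sup>+r. ?K r * indicator {0<..} r + ?K (- r) * indicator {0<..} r \<partial>lborel)"
      by (rule nn_integral_add[symmetric]) measurable
    also have "\<dots> = (\<integral>\<^sup>+r\<in>{0<..}. F r * ennreal (2 * (r powr (\<alpha> - 1) * g (r powr \<alpha>))) \<partial>lborel)"
    proof (rule nn_integral_cong)
      fix r :: real
      show "?K r * indicator {0<..} r + ?K (- r) * indicator {0<..} r
        = F r * ennreal (2 * (r powr (\<alpha> - 1) * g (r powr \<alpha>))) * indicator {0<..} r"
      proof (cases "0 < r")
        case True
        then have "jump_density \<alpha> h (r powr \<alpha>) = ennreal (g (r powr \<alpha>))" by (intro J) simp
        moreover have "ennreal (2 * (r powr (\<alpha> - 1) * g (r powr \<alpha>))) = 2 * (ennreal (r powr (\<alpha> - 1)) * ennreal (g (r powr \<alpha>)))"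
          by (simp add: ennreal_mult')
        ultimately show ?thesis using True by (simp add: even mult_ac flip: mult_2)
      qed simp
    qed
    finally show ?thesis using nn\<nu>[OF that] by simp
  qed
  have "(\<integral>\<^sup>+t. ennreal (trunc_exponent N (h t)) \<partial>lborel) < \<infinity>"
    unfolding nn_integral_exponents(1)[OF N hm] using T by (subst nnJ) auto
  then have "exponent_finite h"
    unfolding exponent_finite_def cut
    using hm by (intro integrableI_nonneg) (auto simp: N.trunc_exponent_nonneg)
  moreover have "set_borel_measurable borel {0<..} h"
    using hm by (simp add: set_borel_measurable_def)
  ultimately have Dom: "h \<in> Dom M Y" by (simp add: Dom_iff)
  have "char \<mu> z = char (law M (improper_integral M Y h)) z" for z
  proof -
    have "ennreal (\<integral>t. cos_exponent N (z * h t) \<partial>lborel) = (\<integral>\<^sup>+t. ennreal (cos_exponent N (z * h t)) \<partial>lborel)"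
      using law_improper_integral(3)[OF Dom, of z]
      by (intro nn_integral_eq_integral[symmetric]) (auto simp: cut N.cos_exponent_nonneg)
    also have "\<dots> = (\<integral>\<^sup>+x. ennreal (1 - cos (z * x)) \<partial>\<nu>)"
      unfolding nn_integral_exponents(2)[OF N hm] by (rule nnJ) auto
    also have "\<dots> = ennreal (cos_exponent \<nu> z)"
      unfolding cos_exponent_def by (rule nn_integral_eq_integral[OF integral_Re_levy_kernel(2)[OF levy]]) simp
    finally have "(\<integral>t. cos_exponent N (z * h t) \<partial>lborel) = cos_exponent \<nu> z"
      by (subst (asm) ennreal_inj) (auto simp: N.cos_exponent_nonneg cos_exponent_def[of \<nu>] intro!: integral_nonneg)
    then show ?thesis
      unfolding char_symmetric_triplet[OF \<mu> sym t0] law_improper_integral(2)[OF Dom] cut by simp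
  qed
  then have "\<mu> = law M (improper_integral M Y h)"
    by (intro Levy_uniqueness[OF \<mu> law_improper_integral(1)[OF Dom]]) (simp add: fun_eq_iff)
  moreover have "h \<in> Dom_down M Y" using Dom h by (simp add: Dom_down_def)
  ultimately show ?thesis by blast
qed

theorem theorem5p1:
  fixes \<alpha> :: real and M :: "'a measure" and Y :: "real \<Rightarrow> 'a \<Rightarrow> real"
  assumes "0 < \<alpha>"
    and "compound_poisson_process M Y (nu_Y \<alpha>)"
  shows "E_class0_sym \<alpha> = {law M (improper_integral M Y h) | h. h \<in> Dom M Y} \<and>
    {law M (improper_integral M Y h) | h. h \<in> Dom M Y} =
      {law M (improper_integral M Y h) | h. h \<in> Dom_down M Y}"
proof -
  interpret symmetric_levy_process M Y "nu_Y \<alpha>" by (rule compound_poisson_imp_symmetric_levy[OF assms(2)])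
  \<comment> \<open>A cycle of three inclusions: the class, decreasing integrands, all integrands,
    the class.\<close>
  have "E_class0_sym \<alpha> \<subseteq> {law M (improper_integral M Y h) | h. h \<in> Dom_down M Y}"
    using E_class0_sym_imp_law[OF refl assms(1)] by blast
  moreover have "Dom_down M Y \<subseteq> Dom M Y" by (auto simp: Dom_down_def)
  moreover have "{law M (improper_integral M Y h) | h. h \<in> Dom M Y} \<subseteq> E_class0_sym \<alpha>"
    using law_in_E_class0_sym[OF refl assms(1)] by blast
  ultimately show ?thesis by blast
qed

end
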